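(* Let $T>0$. Suppose that for every $j\in\mathbb{N}$, $b^j,u^j\in C_w([0,T);L^2(\mathbb{T}^2;\mathbb{R}^2))$ satisfy, in the sense of distributions, $$\partial_tb^j+\operatorname{div}(b^j\otimes u^j-u^j\otimes b^j)=0,\qquad \operatorname{div}u^j=\operatorname{div}b^j=0,\qquad u^j(\cdot,0)=u^j_0,\ b^j(\cdot,0)=b^j_0,$$ with divergence-free $u^j_0,b^j_0\in L^2(\mathbb{T}^2;\mathbb{R}^2)$, and $\int_{\mathbb{T}^2}u^j(x,t)\,dx=\int_{\mathbb{T}^2}b^j(x,t)\,dx=0$ for a.e. $t\in[0,T)$. Suppose $\sup_{j}(\|u^j\|_{L^\infty_tL^2_x}+\|b^j\|_{L^\infty_tL^2_x})<\infty$ and $b^j\rightharpoonup b$, $u^j\rightharpoonup u$ weakly in $L^2(\mathbb{T}^2\times[0,T);\mathbb{R}^2)$. Then, after redefining $b$ on a set of times of measure zero, $b\in C_w([0,T);L^2(\mathbb{T}^2;\mathbb{R}^2))$, and the mean-square magnetic potential $\int_{\mathbb{T}^2}|\Psi(x,t)|^2\,dx$ is constant in $t\in[0,T)$, where $\Psi$ is the mean-zero stream function of $b$.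
   Context: $\mathbb{T}^2=[0,1]^2$ is the flat torus; $(v\otimes w)_{ij}=v_iw_j$; $(\operatorname{div}M)_i=\sum_j\partial_jM_{ij}$. $v\in C_w([0,T);L^2(\mathbb{T}^2;\mathbb{R}^2))$ means that $v\in L^\infty_tL^2_x(\mathbb{T}^2\times[0,T);\mathbb{R}^2)$ and that $t_j\to t$ implies $v(\cdot,t_j)\rightharpoonup v(\cdot,t)$ weakly in $L^2$ for every $t\in[0,T)$ (similarly with $W^{1,2}$). The evolution equation with initial data means $\int_0^T\!\int_{\mathbb{T}^2}[b^j\cdot\partial_t\varphi+(b^j\otimes u^j-u^j\otimes b^j):D\varphi]+\int_{\mathbb{T}^2}b^j_0\cdot\varphi(\cdot,0)=0$ for all $\varphi\in C_c^\infty(\mathbb{T}^2\times[0,T);\mathbb{R}^2)$. The mean-zero stream function of $b$ is the unique $\Psi\in C_w([0,T);W^{1,2}(\mathbb{T}^2))$ with $(\partial_2\Psi,-\partial_1\Psi)=b$ and $\int_{\mathbb{T}^2}\Psi(x,t)\,dx=0$ for every $t\in[0,T)$. *)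

theory Defs
  imports "HOL-Analysis.Analysis" "HOL-Probability.Essential_Supremum"
begin

(* A function on the torus is represented by its values on the unit square (elements of Lebesgue
   and Sobolev spaces) or by its periodic extension to the plane (smooth functions).
   Time-dependent fields are curried with time as the first argument: v t x stands for v(x,t). *)

definition torus :: "(real^2) set" where
  "torus = cbox 0 1"

subsection \<open>Smooth test functions\<close>

primrec Ck :: "nat \<Rightarrow> ('a::euclidean_space \<Rightarrow> 'b::real_normed_vector) \<Rightarrow> bool" where
  "Ck 0 f \<longleftrightarrow> continuous_on UNIV f"
| "Ck (Suc k) f \<longleftrightarrow>
     f differentiable_on UNIV \<and> (\<forall>e\<in>Basis. Ck k (\<lambda>x. frechet_derivative f (at x) e))"

definition smooth :: "('a::euclidean_space \<Rightarrow> 'b::real_normed_vector) \<Rightarrow> bool" where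
  "smooth f \<longleftrightarrow> (\<forall>k. Ck k f)"

definition periodic :: "(real^2 \<Rightarrow> 'b) \<Rightarrow> bool" where
  "periodic f \<longleftrightarrow> (\<forall>x i. f (x + axis i 1) = f x)"

definition torus_test :: "(real^2 \<Rightarrow> 'b::real_normed_vector) set" where
  "torus_test = {\<psi>. smooth \<psi> \<and> periodic \<psi>}"

(* Compact support in torus x [0,T): a test function need not vanish at time 0.  It is given as
   the restriction to nonnegative times of a function that is smooth for all times. *)
definition spacetime_test ::
    "real \<Rightarrow> (real \<Rightarrow> real^2 \<Rightarrow> 'b::real_normed_vector) set" where
  "spacetime_test T = {\<phi>. smooth (\<lambda>(t, x). \<phi> t x) \<and> (\<forall>t. periodic (\<phi> t)) \<and>
     (\<exists>T'<T. \<forall>t>T'. \<forall>x. \<phi> t x = 0)}"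

(* Compact support in torus x (0,T). *)
definition spacetime_test_interior ::
    "real \<Rightarrow> (real \<Rightarrow> real^2 \<Rightarrow> 'b::real_normed_vector) set" where
  "spacetime_test_interior T = {\<phi>. smooth (\<lambda>(t, x). \<phi> t x) \<and> (\<forall>t. periodic (\<phi> t)) \<and>
     (\<exists>a b. 0 < a \<and> b < T \<and> (\<forall>t. t \<notin> {a..b} \<longrightarrow> (\<forall>x. \<phi> t x = 0)))}"

definition time_deriv :: "(real \<Rightarrow> real^2 \<Rightarrow> 'b::real_normed_vector) \<Rightarrow> real \<Rightarrow> real^2 \<Rightarrow> 'b" where
  "time_deriv \<phi> t x = vector_derivative (\<lambda>s. \<phi> s x) (at t)"

definition grad :: "(real^2 \<Rightarrow> real) \<Rightarrow> real^2 \<Rightarrow> real^2" where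
  "grad \<psi> x = (\<chi> i. frechet_derivative \<psi> (at x) (axis i 1))"

(* Entry (i,j) is the j-th partial derivative of the i-th component. *)
definition jacobian :: "(real^2 \<Rightarrow> real^2) \<Rightarrow> real^2 \<Rightarrow> real^2^2" where
  "jacobian \<phi> x = matrix (frechet_derivative \<phi> (at x))"

definition tensor :: "real^2 \<Rightarrow> real^2 \<Rightarrow> real^2^2" where
  "tensor v w = (\<chi> i j. v $ i * w $ j)"

subsection \<open>Square-integrable functions\<close>

definition L2 :: "'a::euclidean_space set \<Rightarrow> ('a \<Rightarrow> 'b::euclidean_space) set" where
  "L2 S = {f. f \<in> borel_measurable (lebesgue_on S) \<and>
              integrable (lebesgue_on S) (\<lambda>x. (norm (f x))\<^sup>2)}"

definition L2_norm :: "'a::euclidean_space set \<Rightarrow> ('a \<Rightarrow> 'b::euclidean_space) \<Rightarrow> real" where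
  "L2_norm S f = sqrt (LINT x|lebesgue_on S. (norm (f x))\<^sup>2)"

definition L2_inner ::
    "'a::euclidean_space set \<Rightarrow> ('a \<Rightarrow> 'b::euclidean_space) \<Rightarrow> ('a \<Rightarrow> 'b) \<Rightarrow> real" where
  "L2_inner S f g = (LINT x|lebesgue_on S. f x \<bullet> g x)"

definition weak_lim_L2 ::
    "'a::euclidean_space set \<Rightarrow> (nat \<Rightarrow> 'a \<Rightarrow> 'b::euclidean_space) \<Rightarrow> ('a \<Rightarrow> 'b) \<Rightarrow> bool" where
  "weak_lim_L2 S F f \<longleftrightarrow> (\<forall>n. F n \<in> L2 S) \<and> f \<in> L2 S \<and>
     (\<forall>w\<in>L2 S. (\<lambda>n. L2_inner S (F n) w) \<longlonglongrightarrow> L2_inner S f w)"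

subsection \<open>The Sobolev space of order one\<close>

definition has_weak_gradient :: "(real^2 \<Rightarrow> real) \<Rightarrow> (real^2 \<Rightarrow> real^2) \<Rightarrow> bool" where
  "has_weak_gradient f g \<longleftrightarrow> f \<in> L2 torus \<and> g \<in> L2 torus \<and>
     (\<forall>\<psi>\<in>torus_test. \<forall>i.
        (LINT x|lebesgue_on torus. f x * grad \<psi> x $ i) =
        - (LINT x|lebesgue_on torus. g x $ i * \<psi> x))"

definition W12 :: "(real^2 \<Rightarrow> real) set" where
  "W12 = {f. \<exists>g. has_weak_gradient f g}"

(* An arbitrary representative; weak gradients are determined up to null sets. *)
definition weak_grad :: "(real^2 \<Rightarrow> real) \<Rightarrow> real^2 \<Rightarrow> real^2" where
  "weak_grad f = (SOME g. has_weak_gradient f g)"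

definition W12_inner :: "(real^2 \<Rightarrow> real) \<Rightarrow> (real^2 \<Rightarrow> real) \<Rightarrow> real" where
  "W12_inner f g = L2_inner torus f g + L2_inner torus (weak_grad f) (weak_grad g)"

definition W12_norm :: "(real^2 \<Rightarrow> real) \<Rightarrow> real" where
  "W12_norm f = sqrt ((L2_norm torus f)\<^sup>2 + (L2_norm torus (weak_grad f))\<^sup>2)"

definition weak_lim_W12 :: "(nat \<Rightarrow> real^2 \<Rightarrow> real) \<Rightarrow> (real^2 \<Rightarrow> real) \<Rightarrow> bool" where
  "weak_lim_W12 F f \<longleftrightarrow> (\<forall>n. F n \<in> W12) \<and> f \<in> W12 \<and>
     (\<forall>w\<in>W12. (\<lambda>n. W12_inner (F n) w) \<longlonglongrightarrow> W12_inner f w)"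

subsection \<open>Time-dependent functions\<close>

definition spacetime :: "real \<Rightarrow> (real \<times> (real^2)) set" where
  "spacetime T = {0..<T} \<times> torus"

definition Linf_L2_norm :: "real \<Rightarrow> (real \<Rightarrow> real^2 \<Rightarrow> 'b::euclidean_space) \<Rightarrow> ereal" where
  "Linf_L2_norm T v = esssup (lebesgue_on {0..<T}) (\<lambda>t. ereal (L2_norm torus (v t)))"

definition Linf_L2 :: "real \<Rightarrow> (real \<Rightarrow> real^2 \<Rightarrow> 'b::euclidean_space) set" where
  "Linf_L2 T = {v. (\<lambda>(t, x). v t x) \<in> borel_measurable (lebesgue_on (spacetime T)) \<and>
     (AE t in lebesgue_on {0..<T}. v t \<in> L2 torus) \<and> Linf_L2_norm T v < \<infinity>}"

definition Linf_W12 :: "real \<Rightarrow> (real \<Rightarrow> real^2 \<Rightarrow> real) set" where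
  "Linf_W12 T = {f. (\<lambda>(t, x). f t x) \<in> borel_measurable (lebesgue_on (spacetime T)) \<and>
     (AE t in lebesgue_on {0..<T}. f t \<in> W12) \<and>
     esssup (lebesgue_on {0..<T}) (\<lambda>t. ereal (W12_norm (f t))) < \<infinity>}"

definition Cw_L2 :: "real \<Rightarrow> (real \<Rightarrow> real^2 \<Rightarrow> 'b::euclidean_space) set" where
  "Cw_L2 T = {v. v \<in> Linf_L2 T \<and>
     (\<forall>t\<in>{0..<T}. \<forall>s. (\<forall>n. s n \<in> {0..<T}) \<and> s \<longlonglongrightarrow> t \<longrightarrow>
        weak_lim_L2 torus (\<lambda>n. v (s n)) (v t))}"

definition Cw_W12 :: "real \<Rightarrow> (real \<Rightarrow> real^2 \<Rightarrow> real) set" where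
  "Cw_W12 T = {f. f \<in> Linf_W12 T \<and>
     (\<forall>t\<in>{0..<T}. \<forall>s. (\<forall>n. s n \<in> {0..<T}) \<and> s \<longlonglongrightarrow> t \<longrightarrow>
        weak_lim_W12 (\<lambda>n. f (s n)) (f t))}"

subsection \<open>The equations\<close>

definition div_free :: "(real^2 \<Rightarrow> real^2) \<Rightarrow> bool" where
  "div_free v \<longleftrightarrow> (\<forall>\<psi>\<in>torus_test. (LINT x|lebesgue_on torus. v x \<bullet> grad \<psi> x) = 0)"

definition div_free_spacetime :: "real \<Rightarrow> (real \<Rightarrow> real^2 \<Rightarrow> real^2) \<Rightarrow> bool" where
  "div_free_spacetime T v \<longleftrightarrow> (\<forall>\<psi>\<in>spacetime_test_interior T.
     (LINT (t, x)|lebesgue_on (spacetime T). v t x \<bullet> grad (\<psi> t) x) = 0)"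

(* The inner product of matrices is the Frobenius product. *)
definition weak_induction ::
    "real \<Rightarrow> (real \<Rightarrow> real^2 \<Rightarrow> real^2) \<Rightarrow> (real \<Rightarrow> real^2 \<Rightarrow> real^2) \<Rightarrow> (real^2 \<Rightarrow> real^2) \<Rightarrow> bool" where
  "weak_induction T b u b0 \<longleftrightarrow> (\<forall>\<phi>\<in>spacetime_test T.
     (LINT (t, x)|lebesgue_on (spacetime T).
        b t x \<bullet> time_deriv \<phi> t x +
        (tensor (b t x) (u t x) - tensor (u t x) (b t x)) \<bullet> jacobian (\<phi> t) x) +
     (LINT x|lebesgue_on torus. b0 x \<bullet> \<phi> 0 x) = 0)"

definition mean_zero :: "(real^2 \<Rightarrow> 'b::euclidean_space) \<Rightarrow> bool" where
  "mean_zero f \<longleftrightarrow> (LINT x|lebesgue_on torus. f x) = 0"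

definition stream_function ::
    "real \<Rightarrow> (real \<Rightarrow> real^2 \<Rightarrow> real^2) \<Rightarrow> (real \<Rightarrow> real^2 \<Rightarrow> real) \<Rightarrow> bool" where
  "stream_function T b \<Psi> \<longleftrightarrow> \<Psi> \<in> Cw_W12 T \<and>
     (\<forall>t\<in>{0..<T}. mean_zero (\<Psi> t) \<and>
        (AE x in lebesgue_on torus.
           b t x = vector [weak_grad (\<Psi> t) x $ 2, - weak_grad (\<Psi> t) x $ 1]))"

end

(* In two dimensions a divergence-free b has a stream function Psi, and the induction equation says
   that Psi is transported by u.  Testing with trigonometric kernels gives the evolution of the
   Fejer means Psi_N up to a commutator that tends to 0 in L^1 at almost every time.  As u is
   divergence-free, it moves functions of Psi_N without changing their integral, so the integral of
   (1 - cos (d Psi)) / d^2 is conserved (the cosine keeps all derivatives bounded, so that the L^1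
   smallness of the commutator suffices); d -> 0 gives conservation of the integral of Psi^2 for
   each j.  The Fourier coefficients of b^j are Lipschitz in time uniformly in j, hence convergent
   at every time by the weak convergence on space-time.  The uniform L^2 bound on b^j controls the
   Fourier tails of Psi^j, so by Parseval the conserved quantity passes to the limit. *)

theory Submission imports Defs "HOL-Probability.Probability_Measure" begin

subsection \<open>Square-integrable functions\<close>

text \<open>Two obstacles shape the argument. The flux formed from \<open>b j\<close> and
  \<open>u j\<close> is bounded only in L^1, and products of weakly convergent fields need not
  converge to the product of the limits. So no evolution equation is derived for the limit; only
  linear quantities and the potential, which is one derivative smoother than the field, are carried
  over. For a single flow the potential lies in W^{1,2}, which in the plane does not embed into
  L^infinity, so it cannot be paired directly with an error that is small only in L^1. Smoothing
  uses Fejer means: their kernel is nonnegative, hence they contract L^1, which the flux requires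
  and which fails for plain Fourier sums, and they act diagonally on Fourier coefficients, hence
  commute with forming the stream function and its gradient. The smoothed potential is Lipschitz in
  time with a constant that grows with N. That constant enters only through an error quadratic in
  the time step, removed by refining a partition while N is fixed. Then N tends to infinity at fixed
  d, and d tends to 0 last.\<close>

lemma integrable_mult_L2:
  fixes f g :: "'a \<Rightarrow> real"
  assumes [measurable]: "f \<in> borel_measurable M" "g \<in> borel_measurable M"
    and f: "integrable M (\<lambda>x. (f x)\<^sup>2)" and g: "integrable M (\<lambda>x. (g x)\<^sup>2)"
  shows "integrable M (\<lambda>x. f x * g x)"
proof (rule Bochner_Integration.integrable_bound)
  show "integrable M (\<lambda>x. (f x)\<^sup>2 + (g x)\<^sup>2)" using f g by simp
  have "\<bar>f x * g x\<bar> \<le> (f x)\<^sup>2 + (g x)\<^sup>2" for x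
    using sum_squares_bound[of "\<bar>f x\<bar>" "\<bar>g x\<bar>"] mult_nonneg_nonneg[of "\<bar>f x\<bar>" "\<bar>g x\<bar>"]
    by (simp add: abs_mult del: mult_nonneg_nonneg)
  then show "AE x in M. norm (f x * g x) \<le> norm ((f x)\<^sup>2 + (g x)\<^sup>2)"
    by auto
qed simp

text \<open>Cauchy-Schwarz by the discriminant: the integral of
  \<open>(s * \<bar>f x\<bar> - \<bar>g x\<bar>)\<^sup>2\<close> is a nonnegative quadratic in
  \<open>s\<close>. The modulus stays inside the integral because the flux estimates need L^1 norms,
  not just pairings.\<close>

lemma integral_abs_mult_le_L2:
  fixes f g :: "'a \<Rightarrow> real"
  assumes [measurable]: "f \<in> borel_measurable M" "g \<in> borel_measurable M"
    and f: "integrable M (\<lambda>x. (f x)\<^sup>2)" and g: "integrable M (\<lambda>x. (g x)\<^sup>2)"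
  shows "(LINT x|M. \<bar>f x * g x\<bar>) \<le> sqrt (LINT x|M. (f x)\<^sup>2) * sqrt (LINT x|M. (g x)\<^sup>2)"
proof -
  define A where "A = (LINT x|M. (f x)\<^sup>2)"
  define B where "B = (LINT x|M. (g x)\<^sup>2)"
  define C where "C = (LINT x|M. \<bar>f x * g x\<bar>)"
  have fg: "integrable M (\<lambda>x. \<bar>f x * g x\<bar>)" using integrable_mult_L2[OF assms] by simp
  have nn: "A \<ge> 0" "B \<ge> 0" "C \<ge> 0" unfolding A_def B_def C_def by (auto intro: integral_nonneg_AE)
  have key: "0 \<le> s\<^sup>2 * A - 2 * s * C + B" for s
  proof -
    have "0 \<le> (LINT x|M. (s * \<bar>f x\<bar> - \<bar>g x\<bar>)\<^sup>2)" by (intro integral_nonneg_AE) auto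
    also have "\<dots> = (LINT x|M. s\<^sup>2 * (f x)\<^sup>2 - 2 * s * \<bar>f x * g x\<bar> + (g x)\<^sup>2)"
      by (intro Bochner_Integration.integral_cong) (auto simp: power2_diff power_mult_distrib abs_mult)
    also have "\<dots> = s\<^sup>2 * A - 2 * s * C + B"
      unfolding A_def B_def C_def using f g fg by simp
    finally show ?thesis .
  qed
  have "C\<^sup>2 \<le> A * B"
  proof (cases "A = 0")
    case True
    have "C = 0"
    proof (rule ccontr)
      assume "C \<noteq> 0" then have "C > 0" using nn by simp
      \<comment> \<open>With \<open>A = 0\<close> the quadratic is affine in \<open>s\<close>, and
        this \<open>s\<close> gives it the value -1.\<close>
      then show False using key[of "(B + 1) / (2*C)"] True nn by (simp add: field_simps)
    qed
    then show ?thesis using True by simp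
  next
    case False
    then have "A > 0" using nn by simp
    \<comment> \<open>\<open>C / A\<close> is the point where the quadratic attains its
      minimum.\<close>
    then show ?thesis using key[of "C / A"] by (simp add: field_simps power2_eq_square)
  qed
  then show ?thesis
    using nn unfolding A_def[symmetric] B_def[symmetric] C_def[symmetric]
    by (metis real_le_rsqrt real_sqrt_mult)
qed

lemma L2_measurable [measurable_dest]: "f \<in> L2 S \<Longrightarrow> f \<in> borel_measurable (lebesgue_on S)"
  by (simp add: L2_def)

lemma L2_integrable_square: "f \<in> L2 S \<Longrightarrow> integrable (lebesgue_on S) (\<lambda>x. (norm (f x))\<^sup>2)"
  by (simp add: L2_def)

lemma L2_norm_nonneg [simp]: "0 \<le> L2_norm S f"
  by (simp add: L2_norm_def)

lemma L2_norm_power2: "(L2_norm S f)\<^sup>2 = (LINT x|lebesgue_on S. (norm (f x))\<^sup>2)"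
  by (simp add: L2_norm_def)

lemma L2_bound:
  fixes f :: "'a::euclidean_space \<Rightarrow> 'b::euclidean_space" and g :: "'a \<Rightarrow> 'c::euclidean_space"
  assumes "g \<in> L2 S" and "f \<in> borel_measurable (lebesgue_on S)"
    and "AE x in lebesgue_on S. norm (f x) \<le> C * norm (g x)"
  shows "f \<in> L2 S"
proof -
  have [measurable]: "f \<in> borel_measurable (lebesgue_on S)" by fact
  have "integrable (lebesgue_on S) (\<lambda>x. (norm (f x))\<^sup>2)"
  proof (rule Bochner_Integration.integrable_bound)
    show "integrable (lebesgue_on S) (\<lambda>x. C\<^sup>2 * (norm (g x))\<^sup>2)"
      using L2_integrable_square[OF assms(1)] by simp
    show "AE x in lebesgue_on S. norm ((norm (f x))\<^sup>2) \<le> norm (C\<^sup>2 * (norm (g x))\<^sup>2)"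
      using assms(3)
    proof eventually_elim
      case (elim x)
      then have "(norm (f x))\<^sup>2 \<le> (C * norm (g x))\<^sup>2" by (intro power_mono) auto
      then show ?case by (simp add: power_mult_distrib)
    qed
  qed simp
  then show ?thesis using assms by (simp add: L2_def)
qed

lemma L2_add:
  assumes "f \<in> L2 S" "g \<in> L2 S" shows "(\<lambda>x. f x + g x) \<in> L2 S"
proof -
  note [measurable] = L2_measurable[OF assms(1)] L2_measurable[OF assms(2)]
  have "integrable (lebesgue_on S) (\<lambda>x. (norm (f x + g x))\<^sup>2)"
  proof (rule Bochner_Integration.integrable_bound)
    show "integrable (lebesgue_on S) (\<lambda>x. 2 * (norm (f x))\<^sup>2 + 2 * (norm (g x))\<^sup>2)"
      using L2_integrable_square[OF assms(1)] L2_integrable_square[OF assms(2)] by simp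
    have "(norm (f x + g x))\<^sup>2 \<le> 2 * (norm (f x))\<^sup>2 + 2 * (norm (g x))\<^sup>2" for x
    proof -
      have "(norm (f x + g x))\<^sup>2 \<le> (norm (f x) + norm (g x))\<^sup>2"
        by (intro power_mono norm_triangle_ineq) auto
      also have "\<dots> \<le> 2 * (norm (f x))\<^sup>2 + 2 * (norm (g x))\<^sup>2"
        using sum_squares_bound[of "norm (f x)" "norm (g x)"] by (simp add: power2_sum)
      finally show ?thesis .
    qed
    then show "AE x in lebesgue_on S. norm ((norm (f x + g x))\<^sup>2) \<le> norm (2 * (norm (f x))\<^sup>2 + 2 * (norm (g x))\<^sup>2)"
      by auto
  qed simp
  then show ?thesis by (simp add: L2_def)
qed

lemma L2_scaleR: "f \<in> L2 S \<Longrightarrow> (\<lambda>x. c *\<^sub>R f x) \<in> L2 S"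
  by (rule L2_bound[where C="\<bar>c\<bar>" and g=f]) auto

lemma L2_diff: "f \<in> L2 S \<Longrightarrow> g \<in> L2 S \<Longrightarrow> (\<lambda>x. f x - g x) \<in> L2 S"
  using L2_add[of f S "\<lambda>x. (-1) *\<^sub>R g x"] L2_scaleR[of g S "-1"] by simp

lemma L2_inner_integrable:
  assumes "f \<in> L2 S" "g \<in> L2 S" shows "integrable (lebesgue_on S) (\<lambda>x. f x \<bullet> g x)"
proof -
  note [measurable] = L2_measurable[OF assms(1)] L2_measurable[OF assms(2)]
  have "integrable (lebesgue_on S) (\<lambda>x. norm (f x) * norm (g x))"
    using L2_integrable_square[OF assms(1)] L2_integrable_square[OF assms(2)]
    by (intro integrable_mult_L2) auto
  then show ?thesis
    by (rule Bochner_Integration.integrable_bound) (auto simp: Cauchy_Schwarz_ineq2)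
qed

lemma L2_norm_mult_integrable:
  fixes f :: "'a::euclidean_space \<Rightarrow> 'b::euclidean_space" and g :: "'a \<Rightarrow> 'c::euclidean_space"
  assumes "f \<in> L2 S" "g \<in> L2 S"
  shows "integrable (lebesgue_on S) (\<lambda>x. norm (f x) * norm (g x))"
    and "(LINT x|lebesgue_on S. norm (f x) * norm (g x)) \<le> L2_norm S f * L2_norm S g"
proof -
  note [measurable] = L2_measurable[OF assms(1)] L2_measurable[OF assms(2)]
  show "integrable (lebesgue_on S) (\<lambda>x. norm (f x) * norm (g x))"
    using L2_integrable_square[OF assms(1)] L2_integrable_square[OF assms(2)]
    by (intro integrable_mult_L2) auto
  show "(LINT x|lebesgue_on S. norm (f x) * norm (g x)) \<le> L2_norm S f * L2_norm S g"
    using integral_abs_mult_le_L2[of "\<lambda>x. norm (f x)" "lebesgue_on S" "\<lambda>x. norm (g x)"]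
      L2_integrable_square[OF assms(1)] L2_integrable_square[OF assms(2)]
    by (simp add: L2_norm_def)
qed

lemma L2_Cauchy_Schwarz:
  assumes "f \<in> L2 S" "g \<in> L2 S" shows "\<bar>L2_inner S f g\<bar> \<le> L2_norm S f * L2_norm S g"
proof -
  have "\<bar>L2_inner S f g\<bar> \<le> (LINT x|lebesgue_on S. \<bar>f x \<bullet> g x\<bar>)"
    unfolding L2_inner_def by (rule integral_abs_bound)
  also have "\<dots> \<le> (LINT x|lebesgue_on S. norm (f x) * norm (g x))"
    using L2_inner_integrable[OF assms] L2_norm_mult_integrable(1)[OF assms]
    by (intro integral_mono) (auto simp: Cauchy_Schwarz_ineq2)
  finally show ?thesis using L2_norm_mult_integrable(2)[OF assms] by simp
qed

lemma L2_inner_commute: "L2_inner S f g = L2_inner S g f"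
  by (simp add: L2_inner_def inner_commute)

lemma L2_inner_self: "L2_inner S f f = (L2_norm S f)\<^sup>2"
  by (simp add: L2_inner_def L2_norm_power2 power2_norm_eq_inner)

lemma L2_inner_diff_right:
  assumes "f \<in> L2 S" "g \<in> L2 S" "h \<in> L2 S"
  shows "L2_inner S f (\<lambda>x. g x - h x) = L2_inner S f g - L2_inner S f h"
  unfolding L2_inner_def using L2_inner_integrable[OF assms(1,2)] L2_inner_integrable[OF assms(1,3)]
  by (simp add: inner_diff_right)

lemma L2_inner_diff_left:
  assumes "f \<in> L2 S" "g \<in> L2 S" "h \<in> L2 S"
  shows "L2_inner S (\<lambda>x. g x - h x) f = L2_inner S g f - L2_inner S h f"
  using L2_inner_diff_right[OF assms] by (simp add: L2_inner_commute)

lemma L2_component: 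
  fixes f :: "'a::euclidean_space \<Rightarrow> real^2" 
  assumes "f \<in> L2 S" shows "(\<lambda>x. f x $ i) \<in> L2 S"
proof (rule L2_bound[OF assms, of _ 1])
  note [measurable] = L2_measurable[OF assms(1)]
  have "(\<lambda>x. f x \<bullet> axis i 1) \<in> borel_measurable (lebesgue_on S)" by measurable
  then show "(\<lambda>x. f x $ i) \<in> borel_measurable (lebesgue_on S)" by (simp add: inner_axis)
qed (auto simp: component_le_norm_cart)

lemma norm2_vec2: "(norm (v::real^2))\<^sup>2 = (v$1)\<^sup>2 + (v$2)\<^sup>2"
  unfolding power2_norm_eq_inner inner_vec_def sum_2 by (simp add: power2_eq_square)

lemma inner_vec2: "(v::real^2) \<bullet> w = v$1 * w$1 + v$2 * w$2"
  by (simp add: inner_vec_def sum_2)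

lemma borel_measurable_vec2:
  fixes f :: "'a \<Rightarrow> real^2"
  assumes "(\<lambda>x. f x $ 1) \<in> borel_measurable M" "(\<lambda>x. f x $ 2) \<in> borel_measurable M"
  shows "f \<in> borel_measurable M"
proof (subst borel_measurable_euclidean_space, intro ballI)
  fix i :: "real^2" assume "i \<in> Basis"
  then show "(\<lambda>x. f x \<bullet> i) \<in> borel_measurable M"
    using assms by (auto simp: Basis_vec_def inner_axis exhaust_2 forall_2 UNIV_2)
qed

lemma borel_measurable_vec_nth [measurable (raw)]:
  fixes f :: "'a \<Rightarrow> real^2"
  assumes [measurable]: "f \<in> borel_measurable M" shows "(\<lambda>x. f x $ i) \<in> borel_measurable M"
proof -
  have "(\<lambda>x. f x \<bullet> axis i 1) \<in> borel_measurable M" by measurable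
  then show ?thesis by (simp add: inner_axis)
qed

lemma L2_vec2:
  fixes f :: "'a::euclidean_space \<Rightarrow> real^2" 
  assumes "(\<lambda>x. f x $ 1) \<in> L2 S" "(\<lambda>x. f x $ 2) \<in> L2 S" shows "f \<in> L2 S"
  using L2_integrable_square[OF assms(1)] L2_integrable_square[OF assms(2)]
    borel_measurable_vec2[OF L2_measurable[OF assms(1)] L2_measurable[OF assms(2)]]
  by (simp add: L2_def norm2_vec2)

subsection \<open>The torus and its characters\<close>

abbreviation MT :: "(real^2) measure" where "MT \<equiv> lebesgue_on torus"

lemma torus_sets [measurable, simp]: "torus \<in> sets lebesgue" "torus \<in> sets borel"
  by (auto simp: torus_def)

lemma compact_torus: "compact torus"
  by (simp add: torus_def)

lemma Basis_real2: "(Basis :: (real^2) set) = {axis 1 1, axis 2 1}"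
  by (auto simp: Basis_vec_def UNIV_2)

lemma axis12_neq: "axis 1 1 \<noteq> (axis 2 1 :: real^2)"
  by (simp add: axis_eq_axis)

lemma axis_nth_2 [simp]:
  "axis 1 a $ (1::2) = (a::real)" "axis 1 a $ (2::2) = (0::real)"
  "axis 2 a $ (1::2) = (0::real)" "axis 2 a $ (2::2) = (a::real)"
  by (simp_all add: axis_def)

lemma mem_torus: "x \<in> torus \<longleftrightarrow> 0 \<le> x$1 \<and> x$1 \<le> 1 \<and> 0 \<le> x$2 \<and> x$2 \<le> 1"
  by (auto simp: torus_def mem_box_cart forall_2)

lemma emeasure_torus: "emeasure MT torus = 1"
  by (simp add: emeasure_restrict_space torus_def emeasure_lborel_cbox_eq Basis_real2 axis12_neq 
      inner_axis prod.insert)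

interpretation MT: prob_space MT
  by (rule prob_spaceI) (simp add: emeasure_torus)

text \<open>The factor \<open>2 * pi\<close> belongs to the frequency, so that the gradient of a
  character is \<open>\<i>\<close> times \<open>freq k\<close> times the character, with no further
  constant.\<close>

definition freq :: "int \<times> int \<Rightarrow> real^2" where
  "freq k = vector [2 * pi * of_int (fst k), 2 * pi * of_int (snd k)]"

lemma freq_nth [simp]: "freq k $ 1 = 2 * pi * of_int (fst k)" "freq k $ 2 = 2 * pi * of_int (snd k)"
  by (simp_all add: freq_def)

lemma vec2_eqI: "(x::real^2) $ 1 = y $ 1 \<Longrightarrow> x $ 2 = y $ 2 \<Longrightarrow> x = y"
  by (simp add: vec_eq_iff forall_2)

lemma freq_add: "freq (k + l) = freq k + freq l"
  by (rule vec2_eqI) (simp_all add: algebra_simps)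

lemma freq_minus: "freq (- k) = - freq k"
  by (rule vec2_eqI) (simp_all add: algebra_simps)

lemma freq_0 [simp]: "freq 0 = 0"
  by (rule vec2_eqI) (simp_all)

lemma freq_eq_0 [simp]: "freq k = 0 \<longleftrightarrow> k = 0"
  by (cases k) (auto simp: vec_eq_iff forall_2 zero_prod_def)

definition chr :: "int \<times> int \<Rightarrow> real^2 \<Rightarrow> complex" where
  "chr k x = cis (freq k \<bullet> x)"

lemma chr_add: "chr (k + l) x = chr k x * chr l x"
  by (simp add: chr_def freq_add inner_add_left cis_mult)

lemma chr_minus: "chr (- k) x = cnj (chr k x)"
  by (simp add: chr_def freq_minus cis_cnj)

lemma chr_diff: "chr (k - l) x = chr k x * cnj (chr l x)"
  using chr_add[of k "-l" x] by (simp add: chr_minus)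

lemma chr_0 [simp]: "chr 0 x = 1"
  by (simp add: chr_def)

lemma norm_chr [simp]: "norm (chr k x) = 1"
  by (simp add: chr_def)

lemma continuous_on_chr [continuous_intros]:
  "continuous_on S f \<Longrightarrow> continuous_on S (\<lambda>x. chr k (f x))"
  unfolding chr_def cis_conv_exp by (intro continuous_intros)

lemma borel_measurable_chr [measurable]: "chr k \<in> borel_measurable borel"
  by (intro borel_measurable_continuous_onI continuous_intros)

lemma borel_measurable_MT: "f \<in> borel_measurable borel \<Longrightarrow> f \<in> borel_measurable MT"
  by (simp add: measurable_completion measurable_restrict_space1)

lemma borel_measurable_chr_MT [measurable]: "chr k \<in> borel_measurable MT"
  by (intro borel_measurable_MT borel_measurable_chr)

lemma integral_cis_unit_interval:
  "(LINT s|lborel. indicator {0..1} s *\<^sub>R cis (2 * pi * of_int n * s)) = (if n = 0 then 1 else 0)"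
proof (cases "n = 0")
  case False
  define c where "c = 2 * pi * of_int n"
  have c: "c \<noteq> 0" using False by (simp add: c_def)
  have "(LINT s|lborel. indicator {0..1} s *\<^sub>R cis (c * s)) = cis (c * 1) / (\<i> * c) - cis (c * 0) / (\<i> * c)"
  proof (rule integral_FTC_atLeastAtMost)
    fix s :: real 
    have "((\<lambda>z. exp (\<i> * c * z) / (\<i> * c)) has_field_derivative exp (\<i> * c * of_real s)) (at (of_real s))"
      using c by (auto intro!: derivative_eq_intros)
    from has_vector_derivative_real_field[OF this]
    show "((\<lambda>s. cis (c * s) / (\<i> * c)) has_vector_derivative cis (c * s)) (at s within {0..1})"
      by (simp add: cis_conv_exp mult.assoc)
  qed (auto simp: cis_conv_exp intro!: continuous_intros)
  also have "\<dots> = 0"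
    using cis_multiple_2pi[of "of_int n"] by (simp add: c_def)
  finally show ?thesis using False by (simp add: c_def)
qed (simp add: measure_def)

text \<open>All orthogonality relations at once, since
  \<open>chr k x * cnj (chr l x) = chr (k - l) x\<close>. Lebesgue measure on the plane is the image
  of a product measure over \<open>Basis\<close>, and both the indicator of the square and the
  character factor over the coordinates.\<close>

lemma integral_chr: "(LINT x|MT. chr k x) = (if k = 0 then 1 else 0)"
proof -
  interpret product_sigma_finite "\<lambda>b::real^2. lborel :: real measure"
    by standard
  define c where "c b = (if b = axis 1 1 then fst k else snd k)" for b :: "real^2"
  define h where "h b s = indicator {0..1::real} s *\<^sub>R cis (2 * pi * of_int (c b) * s)" for b s
  have h_int: "integrable lborel (h b)" for b
    unfolding h_def 
    by (intro borel_integrable_compact) (auto simp: cis_conv_exp intro!: continuous_intros)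
  have prod2: "(\<Prod>b\<in>Basis. F b) = F (axis 1 1) * F (axis 2 1)" for F :: "real^2 \<Rightarrow> complex"
    by (simp add: Basis_real2 axis12_neq)
  have "(LINT x|MT. chr k x) = (LINT x|lebesgue. indicator torus x *\<^sub>R chr k x)"
    by (simp add: integral_restrict_space)
  also have "\<dots> = (LINT x|lborel. indicator torus x *\<^sub>R chr k x)"
    by (rule integral_completion) measurable
  also have "\<dots> = (LINT f|(\<Pi>\<^sub>M b\<in>(Basis::(real^2) set). lborel). 
      indicator torus (\<Sum>b\<in>Basis. f b *\<^sub>R b) *\<^sub>R chr k (\<Sum>b\<in>Basis. f b *\<^sub>R b))"
    by (subst lborel_eq, rule integral_distr) measurable
  also have "\<dots> = (LINT f|(\<Pi>\<^sub>M b\<in>(Basis::(real^2) set). lborel). (\<Prod>b\<in>Basis. h b (f b)))"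
  proof (rule Bochner_Integration.integral_cong[OF refl])
    fix f :: "real^2 \<Rightarrow> real"
    have *: "(\<Sum>b\<in>Basis. f b *\<^sub>R b) = vector [f (axis 1 1), f (axis 2 1)]"
      by (rule vec2_eqI) (simp_all add: Basis_real2 axis12_neq)
    show "indicator torus (\<Sum>b\<in>Basis. f b *\<^sub>R b) *\<^sub>R chr k (\<Sum>b\<in>Basis. f b *\<^sub>R b) = (\<Prod>b\<in>Basis. h b (f b))"
      unfolding * prod2 h_def c_def chr_def
      using axis12_neq by (auto simp: inner_vec2 mem_torus cis_mult indicator_def)
  qed
  also have "\<dots> = (\<Prod>b\<in>Basis. integral\<^sup>L lborel (h b))"
    by (rule product_integral_prod) (auto simp: h_int)
  also have "\<dots> = (if k = 0 then 1 else 0)"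
    unfolding prod2 h_def integral_cis_unit_interval using axis12_neq
    by (cases k) (auto simp: c_def zero_prod_def)
  finally show ?thesis .
qed

subsection \<open>Smooth functions\<close>

text \<open>\<open>Ck\<close> speaks of the chosen \<open>frechet_derivative\<close>. By uniqueness
  of derivatives an explicit formula may be supplied instead, which is how the inductions below
  enter.\<close>

lemma Ck_SucI:
  assumes "\<And>x. (f has_derivative f' x) (at x)" and "\<And>e. e \<in> Basis \<Longrightarrow> Ck k (\<lambda>x. f' x e)"
  shows "Ck (Suc k) f"
proof -
  have "frechet_derivative f (at x) = f' x" for x
    using frechet_derivative_at[OF assms(1)] by simp
  then show ?thesis using assms by (auto simp: differentiable_on_def differentiable_def)
qed

lemma Ck_Suc_has_derivative:
  "Ck (Suc k) f \<Longrightarrow> (f has_derivative frechet_derivative f (at x)) (at x)"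
  by (auto simp: differentiable_on_def frechet_derivative_works[symmetric])

lemma Ck_Suc_D: "Ck (Suc k) f \<Longrightarrow> e \<in> Basis \<Longrightarrow> Ck k (\<lambda>x. frechet_derivative f (at x) e)"
  by simp

lemma Ck_SucD: "Ck (Suc k) f \<Longrightarrow> Ck k f"
proof (induction k arbitrary: f)
  case 0
  then show ?case by (simp add: differentiable_imp_continuous_on)
next
  case (Suc k)
  show ?case
  proof (rule Ck_SucI)
    show "(f has_derivative frechet_derivative f (at x)) (at x)" for x
      using Suc.prems by (rule Ck_Suc_has_derivative)
    show "Ck k (\<lambda>x. frechet_derivative f (at x) e)" if "e \<in> Basis" for e
      using Ck_Suc_D[OF Suc.prems that] by (rule Suc.IH)
  qed
qed

lemma Ck_const [intro]: "Ck k (\<lambda>x. c)"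
proof (induction k arbitrary: c)
  case (Suc k)
  show ?case by (rule Ck_SucI[OF has_derivative_const]) (rule Suc.IH)
qed simp

lemma Ck_add:
  assumes "Ck k f" "Ck k g" shows "Ck k (\<lambda>x. f x + g x)"
  using assms
proof (induction k arbitrary: f g)
  case (Suc k)
  show ?case
  proof (rule Ck_SucI)
    show "((\<lambda>x. f x + g x) has_derivative 
        (\<lambda>e. frechet_derivative f (at x) e + frechet_derivative g (at x) e)) (at x)" for x
      using Suc.prems by (intro has_derivative_add Ck_Suc_has_derivative)
    show "Ck k (\<lambda>x. frechet_derivative f (at x) e + frechet_derivative g (at x) e)" if "e \<in> Basis" for e
      using Suc.prems that by (intro Suc.IH Ck_Suc_D)
  qed
qed (auto intro: continuous_intros)

lemma Ck_scaleR:
  fixes f :: "'a::euclidean_space \<Rightarrow> real"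
  assumes "Ck k f" "Ck k g" shows "Ck k (\<lambda>x. f x *\<^sub>R g x)"
  using assms
proof (induction k arbitrary: f g)
  case (Suc k)
  show ?case
  proof (rule Ck_SucI)
    show "((\<lambda>x. f x *\<^sub>R g x) has_derivative 
        (\<lambda>e. f x *\<^sub>R frechet_derivative g (at x) e + frechet_derivative f (at x) e *\<^sub>R g x)) (at x)" for x
      using Suc.prems by (intro has_derivative_scaleR Ck_Suc_has_derivative)
    show "Ck k (\<lambda>x. f x *\<^sub>R frechet_derivative g (at x) e + frechet_derivative f (at x) e *\<^sub>R g x)" 
      if "e \<in> Basis" for e
      by (rule Ck_add[OF Suc.IH[OF Ck_SucD[OF Suc.prems(1)] Ck_Suc_D[OF Suc.prems(2) that]]
            Suc.IH[OF Ck_Suc_D[OF Suc.prems(1) that] Ck_SucD[OF Suc.prems(2)]]])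
  qed
qed (auto intro: continuous_intros)

lemma Ck_mult:
  fixes f g :: "'a::euclidean_space \<Rightarrow> real"
  shows "Ck k f \<Longrightarrow> Ck k g \<Longrightarrow> Ck k (\<lambda>x. f x * g x)"
  using Ck_scaleR[of k f g] by simp

lemma Ck_sum: "(\<And>i. i \<in> I \<Longrightarrow> Ck k (f i)) \<Longrightarrow> Ck k (\<lambda>x. \<Sum>i\<in>I. f i x)"
  by (induction I rule: infinite_finite_induct) (auto intro: Ck_add)

text \<open>Affine inner maps suffice for what follows: rescaled cutoffs in time and the two
  coordinate projections of space-time.\<close>

lemma Ck_compose_affine:
  fixes f :: "'b::euclidean_space \<Rightarrow> 'c::real_normed_vector" and L :: "'a::euclidean_space \<Rightarrow> 'b"
  assumes "bounded_linear L" "Ck k f" shows "Ck k (\<lambda>x. f (L x + c))"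
  using assms(2)
proof (induction k arbitrary: f)
  case 0
  have L: "continuous_on UNIV (\<lambda>x. L x + c)"
    by (intro continuous_on_add continuous_on_const linear_continuous_on assms(1))
  have f: "continuous_on UNIV f" using 0 by simp
  have "continuous_on UNIV (\<lambda>x. f (L x + c))"
    by (rule continuous_on_compose2[OF f L]) simp
  then show ?case by simp
next
  case (Suc k)
  let ?D = "\<lambda>x. frechet_derivative f (at x)"
  have D: "(f has_derivative ?D x) (at x)" for x using Suc.prems by (rule Ck_Suc_has_derivative)
  show ?case
  proof (rule Ck_SucI)
    have "((\<lambda>x. L x + c) has_derivative L) (at x)" for x
      by (rule has_derivative_eq_rhs[OF has_derivative_add[OF bounded_linear_imp_has_derivative[OF assms(1)] has_derivative_const]]) simp
    from has_derivative_compose[OF this D]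
    show "((\<lambda>x. f (L x + c)) has_derivative (\<lambda>e. ?D (L x + c) (L e))) (at x)" for x .
    fix e :: 'a
    \<comment> \<open>\<open>Ck\<close> controls derivatives along basis vectors only, and
      \<open>L e\<close> need not be one, so it is expanded in the basis.\<close>
    have "?D y (L e) = (\<Sum>b\<in>Basis. (L e \<bullet> b) *\<^sub>R ?D y b)" for y
    proof -
      interpret linear "?D y" using has_derivative_linear[OF D] .
      have "?D y (L e) = ?D y (\<Sum>b\<in>Basis. (L e \<bullet> b) *\<^sub>R b)" by (simp add: euclidean_representation)
      also have "\<dots> = (\<Sum>b\<in>Basis. (L e \<bullet> b) *\<^sub>R ?D y b)" by (simp add: sum scaleR)
      finally show ?thesis .
    qed
    moreover have "Ck k (\<lambda>x. ?D (L x + c) b)" if "b \<in> Basis" for b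
      using Suc.IH[OF Ck_Suc_D[OF Suc.prems that]] .
    ultimately show "Ck k (\<lambda>x. ?D (L x + c) (L e))"
      by (simp add: Ck_sum Ck_scaleR Ck_const)
  qed
qed

lemma Ck_linear: "bounded_linear f \<Longrightarrow> Ck k f"
proof (induction k)
  case 0 then show ?case by (simp add: linear_continuous_on)
next
  case (Suc k) then show ?case
    by (intro Ck_SucI[where f'="\<lambda>_. f"]) (auto intro: bounded_linear_imp_has_derivative)
qed

text \<open>One induction for both functions, because each is up to sign the derivative of the
  other.\<close>

lemma Ck_cos_sin:
  fixes f :: "'a::euclidean_space \<Rightarrow> real"
  assumes "Ck k f" shows "Ck k (\<lambda>x. cos (f x)) \<and> Ck k (\<lambda>x. sin (f x))"
  using assms
proof (induction k)
  case (Suc k)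
  note IH = Suc.IH[OF Ck_SucD[OF Suc.prems]]
  have D: "(f has_derivative frechet_derivative f (at x)) (at x)" for x 
    using Suc.prems by (rule Ck_Suc_has_derivative)
  have "Ck (Suc k) (\<lambda>x. cos (f x))"
  proof (rule Ck_SucI)
    show "((\<lambda>x. cos (f x)) has_derivative (\<lambda>e. (-1) * (sin (f x) * frechet_derivative f (at x) e))) (at x)" for x
      by (rule has_derivative_eq_rhs[OF has_derivative_cos[OF D]]) auto
    show "Ck k (\<lambda>x. (-1) * (sin (f x) * frechet_derivative f (at x) e))" if "e \<in> Basis" for e
      using IH Ck_Suc_D[OF Suc.prems that] by (intro Ck_mult) auto
  qed
  moreover have "Ck (Suc k) (\<lambda>x. sin (f x))"
  proof (rule Ck_SucI)
    show "((\<lambda>x. sin (f x)) has_derivative (\<lambda>e. cos (f x) * frechet_derivative f (at x) e)) (at x)" for x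
      by (rule has_derivative_eq_rhs[OF has_derivative_sin[OF D]]) auto
    show "Ck k (\<lambda>x. cos (f x) * frechet_derivative f (at x) e)" if "e \<in> Basis" for e
      using IH Ck_Suc_D[OF Suc.prems that] by (intro Ck_mult) auto
  qed
  ultimately show ?case by blast
qed (auto intro: continuous_intros)

text \<open>The derivative is a product of the same inverse and a derivative of \<open>f\<close>, so
  the induction hypothesis closes the step.\<close>

lemma Ck_inverse:
  fixes f :: "'a::euclidean_space \<Rightarrow> real"
  assumes "Ck k f" "\<And>x. f x \<noteq> 0" shows "Ck k (\<lambda>x. inverse (f x))"
  using assms(1)
proof (induction k)
  case (Suc k)
  note IH = Suc.IH[OF Ck_SucD[OF Suc.prems]]
  show ?case
  proof (rule Ck_SucI)
    show "((\<lambda>x. inverse (f x)) has_derivative 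
        (\<lambda>e. (-1) * ((inverse (f x) * frechet_derivative f (at x) e) * inverse (f x)))) (at x)" for x
      by (rule has_derivative_eq_rhs[OF Deriv.has_derivative_inverse[OF assms(2) Ck_Suc_has_derivative[OF Suc.prems]]]) 
        (simp add: mult_ac)
    show "Ck k (\<lambda>x. (-1) * ((inverse (f x) * frechet_derivative f (at x) e) * inverse (f x)))" if "e \<in> Basis" for e
      using IH Ck_Suc_D[OF Suc.prems that] by (intro Ck_mult) auto
  qed
qed (use assms(2) in \<open>auto intro!: continuous_intros\<close>)

lemma smooth_continuous: "smooth f \<Longrightarrow> continuous_on UNIV f"
  unfolding smooth_def using Ck.simps(1) by blast

lemma smooth_has_derivative: "smooth f \<Longrightarrow> (f has_derivative frechet_derivative f (at x)) (at x)"
  unfolding smooth_def using Ck_Suc_has_derivative by blast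

lemma smooth_deriv: "smooth f \<Longrightarrow> e \<in> Basis \<Longrightarrow> smooth (\<lambda>x. frechet_derivative f (at x) e)"
  unfolding smooth_def using Ck_Suc_D by blast

lemma smooth_const [intro]: "smooth (\<lambda>x. c)"
  by (auto simp: smooth_def)

lemma smooth_scaleR:
  fixes f :: "'a::euclidean_space \<Rightarrow> real"
  shows "smooth f \<Longrightarrow> smooth g \<Longrightarrow> smooth (\<lambda>x. f x *\<^sub>R g x)"
  by (auto simp: smooth_def intro: Ck_scaleR)

lemma smooth_mult:
  fixes f :: "'a::euclidean_space \<Rightarrow> real"
  shows "smooth f \<Longrightarrow> smooth g \<Longrightarrow> smooth (\<lambda>x. f x * g x)"
  by (auto simp: smooth_def intro: Ck_mult)

lemma smooth_add: "smooth f \<Longrightarrow> smooth g \<Longrightarrow> smooth (\<lambda>x. f x + g x)"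
  by (auto simp: smooth_def intro: Ck_add)

lemma smooth_sum: "(\<And>i. i \<in> I \<Longrightarrow> smooth (f i)) \<Longrightarrow> smooth (\<lambda>x. \<Sum>i\<in>I. f i x)"
  by (auto simp: smooth_def intro: Ck_sum)

lemma smooth_compose_affine: 
  fixes f :: "'b::euclidean_space \<Rightarrow> 'c::real_normed_vector" and L :: "'a::euclidean_space \<Rightarrow> 'b"
  shows "bounded_linear L \<Longrightarrow> smooth f \<Longrightarrow> smooth (\<lambda>x. f (L x + c))"
  by (auto simp: smooth_def intro: Ck_compose_affine)

lemma smooth_linear: "bounded_linear f \<Longrightarrow> smooth f"
  by (auto simp: smooth_def intro: Ck_linear)

lemma smooth_cos: "smooth f \<Longrightarrow> smooth (\<lambda>x. cos (f x :: real))"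
  and smooth_sin: "smooth f \<Longrightarrow> smooth (\<lambda>x. sin (f x :: real))"
  using Ck_cos_sin by (auto simp: smooth_def)

lemma smooth_inverse:
  fixes f :: "'a::euclidean_space \<Rightarrow> real"
  shows "smooth f \<Longrightarrow> (\<And>x. f x \<noteq> 0) \<Longrightarrow> smooth (\<lambda>x. inverse (f x))"
  by (auto simp: smooth_def intro: Ck_inverse)

section \<open>Smooth cutoffs in one variable\<close>

definition flat_exp :: "nat \<Rightarrow> real \<Rightarrow> real" where
  "flat_exp n t = (if t > 0 then (1/t)^n * exp (-(1/t)) else 0)"

text \<open>From the right, y = 1/t turns this into the decay of y^n / exp y at infinity; from the
  left the function is zero.\<close>

lemma flat_exp_tendsto_0: "(flat_exp n \<longlongrightarrow> 0) (at 0)"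
proof -
  have "((\<lambda>y. y ^ n / exp y) \<longlongrightarrow> (0::real)) at_top"
    by (rule tendsto_power_div_exp_0)
  from filterlim_compose[OF this filterlim_inverse_at_top_right]
  have "((\<lambda>t. (inverse t) ^ n / exp (inverse t)) \<longlongrightarrow> (0::real)) (at_right 0)" .
  moreover have "\<forall>\<^sub>F t in at_right 0. (inverse t) ^ n / exp (inverse t) = flat_exp n t"
    by (auto simp: eventually_at_right_less flat_exp_def exp_minus field_simps 
        intro!: eventually_mono[OF eventually_at_right_less])
  ultimately have "(flat_exp n \<longlongrightarrow> 0) (at_right 0)"
    by (rule Lim_transform_eventually)
  moreover have "(flat_exp n \<longlongrightarrow> 0) (at_left 0)"
    by (rule Lim_transform_eventually[OF tendsto_const])
       (auto simp: flat_exp_def eventually_at_left_field intro!: exI[of _ "-1"])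
  ultimately show ?thesis by (simp add: filterlim_at_split)
qed

text \<open>\<open>flat_exp 0\<close> is the classical function exp(-1/t) extended by zero. The
  powers of 1/t are carried along because they make the family closed under differentiation, so that
  smoothness is an induction over all \<open>n\<close> at once.\<close>

lemma flat_exp_deriv:
  "(flat_exp n has_real_derivative (flat_exp (n + 2) t - real n * flat_exp (n + 1) t)) (at t)"
proof -
  consider "t > 0" | "t < 0" | "t = 0" by linarith
  then show ?thesis
  proof cases
    case 1
    have y: "((\<lambda>t. 1/t) has_real_derivative (- ((1/t)^2))) (at t)"
      using 1 by (auto intro!: derivative_eq_intros simp: power2_eq_square)
    have "((\<lambda>t. (1/t)^n * exp (-(1/t))) has_real_derivative 
        (exp (-(1/t)) * (- (- ((1/t)^2)))) * (1/t)^n + (real n * ((- ((1/t)^2)) * (1/t)^(n - Suc 0))) * exp (-(1/t))) (at t)"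
      by (rule DERIV_cong[OF DERIV_mult[OF DERIV_power[OF y] DERIV_fun_exp[OF DERIV_minus[OF y]]]]) simp
    moreover have "(exp (-y) * (- (- (y^2)))) * y^n + (real n * ((- (y^2)) * y^(n - Suc 0))) * exp (-y)
        = y^(n+2) * exp (-y) - real n * (y^(n+1) * exp (-y))" for y :: real
      by (cases n) (simp_all add: algebra_simps power_add power2_eq_square)
    ultimately have "((\<lambda>t. (1/t)^n * exp (-(1/t))) has_real_derivative 
        (flat_exp (n + 2) t - real n * flat_exp (n + 1) t)) (at t)"
      using 1 by (simp only: flat_exp_def if_True)
    moreover have "\<forall>\<^sub>F s in nhds t. (1/s)^n * exp (-(1/s)) = flat_exp n s"
      using eventually_nhds_in_open[of "{0<..}" t] 1 by (auto elim!: eventually_mono simp: flat_exp_def)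
    ultimately show ?thesis by (subst (asm) DERIV_cong_ev[OF refl _ refl]) 
  next
    case 2
    have "\<forall>\<^sub>F s in nhds t. 0 = flat_exp n s"
      using eventually_nhds_in_open[of "{..<0}" t] 2 by (auto elim!: eventually_mono simp: flat_exp_def)
    then have "((\<lambda>_. 0) has_real_derivative 0) (at t) \<longleftrightarrow> (flat_exp n has_real_derivative 0) (at t)"
      by (intro DERIV_cong_ev) auto
    then show ?thesis using 2 by (simp add: flat_exp_def)
  next
    case 3
    \<comment> \<open>At the origin the difference quotient is the next member of the family, whose
      limit there is already known.\<close>
    have "flat_exp n t / t = flat_exp (n + 1) t" for t by (simp add: flat_exp_def)
    then have "(\<lambda>h. (flat_exp n (0 + h) - flat_exp n 0) / h) = flat_exp (n + 1)"
      by (auto simp: flat_exp_def fun_eq_iff)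
    then show ?thesis using 3 flat_exp_tendsto_0[of "n+1"] by (simp add: DERIV_def flat_exp_def)
  qed
qed

lemma Ck_flat_exp: "Ck k (flat_exp n)"
proof (induction k arbitrary: n)
  case 0
  have "continuous_on UNIV (flat_exp n)" by (rule DERIV_continuous_on) (rule flat_exp_deriv)
  then show ?case by simp
next
  case (Suc k)
  show ?case
  proof (rule Ck_SucI)
    show "(flat_exp n has_derivative (\<lambda>e. (flat_exp (n + 2) t - real n * flat_exp (n + 1) t) * e)) (at t)" for t
      using flat_exp_deriv[of n t] by (simp add: has_field_derivative_def)
    have "Ck k (\<lambda>t. flat_exp (n + 2) t + (- real n) * flat_exp (n + 1) t)"
      by (intro Ck_add Ck_mult Suc.IH Ck_const)
    then show "Ck k (\<lambda>t. (flat_exp (n + 2) t - real n * flat_exp (n + 1) t) * e)" if "e \<in> Basis" for e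
      using that by simp
  qed
qed

lemma smooth_real_affine:
  fixes f :: "real \<Rightarrow> 'c::real_normed_vector"
  shows "smooth f \<Longrightarrow> smooth (\<lambda>t. f (a * t + c))"
  by (rule smooth_compose_affine) (auto intro: bounded_linear_mult_right)

text \<open>The quotient f(x) / (f(x) + f(1 - x)) with f = \<open>flat_exp 0\<close>; the
  denominator is positive because x and 1 - x are never both nonpositive. Its rescalings cut a time
  integral off at a prescribed time.\<close>

lemma smooth_step_exists:
  "\<exists>S :: real \<Rightarrow> real. smooth S \<and> (\<forall>x\<le>0. S x = 0) \<and> (\<forall>x\<ge>1. S x = 1) \<and> (\<forall>x. 0 \<le> S x \<and> S x \<le> 1)"
proof -
  define f where "f = flat_exp 0"
  define S where "S x = f x * inverse (f x + f ((-1) * x + 1))" for x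
  have f: "smooth f" by (simp add: smooth_def f_def Ck_flat_exp)
  have f1: "smooth (\<lambda>x. f ((-1) * x + 1))" by (rule smooth_real_affine[OF f])
  have nn: "f x \<ge> 0" "x > 0 \<Longrightarrow> f x > 0" "x \<le> 0 \<Longrightarrow> f x = 0" for x by (auto simp: f_def flat_exp_def)
  have pos: "f x + f ((-1) * x + 1) > 0" for x
    using nn(1)[of x] nn(1)[of "(-1) * x + 1"] nn(2)[of x] nn(2)[of "(-1) * x + 1"]
    by (cases "x > 0") (auto intro: add_pos_nonneg add_nonneg_pos)
  have "smooth S"
    unfolding S_def using pos by (intro smooth_mult smooth_inverse smooth_add f f1) (auto simp: less_imp_neq[symmetric])
  moreover have "x \<le> 0 \<Longrightarrow> S x = 0" for x by (simp add: S_def nn)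
  moreover have "x \<ge> 1 \<Longrightarrow> S x = 1" for x using pos[of x] nn(3)[of "(-1) * x + 1"] by (simp add: S_def)
  moreover have "0 \<le> S x" for x using pos[of x] nn(1)[of x] by (simp add: S_def)
  moreover have "S x \<le> 1" for x using pos[of x] nn(1)[of "(-1) * x + 1"] by (simp add: S_def field_simps)
  ultimately show ?thesis by blast
qed

text \<open>The product f(x) f(1 - x). Strict positivity inside is what later lets a vanishing
  weighted integral force the other factor to vanish.\<close>

lemma smooth_bump_exists:
  "\<exists>B :: real \<Rightarrow> real. smooth B \<and> (\<forall>x. x \<notin> {0..1} \<longrightarrow> B x = 0) \<and> (\<forall>x. 0 < x \<longrightarrow> x < 1 \<longrightarrow> 0 < B x) \<and> (\<forall>x. 0 \<le> B x)"
proof -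
  define f where "f = flat_exp 0"
  define S where "S x = f x * f ((-1) * x + 1)" for x
  have f: "smooth f" by (simp add: smooth_def f_def Ck_flat_exp)
  have f1: "smooth (\<lambda>x. f ((-1) * x + 1))" by (rule smooth_real_affine[OF f])
  have "smooth S"
    unfolding S_def by (intro smooth_mult f f1)
  then show ?thesis by (intro exI[of _ S]) (auto simp: S_def f_def flat_exp_def)
qed

section \<open>Smooth periodic test functions\<close>

lemma torus_test_smooth: "\<psi> \<in> torus_test \<Longrightarrow> smooth \<psi>"
  by (simp add: torus_test_def)

lemma torus_test_periodic: "\<psi> \<in> torus_test \<Longrightarrow> periodic \<psi>"
  by (simp add: torus_test_def)

lemma torus_test_const: "(\<lambda>x. c) \<in> torus_test"
  by (auto simp: torus_test_def periodic_def)

lemma torus_test_sum: "(\<And>i. i \<in> I \<Longrightarrow> f i \<in> torus_test) \<Longrightarrow> (\<lambda>x. \<Sum>i\<in>I. f i x) \<in> torus_test"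
  by (auto simp: torus_test_def periodic_def intro!: smooth_sum)

lemma torus_test_scaleR: 
  fixes f :: "real^2 \<Rightarrow> real"
  shows "f \<in> torus_test \<Longrightarrow> g \<in> torus_test \<Longrightarrow> (\<lambda>x. f x *\<^sub>R g x) \<in> torus_test"
  by (auto simp: torus_test_def periodic_def intro!: smooth_scaleR)

lemma torus_test_mult: 
  fixes f :: "real^2 \<Rightarrow> real"
  shows "f \<in> torus_test \<Longrightarrow> g \<in> torus_test \<Longrightarrow> (\<lambda>x. f x * g x) \<in> torus_test"
  using torus_test_scaleR[of f g] by simp

lemma torus_test_cos: "f \<in> torus_test \<Longrightarrow> (\<lambda>x. cos (f x :: real)) \<in> torus_test"
  and torus_test_sin: "f \<in> torus_test \<Longrightarrow> (\<lambda>x. sin (f x :: real)) \<in> torus_test"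
  by (auto simp: torus_test_def periodic_def intro!: smooth_cos smooth_sin)

lemma freq_axis: "freq k \<bullet> axis i 1 = 2 * pi * of_int (if i = 1 then fst k else snd k)"
  using exhaust_2[of i] by (auto simp: inner_axis)

text \<open>The free phase \<open>c\<close> serves the translated kernels in
  \<open>psi_test\<close>, where it depends on the base point.\<close>

lemma torus_test_trig:
  "(\<lambda>x. cos (freq k \<bullet> x + c)) \<in> torus_test" "(\<lambda>x. sin (freq k \<bullet> x + c)) \<in> torus_test"
proof -
  have "smooth (\<lambda>x::real^2. freq k \<bullet> x + c)"
    by (intro smooth_add smooth_linear bounded_linear_inner_right smooth_const)
  moreover have "periodic (\<lambda>x. cos (freq k \<bullet> x + c))" "periodic (\<lambda>x. sin (freq k \<bullet> x + c))"
    unfolding periodic_def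
  proof (safe)
    fix x i
    define n where "n = (if i = (1::2) then fst k else snd k)"
    have *: "freq k \<bullet> (x + axis i 1) + c = (freq k \<bullet> x + c) + of_int n * (2 * pi)"
      by (simp add: inner_add_right freq_axis n_def)
    show "cos (freq k \<bullet> (x + axis i 1) + c) = cos (freq k \<bullet> x + c)"
      "sin (freq k \<bullet> (x + axis i 1) + c) = sin (freq k \<bullet> x + c)"
      unfolding * by (simp_all add: cos_add sin_add cos_int_2pin sin_int_2pin mult.commute[of _ "2*pi"])
  qed
  ultimately show "(\<lambda>x. cos (freq k \<bullet> x + c)) \<in> torus_test" "(\<lambda>x. sin (freq k \<bullet> x + c)) \<in> torus_test"
    by (auto simp: torus_test_def intro: smooth_cos smooth_sin)
qed

subsection \<open>Trigonometric polynomials are dense\<close>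

text \<open>Generated by closure rather than defined as finite sums, so that the algebra properties
  follow by rule induction; \<open>trig_sum_form\<close> recovers the finite sum.\<close>

inductive trig :: "(real^2 \<Rightarrow> complex) \<Rightarrow> bool" where
  trig_chr: "trig (\<lambda>x. c * chr k x)"
| trig_add: "trig p \<Longrightarrow> trig q \<Longrightarrow> trig (\<lambda>x. p x + q x)"

lemma trig_const: "trig (\<lambda>x. c)"
  using trig_chr[of c 0] by simp

lemma trig_chr_mult: "trig p \<Longrightarrow> trig (\<lambda>x. c * chr k x * p x)"
proof (induction rule: trig.induct)
  case (trig_chr d l)
  show ?case using trig.trig_chr[of "c * d" "k + l"] by (simp add: chr_add mult_ac)
next
  case (trig_add p q)
  then show ?case using trig.trig_add by (simp add: distrib_left)
qed

lemma trig_mult: "trig p \<Longrightarrow> trig q \<Longrightarrow> trig (\<lambda>x. p x * q x)"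
proof (induction rule: trig.induct)
  case (trig_chr d l)
  then show ?case by (rule trig_chr_mult)
next
  case (trig_add p p')
  then show ?case using trig.trig_add by (simp add: distrib_right)
qed

lemma trig_cnj: "trig p \<Longrightarrow> trig (\<lambda>x. cnj (p x))"
proof (induction rule: trig.induct)
  case (trig_chr d l)
  show ?case using trig.trig_chr[of "cnj d" "-l"] by (simp add: chr_minus)
next
  case (trig_add p p')
  then show ?case using trig.trig_add by simp
qed

lemma trig_sum_form:
  "trig p \<Longrightarrow> \<exists>S c. finite S \<and> p = (\<lambda>x. \<Sum>k\<in>S. c k * chr k x)"
proof (induction rule: trig.induct)
  case (trig_chr d l)
  show ?case by (rule exI[of _ "{l}"]) (auto intro!: exI[of _ "\<lambda>_. d"])
next
  case (trig_add p q)
  then obtain S c S' c' where S: "finite S" "p = (\<lambda>x. \<Sum>k\<in>S. c k * chr k x)"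
    "finite S'" "q = (\<lambda>x. \<Sum>k\<in>S'. c' k * chr k x)" by blast
  have "p x = (\<Sum>k\<in>S \<union> S'. (if k \<in> S then c k else 0) * chr k x)" for x
    unfolding S(2) using S(1,3) by (intro sum.mono_neutral_cong_left) auto
  moreover have "q x = (\<Sum>k\<in>S \<union> S'. (if k \<in> S' then c' k else 0) * chr k x)" for x
    unfolding S(4) using S(1,3) by (intro sum.mono_neutral_cong_left) auto
  ultimately have "(\<lambda>x. p x + q x) = (\<lambda>x. \<Sum>k\<in>S \<union> S'. 
      ((if k \<in> S then c k else 0) + (if k \<in> S' then c' k else 0)) * chr k x)"
    by (simp add: distrib_right sum.distrib fun_eq_iff)
  then show ?case using S(1,3) 
    by (intro exI[of _ "S \<union> S'"] exI[of _ "\<lambda>k. (if k \<in> S then c k else 0) + (if k \<in> S' then c' k else 0)"]) simp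
qed

text \<open>Stone-Weierstrass yields polynomials in real coordinates, so real and imaginary parts
  must stay within the class.\<close>

lemma trig_Re: assumes "trig p" shows "trig (\<lambda>x. of_real (Re (p x)))"
proof -
  have "trig (\<lambda>x. (1/2) * (p x + cnj (p x)))"
    by (intro trig_mult trig_const trig_add trig_cnj assms)
  then show ?thesis by (simp add: complex_add_cnj)
qed

lemma trig_Im: assumes "trig p" shows "trig (\<lambda>x. of_real (Im (p x)))"
proof -
  have "trig (\<lambda>x. of_real (Re (- \<i> * p x)))"
    by (intro trig_Re trig_mult trig_const assms)
  then show ?thesis by simp
qed

text \<open>Through the two basic characters the torus becomes a compact set in the space of pairs of
  complex numbers, where the Stone--Weierstrass theorem for polynomials applies.\<close>

lemma trig_uniformly_dense:
  fixes h :: "real^2 \<Rightarrow> real"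
  assumes h: "continuous_on torus h" and "0 < e"
    and inv: "\<And>x y. x \<in> torus \<Longrightarrow> y \<in> torus \<Longrightarrow> chr (1,0) x = chr (1,0) y \<Longrightarrow> 
       chr (0,1) x = chr (0,1) y \<Longrightarrow> h x = h y"
  obtains p where "trig p" "\<And>x. x \<in> torus \<Longrightarrow> norm (of_real (h x) - p x) < e"
proof -
  define Q where "Q x = (chr (1,0) x, chr (0,1) x)" for x
  \<comment> \<open>Which preimage is taken does not matter: by \<open>inv\<close>, \<open>h\<close>
    agrees at points that the two characters identify.\<close>
  define H where "H z = h (inv_into torus Q z)" for z
  have HQ: "H (Q x) = h x" if "x \<in> torus" for x
  proof -
    let ?y = "inv_into torus Q (Q x)"
    have "?y \<in> torus" "Q ?y = Q x" using that by (auto intro: inv_into_into f_inv_into_f)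
    then show ?thesis unfolding H_def using that by (intro inv) (auto simp: Q_def)
  qed
  have contQ: "continuous_on A Q" for A unfolding Q_def by (intro continuous_intros)
  have compQ: "compact (Q ` torus)" by (intro compact_continuous_image contQ compact_torus)
  have "continuous_on (Q ` torus) H"
  \<comment> \<open>The selected inverse of \<open>Q\<close> need not be continuous. But the
    preimage of a closed set under \<open>H\<close> is the \<open>Q\<close>-image of a compact set,
    hence closed.\<close>
  proof (subst continuous_on_closed_vimage)
    show "closed (Q ` torus)" using compQ by (rule compact_imp_closed)
    show "\<forall>B. closed B \<longrightarrow> closed (H -` B \<inter> Q ` torus)"
    proof (intro allI impI)
      fix B :: "real set" assume "closed B"
      then have "closed (h -` B \<inter> torus)"
        using h continuous_on_closed_vimage[OF compact_imp_closed[OF compact_torus]] by blast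
      then have "compact (Q ` (h -` B \<inter> torus))"
        by (intro compact_continuous_image contQ) (metis compact_Int_closed compact_torus inf_assoc inf_commute inf_idem)
      moreover have "H -` B \<inter> Q ` torus = Q ` (h -` B \<inter> torus)"
        using HQ by auto
      ultimately show "closed (H -` B \<inter> Q ` torus)" by (simp add: compact_imp_closed)
    qed
  qed
  from Stone_Weierstrass_real_polynomial_function[OF compQ this \<open>0 < e\<close>]
  obtain g where g: "real_polynomial_function g" "\<And>z. z \<in> Q ` torus \<Longrightarrow> \<bar>H z - g z\<bar> < e" by blast
  have "trig (\<lambda>x. of_real (g (Q x)))"
    using g(1)
  proof (induction rule: real_polynomial_function.induct)
    case (linear f)
    \<comment> \<open>A real-linear functional on pairs of complex numbers is determined by its
      values at four real basis vectors.\<close>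
    have "of_real (f (Q x)) = of_real (Re (1 * chr (1,0) x)) * of_real (f (1,0)) + of_real (Im (1 * chr (1,0) x)) * of_real (f (\<i>,0))
        + of_real (Re (1 * chr (0,1) x)) * of_real (f (0,1)) + of_real (Im (1 * chr (0,1) x)) * complex_of_real (f (0,\<i>))" for x
    proof -
      interpret bounded_linear f by fact
      have "Q x = Re (chr (1,0) x) *\<^sub>R (1,0) + Im (chr (1,0) x) *\<^sub>R (\<i>,0) +
          Re (chr (0,1) x) *\<^sub>R (0,1) + Im (chr (0,1) x) *\<^sub>R (0,\<i>)"
        by (auto simp: Q_def complex_eq_iff)
      then have "f (Q x) = Re (chr (1,0) x) *\<^sub>R f (1,0) + Im (chr (1,0) x) *\<^sub>R f (\<i>,0) +
          Re (chr (0,1) x) *\<^sub>R f (0,1) + Im (chr (0,1) x) *\<^sub>R f (0,\<i>)"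
        by (simp only: add scaleR)
      then show ?thesis by simp
    qed
    then show ?case by (simp only:) (intro trig_add trig_mult trig_const trig_Re trig_Im trig_chr)
  qed (auto intro: trig_const trig_add trig_mult)
  then show ?thesis
  proof (rule that)
    fix x assume "x \<in> torus"
    then have "\<bar>h x - g (Q x)\<bar> < e" using g(2)[of "Q x"] HQ by auto
    then show "norm (of_real (h x) - complex_of_real (g (Q x))) < e"
      by (metis norm_of_real of_real_diff)
  qed
qed

text \<open>Together the two characters see a point exactly up to integer translations; on the
  closed square this identifies only boundary points.\<close>

lemma chr_basic_eq_iff:
  "chr (1,0) x = chr (1,0) y \<longleftrightarrow> (\<exists>n::int. x $ 1 = y $ 1 + n)"
  "chr (0,1) x = chr (0,1) y \<longleftrightarrow> (\<exists>n::int. x $ 2 = y $ 2 + n)"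
proof -
  have *: "cis (2 * pi * a) = cis (2 * pi * b) \<longleftrightarrow> (\<exists>n::int. a = b + n)" for a b :: real
  proof -
    have "cis (2 * pi * a) = cis (2 * pi * b) \<longleftrightarrow> (\<exists>n::int. 2 * pi * a = 2 * pi * b + 2 * pi * n)"
      by (simp add: complex_eq_iff sin_cos_eq_iff[symmetric] conj_commute)
    also have "\<dots> \<longleftrightarrow> (\<exists>n::int. a = b + n)"
      by (simp add: distrib_left[symmetric] del: distrib_left)
    finally show ?thesis .
  qed
  show "chr (1,0) x = chr (1,0) y \<longleftrightarrow> (\<exists>n::int. x $ 1 = y $ 1 + n)"
    "chr (0,1) x = chr (0,1) y \<longleftrightarrow> (\<exists>n::int. x $ 2 = y $ 2 + n)"
    by (simp_all add: chr_def inner_vec2 *)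
qed

lemma continuous_on_trig: "trig p \<Longrightarrow> continuous_on A p"
  by (induction rule: trig.induct) (auto intro!: continuous_intros)

lemma trig_measurable: "trig p \<Longrightarrow> p \<in> borel_measurable MT"
  by (intro borel_measurable_MT borel_measurable_continuous_onI continuous_on_trig)

text \<open>Continuous functions converging almost everywhere to \<open>f\<close> are clamped to the
  range of \<open>f\<close> and cut off near the boundary of the square. The result respects the
  identification of opposite edges, so it is uniformly close to a trigonometric polynomial, and
  dominated convergence finishes.\<close>

lemma trig_dense_L2_bounded:
  fixes f :: "real^2 \<Rightarrow> real"
  assumes [measurable]: "f \<in> borel_measurable MT" and B: "\<And>x. \<bar>f x\<bar> \<le> B" and e: "0 < e"
  obtains p where "trig p" "(LINT x|MT. (norm (of_real (f x) - p x))\<^sup>2) < e"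
proof -
  have B0: "B \<ge> 0" using B[of 0] by linarith
  have "f measurable_on torus" by (subst measurable_on_iff_borel_measurable) auto
  then obtain N g where N: "negligible N" and g: "\<And>n. continuous_on UNIV (g n)"
    "\<And>x. x \<notin> N \<Longrightarrow> (\<lambda>n. g n x) \<longlonglongrightarrow> (if x \<in> torus then f x else 0)"
    unfolding measurable_on_def by blast
  \<comment> \<open>Vanishes on the boundary of the square, and at each interior point equals 1 once
    \<open>n\<close> is large.\<close>
  define d where "d n x = min 1 (real n * (x$1 * (1 - x$1) * (x$2 * (1 - x$2))))" for n and x :: "real^2"
  define h where "h n x = d n x * max (-B) (min B (g n x))" for n x
  have "\<exists>p. trig p \<and> (\<forall>x\<in>torus. norm (of_real (h n x) - p x) < inverse (real (Suc n)))" for n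
  proof -
    have g': "continuous_on torus (g n)" using g(1) continuous_on_subset by blast
    have "continuous_on torus (h n)" unfolding h_def d_def by (intro continuous_intros g')
    moreover have "h n x = h n y" 
      if xy: "x \<in> torus" "y \<in> torus" "chr (1,0) x = chr (1,0) y" "chr (0,1) x = chr (0,1) y" for x y
    proof -
      obtain m1 m2 :: int where m: "x$1 = y$1 + m1" "x$2 = y$2 + m2" 
        using xy(3,4) by (auto simp: chr_basic_eq_iff)
      have m01: "real_of_int m1 \<le> 1" "real_of_int m1 \<ge> -1" "real_of_int m2 \<le> 1" "real_of_int m2 \<ge> -1" 
        using xy(1,2) m unfolding mem_torus by linarith+
      \<comment> \<open>A nonzero integer shift within the square is by exactly one and joins
        opposite edges, where the cutoff is zero.\<close>
      have b1: "x$1 * (1 - x$1) = 0 \<and> y$1 * (1 - y$1) = 0" if "m1 \<noteq> 0"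
      proof -
        have "m1 = 1 \<or> m1 = -1" using that m01 by linarith
        then show ?thesis using \<open>x \<in> torus\<close> \<open>y \<in> torus\<close> m unfolding mem_torus by auto
      qed
      have b2: "x$2 * (1 - x$2) = 0 \<and> y$2 * (1 - y$2) = 0" if "m2 \<noteq> 0"
      proof -
        have "m2 = 1 \<or> m2 = -1" using that m01 by linarith
        then show ?thesis using \<open>x \<in> torus\<close> \<open>y \<in> torus\<close> m unfolding mem_torus by auto
      qed
      show ?thesis
      proof (cases "m1 = 0 \<and> m2 = 0")
        case True then have "x = y" using m by (intro vec2_eqI) auto
        then show ?thesis by simp
      next
        case False
        then have "d n x = 0" "d n y = 0" using b1 b2 unfolding d_def by auto
        then show ?thesis by (simp add: h_def)
      qed
    qed
    ultimately show ?thesis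
      using trig_uniformly_dense[of "h n" "inverse (real (Suc n))"] by (metis inverse_Suc)
  qed
  then obtain p where p: "\<And>n. trig (p n)" "\<And>n x. x \<in> torus \<Longrightarrow> norm (of_real (h n x) - p n x) < inverse (real (Suc n))"
    by metis
  have "negligible (N \<union> (torus - box 0 1))"
    unfolding torus_def by (intro negligible_Un N negligible_frontier_interval)
  then have "N \<union> (torus - box 0 1) \<in> null_sets lebesgue" by (simp add: negligible_iff_null_sets)
  then have "AE x in lebesgue. x \<notin> N \<union> (torus - box 0 1)" by (rule AE_not_in)
  then have AE: "AE x in MT. x \<notin> N \<union> (torus - box 0 1)"
    by (subst AE_restrict_space_iff) (auto elim: eventually_mono)
  have lim: "AE x in MT. (\<lambda>n. (norm (of_real (f x) - p n x))\<^sup>2) \<longlonglongrightarrow> 0"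
    using AE AE_space
  proof eventually_elim
    case (elim x)
    then have x: "x \<in> torus" "x \<in> box 0 1" "x \<notin> N" by auto
    have "(\<lambda>n. max (-B) (min B (g n x))) \<longlonglongrightarrow> max (-B) (min B (f x))"
      using g(2)[OF x(3)] x(1) by (intro tendsto_intros) auto
    also have "max (-B) (min B (f x)) = f x" using B[of x] by linarith
    finally have 1: "(\<lambda>n. max (-B) (min B (g n x))) \<longlonglongrightarrow> f x" .
    have "\<forall>i. 0 < x$i \<and> x$i < 1" using x(2) by (auto simp: mem_box_cart)
    then have pos: "x$1 * (1 - x$1) * (x$2 * (1 - x$2)) > 0" by simp
    obtain n0 where n0: "1 < real n0 * (x$1 * (1 - x$1) * (x$2 * (1 - x$2)))"
      using reals_Archimedean3[OF pos] by blast
    have "d n x = 1" if "n \<ge> n0" for n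
    proof -
      have "real n0 * (x$1 * (1 - x$1) * (x$2 * (1 - x$2))) \<le> real n * (x$1 * (1 - x$1) * (x$2 * (1 - x$2)))"
        using that pos by (intro mult_right_mono) auto
      then show ?thesis using n0 unfolding d_def by linarith
    qed
    then have "\<forall>\<^sub>F n in sequentially. d n x = 1" unfolding eventually_sequentially by blast
    then have "(\<lambda>n. d n x) \<longlonglongrightarrow> 1" by (rule tendsto_eventually)
    from tendsto_mult[OF this 1] have "(\<lambda>n. h n x) \<longlonglongrightarrow> f x" unfolding h_def by simp
    then have 2: "(\<lambda>n. complex_of_real (h n x)) \<longlonglongrightarrow> of_real (f x)" by (rule tendsto_of_real)
    have "(\<lambda>n. of_real (h n x) - p n x) \<longlonglongrightarrow> 0"
      by (rule Lim_null_comparison[OF _ LIMSEQ_inverse_real_of_nat])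
         (use p(2)[OF x(1)] in \<open>auto intro!: always_eventually less_imp_le\<close>)
    from tendsto_diff[OF 2 this] have "(\<lambda>n. p n x) \<longlonglongrightarrow> of_real (f x)" by simp
    then have "(\<lambda>n. (norm (of_real (f x) - p n x))\<^sup>2) \<longlonglongrightarrow> (norm (of_real (f x) - complex_of_real (f x)))\<^sup>2"
      by (intro tendsto_intros)
    then show ?case by simp
  qed
  have [measurable]: "p n \<in> borel_measurable MT" for n using trig_measurable[OF p(1)] .
  have "(\<lambda>n. LINT x|MT. (norm (of_real (f x) - p n x))\<^sup>2) \<longlonglongrightarrow> (LINT x|MT. 0)"
  \<comment> \<open>The bound adds \<open>B\<close> for \<open>f\<close>, \<open>B\<close> for the
    clamped approximation, and 1 for its uniform distance to \<open>p n\<close>, which is below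
    \<open>inverse (real (Suc n))\<close>.\<close>
  proof (rule integral_dominated_convergence[where w="\<lambda>_. (2 * B + 1)\<^sup>2"])
    show "AE x in MT. norm ((norm (of_real (f x) - p n x))\<^sup>2) \<le> (2 * B + 1)\<^sup>2" for n
    proof (rule AE_I2)
      fix x assume "x \<in> space MT"
      then have x: "x \<in> torus" by simp
      then have d: "0 \<le> d n x" "d n x \<le> 1" unfolding d_def mem_torus by auto
      have "\<bar>h n x\<bar> = d n x * \<bar>max (-B) (min B (g n x))\<bar>" unfolding h_def using d by (simp add: abs_mult)
      also have "\<dots> \<le> 1 * B" using d B0 by (intro mult_mono) auto
      finally have "\<bar>h n x\<bar> \<le> B" by simp
      moreover have "norm (of_real (h n x) - p n x) < 1"
        using p(2)[OF x, of n] by (smt (verit) inverse_Suc le_imp_inverse_le of_nat_Suc of_nat_0_le_iff inverse_1)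
      moreover have "norm (of_real (f x) - p n x) \<le> \<bar>f x\<bar> + \<bar>h n x\<bar> + norm (of_real (h n x) - p n x)"
        using norm_triangle_ineq[of "of_real (f x) - of_real (h n x)" "of_real (h n x) - p n x"]
          norm_triangle_ineq4[of "complex_of_real (f x)" "of_real (h n x)"] by simp
      ultimately have "norm (of_real (f x) - p n x) \<le> 2 * B + 1" using B[of x] by linarith
      then show "norm ((norm (of_real (f x) - p n x))\<^sup>2) \<le> (2 * B + 1)\<^sup>2" by (simp add: power_mono)
    qed
  qed (use lim in auto)
  then have "\<forall>\<^sub>F n in sequentially. (LINT x|MT. (norm (of_real (f x) - p n x))\<^sup>2) < e"
    using e by (intro order_tendstoD) auto
  then obtain n where "(LINT x|MT. (norm (of_real (f x) - p n x))\<^sup>2) < e"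
    by (auto simp: eventually_sequentially)
  then show ?thesis using that p(1) by blast
qed

definition trunc :: "real \<Rightarrow> real \<Rightarrow> real" where "trunc B y = max (-B) (min B y)"

lemma trunc_bounds: "0 \<le> B \<Longrightarrow> \<bar>trunc B y\<bar> \<le> B" "0 \<le> B \<Longrightarrow> \<bar>y - trunc B y\<bar> \<le> \<bar>y\<bar>"
  by (auto simp: trunc_def)

lemma trunc_tendsto: "(\<lambda>n. y - trunc (real n) y) \<longlonglongrightarrow> 0"
proof (rule tendsto_eventually)
  obtain n0 where "\<bar>y\<bar> \<le> real n0" using real_arch_simple by blast
  then show "\<forall>\<^sub>F n in sequentially. y - trunc (real n) y = 0"
    by (intro eventually_sequentiallyI[of n0]) (auto simp: trunc_def)
qed

lemma measurable_trunc [measurable (raw)]: "f \<in> borel_measurable M \<Longrightarrow> (\<lambda>x. trunc B (f x)) \<in> borel_measurable M"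
  unfolding trunc_def by (intro borel_measurable_max borel_measurable_min) simp_all

text \<open>Truncation reduces to the bounded case; the truncation error tends to zero in L^2 with
  \<open>f\<close> itself as dominating function.\<close>

lemma trig_dense_L2:
  fixes f :: "real^2 \<Rightarrow> real"
  assumes f: "f \<in> L2 torus" and e: "0 < e"
  obtains p where "trig p" "(LINT x|MT. (norm (of_real (f x) - p x))\<^sup>2) < e"
proof -
  note [measurable] = L2_measurable[OF f]
  have "(\<lambda>n. LINT x|MT. (f x - trunc (real n) (f x))\<^sup>2) \<longlonglongrightarrow> (LINT x|MT. 0)"
  proof (rule integral_dominated_convergence[where w="\<lambda>x. (f x)\<^sup>2"])
    show "integrable MT (\<lambda>x. (f x)\<^sup>2)" using L2_integrable_square[OF f] by simp
    show "AE x in MT. (\<lambda>n. (f x - trunc (real n) (f x))\<^sup>2) \<longlonglongrightarrow> 0"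
    proof (rule AE_I2)
      show "(\<lambda>n. (f x - trunc (real n) (f x))\<^sup>2) \<longlonglongrightarrow> 0" for x
        using tendsto_power[OF trunc_tendsto[of "f x"], of 2] by (simp only: power_zero_numeral)
    qed
    show "AE x in MT. norm ((f x - trunc (real n) (f x))\<^sup>2) \<le> (f x)\<^sup>2" for n
      using trunc_bounds(2) by (auto simp: abs_le_square_iff[symmetric])
  qed auto
  then have "\<forall>\<^sub>F n in sequentially. (LINT x|MT. (f x - trunc (real n) (f x))\<^sup>2) < e / 4"
    using e by (intro order_tendstoD) auto
  then obtain n where n: "(LINT x|MT. (f x - trunc (real n) (f x))\<^sup>2) < e / 4"
    by (auto simp: eventually_sequentially)
  obtain p where p: "trig p" "(LINT x|MT. (norm (of_real (trunc (real n) (f x)) - p x))\<^sup>2) < e / 4"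
    using trig_dense_L2_bounded[of "\<lambda>x. trunc (real n) (f x)" "real n" "e/4"] e trunc_bounds(1) by auto
  note [measurable] = trig_measurable[OF p(1)]
  have i1: "integrable MT (\<lambda>x. (f x - trunc (real n) (f x))\<^sup>2)"
    by (rule Bochner_Integration.integrable_bound[OF L2_integrable_square[OF f]])
       (use trunc_bounds(2) in \<open>auto simp: abs_le_square_iff[symmetric]\<close>)
  obtain C where C: "\<And>x. x \<in> torus \<Longrightarrow> norm (p x) \<le> C"
    using compact_imp_bounded[OF compact_continuous_image[OF continuous_on_trig[OF p(1)] compact_torus]]
    by (auto simp: bounded_iff)
  have i2: "integrable MT (\<lambda>x. (norm (of_real (trunc (real n) (f x)) - p x))\<^sup>2)"
  proof (rule MT.integrable_const_bound[of _ "(real n + C)\<^sup>2"])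
    show "AE x in MT. norm ((norm (of_real (trunc (real n) (f x)) - p x))\<^sup>2) \<le> (real n + C)\<^sup>2"
    proof (rule AE_I2)
      fix x assume "x \<in> space MT"
      then have "norm (of_real (trunc (real n) (f x)) - p x) \<le> real n + C"
        using C[of x] trunc_bounds(1)[of "real n" "f x"]
          norm_triangle_ineq4[of "complex_of_real (trunc (real n) (f x))" "p x"] by simp
      then show "norm ((norm (of_real (trunc (real n) (f x)) - p x))\<^sup>2) \<le> (real n + C)\<^sup>2" by (simp add: power_mono)
    qed
  qed simp
  \<comment> \<open>The two factors 2 here account for the tolerances \<open>e / 4\<close> chosen
    above.\<close>
  have le: "(norm (of_real (f x) - p x))\<^sup>2 \<le> 2 * (f x - trunc (real n) (f x))\<^sup>2 
      + 2 * (norm (of_real (trunc (real n) (f x)) - p x))\<^sup>2" for x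
  proof -
    let ?t = "trunc (real n) (f x)"
    have "norm (of_real (f x) - p x) \<le> \<bar>f x - ?t\<bar> + norm (of_real ?t - p x)"
      using norm_triangle_ineq[of "of_real (f x) - of_real ?t" "of_real ?t - p x"]
        norm_of_real[of "f x - ?t", where 'a=complex] unfolding of_real_diff by simp
    then have "(norm (of_real (f x) - p x))\<^sup>2 \<le> (\<bar>f x - ?t\<bar> + norm (of_real ?t - p x))\<^sup>2"
      by (intro power_mono) auto
    also have "\<dots> \<le> 2 * (f x - ?t)\<^sup>2 + 2 * (norm (of_real ?t - p x))\<^sup>2"
      using sum_squares_bound[of "\<bar>f x - ?t\<bar>" "norm (of_real ?t - p x)"] by (simp add: power2_sum)
    finally show ?thesis .
  qed
  have "(LINT x|MT. (norm (of_real (f x) - p x))\<^sup>2) \<le> (LINT x|MT. 2 * (f x - trunc (real n) (f x))\<^sup>2 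
      + 2 * (norm (of_real (trunc (real n) (f x)) - p x))\<^sup>2)"
    using i1 i2 le by (intro integral_mono_AE' AE_I2) auto
  also have "\<dots> < e" using i1 i2 n p(2) e by simp
  finally show ?thesis using that p(1) by blast
qed

subsection \<open>Fourier coefficients and Parseval's identity\<close>

definition fc :: "(real^2 \<Rightarrow> real) \<Rightarrow> int \<times> int \<Rightarrow> complex" where
  "fc f k = (LINT x|MT. of_real (f x) * cnj (chr k x))"

lemma L2_imp_integrable:
  fixes f :: "real^2 \<Rightarrow> real" assumes "f \<in> L2 torus" shows "integrable MT f"
proof -
  note [measurable] = L2_measurable[OF assms]
  show ?thesis
    using integrable_mult_L2[of f MT "\<lambda>_. 1"] L2_integrable_square[OF assms] by simp
qed

lemma integral_abs_le_L2_norm: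
  fixes f :: "real^2 \<Rightarrow> real" assumes "f \<in> L2 torus" 
  shows "(LINT x|MT. \<bar>f x\<bar>) \<le> L2_norm torus f"
proof -
  note [measurable] = L2_measurable[OF assms]
  show ?thesis
    using integral_abs_mult_le_L2[of f MT "\<lambda>_. 1"] L2_integrable_square[OF assms] 
    by (simp add: L2_norm_def MT.prob_space[simplified])
qed

lemma integrable_mult_chr:
  fixes f :: "real^2 \<Rightarrow> real" assumes "integrable MT f"
  shows "integrable MT (\<lambda>x. of_real (f x) * cnj (chr k x))"
proof (rule Bochner_Integration.integrable_bound[OF assms])
  have [measurable]: "f \<in> borel_measurable MT" using assms by simp
  have [measurable]: "(\<lambda>x. cnj (chr k x)) \<in> borel_measurable MT"
    using borel_measurable_chr_MT[of "-k"] by (simp add: chr_minus[abs_def])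
  show "(\<lambda>x. of_real (f x) * cnj (chr k x)) \<in> borel_measurable MT" by measurable
qed (auto simp: norm_mult)

lemma fc_diff: "integrable MT f \<Longrightarrow> integrable MT g \<Longrightarrow> fc (\<lambda>x. f x - g x) k = fc f k - fc g k"
  unfolding fc_def using integrable_mult_chr[of f k] integrable_mult_chr[of g k]
  by (simp add: left_diff_distrib)

lemma fc_scale: "fc (\<lambda>x. a * f x) k = of_real a * fc f k"
  unfolding fc_def by (simp add: mult.assoc)

lemma fc_add: "integrable MT f \<Longrightarrow> integrable MT g \<Longrightarrow> fc (\<lambda>x. f x + g x) k = fc f k + fc g k"
  unfolding fc_def using integrable_mult_chr[of f k] integrable_mult_chr[of g k]
  by (simp add: distrib_right)

lemma fc_minus: "fc f (- k) = cnj (fc f k)"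
proof -
  have "cnj (fc f k) = (LINT x|MT. cnj (of_real (f x) * cnj (chr k x)))"
    unfolding fc_def by (rule Bochner_Integration.integral_cnj[symmetric])
  then show ?thesis by (simp add: fc_def chr_minus)
qed

lemma fc_cong_AE:
  assumes "AE x in MT. f x = g x" and [measurable]: "f \<in> borel_measurable MT" "g \<in> borel_measurable MT"
  shows "fc f k = fc g k"
proof -
  have [measurable]: "(\<lambda>x. cnj (chr k x)) \<in> borel_measurable MT"
    using borel_measurable_chr_MT[of "-k"] by (simp add: chr_minus[abs_def])
  show ?thesis unfolding fc_def using assms(1) by (intro integral_cong_AE) auto
qed

lemma norm_fc_le: assumes "integrable MT f" shows "norm (fc f k) \<le> (LINT x|MT. \<bar>f x\<bar>)"
proof -
  have "norm (fc f k) \<le> (LINT x|MT. norm (of_real (f x) * cnj (chr k x)))"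
    unfolding fc_def by (rule integral_norm_bound)
  then show ?thesis by (simp add: norm_mult)
qed

lemma fc_trig_parts:
  assumes "integrable MT f"
  shows "Re (fc f k) = (LINT x|MT. f x * cos (freq k \<bullet> x))" "Im (fc f k) = - (LINT x|MT. f x * sin (freq k \<bullet> x))"
  unfolding fc_def using integrable_mult_chr[OF assms, of k]
  by (simp_all add: chr_def flip: integral_Re integral_Im)

lemma trig_bounded:
  assumes "trig p" obtains C where "\<And>x. x \<in> torus \<Longrightarrow> norm (p x) \<le> C"
  using compact_imp_bounded[OF compact_continuous_image[OF continuous_on_trig[OF assms] compact_torus]]
  by (auto simp: bounded_iff)

lemma trig_integrable: assumes "trig p" shows "integrable MT p"
proof -
  obtain C where "\<And>x. x \<in> torus \<Longrightarrow> norm (p x) \<le> C" using trig_bounded[OF assms] by blast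
  then show ?thesis using trig_measurable[OF assms] by (intro MT.integrable_const_bound[of _ C]) auto
qed

lemma trig_sum: "finite S \<Longrightarrow> trig (\<lambda>x. \<Sum>k\<in>S. c k * chr k x)"
proof (induction S rule: finite_induct)
  case empty then show ?case by (simp add: trig_const)
next
  case (insert k S) then show ?case by (simp add: trig_add trig_chr)
qed

lemma integral_norm2_trig_sum:
  assumes "finite S"
  shows "(LINT x|MT. (norm (\<Sum>k\<in>S. c k * chr k x))\<^sup>2) = (\<Sum>k\<in>S. (norm (c k))\<^sup>2)"
proof -
  have "complex_of_real ((norm (\<Sum>k\<in>S. c k * chr k x))\<^sup>2) = (\<Sum>k\<in>S. \<Sum>l\<in>S. c k * cnj (c l) * chr (k - l) x)" for x
    by (simp only: complex_norm_square cnj_sum sum_product complex_cnj_mult chr_diff) (simp add: mult_ac)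
  then have "complex_of_real (LINT x|MT. (norm (\<Sum>k\<in>S. c k * chr k x))\<^sup>2) = 
      (LINT x|MT. (\<Sum>k\<in>S. \<Sum>l\<in>S. c k * cnj (c l) * chr (k - l) x))"
    by (simp flip: integral_complex_of_real)
  also have "\<dots> = (\<Sum>k\<in>S. \<Sum>l\<in>S. c k * cnj (c l) * (LINT x|MT. chr (k - l) x))"
    by (simp add: Bochner_Integration.integral_sum trig_integrable[OF trig_chr] 
        trig_integrable[OF trig_chr[of 1], simplified])
  also have "\<dots> = (\<Sum>k\<in>S. c k * cnj (c k))"
    using assms by (intro sum.cong refl) (simp add: integral_chr if_distrib[of "\<lambda>z. _ * z"] sum.delta cong: if_cong)
  also have "\<dots> = complex_of_real (\<Sum>k\<in>S. (norm (c k))\<^sup>2)"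
    by (simp only: of_real_sum complex_norm_square)
  finally show ?thesis by (simp only: of_real_eq_iff)
qed

lemma trig_square_integrable: assumes "trig p" shows "integrable MT (\<lambda>x. (norm (p x))\<^sup>2)"
proof -
  obtain C where "\<And>x. x \<in> torus \<Longrightarrow> norm (p x) \<le> C" using trig_bounded[OF assms] by blast
  then show ?thesis using trig_measurable[OF assms] 
    by (intro MT.integrable_const_bound[of _ "C^2"]) (auto simp: power_mono)
qed

text \<open>Completing the square in the coefficients. Taking \<open>c = fc f\<close> yields
  Bessel's inequality; dropping the last sum shows that the Fourier coefficients give the best
  approximation with frequencies in \<open>S\<close>.\<close>

lemma integral_norm2_diff_trig_sum:
  assumes f: "f \<in> L2 torus" and S: "finite S"
  shows "(LINT x|MT. (norm (of_real (f x) - (\<Sum>k\<in>S. c k * chr k x)))\<^sup>2) = 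
    (LINT x|MT. (f x)\<^sup>2) - (\<Sum>k\<in>S. (norm (fc f k))\<^sup>2) + (\<Sum>k\<in>S. (norm (c k - fc f k))\<^sup>2)"
proof -
  let ?P = "\<lambda>x. \<Sum>k\<in>S. c k * chr k x"
  have fi: "integrable MT f" using L2_imp_integrable[OF f] .
  have eq: "(norm (of_real (f x) - ?P x))\<^sup>2 = (f x)\<^sup>2 - 2 * Re (\<Sum>k\<in>S. cnj (c k) * (of_real (f x) * cnj (chr k x))) + (norm (?P x))\<^sup>2" for x
  proof -
    have "(norm (z - w))\<^sup>2 = (norm z)\<^sup>2 - 2 * Re (z * cnj w) + (norm w)\<^sup>2" for z w :: complex
      by (simp add: cmod_power2 power2_diff algebra_simps)
    from this[of "of_real (f x)" "?P x"] show ?thesis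
      by (simp add: sum_distrib_left mult_ac)
  qed
  have i1: "integrable MT (\<lambda>x. \<Sum>k\<in>S. cnj (c k) * (of_real (f x) * cnj (chr k x)))"
    by (intro Bochner_Integration.integrable_sum integrable_mult_right integrable_mult_chr fi)
  then have i2: "integrable MT (\<lambda>x. Re (\<Sum>k\<in>S. cnj (c k) * (of_real (f x) * cnj (chr k x))))" by (rule integrable_Re)
  have "(LINT x|MT. (\<Sum>k\<in>S. cnj (c k) * (of_real (f x) * cnj (chr k x)))) = (\<Sum>k\<in>S. cnj (c k) * fc f k)"
    unfolding fc_def by (simp add: Bochner_Integration.integral_sum integrable_mult_chr fi)
  then have I: "(LINT x|MT. Re (\<Sum>k\<in>S. cnj (c k) * (of_real (f x) * cnj (chr k x)))) = Re (\<Sum>k\<in>S. cnj (c k) * fc f k)"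
    using integral_Re[OF i1] by simp
  have "(LINT x|MT. (norm (of_real (f x) - ?P x))\<^sup>2) = (LINT x|MT. (f x)\<^sup>2) 
      - 2 * Re (\<Sum>k\<in>S. cnj (c k) * fc f k) + (\<Sum>k\<in>S. (norm (c k))\<^sup>2)"
    unfolding eq integral_norm2_trig_sum[OF S, symmetric] I[symmetric]
    using L2_integrable_square[OF f] i2 trig_square_integrable[OF trig_sum[OF S]] by simp
  also have "\<dots> = (LINT x|MT. (f x)\<^sup>2) - (\<Sum>k\<in>S. (norm (fc f k))\<^sup>2) + (\<Sum>k\<in>S. (norm (c k - fc f k))\<^sup>2)"
  proof -
    have "(norm (c k - fc f k))\<^sup>2 = (norm (c k))\<^sup>2 - 2 * Re (cnj (c k) * fc f k) + (norm (fc f k))\<^sup>2" for k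
      by (simp add: cmod_power2 power2_diff algebra_simps)
    then show ?thesis by (simp add: sum.distrib sum_subtractf sum_distrib_left)
  qed
  finally show ?thesis .
qed

lemma Bessel: 
  assumes "f \<in> L2 torus" "finite S" shows "(\<Sum>k\<in>S. (norm (fc f k))\<^sup>2) \<le> (LINT x|MT. (f x)\<^sup>2)"
proof -
  have "0 \<le> (LINT x|MT. (norm (of_real (f x) - (\<Sum>k\<in>S. fc f k * chr k x)))\<^sup>2)"
    by (intro integral_nonneg_AE) auto
  then show ?thesis using integral_norm2_diff_trig_sum[OF assms, of "fc f"] by simp
qed

text \<open>Density supplies some close trigonometric polynomial, and the Fourier sum on the same
  frequencies is at least as close.\<close>

lemma Parseval_approx:
  assumes f: "f \<in> L2 torus" and e: "0 < e"
  obtains S where "finite S" "(LINT x|MT. (f x)\<^sup>2) - (\<Sum>k\<in>S. (norm (fc f k))\<^sup>2) < e"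
proof -
  obtain p where p: "trig p" "(LINT x|MT. (norm (of_real (f x) - p x))\<^sup>2) < e"
    using trig_dense_L2[OF f e] by blast
  obtain S c where S: "finite S" "p = (\<lambda>x. \<Sum>k\<in>S. c k * chr k x)" using trig_sum_form[OF p(1)] by blast
  have "(LINT x|MT. (f x)\<^sup>2) - (\<Sum>k\<in>S. (norm (fc f k))\<^sup>2) \<le> (LINT x|MT. (norm (of_real (f x) - p x))\<^sup>2)"
    unfolding S(2) integral_norm2_diff_trig_sum[OF f S(1)] by (simp add: sum_nonneg)
  then show ?thesis using that[OF S(1)] p(2) by simp
qed

lemma fc_eq_0_imp_AE_0:
  assumes f: "f \<in> L2 torus" and "\<And>k. fc f k = 0" shows "AE x in MT. f x = 0"
proof -
  have "(LINT x|MT. (f x)\<^sup>2) \<le> 0"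
  proof (rule field_le_epsilon)
    fix e :: real assume "0 < e"
    then obtain S where "(LINT x|MT. (f x)\<^sup>2) - (\<Sum>k\<in>S. (norm (fc f k))\<^sup>2) < e"
      using Parseval_approx[OF f] by blast
    then show "(LINT x|MT. (f x)\<^sup>2) \<le> 0 + e" by (simp add: assms(2))
  qed
  moreover have "(LINT x|MT. (f x)\<^sup>2) \<ge> 0" by (intro integral_nonneg_AE) auto
  ultimately show ?thesis
    using integral_nonneg_eq_0_iff_AE[of MT "\<lambda>x. (f x)\<^sup>2"] L2_integrable_square[OF f] by simp
qed

lemma fc_eq_imp_AE_eq:
  assumes f: "f \<in> L2 torus" "g \<in> L2 torus" and "\<And>k. fc f k = fc g k" shows "AE x in MT. f x = g x"
proof -
  have "AE x in MT. f x - g x = 0"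
    using assms by (intro fc_eq_0_imp_AE_0 L2_diff) (auto simp: fc_diff L2_imp_integrable)
  then show ?thesis by simp
qed

lemma L2_bounded_continuous:
  fixes f :: "real^2 \<Rightarrow> 'b::euclidean_space"
  assumes "continuous_on UNIV f" shows "f \<in> L2 torus"
proof -
  have "continuous_on torus (\<lambda>x. (norm (f x))\<^sup>2)" 
    by (intro continuous_intros continuous_on_subset[OF assms]) auto
  then obtain C where C: "\<And>x. x \<in> torus \<Longrightarrow> norm ((norm (f x))\<^sup>2) \<le> C"
    using compact_imp_bounded[OF compact_continuous_image[OF _ compact_torus]] by (fastforce simp: bounded_iff)
  have m: "f \<in> borel_measurable MT" using assms by (intro borel_measurable_MT borel_measurable_continuous_onI)
  then have "integrable MT (\<lambda>x. (norm (f x))\<^sup>2)"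
    using C by (intro MT.integrable_const_bound[of _ C]) auto
  then show ?thesis using m by (simp add: L2_def)
qed

lemma L2_Re_trig: "trig p \<Longrightarrow> (\<lambda>x. Re (p x)) \<in> L2 torus"
  by (intro L2_bounded_continuous continuous_intros continuous_on_trig)

subsection \<open>The Riesz--Fischer theorem\<close>

text \<open>Conjugate-symmetric coefficients on a symmetric frequency set give a real sum, so
  \<open>Re\<close> changes nothing and the coefficients can still be read off by
  orthogonality.\<close>

lemma real_trig_sum:
  assumes "finite S" "uminus ` S = S" "\<And>k. c (- k) = cnj (c k)"
  shows "of_real (Re (\<Sum>k\<in>S. c k * chr k x)) = (\<Sum>k\<in>S. c k * chr k x)"
proof -
  have "cnj (\<Sum>k\<in>S. c k * chr k x) = (\<Sum>k\<in>S. c (-k) * chr (-k) x)"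
    by (simp add: assms(3) chr_minus)
  also have "\<dots> = (\<Sum>k\<in>uminus ` S. c k * chr k x)" by (subst sum.reindex) (auto simp: inj_on_def)
  also have "\<dots> = (\<Sum>k\<in>S. c k * chr k x)" by (simp only: assms(2))
  finally show ?thesis by (intro of_real_Re) (simp only: Reals_cnj_iff)
qed

lemma fc_real_trig_sum:
  assumes "finite S" "uminus ` S = S" "\<And>k. c (- k) = cnj (c k)"
  shows "fc (\<lambda>x. Re (\<Sum>k\<in>S. c k * chr k x)) l = (if l \<in> S then c l else 0)"
proof -
  have "fc (\<lambda>x. Re (\<Sum>k\<in>S. c k * chr k x)) l = (LINT x|MT. (\<Sum>k\<in>S. c k * chr (k - l) x))"
    unfolding fc_def real_trig_sum[where c=c, OF assms] by (simp add: sum_distrib_right chr_diff mult.assoc)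
  also have "\<dots> = (\<Sum>k\<in>S. c k * (LINT x|MT. chr (k - l) x))"
    by (simp add: Bochner_Integration.integral_sum trig_integrable[OF trig_chr] 
        trig_integrable[OF trig_chr[of 1], simplified])
  also have "\<dots> = (if l \<in> S then c l else 0)"
    using assms(1) by (simp add: integral_chr if_distrib[of "\<lambda>z. _ * z"] sum.delta cong: if_cong)
  finally show ?thesis .
qed

lemma integral_Re_trig_sum_le:
  assumes "finite S"
  shows "(LINT x|MT. (Re (\<Sum>k\<in>S. c k * chr k x))\<^sup>2) \<le> (\<Sum>k\<in>S. (norm (c k))\<^sup>2)"
  unfolding integral_norm2_trig_sum[OF assms, symmetric]
  using L2_integrable_square[OF L2_Re_trig[OF trig_sum[OF assms]]] trig_square_integrable[OF trig_sum[OF assms]]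
  by (intro integral_mono) (auto simp: abs_Re_le_cmod abs_le_square_iff[symmetric] simp del: Re_sum)

text \<open>The geometric tail makes the successive differences of the partial sums summable in L^1,
  so the sums converge almost everywhere without passing to a subsequence. Having the limit as an
  explicit \<open>lim\<close> makes joint measurability available when the coefficients depend on
  time.\<close>

lemma Riesz_Fischer_rapid:
  fixes S :: "nat \<Rightarrow> (int \<times> int) set"
  assumes S: "\<And>m. finite (S m)" "\<And>m. uminus ` S m = S m" "incseq S" "(\<Union>m. S m) = UNIV"
    and c: "\<And>k. c (- k) = cnj (c k)"
    and tail: "\<And>m F. finite F \<Longrightarrow> F \<inter> S m = {} \<Longrightarrow> (\<Sum>k\<in>F. (norm (c k))\<^sup>2) \<le> B * (1/4)^m"
  defines "P \<equiv> \<lambda>m x. Re (\<Sum>k\<in>S m. c k * chr k x)"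
  defines "f \<equiv> \<lambda>x. lim (\<lambda>m. P m x)"
  shows "f \<in> L2 torus" "fc f k = c k" 
proof -
  have P_L2: "P m \<in> L2 torus" for m unfolding P_def by (intro L2_Re_trig trig_sum S(1))
  note [measurable] = L2_measurable[OF P_L2]
  have f_meas [measurable]: "f \<in> borel_measurable MT" unfolding f_def by measurable
  have B: "0 \<le> B" using tail[of "{}" 0] by simp
  have diff: "(LINT x|MT. (P n x - P m x)\<^sup>2) \<le> B * (1/4)^m" if "m \<le> n" for m n
  proof -
    have sub: "S m \<subseteq> S n" using S(3) that by (rule incseqD)
    have "P n x - P m x = Re (\<Sum>k\<in>S n - S m. c k * chr k x)" for x
      unfolding P_def using sum.subset_diff[OF sub S(1), of "\<lambda>k. c k * chr k x"] by simp
    then have "(LINT x|MT. (P n x - P m x)\<^sup>2) \<le> (\<Sum>k\<in>S n - S m. (norm (c k))\<^sup>2)"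
      using integral_Re_trig_sum_le[of "S n - S m" c] S(1) by simp
    also have "\<dots> \<le> B * (1/4)^m" using S(1) by (intro tail) auto
    finally show ?thesis .
  qed
  have diff1: "(LINT x|MT. \<bar>P (Suc m) x - P m x\<bar>) \<le> sqrt B * (1/2)^m" for m
  proof -
    have "(LINT x|MT. \<bar>P (Suc m) x - P m x\<bar>) \<le> L2_norm torus (\<lambda>x. P (Suc m) x - P m x)"
      by (intro integral_abs_le_L2_norm L2_diff P_L2)
    also have "\<dots> \<le> sqrt (B * (1/4)^m)" unfolding L2_norm_def using diff[of m "Suc m"] by simp
    also have "\<dots> = sqrt B * (1/2)^m"
      using real_sqrt_power[of "1/4" m] by (simp add: real_sqrt_mult real_sqrt_divide)
    finally show ?thesis .
  qed
  \<comment> \<open>The sum of the absolute increments has finite integral, hence is finite almost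
    everywhere, and the telescoping series converges.\<close>
  have conv: "AE x in MT. convergent (\<lambda>m. P m x)"
  proof -
    have "(\<integral>\<^sup>+x. (\<Sum>m. ennreal \<bar>P (Suc m) x - P m x\<bar>) \<partial>MT) = (\<Sum>m. \<integral>\<^sup>+x. ennreal \<bar>P (Suc m) x - P m x\<bar> \<partial>MT)"
      by (rule nn_integral_suminf) measurable
    also have "\<dots> = (\<Sum>m. ennreal (LINT x|MT. \<bar>P (Suc m) x - P m x\<bar>))"
      using L2_imp_integrable[OF L2_diff[OF P_L2 P_L2]] by (subst nn_integral_eq_integral) auto
    also have "\<dots> \<le> (\<Sum>m. ennreal (sqrt B * (1/2)^m))"
      using diff1 by (intro suminf_le) (auto intro: ennreal_leI)
    also have "\<dots> = ennreal (\<Sum>m. sqrt B * (1/2)^m)"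
      using B by (intro suminf_ennreal2) (auto intro!: summable_mult)
    also have "\<dots> < \<infinity>" by simp
    finally have "AE x in MT. (\<Sum>m. ennreal \<bar>P (Suc m) x - P m x\<bar>) \<noteq> \<infinity>"
      by (intro nn_integral_PInf_AE) (auto simp: less_top)
    then show ?thesis
    proof eventually_elim
      case (elim x)
      have "summable (\<lambda>m. \<bar>P (Suc m) x - P m x\<bar>)" 
        using elim by (intro summable_suminf_not_top) (auto simp: top_unique)
      then have "summable (\<lambda>m. P (Suc m) x - P m x)" by (rule summable_rabs_cancel)
      then have "convergent (\<lambda>n. \<Sum>m<n. P (Suc m) x - P m x)" by (simp add: summable_iff_convergent)
      moreover have "(\<lambda>n. \<Sum>m<n. P (Suc m) x - P m x) = (\<lambda>n. P n x - P 0 x)"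
        by (intro ext sum_lessThan_telescope)
      ultimately have "convergent (\<lambda>n. P n x - P 0 x)" by (simp only:)
      from convergent_add[OF this convergent_const[of "P 0 x"]] show ?case by simp
    qed
  qed
  \<comment> \<open>Fatou's lemma in \<open>n\<close> transfers the bound for
    \<open>P n - P m\<close> to \<open>f - P m\<close>.\<close>
  have fP: "integrable MT (\<lambda>x. (f x - P m x)\<^sup>2) \<and> (LINT x|MT. (f x - P m x)\<^sup>2) \<le> B * (1/4)^m" for m
  proof -
    have "(\<integral>\<^sup>+x. ennreal ((f x - P m x)\<^sup>2) \<partial>MT) = (\<integral>\<^sup>+x. liminf (\<lambda>n. ennreal ((P n x - P m x)\<^sup>2)) \<partial>MT)"
    proof (rule nn_integral_cong_AE, use conv in eventually_elim)
      case (elim x)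
      then have "(\<lambda>n. P n x) \<longlonglongrightarrow> f x" by (simp add: f_def convergent_LIMSEQ_iff)
      then have "(\<lambda>n. ennreal ((P n x - P m x)\<^sup>2)) \<longlonglongrightarrow> ennreal ((f x - P m x)\<^sup>2)"
        by (intro tendsto_ennrealI tendsto_intros)
      from lim_imp_Liminf[OF trivial_limit_sequentially this] show ?case by (rule sym)
    qed
    also have "\<dots> \<le> liminf (\<lambda>n. \<integral>\<^sup>+x. ennreal ((P n x - P m x)\<^sup>2) \<partial>MT)"
      by (rule nn_integral_liminf) measurable
    also have "\<dots> \<le> liminf (\<lambda>n. ennreal (B * (1/4)^m))"
    proof (rule Liminf_mono, rule eventually_sequentiallyI[of m])
      fix n assume "m \<le> n"
      have "(\<integral>\<^sup>+x. ennreal ((P n x - P m x)\<^sup>2) \<partial>MT) = ennreal (LINT x|MT. (P n x - P m x)\<^sup>2)"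
        using L2_integrable_square[OF L2_diff[OF P_L2[of n] P_L2[of m]]] by (intro nn_integral_eq_integral) auto
      then show "(\<integral>\<^sup>+x. ennreal ((P n x - P m x)\<^sup>2) \<partial>MT) \<le> ennreal (B * (1/4)^m)"
        using diff[OF \<open>m \<le> n\<close>] by (simp add: ennreal_leI)
    qed
    also have "\<dots> = ennreal (B * (1/4)^m)" by (simp add: Liminf_const)
    finally have le: "(\<integral>\<^sup>+x. ennreal ((f x - P m x)\<^sup>2) \<partial>MT) \<le> ennreal (B * (1/4)^m)" .
    have int: "integrable MT (\<lambda>x. (f x - P m x)\<^sup>2)"
      using le by (intro integrableI_bounded) (auto simp: ennreal_power[symmetric] intro: le_less_trans)
    then show ?thesis
      using le nn_integral_eq_integral[OF int] B by (simp add: ennreal_le_iff)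
  qed
  have fP_L2: "(\<lambda>x. f x - P m x) \<in> L2 torus" for m using fP[of m] by (simp add: L2_def)
  show f_L2: "f \<in> L2 torus" using L2_add[OF fP_L2[of 0] P_L2[of 0]] by simp
  have "(\<lambda>m. fc f k - fc (P m) k) \<longlonglongrightarrow> 0"
  proof (rule Lim_null_comparison[OF always_eventually], rule allI)
    fix m
    have "norm (fc f k - fc (P m) k) = norm (fc (\<lambda>x. f x - P m x) k)"
      by (simp add: fc_diff L2_imp_integrable f_L2 P_L2)
    also have "\<dots> \<le> L2_norm torus (\<lambda>x. f x - P m x)"
      using norm_fc_le[OF L2_imp_integrable[OF fP_L2]] integral_abs_le_L2_norm[OF fP_L2] by (rule order_trans)
    also have "\<dots> \<le> sqrt (B * (1/4)^m)" unfolding L2_norm_def using fP[of m] by simp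
    finally show "norm (fc f k - fc (P m) k) \<le> sqrt (B * (1/4)^m)" .
  next
    have "(\<lambda>m. sqrt (B * (1/4)^m)) \<longlonglongrightarrow> sqrt (B * 0)" by (intro tendsto_intros LIMSEQ_power_zero) auto
    then show "(\<lambda>m. sqrt (B * (1/4)^m)) \<longlonglongrightarrow> 0" by simp
  qed
  moreover have "\<forall>\<^sub>F m in sequentially. fc f k - fc (P m) k = fc f k - c k"
  proof -
    obtain m0 where "k \<in> S m0" using S(4) by blast
    then have "k \<in> S m" if "m \<ge> m0" for m using incseqD[OF S(3) that] by blast
    then show ?thesis 
      unfolding P_def by (intro eventually_sequentiallyI[of m0]) (simp only: fc_real_trig_sum[where c=c, OF S(1,2) c] if_True)
  qed
  ultimately have "(\<lambda>m. fc f k - c k) \<longlonglongrightarrow> 0" by (rule Lim_transform_eventually)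
  then show "fc f k = c k" by (simp add: LIMSEQ_const_iff)
qed

definition cube :: "nat \<Rightarrow> (int \<times> int) set" where
  "cube N = {- int N..int N} \<times> {- int N..int N}"

lemma finite_cube [simp]: "finite (cube N)"
  by (simp add: cube_def)

lemma uminus_cube: "uminus ` cube N = cube N"
proof -
  have "uminus ` cube N \<subseteq> cube N" by (auto simp: cube_def)
  moreover have "k \<in> uminus ` cube N" if "k \<in> cube N" for k
    using that by (intro image_eqI[of _ _ "-k"]) (auto simp: cube_def)
  ultimately show ?thesis by blast
qed

lemma mono_cube: "M \<le> N \<Longrightarrow> cube M \<subseteq> cube N"
  by (auto simp: cube_def)

lemma finite_subset_cube: assumes "finite F" obtains N where "F \<subseteq> cube N"
proof -
  have "\<exists>N. F \<subseteq> cube N" using assms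
  proof (induction F rule: finite_induct)
    case (insert k F)
    then obtain N where "F \<subseteq> cube N" by blast
    moreover have "k \<in> cube (nat \<bar>fst k\<bar> + nat \<bar>snd k\<bar>)" by (cases k) (auto simp: cube_def)
    ultimately have "insert k F \<subseteq> cube (N + (nat \<bar>fst k\<bar> + nat \<bar>snd k\<bar>))"
      using mono_cube[of N "N + (nat \<bar>fst k\<bar> + nat \<bar>snd k\<bar>)"] 
        mono_cube[of "nat \<bar>fst k\<bar> + nat \<bar>snd k\<bar>" "N + (nat \<bar>fst k\<bar> + nat \<bar>snd k\<bar>)"] by auto
    then show ?case by blast
  qed simp
  then show ?thesis using that by blast
qed

text \<open>Square-summability gives cubes outside which the remaining mass is as small as desired;
  choosing them fast enough reduces to the rapid case.\<close>

lemma Riesz_Fischer: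
  assumes c: "\<And>k. c (- k) = cnj (c k)" and B: "\<And>F. finite F \<Longrightarrow> (\<Sum>k\<in>F. (norm (c k))\<^sup>2) \<le> B"
  obtains f where "f \<in> L2 torus" "\<And>k. fc f k = c k"
proof -
  define s where "s = (SUP F\<in>Collect finite. \<Sum>k\<in>F. (norm (c k))\<^sup>2)"
  have bdd: "bdd_above ((\<lambda>F. \<Sum>k\<in>F. (norm (c k))\<^sup>2) ` Collect finite)"
    using B by (auto simp: bdd_above_def)
  have le_s: "(\<Sum>k\<in>F. (norm (c k))\<^sup>2) \<le> s" if "finite F" for F
    unfolding s_def using that by (intro cSUP_upper bdd) auto
  have "\<exists>N. \<forall>F. finite F \<longrightarrow> F \<inter> cube N = {} \<longrightarrow> (\<Sum>k\<in>F. (norm (c k))\<^sup>2) \<le> e" if "e > 0" for e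
  proof -
    have "s - e < s" using that by simp
    then obtain X where X: "finite X" "s - e < (\<Sum>k\<in>X. (norm (c k))\<^sup>2)"
      using less_cSUP_iff[OF _ bdd, of "s - e"] unfolding s_def by auto
    obtain N where N: "X \<subseteq> cube N" using finite_subset_cube[OF X(1)] by blast
    have "(\<Sum>k\<in>F. (norm (c k))\<^sup>2) \<le> e" if F: "finite F" "F \<inter> cube N = {}" for F
    proof -
      have "(\<Sum>k\<in>F \<union> X. (norm (c k))\<^sup>2) = (\<Sum>k\<in>F. (norm (c k))\<^sup>2) + (\<Sum>k\<in>X. (norm (c k))\<^sup>2)"
        using F X(1) N by (intro sum.union_disjoint) auto
      then show ?thesis using le_s[of "F \<union> X"] X F(1) by simp
    qed
    then show ?thesis by blast
  qed
  then have "\<forall>m. \<exists>N. \<forall>F. finite F \<longrightarrow> F \<inter> cube N = {} \<longrightarrow> (\<Sum>k\<in>F. (norm (c k))\<^sup>2) \<le> (1/4)^m" by simp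
  then obtain N where N: "\<And>m F. finite F \<Longrightarrow> F \<inter> cube (N m) = {} \<Longrightarrow> (\<Sum>k\<in>F. (norm (c k))\<^sup>2) \<le> (1/4)^m" by metis
  \<comment> \<open>The sum makes \<open>n\<close> monotone and at least \<open>N m\<close>; the
    extra \<open>m\<close> guarantees that the cubes exhaust all frequencies.\<close>
  define n where "n m = (\<Sum>i\<le>m. N i) + m" for m
  define S where "S m = cube (n m)" for m
  have nN: "N m \<le> n m" "m \<le> n m" for m
    unfolding n_def using member_le_sum[of m "{..m}" N] by auto
  have S: "finite (S m)" "uminus ` S m = S m" for m by (simp_all add: S_def uminus_cube)
  have "incseq n" unfolding n_def by (intro incseq_SucI) simp
  then have S3: "incseq S" unfolding S_def incseq_def using mono_cube by blast
  have S4: "(\<Union>m. S m) = UNIV"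
  proof -
    have "k \<in> (\<Union>m. S m)" for k
    proof -
      obtain M where "{k} \<subseteq> cube M" using finite_subset_cube[of "{k}"] by auto
      then have "k \<in> S M" unfolding S_def using mono_cube[OF nN(2)[of M]] by auto
      then show ?thesis by blast
    qed
    then show ?thesis by blast
  qed
  have tail: "(\<Sum>k\<in>F. (norm (c k))\<^sup>2) \<le> 1 * (1/4)^m" if "finite F" "F \<inter> S m = {}" for F m
    using N[OF that(1), of m] that(2) mono_cube[OF nN(1)[of m]] unfolding S_def by auto
  from Riesz_Fischer_rapid[OF S S3 S4 c tail] show ?thesis using that by blast
qed

subsection \<open>Fejer means\<close>

definition fw1 :: "nat \<Rightarrow> int \<Rightarrow> real" where
  "fw1 N k = 1 - \<bar>real_of_int k\<bar> / (real N + 1)"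

text \<open>Product weights make the planar kernel a product of two one-dimensional Fejer kernels,
  so that positivity is inherited.\<close>

definition fw :: "nat \<Rightarrow> int \<times> int \<Rightarrow> real" where
  "fw N k = fw1 N (fst k) * fw1 N (snd k)"

definition fejer_kernel :: "nat \<Rightarrow> real^2 \<Rightarrow> real^2 \<Rightarrow> real" where
  "fejer_kernel N x y = (\<Sum>k\<in>cube N. fw N k * cos (freq k \<bullet> (x - y)))"

definition fejer :: "nat \<Rightarrow> (real^2 \<Rightarrow> real) \<Rightarrow> real^2 \<Rightarrow> real" where
  "fejer N f x = (LINT y|MT. fejer_kernel N x y * f y)"

lemma dirichlet_sum:
  "(\<Sum>k\<in>{- int N..int N}. cis (of_int k * t)) = 1 + (\<Sum>n<N. cis (real (Suc n) * t)) + (\<Sum>n<N. cis (- (real (Suc n) * t)))"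
proof (induction N)
  case (Suc N)
  have "{- int (Suc N)..int (Suc N)} = insert (- int (Suc N)) (insert (int (Suc N)) {- int N..int N})" by auto
  moreover have "(- 1 - real N) * t = - ((1 + real N) * t)" by (simp add: algebra_simps)
  ultimately show ?case using Suc by simp
qed simp

text \<open>In the induction the new exponential contributes 1 and two cross terms. These assemble
  into the Dirichlet sum up to \<open>N + 1\<close>, which raises every weight by one.\<close>

lemma fejer_sum_scaled:
  "of_real ((norm (\<Sum>m<Suc N. cis (real m * t)))\<^sup>2) = (\<Sum>k\<in>{- int N..int N}. of_real (real N + 1 - \<bar>of_int k\<bar>) * cis (of_int k * t))"
proof (induction N)
  case (Suc N)
  let ?D = "\<Sum>m<Suc N. cis (real m * t)"
  let ?e = "cis (real (Suc N) * t)"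
  have X: "?e * cnj ?D = (\<Sum>m<Suc N. cis (real (Suc m) * t))"
  proof -
    have "?e * cnj ?D = (\<Sum>m<Suc N. cis (real (Suc N - m) * t))"
      unfolding cnj_sum sum_distrib_left
      by (intro sum.cong refl) (auto simp add: cis_cnj cis_mult of_nat_diff left_diff_distrib)
    also have "\<dots> = (\<Sum>m<Suc N. cis (real (Suc (Suc N - Suc m)) * t))"
      by (intro sum.cong refl) (simp add: Suc_diff_le)
    also have "\<dots> = (\<Sum>m<Suc N. cis (real (Suc m) * t))"
      by (rule sum.nat_diff_reindex)
    finally show ?thesis .
  qed
  have "cnj (?e * cnj ?D) = (\<Sum>m<Suc N. cis (- (real (Suc m) * t)))"
    unfolding X by (simp only: cnj_sum cis_cnj)
  then have Y: "cnj ?e * ?D = (\<Sum>m<Suc N. cis (- (real (Suc m) * t)))" by simp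
  have "complex_of_real ((norm (d + e))\<^sup>2) = of_real ((norm d)\<^sup>2) + (1 + e * cnj d + cnj e * d)"
    if "norm e = 1" for d e :: complex
  proof -
    have "e * cnj e = 1" using that complex_norm_square[of e] by simp
    then show ?thesis by (simp only: complex_norm_square complex_cnj_add) (simp add: algebra_simps)
  qed
  from this[of ?e ?D]
  have "complex_of_real ((norm (?D + ?e))\<^sup>2) = of_real ((norm ?D)\<^sup>2) + 
      (1 + (\<Sum>m<Suc N. cis (real (Suc m) * t)) + (\<Sum>m<Suc N. cis (- (real (Suc m) * t))))"
    by (simp only: X Y norm_cis)
  also have "1 + (\<Sum>m<Suc N. cis (real (Suc m) * t)) + (\<Sum>m<Suc N. cis (- (real (Suc m) * t))) = 
      (\<Sum>k\<in>{- int (Suc N)..int (Suc N)}. cis (of_int k * t))"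
    by (rule dirichlet_sum[symmetric])
  also have "complex_of_real ((norm ?D)\<^sup>2) = (\<Sum>k\<in>{- int N..int N}. of_real (real N + 1 - \<bar>of_int k\<bar>) * cis (of_int k * t))"
    by (rule Suc)
  \<comment> \<open>The two new frequencies carry the weight N + 1 - (N + 1) = 0, so the range can
    be enlarged before the sums are merged.\<close>
  also have "\<dots> = (\<Sum>k\<in>{- int (Suc N)..int (Suc N)}. of_real (real N + 1 - \<bar>of_int k\<bar>) * cis (of_int k * t))"
  proof (rule sum.mono_neutral_left)
    show "\<forall>k\<in>{- int (Suc N)..int (Suc N)} - {- int N..int N}. complex_of_real (real N + 1 - \<bar>of_int k\<bar>) * cis (of_int k * t) = 0"
    proof
      fix k assume "k \<in> {- int (Suc N)..int (Suc N)} - {- int N..int N}"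
      then have "\<bar>k\<bar> = int (Suc N)" by auto
      then have "real_of_int \<bar>k\<bar> = real N + 1" by simp
      then show "complex_of_real (real N + 1 - \<bar>of_int k\<bar>) * cis (of_int k * t) = 0" by simp
    qed
  qed auto
  finally show ?case by (simp add: sum.distrib[symmetric] algebra_simps)
qed simp

lemma fejer_sum_nonneg:
  "(\<Sum>k\<in>{- int N..int N}. of_real (fw1 N k) * cis (of_int k * t)) = of_real ((norm (\<Sum>m<Suc N. cis (real m * t)))\<^sup>2 / (real N + 1))"
proof -
  have "of_real (real N + 1) * (\<Sum>k\<in>{- int N..int N}. of_real (fw1 N k) * cis (of_int k * t)) = 
    (\<Sum>k\<in>{- int N..int N}. of_real (real N + 1 - \<bar>of_int k\<bar>) * cis (of_int k * t))"
  proof (unfold sum_distrib_left, intro sum.cong refl)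
    fix k
    have "(real N + 1) * fw1 N k = real N + 1 - \<bar>of_int k\<bar>" by (simp add: fw1_def field_simps)
    then show "complex_of_real (real N + 1) * (of_real (fw1 N k) * cis (of_int k * t)) = 
       of_real (real N + 1 - \<bar>of_int k\<bar>) * cis (of_int k * t)"
      by (metis mult.assoc of_real_mult)
  qed
  then have "of_real (real N + 1) * (\<Sum>k\<in>{- int N..int N}. of_real (fw1 N k) * cis (of_int k * t)) = 
      complex_of_real ((norm (\<Sum>m<Suc N. cis (real m * t)))\<^sup>2)"
    by (simp only: fejer_sum_scaled)
  moreover have "complex_of_real (real N + 1) \<noteq> 0" by (simp only: of_real_eq_0_iff)
  ultimately show ?thesis by (simp only: of_real_divide) (metis nonzero_mult_div_cancel_left)
qed

text \<open>In each coordinate the kernel is the square of a modulus divided by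
  \<open>N + 1\<close>. This is the property that separates Fejer means from Fourier partial
  sums.\<close>

lemma fejer_kernel_nonneg: "0 \<le> fejer_kernel N x y"
proof -
  let ?a = "2 * pi * (x - y) $ 1" and ?b = "2 * pi * (x - y) $ 2"
  let ?g = "\<lambda>t. (norm (\<Sum>m<Suc N. cis (real m * t)))\<^sup>2 / (real N + 1)"
  have "complex_of_real (?g ?a * ?g ?b) = (\<Sum>k1\<in>{- int N..int N}. of_real (fw1 N k1) * cis (of_int k1 * ?a)) *
      (\<Sum>k2\<in>{- int N..int N}. of_real (fw1 N k2) * cis (of_int k2 * ?b))"
    by (simp only: fejer_sum_nonneg of_real_mult)
  also have "\<dots> = (\<Sum>k\<in>cube N. of_real (fw N k) * cis (freq k \<bullet> (x - y)))"
    unfolding cube_def sum_product sum.cartesian_product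
    by (intro sum.cong refl) (auto simp: fw_def inner_vec2 cis_mult[symmetric] mult_ac)
  finally have "Re (complex_of_real (?g ?a * ?g ?b)) = Re (\<Sum>k\<in>cube N. of_real (fw N k) * cis (freq k \<bullet> (x - y)))" by simp
  then have "fejer_kernel N x y = ?g ?a * ?g ?b" by (simp add: fejer_kernel_def)
  then show ?thesis by simp
qed

lemma fw1_bounds: "k \<in> {- int N..int N} \<Longrightarrow> 0 \<le> fw1 N k \<and> fw1 N k \<le> 1"
proof -
  assume "k \<in> {- int N..int N}"
  then have "\<bar>k\<bar> \<le> int N" by auto
  then have "\<bar>real_of_int k\<bar> \<le> real N" by (metis of_int_abs of_int_le_iff of_int_of_nat_eq)
  then show ?thesis by (simp add: fw1_def divide_le_eq)
qed

lemma fw_bounds: "k \<in> cube N \<Longrightarrow> 0 \<le> fw N k" "k \<in> cube N \<Longrightarrow> fw N k \<le> 1"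
  using fw1_bounds[of "fst k" N] fw1_bounds[of "snd k" N]
  by (auto simp: cube_def fw_def mult_le_one)

lemma fw_0 [simp]: "fw N 0 = 1"
  by (simp add: fw_def fw1_def)

lemma zero_in_cube [simp]: "0 \<in> cube N"
  by (simp add: cube_def zero_prod_def)

lemma fw_tendsto: "(\<lambda>N. fw N k) \<longlonglongrightarrow> 1"
proof -
  have "(\<lambda>N. fw1 N j) \<longlonglongrightarrow> 1 - \<bar>real_of_int j\<bar> * 0" for j
    unfolding fw1_def divide_inverse
    using LIMSEQ_inverse_real_of_nat by (intro tendsto_intros) (simp add: add.commute)
  then have "(\<lambda>N. fw1 N j) \<longlonglongrightarrow> 1" for j by simp
  from tendsto_mult[OF this this] show ?thesis by (simp add: fw_def)
qed

lemma cos_freq_diff: "cos (freq k \<bullet> (x - y)) = Re (chr k x * cnj (chr k y))"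
  by (simp add: chr_def cis_cnj cis_mult inner_diff_right)

lemma integrable_cos_mult:
  assumes "integrable MT f" shows "integrable MT (\<lambda>y. cos (freq k \<bullet> (x - y)) * f y)"
proof -
  have "integrable MT (\<lambda>y. Re (chr k x * (of_real (f y) * cnj (chr k y))))"
    by (intro integrable_Re integrable_mult_right integrable_mult_chr assms)
  moreover have "Re (chr k x * (of_real (f y) * cnj (chr k y))) = cos (freq k \<bullet> (x - y)) * f y" for y
    unfolding cos_freq_diff by (simp add: algebra_simps)
  ultimately show ?thesis by simp
qed

lemma integral_cos_mult:
  assumes "integrable MT f" shows "(LINT y|MT. cos (freq k \<bullet> (x - y)) * f y) = Re (fc f k * chr k x)"
proof -
  have eq: "cos (freq k \<bullet> (x - y)) * f y = Re (chr k x * (of_real (f y) * cnj (chr k y)))" for y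
    unfolding cos_freq_diff by (simp add: algebra_simps)
  have "(LINT y|MT. cos (freq k \<bullet> (x - y)) * f y) = Re (LINT y|MT. chr k x * (of_real (f y) * cnj (chr k y)))"
    unfolding eq by (intro integral_Re integrable_mult_right integrable_mult_chr assms)
  also have "(LINT y|MT. chr k x * (of_real (f y) * cnj (chr k y))) = chr k x * fc f k"
    unfolding fc_def by (rule integral_mult_right_zero)
  finally show ?thesis by (simp only: mult.commute)
qed

lemma fejer_eq:
  assumes "integrable MT f" 
  shows "fejer N f x = (\<Sum>k\<in>cube N. fw N k * Re (fc f k * chr k x))"
    and "fejer N f x = Re (\<Sum>k\<in>cube N. (of_real (fw N k) * fc f k) * chr k x)"
proof -
  have "fejer N f x = (\<Sum>k\<in>cube N. fw N k * (LINT y|MT. cos (freq k \<bullet> (x - y)) * f y))"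
    unfolding fejer_def fejer_kernel_def sum_distrib_right
    by (simp add: Bochner_Integration.integral_sum integrable_cos_mult[OF assms] mult.assoc)
  then show *: "fejer N f x = (\<Sum>k\<in>cube N. fw N k * Re (fc f k * chr k x))"
    by (simp add: integral_cos_mult[OF assms])
  have "fw N k * Re (fc f k * chr k x) = Re ((of_real (fw N k) * fc f k) * chr k x)" for k
    by (simp add: algebra_simps)
  then show "fejer N f x = Re (\<Sum>k\<in>cube N. (of_real (fw N k) * fc f k) * chr k x)"
    unfolding * Re_sum by simp
qed

lemma continuous_on_fejer: "integrable MT f \<Longrightarrow> continuous_on A (fejer N f)"
proof -
  assume "integrable MT f"
  then have "fejer N f = (\<lambda>x. Re (\<Sum>k\<in>cube N. (of_real (fw N k) * fc f k) * chr k x))"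
    by (intro ext fejer_eq(2))
  then show ?thesis by (simp only:) (intro continuous_intros)
qed

lemma fejer_L2: "integrable MT f \<Longrightarrow> fejer N f \<in> L2 torus"
  by (intro L2_bounded_continuous continuous_on_fejer)

text \<open>Only the zero frequency survives integration, and its weight is 1.\<close>

lemma integral_fejer:
  assumes "integrable MT f" shows "(LINT x|MT. fejer N f x) = (LINT x|MT. f x)"
proof -
  have i: "integrable MT (\<lambda>x. fc f k * chr k x)" for k by (rule trig_integrable[OF trig_chr])
  have "(LINT x|MT. fejer N f x) = (\<Sum>k\<in>cube N. fw N k * (LINT x|MT. Re (fc f k * chr k x)))"
    unfolding fejer_eq(1)[OF assms] using integrable_Re[OF i] by (simp add: Bochner_Integration.integral_sum del: times_complex.sel)
  also have "\<dots> = (\<Sum>k\<in>cube N. if k = 0 then Re (fc f 0) else 0)"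
  proof (intro sum.cong refl)
    fix k
    have "(LINT x|MT. Re (fc f k * chr k x)) = Re (fc f k * (LINT x|MT. chr k x))"
      by (subst integral_Re[OF i]) simp
    then show "fw N k * (LINT x|MT. Re (fc f k * chr k x)) = (if k = 0 then Re (fc f 0) else 0)"
      by (simp add: integral_chr del: times_complex.sel)
  qed
  also have "\<dots> = Re (fc f 0)" by simp
  also have "\<dots> = (LINT x|MT. f x)" by (simp add: fc_def)
  finally show ?thesis .
qed

lemma fejer_kernel_mult_integrable: "integrable MT f \<Longrightarrow> integrable MT (\<lambda>y. fejer_kernel N x y * f y)"
  unfolding fejer_kernel_def sum_distrib_right mult.assoc
  by (intro Bochner_Integration.integrable_sum integrable_mult_right integrable_cos_mult)

lemma fejer_diff:
  "integrable MT f \<Longrightarrow> integrable MT g \<Longrightarrow> fejer N (\<lambda>x. f x - g x) x = fejer N f x - fejer N g x"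
  unfolding fejer_def by (simp add: right_diff_distrib fejer_kernel_mult_integrable)

lemma abs_fejer_le: 
  assumes "integrable MT f" shows "\<bar>fejer N f x\<bar> \<le> fejer N (\<lambda>y. \<bar>f y\<bar>) x"
proof -
  have "\<bar>fejer N f x\<bar> \<le> (LINT y|MT. \<bar>fejer_kernel N x y * f y\<bar>)"
    unfolding fejer_def by (rule integral_abs_bound)
  then show ?thesis by (simp add: abs_mult fejer_kernel_nonneg fejer_def)
qed

text \<open>A nonnegative kernel moves the modulus inside, and the mean of
  \<open>\<bar>f\<bar>\<close> is preserved. This is the estimate available for the flux, which is
  merely integrable.\<close>

lemma fejer_L1_contraction:
  assumes f: "integrable MT f" shows "(LINT x|MT. \<bar>fejer N f x\<bar>) \<le> (LINT x|MT. \<bar>f x\<bar>)"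
proof -
  have f': "integrable MT (\<lambda>y. \<bar>f y\<bar>)" using f by simp
  have "(LINT x|MT. \<bar>fejer N f x\<bar>) \<le> (LINT x|MT. fejer N (\<lambda>y. \<bar>f y\<bar>) x)"
    using abs_fejer_le[OF f] L2_imp_integrable[OF fejer_L2[OF f]] L2_imp_integrable[OF fejer_L2[OF f']]
    by (intro integral_mono) auto
  also have "\<dots> = (LINT x|MT. \<bar>f x\<bar>)" by (rule integral_fejer[OF f'])
  finally show ?thesis .
qed

text \<open>The squared error consists of the Fourier mass outside the cube and the mass inside
  weighted by \<open>(1 - fw N k)\<^sup>2\<close>. A finite set carries almost all the mass, and on
  it the weights tend to 1.\<close>

lemma fejer_tendsto_L2:
  assumes f: "f \<in> L2 torus" shows "(\<lambda>N. LINT x|MT. (fejer N f x - f x)\<^sup>2) \<longlonglongrightarrow> 0"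
proof (rule LIMSEQ_I)
  fix e :: real assume e: "0 < e"
  have fi: "integrable MT f" using L2_imp_integrable[OF f] .
  obtain S where S: "finite S" "(LINT x|MT. (f x)\<^sup>2) - (\<Sum>k\<in>S. (norm (fc f k))\<^sup>2) < e / 4"
    using Parseval_approx[OF f, of "e/4"] e by auto
  obtain N0 where N0: "S \<subseteq> cube N0" using finite_subset_cube[OF S(1)] by blast
  have "(\<lambda>N. \<Sum>k\<in>S. (1 - fw N k)\<^sup>2 * (norm (fc f k))\<^sup>2) \<longlonglongrightarrow> (\<Sum>k\<in>S. (1 - 1)\<^sup>2 * (norm (fc f k))\<^sup>2)"
    by (intro tendsto_intros fw_tendsto)
  then have "(\<lambda>N. \<Sum>k\<in>S. (1 - fw N k)\<^sup>2 * (norm (fc f k))\<^sup>2) \<longlonglongrightarrow> 0" by simp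
  then have "\<forall>\<^sub>F N in sequentially. (\<Sum>k\<in>S. (1 - fw N k)\<^sup>2 * (norm (fc f k))\<^sup>2) < e / 2"
    using e by (intro order_tendstoD) auto
  then obtain N1 where N1: "\<And>N. N \<ge> N1 \<Longrightarrow> (\<Sum>k\<in>S. (1 - fw N k)\<^sup>2 * (norm (fc f k))\<^sup>2) < e / 2"
    by (auto simp: eventually_sequentially)
  have "norm ((LINT x|MT. (fejer N f x - f x)\<^sup>2) - 0) < e" if N: "N \<ge> max N0 N1" for N
  proof -
    have SN: "S \<subseteq> cube N" using N0 mono_cube[of N0 N] N by auto
    let ?P = "\<lambda>x. \<Sum>k\<in>cube N. (of_real (fw N k) * fc f k) * chr k x"
    note fP = trig_sum[OF finite_cube[of N], of "\<lambda>k. of_real (fw N k) * fc f k"]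
    have "(LINT x|MT. (fejer N f x - f x)\<^sup>2) \<le> (LINT x|MT. (norm (of_real (f x) - ?P x))\<^sup>2)"
    proof (rule integral_mono)
      show "integrable MT (\<lambda>x. (fejer N f x - f x)\<^sup>2)"
        using L2_integrable_square[OF L2_diff[OF fejer_L2[OF fi] f]] by simp
      have "norm (of_real (f x) - ?P x) \<le> \<bar>f x\<bar> + norm (?P x)" for x
        by (rule order_trans[OF norm_triangle_ineq4]) simp
      then have "(norm (of_real (f x) - ?P x))\<^sup>2 \<le> (\<bar>f x\<bar> + norm (?P x))\<^sup>2" for x by (intro power_mono) auto
      moreover have "(\<bar>a\<bar> + norm b)\<^sup>2 \<le> 2 * a\<^sup>2 + 2 * (norm b)\<^sup>2" for a and b :: complex
        using sum_squares_bound[of "\<bar>a\<bar>" "norm b"] by (simp add: power2_sum)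
      ultimately have le: "(norm (of_real (f x) - ?P x))\<^sup>2 \<le> 2 * (f x)\<^sup>2 + 2 * (norm (?P x))\<^sup>2" for x
        by (rule order_trans)
      have i: "integrable MT (\<lambda>x. 2 * (f x)\<^sup>2 + 2 * (norm (?P x))\<^sup>2)"
        using L2_integrable_square[OF f] trig_square_integrable[OF fP] by simp
      have [measurable]: "f \<in> borel_measurable MT" "?P \<in> borel_measurable MT" 
        using L2_measurable[OF f] trig_measurable[OF fP] .
      show "integrable MT (\<lambda>x. (norm (of_real (f x) - ?P x))\<^sup>2)"
        by (rule Bochner_Integration.integrable_bound[OF i]) (measurable, intro AE_I2, use le in simp)
      show "(fejer N f x - f x)\<^sup>2 \<le> (norm (of_real (f x) - ?P x))\<^sup>2" for x
      proof -
        have "fejer N f x - f x = - Re (of_real (f x) - ?P x)" unfolding fejer_eq(2)[OF fi] by simp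
        then have "\<bar>fejer N f x - f x\<bar> \<le> norm (of_real (f x) - ?P x)" by (simp only: abs_minus_cancel abs_Re_le_cmod)
        then show ?thesis by (simp only: abs_le_square_iff[symmetric] abs_norm_cancel)
      qed
    qed
    also have "\<dots> = (LINT x|MT. (f x)\<^sup>2) - (\<Sum>k\<in>cube N. (norm (fc f k))\<^sup>2) + (\<Sum>k\<in>cube N. (1 - fw N k)\<^sup>2 * (norm (fc f k))\<^sup>2)"
    proof -
      have "norm (of_real (fw N k) * fc f k - fc f k) = \<bar>1 - fw N k\<bar> * norm (fc f k)" for k
      proof -
        have "of_real (fw N k) * fc f k - fc f k = of_real (fw N k - 1) * fc f k" by (simp add: algebra_simps)
        then show ?thesis by (simp only: norm_mult norm_of_real abs_minus_commute)
      qed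
      then show ?thesis unfolding integral_norm2_diff_trig_sum[OF f finite_cube] by (simp add: power_mult_distrib)
    qed
    also have "(\<Sum>k\<in>cube N. (1 - fw N k)\<^sup>2 * (norm (fc f k))\<^sup>2) = 
       (\<Sum>k\<in>cube N - S. (1 - fw N k)\<^sup>2 * (norm (fc f k))\<^sup>2) + (\<Sum>k\<in>S. (1 - fw N k)\<^sup>2 * (norm (fc f k))\<^sup>2)"
      by (rule sum.subset_diff[OF SN finite_cube])
    \<comment> \<open>Off \<open>S\<close> the factor is at most 1, so these terms merge with the
      mass outside the cube and the total is what \<open>S\<close> misses.\<close>
    also have "(\<Sum>k\<in>cube N - S. (1 - fw N k)\<^sup>2 * (norm (fc f k))\<^sup>2) \<le> (\<Sum>k\<in>cube N - S. (norm (fc f k))\<^sup>2)"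
    proof (rule sum_mono)
      fix k assume "k \<in> cube N - S"
      then have "(1 - fw N k)\<^sup>2 \<le> 1" using fw_bounds[of k N] by (intro power_le_one) auto
      then show "(1 - fw N k)\<^sup>2 * (norm (fc f k))\<^sup>2 \<le> (norm (fc f k))\<^sup>2" by (simp add: mult_left_le_one_le)
    qed
    also have "(\<Sum>k\<in>cube N. (norm (fc f k))\<^sup>2) = (\<Sum>k\<in>cube N - S. (norm (fc f k))\<^sup>2) + (\<Sum>k\<in>S. (norm (fc f k))\<^sup>2)"
      by (rule sum.subset_diff[OF SN finite_cube])
    finally have "(LINT x|MT. (fejer N f x - f x)\<^sup>2) < e" using S(2) N1[of N] N e by auto
    moreover have "0 \<le> (LINT x|MT. (fejer N f x - f x)\<^sup>2)" by (intro integral_nonneg_AE) auto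
    ultimately show ?thesis by simp
  qed
  then show "\<exists>no. \<forall>n\<ge>no. norm ((LINT x|MT. (fejer n f x - f x)\<^sup>2) - 0) < e" by blast
qed

lemma fejer_tendsto_L2_norm:
  assumes "f \<in> L2 torus" shows "(\<lambda>N. L2_norm torus (\<lambda>x. fejer N f x - f x)) \<longlonglongrightarrow> 0"
  using tendsto_real_sqrt[OF fejer_tendsto_L2[OF assms]] by (simp add: L2_norm_def)

text \<open>A bounded truncation is handled in L^2; the discarded part is small in L^1 and stays
  small by contraction.\<close>

lemma fejer_tendsto_L1:
  assumes f: "integrable MT f" shows "(\<lambda>N. LINT x|MT. \<bar>fejer N f x - f x\<bar>) \<longlonglongrightarrow> 0"
proof (rule LIMSEQ_I)
  fix e :: real assume e: "0 < e"
  have [measurable]: "f \<in> borel_measurable MT" using f by simp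
  have "(\<lambda>n. LINT x|MT. \<bar>f x - trunc (real n) (f x)\<bar>) \<longlonglongrightarrow> (LINT x|MT. 0)"
  proof (rule integral_dominated_convergence[where w="\<lambda>x. \<bar>f x\<bar>"])
    show "AE x in MT. (\<lambda>n. \<bar>f x - trunc (real n) (f x)\<bar>) \<longlonglongrightarrow> 0"
      by (intro AE_I2 tendsto_rabs_zero trunc_tendsto)
    show "AE x in MT. norm \<bar>f x - trunc (real n) (f x)\<bar> \<le> \<bar>f x\<bar>" for n
      using trunc_bounds(2)[of "real n"] by auto
  qed (use f in auto)
  then have "\<forall>\<^sub>F n in sequentially. (LINT x|MT. \<bar>f x - trunc (real n) (f x)\<bar>) < e / 4"
    using e by (intro order_tendstoD) auto
  then obtain n where n: "(LINT x|MT. \<bar>f x - trunc (real n) (f x)\<bar>) < e / 4"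
    by (auto simp: eventually_sequentially)
  let ?g = "\<lambda>x. trunc (real n) (f x)"
  have gL2: "?g \<in> L2 torus"
  proof -
    have "(trunc (real n) (f x))\<^sup>2 \<le> (real n)\<^sup>2" for x 
      using trunc_bounds(1)[of "real n" "f x"] by (simp add: abs_le_square_iff[symmetric])
    then have "integrable MT (\<lambda>x. (norm (trunc (real n) (f x)))\<^sup>2)"
      by (intro MT.integrable_const_bound[of _ "(real n)\<^sup>2"]) auto
    then show ?thesis by (simp add: L2_def)
  qed
  have gi: "integrable MT ?g" using L2_imp_integrable[OF gL2] .
  have "\<forall>\<^sub>F N in sequentially. L2_norm torus (\<lambda>x. fejer N ?g x - ?g x) < e / 4"
    using e by (intro order_tendstoD[OF fejer_tendsto_L2_norm[OF gL2]]) auto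
  then obtain N0 where N0: "\<And>N. N \<ge> N0 \<Longrightarrow> L2_norm torus (\<lambda>x. fejer N ?g x - ?g x) < e / 4"
    by (auto simp: eventually_sequentially)
  have "norm ((LINT x|MT. \<bar>fejer N f x - f x\<bar>) - 0) < e" if "N \<ge> N0" for N
  proof -
    have fg: "integrable MT (\<lambda>x. f x - ?g x)" using f gi by simp
    have iN: "integrable MT (fejer N h)" if "integrable MT h" for h using L2_imp_integrable[OF fejer_L2[OF that]] .
    have "(LINT x|MT. \<bar>fejer N f x - f x\<bar>) \<le> (LINT x|MT. \<bar>fejer N (\<lambda>x. f x - ?g x) x\<bar> + \<bar>fejer N ?g x - ?g x\<bar> + \<bar>f x - ?g x\<bar>)"
      using iN[OF f] iN[OF gi] iN[OF fg] f gi by (intro integral_mono) (auto simp: fejer_diff)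
    also have "\<dots> = (LINT x|MT. \<bar>fejer N (\<lambda>x. f x - ?g x) x\<bar>) + (LINT x|MT. \<bar>fejer N ?g x - ?g x\<bar>) + (LINT x|MT. \<bar>f x - ?g x\<bar>)"
      using iN[OF f] iN[OF gi] iN[OF fg] f gi by simp
    also have "(LINT x|MT. \<bar>fejer N (\<lambda>x. f x - ?g x) x\<bar>) \<le> (LINT x|MT. \<bar>f x - ?g x\<bar>)" by (rule fejer_L1_contraction[OF fg])
    also have "(LINT x|MT. \<bar>fejer N ?g x - ?g x\<bar>) \<le> L2_norm torus (\<lambda>x. fejer N ?g x - ?g x)"
      by (intro integral_abs_le_L2_norm L2_diff fejer_L2 gi gL2)
    finally have "(LINT x|MT. \<bar>fejer N f x - f x\<bar>) < e" using n N0[OF that] e by simp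
    moreover have "0 \<le> (LINT x|MT. \<bar>fejer N f x - f x\<bar>)" by (intro integral_nonneg_AE) auto
    ultimately show ?thesis by simp
  qed
  then show "\<exists>no. \<forall>n\<ge>no. norm ((LINT x|MT. \<bar>fejer n f x - f x\<bar>) - 0) < e" by blast
qed

subsection \<open>Lebesgue measure on space-time\<close>

abbreviation MI :: "real \<Rightarrow> real measure" where "MI T \<equiv> lebesgue_on {0..<T}"
abbreviation MS :: "real \<Rightarrow> (real \<times> (real^2)) measure" where "MS T \<equiv> lebesgue_on (spacetime T)"

lemma spacetime_borel [measurable, simp]: "spacetime T \<in> sets borel" "spacetime T \<in> sets lebesgue"
proof -
  have "{0..<T} \<times> torus \<in> sets (borel \<Otimes>\<^sub>M borel)" by measurable
  then show "spacetime T \<in> sets borel" unfolding spacetime_def by (simp only: borel_prod)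
  then show "spacetime T \<in> sets lebesgue" by (simp add: sets_completionI_sets)
qed

lemma AE_lebesgue_onI: "S \<in> sets lebesgue \<Longrightarrow> AE x in lborel. x \<in> S \<longrightarrow> P x \<Longrightarrow> AE x in lebesgue_on S. P x"
  by (simp add: AE_restrict_space_iff AE_completion_iff)

lemma AE_lebesgue_onD: "S \<in> sets lebesgue \<Longrightarrow> AE x in lebesgue_on S. P x \<Longrightarrow> AE x in lborel. x \<in> S \<longrightarrow> P x"
  by (simp add: AE_restrict_space_iff AE_completion_iff)

text \<open>Completeness of Lebesgue measure: changing a function on a null set preserves
  measurability.\<close>

lemma borel_measurable_lebesgue_on_AE:
  fixes f g :: "'a::euclidean_space \<Rightarrow> 'b::euclidean_space"
  assumes S: "S \<in> sets lebesgue" and f: "f \<in> borel_measurable (lebesgue_on S)" and "AE x in lebesgue_on S. f x = g x"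
  shows "g \<in> borel_measurable (lebesgue_on S)"
proof -
  have "(\<lambda>x. if x \<in> S then f x else 0) \<in> borel_measurable lebesgue"
    using f borel_measurable_if[OF S] by blast
  moreover have "AE x in lebesgue. (if x \<in> S then f x else 0) = (if x \<in> S then g x else 0)"
    using assms(3) S by (auto simp: AE_restrict_space_iff elim: eventually_mono)
  ultimately have "(\<lambda>x. if x \<in> S then g x else 0) \<in> borel_measurable lebesgue"
    by (rule borel_measurable_AE)
  then show ?thesis by (rule borel_measurable_if_D)
qed

lemma borel_measurable_lebesgue_on_borel:
  "f \<in> borel_measurable borel \<Longrightarrow> f \<in> borel_measurable (lebesgue_on S)"
  by (simp add: measurable_completion measurable_restrict_space1)

lemma integral_lebesgue_on_borel:
  fixes f :: "'a::euclidean_space \<Rightarrow> real"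
  assumes "S \<in> sets borel" "f \<in> borel_measurable borel" "\<And>x. x \<notin> S \<Longrightarrow> f x = 0"
  shows "(LINT x|lebesgue_on S. f x) = (LINT x|lborel. f x)"
    and "integrable (lebesgue_on S) f \<longleftrightarrow> integrable lborel f"
proof -
  have S: "S \<in> sets lebesgue" using assms(1) by (simp add: sets_completionI_sets)
  have eq: "(\<lambda>x. indicator S x * f x) = f" using assms(3) by (auto simp: indicator_def fun_eq_iff)
  show "(LINT x|lebesgue_on S. f x) = (LINT x|lborel. f x)"
    using S assms(2) by (simp add: integral_restrict_space integral_completion eq)
  show "integrable (lebesgue_on S) f \<longleftrightarrow> integrable lborel f"
    using S assms(2) by (simp add: integrable_restrict_space set_integrable_def integrable_completion eq)
qed

lemma AE_spacetime_slice:
  fixes Q :: "real \<times> (real^2) \<Rightarrow> bool"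
  assumes "AE p in lborel. Q p" shows "AE t in lborel. AE x in lborel. Q (t, x)"
  using lborel_pair.AE_pair[of Q] assms unfolding lborel_prod by blast

lemma AE_slice:
  assumes "AE p in MS T. Q p" shows "AE t in MI T. AE x in MT. Q (t, x)"
proof -
  have "AE p in lborel. p \<in> spacetime T \<longrightarrow> Q p" using assms by (intro AE_lebesgue_onD) auto
  then have "AE t in lborel. AE x in lborel. (t, x) \<in> spacetime T \<longrightarrow> Q (t, x)" by (rule AE_spacetime_slice)
  then show ?thesis
    by (intro AE_lebesgue_onI) (auto elim!: eventually_mono simp: spacetime_def intro!: AE_lebesgue_onI)
qed

lemma AE_time_spacetime:
  assumes "AE t in MI T. P t" shows "AE p in MS T. P (fst p)"
proof -
  have "AE t in lborel. t \<in> {0..<T} \<longrightarrow> P t" using assms by (intro AE_lebesgue_onD) auto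
  then obtain N where N: "N \<in> null_sets lborel" "{t. \<not> (t \<in> {0..<T} \<longrightarrow> P t)} \<subseteq> N"
    by (auto elim!: AE_E simp: null_sets_def)
  have "N \<times> (UNIV :: (real^2) set) \<in> null_sets (lborel \<Otimes>\<^sub>M lborel)"
    using N(1) by (auto simp: null_sets_def lborel.emeasure_pair_measure_Times)
  then have "N \<times> (UNIV :: (real^2) set) \<in> null_sets lborel" by (simp add: lborel_prod)
  then have "AE p in lborel. p \<notin> N \<times> (UNIV :: (real^2) set)" by (rule AE_not_in)
  then show ?thesis
    using N(2) by (intro AE_lebesgue_onI[OF spacetime_borel(2)]) (auto elim!: eventually_mono simp: spacetime_def)
qed

text \<open>The Lebesgue sigma-algebra on space-time is larger than the product of the Lebesgue
  sigma-algebras of its factors, so Fubini is applied to a Borel representative. Letting it vanish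
  off \<open>spacetime T\<close> turns restricted integrals into integrals against
  \<open>lborel\<close>.\<close>

lemma spacetime_borel_representative:
  fixes g :: "real \<times> (real^2) \<Rightarrow> real"
  assumes "g \<in> borel_measurable (MS T)"
  obtains g' where "g' \<in> borel_measurable borel" "\<And>p. p \<notin> spacetime T \<Longrightarrow> g' p = 0" "AE p in MS T. g p = g' p"
proof -
  have "(\<lambda>p. if p \<in> spacetime T then g p else 0) \<in> borel_measurable lebesgue"
    using assms by (subst borel_measurable_if) auto
  from completion_ex_borel_measurable_real[OF this] obtain h 
    where h: "h \<in> borel_measurable lborel" "AE p in lborel. (if p \<in> spacetime T then g p else 0) = h p" by blast
  have [measurable]: "h \<in> borel_measurable borel" using h(1) by simp
  have ae: "AE p in MS T. g p = indicator (spacetime T) p * h p"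
    using h(2) by (intro AE_lebesgue_onI) (auto elim!: eventually_mono)
  show ?thesis by (rule that[of "\<lambda>p. indicator (spacetime T) p * h p"]) (use ae in \<open>auto simp: indicator_def\<close>)
qed

lemma borel_slice: 
  fixes g :: "real \<times> (real^2) \<Rightarrow> real"
  assumes "g \<in> borel_measurable borel" shows "(\<lambda>x. g (t, x)) \<in> borel_measurable borel"
proof -
  have [measurable]: "g \<in> borel_measurable (borel \<Otimes>\<^sub>M borel)" using assms by (simp add: borel_prod)
  show ?thesis by measurable
qed

lemma AE_measurable_slice:
  fixes g :: "real \<times> (real^2) \<Rightarrow> real"
  assumes "g \<in> borel_measurable (MS T)"
  shows "AE t in MI T. (\<lambda>x. g (t, x)) \<in> borel_measurable MT"
proof -
  obtain g' where g': "g' \<in> borel_measurable borel" "AE p in MS T. g p = g' p"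
    using spacetime_borel_representative[OF assms] by metis
  show ?thesis using AE_slice[OF g'(2)]
  proof eventually_elim
    case (elim t)
    show ?case
      by (rule borel_measurable_lebesgue_on_AE[OF _ borel_measurable_MT[OF borel_slice[OF g'(1), of t]]])
        (use elim in \<open>auto elim: eventually_mono\<close>)
  qed
qed

lemma measurable_slice_integral:
  fixes g :: "real \<times> (real^2) \<Rightarrow> real"
  assumes "g \<in> borel_measurable (MS T)"
  shows "(\<lambda>t. LINT x|MT. g (t, x)) \<in> borel_measurable (MI T)"
proof -
  obtain g' where g': "g' \<in> borel_measurable borel" "\<And>p. p \<notin> spacetime T \<Longrightarrow> g' p = 0" "AE p in MS T. g p = g' p"
    using spacetime_borel_representative[OF assms] by metis
  have [measurable]: "g' \<in> borel_measurable (borel \<Otimes>\<^sub>M borel)" using g'(1) by (simp add: borel_prod)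
  have "(\<lambda>t. LINT x|lborel. g' (t, x)) \<in> borel_measurable borel" by measurable
  then have m: "(\<lambda>t. LINT x|lborel. g' (t, x)) \<in> borel_measurable (MI T)" by (rule borel_measurable_lebesgue_on_borel)
  have "AE t in MI T. (LINT x|lborel. g' (t, x)) = (LINT x|MT. g (t, x))"
    using AE_slice[OF g'(3)] AE_measurable_slice[OF assms]
  proof eventually_elim
    case (elim t)
    have "(LINT x|lborel. g' (t, x)) = (LINT x|MT. g' (t, x))"
      using g'(2) by (intro integral_lebesgue_on_borel(1)[symmetric] borel_slice g'(1)) (auto simp: spacetime_def)
    also have "\<dots> = (LINT x|MT. g (t, x))"
      using elim borel_measurable_MT[OF borel_slice[OF g'(1), of t]] by (intro integral_cong_AE) (auto elim: eventually_mono)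
    finally show ?case .
  qed
  from borel_measurable_lebesgue_on_AE[OF _ m this] show ?thesis by simp
qed

lemma Fubini_spacetime:
  fixes g :: "real \<times> (real^2) \<Rightarrow> real"
  assumes g: "integrable (MS T) g"
  shows "AE t in MI T. integrable MT (\<lambda>x. g (t, x))"
    and "integrable (MI T) (\<lambda>t. LINT x|MT. g (t, x))"
    and "(LINT p|MS T. g p) = (LINT t|MI T. LINT x|MT. g (t, x))"
proof -
  have gm: "g \<in> borel_measurable (MS T)" using g by simp
  obtain g' where g': "g' \<in> borel_measurable borel" "\<And>p. p \<notin> spacetime T \<Longrightarrow> g' p = 0" "AE p in MS T. g p = g' p"
    using spacetime_borel_representative[OF gm] by metis
  have [measurable]: "g' \<in> borel_measurable (borel \<Otimes>\<^sub>M borel)" using g'(1) by (simp add: borel_prod)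
  have g'm: "g' \<in> borel_measurable (MS T)" using g'(1) by (rule borel_measurable_lebesgue_on_borel)
  have "integrable (MS T) g'" using g gm g'm g'(3) by (subst integrable_cong_AE[of _ _ g]) (auto elim: eventually_mono)
  then have "integrable lborel g'" using g'(1,2) by (subst integral_lebesgue_on_borel(2)[symmetric]) auto
  then have i: "integrable (lborel \<Otimes>\<^sub>M lborel) g'" by (simp add: lborel_prod)
  have int0: "(LINT x|lborel. g' (t, x)) = 0" if "t \<notin> {0..<T}" for t
  proof -
    have "g' (t, x) = 0" for x using g'(2)[of "(t, x)"] that by (auto simp: spacetime_def)
    then show ?thesis by simp
  qed
  have g'0: "x \<notin> torus \<Longrightarrow> g' (t, x) = 0" for t x using g'(2)[of "(t, x)"] by (simp add: spacetime_def)
  have int_eq: "(LINT x|lborel. g' (t, x)) = (LINT x|MT. g' (t, x))"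
      "integrable MT (\<lambda>x. g' (t, x)) \<longleftrightarrow> integrable lborel (\<lambda>x. g' (t, x))" for t
    by (rule integral_lebesgue_on_borel(1)[symmetric]; use g'0 borel_slice[OF g'(1)] in simp)
       (rule integral_lebesgue_on_borel(2); use g'0 borel_slice[OF g'(1)] in simp)
  have m: "(\<lambda>t. LINT x|lborel. g' (t, x)) \<in> borel_measurable borel" by measurable
  have ae1: "AE t in MI T. integrable MT (\<lambda>x. g' (t, x))"
    using lborel_pair.AE_integrable_fst'[OF i] by (intro AE_lebesgue_onI) (auto simp: int_eq(2) elim!: eventually_mono)
  have ae: "AE t in MI T. integrable MT (\<lambda>x. g (t, x)) \<and> (LINT x|MT. g (t, x)) = (LINT x|lborel. g' (t, x))"
    using ae1 AE_slice[OF g'(3)] AE_measurable_slice[OF gm]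
  proof eventually_elim
    case (elim t)
    have "(LINT x|MT. g' (t, x)) = (LINT x|MT. g (t, x))"
      using elim borel_measurable_MT[OF borel_slice[OF g'(1), of t]] by (intro integral_cong_AE) (auto elim: eventually_mono)
    moreover have "integrable MT (\<lambda>x. g (t, x))"
      using elim by (subst integrable_cong_AE[of _ _ "\<lambda>x. g' (t, x)"]) auto
    ultimately show ?case by (simp add: int_eq)
  qed
  show "AE t in MI T. integrable MT (\<lambda>x. g (t, x))" using ae by (auto elim: eventually_mono)
  have mI: "(\<lambda>t. LINT x|lborel. g' (t, x)) \<in> borel_measurable (MI T)" using m by (rule borel_measurable_lebesgue_on_borel)
  have gI: "(\<lambda>t. LINT x|MT. g (t, x)) \<in> borel_measurable (MI T)" by (rule measurable_slice_integral[OF gm])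
  have "integrable lborel (\<lambda>t. LINT x|lborel. g' (t, x))" using lborel_pair.integrable_fst'[OF i] .
  then have "integrable (MI T) (\<lambda>t. LINT x|lborel. g' (t, x))"
    using m int0 by (subst integral_lebesgue_on_borel(2)) auto
  then show "integrable (MI T) (\<lambda>t. LINT x|MT. g (t, x))"
    using mI gI ae by (subst integrable_cong_AE[of _ _ "\<lambda>t. LINT x|lborel. g' (t, x)"]) (auto elim: eventually_mono)
  have "(LINT p|MS T. g p) = (LINT p|MS T. g' p)" using gm g'm g'(3) by (rule integral_cong_AE)
  also have "\<dots> = (LINT p|lborel. g' p)" using g'(1,2) by (intro integral_lebesgue_on_borel(1)) auto
  also have "\<dots> = (LINT t|lborel. LINT x|lborel. g' (t, x))"
    using lborel_pair.integral_fst'[OF i] by (simp add: lborel_prod)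
  also have "\<dots> = (LINT t|MI T. LINT x|lborel. g' (t, x))" 
    using m int0 by (intro integral_lebesgue_on_borel(1)[symmetric]) auto
  also have "\<dots> = (LINT t|MI T. LINT x|MT. g (t, x))"
    using mI gI ae by (intro integral_cong_AE) (auto elim: eventually_mono)
  finally show "(LINT p|MS T. g p) = (LINT t|MI T. LINT x|MT. g (t, x))" .
qed

text \<open>Tonelli's criterion: slices uniformly bounded in L^1 over a bounded time interval have a
  finite iterated integral.\<close>

lemma integrable_spacetimeI:
  fixes g :: "real \<times> (real^2) \<Rightarrow> real"
  assumes gm: "g \<in> borel_measurable (MS T)"
    and sl: "AE t in MI T. integrable MT (\<lambda>x. g (t, x)) \<and> (LINT x|MT. \<bar>g (t, x)\<bar>) \<le> C"
  shows "integrable (MS T) g"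
proof -
  obtain g' where g': "g' \<in> borel_measurable borel" "\<And>p. p \<notin> spacetime T \<Longrightarrow> g' p = 0" "AE p in MS T. g p = g' p"
    using spacetime_borel_representative[OF gm] by metis
  have [measurable]: "g' \<in> borel_measurable (borel \<Otimes>\<^sub>M borel)" using g'(1) by (simp add: borel_prod)
  have g'm: "g' \<in> borel_measurable (MS T)" using g'(1) by (rule borel_measurable_lebesgue_on_borel)
  have g'0: "x \<notin> torus \<Longrightarrow> g' (t, x) = 0" "t \<notin> {0..<T} \<Longrightarrow> g' (t, x) = 0" for t x
    using g'(2)[of "(t, x)"] by (auto simp: spacetime_def)
  have int_eq: "integrable MT (\<lambda>x. g' (t, x)) \<longleftrightarrow> integrable lborel (\<lambda>x. g' (t, x))" for t
    by (rule integral_lebesgue_on_borel(2); use g'0 borel_slice[OF g'(1)] in simp)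
  have abs_eq: "(LINT x|MT. \<bar>g' (t, x)\<bar>) = (LINT x|lborel. \<bar>g' (t, x)\<bar>)" for t
    by (rule integral_lebesgue_on_borel(1)) (use g'0 borel_slice[OF g'(1), of t] in auto)
  have ae0: "AE t in MI T. integrable MT (\<lambda>x. g' (t, x)) \<and> (LINT x|MT. \<bar>g' (t, x)\<bar>) \<le> C"
    using sl AE_slice[OF g'(3)] AE_measurable_slice[OF gm]
  proof eventually_elim
    case (elim t)
    note m' = borel_measurable_MT[OF borel_slice[OF g'(1), of t]]
    have "integrable MT (\<lambda>x. g' (t, x))"
      using elim m' by (subst integrable_cong_AE[of _ _ "\<lambda>x. g (t, x)"]) (auto elim: eventually_mono)
    moreover have "(LINT x|MT. \<bar>g' (t, x)\<bar>) = (LINT x|MT. \<bar>g (t, x)\<bar>)"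
      using elim m' by (intro integral_cong_AE) (auto elim: eventually_mono)
    ultimately show ?case using elim by simp
  qed
  have ae: "AE t in lborel. t \<in> {0..<T} \<longrightarrow> integrable MT (\<lambda>x. g' (t, x)) \<and> (LINT x|MT. \<bar>g' (t, x)\<bar>) \<le> C"
    using ae0 by (intro AE_lebesgue_onD) auto
  have "integrable (lborel \<Otimes>\<^sub>M lborel) g'"
  proof (rule lborel_pair.Fubini_integrable)
    show "AE t in lborel. integrable lborel (\<lambda>x. g' (t, x))"
      using ae
    proof eventually_elim
      case (elim t) then show ?case using int_eq[of t] g'0(2)[of t] by (cases "t \<in> {0..<T}") simp_all
    qed
    have b: "integrable lborel (\<lambda>t. C * indicator {0..<T} t)"
      using emeasure_bounded_finite[of "{0..<T}"] by (intro integrable_mult_right integrable_real_indicator) auto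
    show "integrable lborel (\<lambda>t. LINT x|lborel. norm (g' (t, x)))"
    proof (rule Bochner_Integration.integrable_bound[OF b])
      show "(\<lambda>t. LINT x|lborel. norm (g' (t, x))) \<in> borel_measurable lborel" by measurable
      show "AE t in lborel. norm (LINT x|lborel. norm (g' (t, x))) \<le> norm (C * indicator {0..<T} t)"
        using ae
      proof eventually_elim
        case (elim t)
        have "0 \<le> (LINT x|lborel. norm (g' (t, x)))" by (intro integral_nonneg_AE) auto
        then show ?case using elim abs_eq[of t] g'0(2)[of t] by (cases "t \<in> {0..<T}") auto
      qed
    qed
  qed measurable
  then have "integrable lborel g'" by (simp add: lborel_prod)
  then have "integrable (MS T) g'" using g'(1,2) by (subst integral_lebesgue_on_borel(2)) auto
  then show ?thesis using gm g'm g'(3) by (subst integrable_cong_AE[of _ _ g']) auto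
qed

text \<open>The cylinder over a null set of times is null in space-time, so a Borel representative
  in time suffices.\<close>

lemma measurable_time_spacetime:
  fixes a :: "real \<Rightarrow> real"
  assumes "a \<in> borel_measurable (MI T)" shows "(\<lambda>p. a (fst p)) \<in> borel_measurable (MS T)"
proof -
  have "(\<lambda>t. if t \<in> {0..<T} then a t else 0) \<in> borel_measurable lebesgue"
    using assms by (subst borel_measurable_if) auto
  from completion_ex_borel_measurable_real[OF this] obtain h 
    where h: "h \<in> borel_measurable lborel" "AE t in lborel. (if t \<in> {0..<T} then a t else 0) = h t" by blast
  have [measurable]: "h \<in> borel_measurable borel" using h(1) by simp
  have "AE t in MI T. h t = a t" using h(2) by (intro AE_lebesgue_onI) (auto elim!: eventually_mono)
  then have 1: "AE p in MS T. h (fst p) = a (fst p)" by (rule AE_time_spacetime)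
  have "(\<lambda>p. h (fst p)) \<in> borel_measurable (borel \<Otimes>\<^sub>M (borel :: (real^2) measure))" by measurable
  then have "(\<lambda>p::real\<times>(real^2). h (fst p)) \<in> borel_measurable borel" by (simp add: borel_prod)
  then show ?thesis
    by (intro borel_measurable_lebesgue_on_AE[OF _ borel_measurable_lebesgue_on_borel 1]) auto
qed

lemma measurable_space_spacetime:
  fixes f :: "real^2 \<Rightarrow> 'b::topological_space"
  assumes "f \<in> borel_measurable borel" shows "(\<lambda>p. f (snd p)) \<in> borel_measurable (MS T)"
proof -
  note [measurable] = assms
  have "(\<lambda>p. f (snd p)) \<in> borel_measurable ((borel :: real measure) \<Otimes>\<^sub>M borel)" by measurable
  then have "(\<lambda>p::real\<times>(real^2). f (snd p)) \<in> borel_measurable borel" by (simp add: borel_prod)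
  then show ?thesis by (rule borel_measurable_lebesgue_on_borel)
qed

lemma emeasure_spacetime: "0 \<le> T \<Longrightarrow> emeasure (MS T) (spacetime T) = ennreal T"
proof -
  assume "0 \<le> T"
  have "emeasure lborel torus = 1" using emeasure_torus by (simp add: emeasure_restrict_space)
  then have "emeasure (lborel \<Otimes>\<^sub>M lborel) ({0..<T} \<times> torus) = ennreal T"
    using \<open>0 \<le> T\<close> by (subst lborel.emeasure_pair_measure_Times) auto
  then show ?thesis by (simp add: emeasure_restrict_space lborel_prod) (simp add: spacetime_def)
qed

lemma finite_measure_MS: "0 \<le> T \<Longrightarrow> finite_measure (MS T)"
  by (rule finite_measureI) (simp add: emeasure_spacetime)

lemma finite_measure_MI: "finite_measure (MI T)"
  using emeasure_bounded_finite[of "{0..<T}"]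
  by (intro finite_measureI) (simp add: emeasure_restrict_space)

text \<open>A set of full measure meets every interval of positive length. Together with weak
  continuity this upgrades statements at almost every time to every time.\<close>

lemma AE_time_dense:
  assumes "AE t in MI T. P t" "t \<in> {0..<T}"
  shows "\<exists>s. (\<forall>n. s n \<in> {0..<T} \<and> P (s n)) \<and> s \<longlonglongrightarrow> t"
proof -
  have ae: "AE r in lborel. r \<in> {0..<T} \<longrightarrow> P r" using assms(1) by (intro AE_lebesgue_onD) auto
  have "\<exists>r. r \<in> {0..<T} \<and> P r \<and> \<bar>r - t\<bar> \<le> inverse (real (Suc n))" for n
  proof (rule ccontr)
    assume *: "\<not> ?thesis"
    \<comment> \<open>The search is made to the right of \<open>t\<close>, where there is always
      room, including at \<open>t = 0\<close>.\<close>
    define d where "d = min T (t + inverse (real (Suc n)))"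
    have d: "t < d" using assms(2) by (auto simp: d_def)
    have "AE r in lborel. r \<notin> {t<..<d}"
      using ae
    proof eventually_elim
      case (elim r)
      then show ?case using * assms(2) by (auto simp: d_def)
    qed
    then have "emeasure lborel {t<..<d} = 0"
      by (subst (asm) AE_iff_measurable[where N="{t<..<d}"]) auto
    then show False using d by simp
  qed
  then obtain s where s: "\<And>n. s n \<in> {0..<T}" "\<And>n. P (s n)" "\<And>n. \<bar>s n - t\<bar> \<le> inverse (real (Suc n))" by metis
  have "(\<lambda>n. s n - t) \<longlonglongrightarrow> 0"
    by (rule Lim_null_comparison[OF _ LIMSEQ_inverse_real_of_nat]) (use s(3) in auto)
  then have "s \<longlonglongrightarrow> t" by (simp add: LIM_zero_iff)
  then show ?thesis using s by blast
qed

subsection \<open>Weakly continuous functions of time\<close>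

lemma Cw_L2_weak_lim:
  "v \<in> Cw_L2 T \<Longrightarrow> t \<in> {0..<T} \<Longrightarrow> (\<And>n. s n \<in> {0..<T}) \<Longrightarrow> s \<longlonglongrightarrow> t \<Longrightarrow> weak_lim_L2 torus (\<lambda>n. v (s n)) (v t)"
  by (auto simp: Cw_L2_def)

lemma Cw_L2_slice: "v \<in> Cw_L2 T \<Longrightarrow> t \<in> {0..<T} \<Longrightarrow> v t \<in> L2 torus"
  using Cw_L2_weak_lim[of v T t "\<lambda>_. t"] by (auto simp: weak_lim_L2_def)

lemma Cw_L2_inner_continuous:
  assumes "v \<in> Cw_L2 T" "w \<in> L2 torus" shows "continuous_on {0..<T} (\<lambda>t. L2_inner torus (v t) w)"
proof (rule continuous_on_sequentiallyI)
  fix s t assume "\<forall>n. s n \<in> {0..<T}" "t \<in> {0..<T}" "s \<longlonglongrightarrow> t"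
  then show "(\<lambda>n. L2_inner torus (v (s n)) w) \<longlonglongrightarrow> L2_inner torus (v t) w"
    using Cw_L2_weak_lim[OF assms(1), of t s] assms(2) by (auto simp: weak_lim_L2_def)
qed

lemma Cw_L2_measurable: 
  fixes v :: "real \<Rightarrow> real^2 \<Rightarrow> 'b::euclidean_space"
  shows "v \<in> Cw_L2 T \<Longrightarrow> (\<lambda>p. v (fst p) (snd p)) \<in> borel_measurable (MS T)"
  by (simp add: Cw_L2_def Linf_L2_def case_prod_unfold)

text \<open>Lower semicontinuity of the norm, by testing the weak convergence with the limit
  itself.\<close>

lemma weak_lim_L2_norm_le:
  assumes "weak_lim_L2 S F f" "\<And>n. L2_norm S (F n) \<le> M" shows "L2_norm S f \<le> M"
proof -
  have f: "f \<in> L2 S" "\<And>n. F n \<in> L2 S" and lim: "(\<lambda>n. L2_inner S (F n) f) \<longlonglongrightarrow> L2_inner S f f"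
    using assms(1) by (auto simp: weak_lim_L2_def)
  have "L2_inner S f f \<le> M * L2_norm S f"
  proof (rule LIMSEQ_le_const2[OF lim], intro exI[of _ 0] allI impI)
    fix n
    have "L2_inner S (F n) f \<le> L2_norm S (F n) * L2_norm S f"
      using L2_Cauchy_Schwarz[OF f(2)[of n] f(1)] by simp
    also have "\<dots> \<le> M * L2_norm S f" using assms(2) by (intro mult_right_mono) auto
    finally show "L2_inner S (F n) f \<le> M * L2_norm S f" .
  qed
  then have "L2_norm S f * L2_norm S f \<le> M * L2_norm S f" by (simp add: L2_inner_self power2_eq_square)
  moreover have "0 \<le> M" using assms(2)[of 0] L2_norm_nonneg[of S "F 0"] by linarith
  ultimately show ?thesis using L2_norm_nonneg[of S f] by (cases "L2_norm S f = 0") auto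
qed

text \<open>The essential bound reaches exceptional times along a sequence of good ones, by lower
  semicontinuity.\<close>

lemma Cw_L2_norm_le:
  assumes "v \<in> Cw_L2 T" "AE t in MI T. L2_norm torus (v t) \<le> M" "t \<in> {0..<T}"
  shows "L2_norm torus (v t) \<le> M"
proof -
  obtain s where "\<And>n. s n \<in> {0..<T}" "\<And>n. L2_norm torus (v (s n)) \<le> M" "s \<longlonglongrightarrow> t"
    using AE_time_dense[OF assms(2,3)] by blast
  then show ?thesis using weak_lim_L2_norm_le[OF Cw_L2_weak_lim[OF assms(1,3)]] by blast
qed

lemma Linf_L2_norm_AE:
  assumes "Linf_L2_norm T v \<le> ereal M" shows "AE t in MI T. L2_norm torus (v t) \<le> M"
  using esssup_AE[where M="MI T" and f="\<lambda>t. ereal (L2_norm torus (v t))"]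
proof eventually_elim
  case (elim t)
  then have "ereal (L2_norm torus (v t)) \<le> ereal M" using assms unfolding Linf_L2_norm_def by (rule order_trans)
  then show ?case by simp
qed

text \<open>Needed to split the bound on the sum of two norms into a bound on each, as these norms
  are extended reals.\<close>

lemma Linf_L2_norm_nonneg: assumes "0 < T" shows "0 \<le> Linf_L2_norm T v"
proof -
  have "0 = esssup (MI T) (\<lambda>t. 0::ereal)"
    using assms by (subst esssup_const) (auto simp: emeasure_restrict_space)
  also have "\<dots> \<le> Linf_L2_norm T v"
  proof (cases "(\<lambda>t. ereal (L2_norm torus (v t))) \<in> borel_measurable (MI T)")
    case True then show ?thesis unfolding Linf_L2_norm_def by (intro esssup_mono) auto
  \<comment> \<open>For a function that is not measurable the essential supremum has the default
    value infinity.\<close>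
  qed (simp add: Linf_L2_norm_def esssup_non_measurable)
  finally show ?thesis .
qed

text \<open>Linear constraints valid at almost every time pass to every time, since the pairing is
  continuous along good times.\<close>

lemma Cw_L2_inner_eq_of_AE:
  assumes "v \<in> Cw_L2 T" "w \<in> L2 torus" "AE t in MI T. L2_inner torus (v t) w = c" "t \<in> {0..<T}"
  shows "L2_inner torus (v t) w = c"
proof -
  obtain s where s: "\<And>n. s n \<in> {0..<T}" "\<And>n. L2_inner torus (v (s n)) w = c" "s \<longlonglongrightarrow> t"
    using AE_time_dense[OF assms(3,4)] by blast
  from Cw_L2_weak_lim[OF assms(1,4) s(1,3)] assms(2)
  have "(\<lambda>n. L2_inner torus (v (s n)) w) \<longlonglongrightarrow> L2_inner torus (v t) w" by (auto simp: weak_lim_L2_def)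
  then show ?thesis using s(2) by (simp add: LIMSEQ_const_iff)
qed

lemma mean_zero_slices:
  fixes v :: "real \<Rightarrow> real^2 \<Rightarrow> real^2"
  assumes v: "v \<in> Cw_L2 T" and mz: "AE t in MI T. mean_zero (v t)" and t: "t \<in> {0..<T}"
  shows "(LINT x|MT. v t x $ i) = 0"
proof -
  have w: "(\<lambda>_. axis i 1 :: real^2) \<in> L2 torus" by (intro L2_bounded_continuous continuous_on_const)
  have "AE t in MI T. L2_inner torus (v t) (\<lambda>_. axis i 1) = 0"
    using mz AE_space
  proof eventually_elim
    case (elim t)
    have vi: "v t \<in> L2 torus" using Cw_L2_slice[OF v] elim(2) by simp
    note [measurable] = L2_measurable[OF vi]
    have "(\<lambda>x. norm (v t x)) \<in> L2 torus"
      using L2_integrable_square[OF vi] by (simp add: L2_def)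
    then have "integrable MT (\<lambda>x. norm (v t x))" by (rule L2_imp_integrable)
    then have "integrable MT (v t)" using L2_measurable[OF vi] by (simp add: integrable_norm_iff)
    then have "L2_inner torus (v t) (\<lambda>_. axis i 1) = (LINT x|MT. v t x) \<bullet> axis i 1"
      unfolding L2_inner_def by (subst integral_inner_left) auto
    then show ?case using elim(1) by (simp add: mean_zero_def)
  qed
  from Cw_L2_inner_eq_of_AE[OF v w this t] show ?thesis by (simp add: L2_inner_def inner_axis)
qed

section \<open>Product test functions and localisation in time\<close>

lemma smooth_time_space:
  fixes \<eta> :: "real \<Rightarrow> real" and \<phi> :: "real^2 \<Rightarrow> 'b::real_normed_vector"
  assumes "smooth \<eta>" "smooth \<phi>" shows "smooth (\<lambda>(t, x). \<eta> t *\<^sub>R \<phi> x)"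
proof -
  have "smooth (\<lambda>p::real\<times>(real^2). \<eta> (fst p + 0))" 
    by (rule smooth_compose_affine[OF bounded_linear_fst assms(1)])
  moreover have "smooth (\<lambda>p::real\<times>(real^2). \<phi> (snd p + 0))" 
    by (rule smooth_compose_affine[OF bounded_linear_snd assms(2)])
  ultimately have "smooth (\<lambda>p. \<eta> (fst p + 0) *\<^sub>R \<phi> (snd p + 0))" by (rule smooth_scaleR)
  then show ?thesis by (simp add: case_prod_unfold)
qed

lemma smooth_real_deriv:
  fixes \<eta> :: "real \<Rightarrow> real"
  assumes "smooth \<eta>"
  shows "(\<eta> has_real_derivative deriv \<eta> t) (at t)" "continuous_on UNIV (deriv \<eta>)"
proof -
  have D: "(\<eta> has_derivative frechet_derivative \<eta> (at t)) (at t)" for t using smooth_has_derivative[OF assms] .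
  show d: "(\<eta> has_real_derivative deriv \<eta> t) (at t)" for t
    using D[of t] by (metis differentiable_def DERIV_deriv_iff_real_differentiable)
  have "frechet_derivative \<eta> (at t) 1 = deriv \<eta> t" for t
    using frechet_derivative_at[OF d[unfolded has_field_derivative_def], of t] by (metis mult.right_neutral)
  moreover have "continuous_on UNIV (\<lambda>t. frechet_derivative \<eta> (at t) 1)"
    by (intro smooth_continuous smooth_deriv assms) simp
  ultimately show "continuous_on UNIV (deriv \<eta>)" by simp
qed

lemma time_deriv_product:
  assumes "smooth \<eta>" shows "time_deriv (\<lambda>t x. \<eta> t *\<^sub>R \<phi> x) t x = deriv \<eta> t *\<^sub>R \<phi> x"
proof -
  have "((\<lambda>s. \<eta> s *\<^sub>R \<phi> x) has_vector_derivative deriv \<eta> t *\<^sub>R \<phi> x) (at t)"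
    using smooth_real_deriv(1)[OF assms, of t] by (auto intro!: derivative_eq_intros simp: has_real_derivative_iff_has_vector_derivative)
  then show ?thesis unfolding time_deriv_def by (rule vector_derivative_at)
qed

lemma frechet_derivative_scaled:
  assumes "smooth \<phi>" shows "frechet_derivative (\<lambda>x. c *\<^sub>R \<phi> x) (at x) = (\<lambda>h. c *\<^sub>R frechet_derivative \<phi> (at x) h)"
  by (rule frechet_derivative_at[symmetric]) (intro has_derivative_scaleR_right smooth_has_derivative assms)

lemma jacobian_scaled: "smooth \<phi> \<Longrightarrow> jacobian (\<lambda>x. c *\<^sub>R \<phi> x) x = c *\<^sub>R jacobian \<phi> x"
  by (simp add: jacobian_def frechet_derivative_scaled matrix_def vec_eq_iff)

lemma grad_scaled: "smooth \<psi> \<Longrightarrow> grad (\<lambda>x. c *\<^sub>R \<psi> x) x = c *\<^sub>R grad \<psi> x"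
  using frechet_derivative_scaled[of \<psi> c] by (simp add: grad_def vec_eq_iff)

lemma spacetime_test_product:
  fixes \<phi> :: "real^2 \<Rightarrow> 'b::real_normed_vector"
  assumes "smooth \<eta>" "T' < T" "\<And>t. t > T' \<Longrightarrow> \<eta> t = 0" "\<phi> \<in> torus_test"
  shows "(\<lambda>t x. \<eta> t *\<^sub>R \<phi> x) \<in> spacetime_test T"
  using assms smooth_time_space[OF assms(1) torus_test_smooth[OF assms(4)]]
  by (auto simp: spacetime_test_def torus_test_def periodic_def)

lemma spacetime_test_interior_product:
  fixes \<phi> :: "real^2 \<Rightarrow> 'b::real_normed_vector"
  assumes "smooth \<eta>" "0 < a" "b < T" "\<And>t. t \<notin> {a..b} \<Longrightarrow> \<eta> t = 0" "\<phi> \<in> torus_test"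
  shows "(\<lambda>t x. \<eta> t *\<^sub>R \<phi> x) \<in> spacetime_test_interior T"
proof -
  have "\<exists>a b. 0 < a \<and> b < T \<and> (\<forall>t. t \<notin> {a..b} \<longrightarrow> (\<forall>x. \<eta> t *\<^sub>R \<phi> x = 0))"
    using assms by (intro exI[of _ a] exI[of _ b]) auto
  then show ?thesis
    using assms(5) smooth_time_space[OF assms(1) torus_test_smooth[OF assms(5)]]
    by (auto simp: spacetime_test_interior_def torus_test_def periodic_def)
qed

lemma torus_test_L2: 
  fixes \<phi> :: "real^2 \<Rightarrow> 'b::euclidean_space" shows "\<phi> \<in> torus_test \<Longrightarrow> \<phi> \<in> L2 torus"
  by (intro L2_bounded_continuous smooth_continuous torus_test_smooth)

lemma continuous_on_vec2:
  fixes f :: "'a::topological_space \<Rightarrow> real^2"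
  assumes "continuous_on S (\<lambda>x. f x $ 1)" "continuous_on S (\<lambda>x. f x $ 2)" shows "continuous_on S f"
proof -
  have "f = (\<lambda>x. \<chi> i. f x $ i)" by (simp add: vec_lambda_eta)
  moreover have "continuous_on S (\<lambda>x. \<chi> i. f x $ i)"
    using assms by (intro continuous_on_vec_lambda) (metis (full_types) exhaust_2)
  ultimately show ?thesis by simp
qed

lemma continuous_on_grad: "smooth \<psi> \<Longrightarrow> continuous_on UNIV (grad \<psi>)"
  by (rule continuous_on_vec2) (auto simp: grad_def Basis_real2 intro!: smooth_continuous smooth_deriv)

lemma grad_L2: "\<psi> \<in> torus_test \<Longrightarrow> grad \<psi> \<in> L2 torus"
  by (intro L2_bounded_continuous continuous_on_grad torus_test_smooth)

text \<open>If \<open>h s\<close> were positive, a bump supported just after \<open>s\<close> would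
  see only positive values of \<open>h\<close>, contradicting the zero integral. The one-sided
  conclusion is also applied to \<open>- h\<close>.\<close>

lemma time_cutoff_integral_zero:
  assumes h: "continuous_on {0..<T} h" and int: "\<And>\<eta> a b. smooth \<eta> \<Longrightarrow> 0 < a \<Longrightarrow> b < T \<Longrightarrow> 
      (\<And>t. t \<notin> {a..b} \<Longrightarrow> \<eta> t = 0) \<Longrightarrow> (LINT t|MI T. \<eta> t * h t) = (0::real)"
    and s: "0 < s" "s < T"
  shows "h s \<le> 0"
proof (rule ccontr)
  assume "\<not> h s \<le> 0"
  then have hs: "0 < h s / 2" by simp
  have "isCont h s" 
    using h s by (intro continuous_on_interior[OF h]) (auto simp: interior_atLeastLessThan)
  then obtain d where d: "d > 0" "\<And>t. \<bar>t - s\<bar> < d \<Longrightarrow> \<bar>h t - h s\<bar> < h s / 2"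
    using hs unfolding continuous_at_eps_delta by (metis dist_real_def)
  define m where "m = min d (T - s)"
  have d': "0 < m" "m \<le> d" "m \<le> T - s" using d(1) s by (auto simp: m_def)
  \<comment> \<open>Halving makes the inequalities strict, so the support \<open>{s..s+e}\<close>
    stays below \<open>T\<close> and where \<open>h\<close> is close to \<open>h s\<close>.\<close>
  define e where "e = m / 2"
  have e1: "0 < e" using d' d(1) s unfolding e_def by linarith
  have e2: "e < d" using d' d(1) s unfolding e_def by linarith
  have e3: "s + e < T" using d' d(1) s unfolding e_def by linarith
  note e = e1 e2 e3
  from smooth_bump_exists obtain B :: "real \<Rightarrow> real" where B0: "smooth B \<and> (\<forall>x. x \<notin> {0..1} \<longrightarrow> B x = 0) \<and> 
      (\<forall>x. 0 < x \<longrightarrow> x < 1 \<longrightarrow> 0 < B x) \<and> (\<forall>x. 0 \<le> B x)" by (rule exE)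
  have B: "smooth B" "\<And>x. x \<notin> {0..1} \<Longrightarrow> B x = 0" "\<And>x. 0 < x \<Longrightarrow> x < 1 \<Longrightarrow> 0 < B x" "\<And>x. 0 \<le> B x"
    using B0 by simp_all
  define \<eta> where "\<eta> t = B ((1/e) * t + (- s / e))" for t
  have \<eta>_eq: "\<eta> t = B ((t - s) / e)" for t using e(1) by (simp add: \<eta>_def field_simps)
  have \<eta>: "smooth \<eta>" unfolding \<eta>_def by (rule smooth_real_affine[OF B(1)])
  have \<eta>0: "\<eta> t = 0" if "t \<notin> {s..s+e}" for t
    unfolding \<eta>_eq using that e(1) by (intro B(2)) (auto simp: divide_simps)
  have zero: "(LINT t|MI T. \<eta> t * h t) = 0" using int[OF \<eta> s(1) e(3) \<eta>0] by blast
  have nn: "0 \<le> \<eta> t * h t" for t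
  proof (cases "t \<in> {s..s+e}")
    case True
    then have "\<bar>h t - h s\<bar> < h s / 2" using e by (intro d(2)) auto
    then have "0 \<le> h t" using hs by linarith
    then show ?thesis using B(4) by (simp add: \<eta>_def)
  qed (simp add: \<eta>0)
  have \<eta>c: "continuous_on A \<eta>" for A using smooth_continuous[OF \<eta>] continuous_on_subset by blast
  have m: "(\<lambda>t. \<eta> t * h t) \<in> borel_measurable (MI T)"
    by (intro continuous_imp_measurable_on_sets_lebesgue continuous_on_mult \<eta>c h) auto
  have bdd: "\<exists>C. \<forall>t. \<bar>\<eta> t * h t\<bar> \<le> C"
  proof -
    have "continuous_on {s..s+e} (\<lambda>t. \<eta> t * h t)"
      using s e by (intro continuous_on_mult \<eta>c continuous_on_subset[OF h]) auto
    then obtain C where "\<And>t. t \<in> {s..s+e} \<Longrightarrow> norm (\<eta> t * h t) \<le> C"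
      using compact_imp_bounded[OF compact_continuous_image[OF _ compact_Icc]] by (fastforce simp: bounded_iff)
    then have *: "\<bar>\<eta> t * h t\<bar> \<le> C" if "t \<in> {s..s+e}" for t using that by (simp only: real_norm_def)
    have "\<bar>\<eta> t * h t\<bar> \<le> max C 0" for t
    proof (cases "t \<in> {s..s+e}")
      case True then show ?thesis using *[of t] by linarith
    qed (simp add: \<eta>0)
    then show ?thesis by blast
  qed
  then obtain C where C: "\<And>t. \<bar>\<eta> t * h t\<bar> \<le> C" by blast
  interpret fm: finite_measure "MI T" by (rule finite_measure_MI)
  have "integrable (MI T) (\<lambda>t. \<eta> t * h t)"
    using m C by (intro fm.integrable_const_bound[of _ C]) auto
  from integral_nonneg_eq_0_iff_AE[OF this] zero nn have ae: "AE t in MI T. \<eta> t * h t = 0" by auto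
  \<comment> \<open>The midpoint of the support is approached by times at which the product
    vanishes, although both factors are positive near it.\<close>
  have se: "s + e/2 \<in> {0..<T}" using s e by auto
  obtain r where r0: "\<forall>n. r n \<in> {0..<T} \<and> \<eta> (r n) * h (r n) = 0" and r2: "r \<longlonglongrightarrow> s + e/2" 
    using AE_time_dense[OF ae se] by (elim exE conjE) (rule that)
  have r: "\<And>n. \<eta> (r n) * h (r n) = 0" "r \<longlonglongrightarrow> s + e/2" using r0 r2 by simp_all
  then have "\<forall>\<^sub>F n in sequentially. r n > s" "\<forall>\<^sub>F n in sequentially. r n < s + e"
    using e by (auto intro: order_tendstoD)
  then have "\<forall>\<^sub>F n in sequentially. False"
  proof eventually_elim
    case (elim n)
    then have "\<eta> (r n) > 0" unfolding \<eta>_eq using e by (intro B(3)) (auto simp: divide_simps)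
    moreover have "\<bar>h (r n) - h s\<bar> < h s / 2" using elim e by (intro d(2)) auto
    then have "h (r n) > 0" using hs by linarith
    ultimately show False using r(1)[of n] by simp
  qed
  then show False by simp
qed

text \<open>\<open>int\<close> is the weak form of h' = G including the initial value. Testing with
  cutoffs that fall from 1 to 0 just before \<open>s\<close> makes the term with
  \<open>deriv \<eta>\<close> converge to \<open>- h s\<close>, by continuity of
  \<open>h\<close>.\<close>

lemma time_cutoff_integral_eq:
  fixes h G :: "real \<Rightarrow> real"
  assumes h: "continuous_on {0..<T} h" and K: "\<And>t. t \<in> {0..<T} \<Longrightarrow> \<bar>h t\<bar> \<le> K"
    and G: "integrable (MI T) G"
    and int: "\<And>\<eta> T'. smooth \<eta> \<Longrightarrow> T' < T \<Longrightarrow> (\<And>t. t > T' \<Longrightarrow> \<eta> t = 0) \<Longrightarrow> 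
      (LINT t|MI T. deriv \<eta> t * h t + \<eta> t * G t) + \<eta> 0 * h 0 = 0"
    and s: "s \<in> {0..<T}"
  shows "h s = h 0 + (LINT t|MI T. indicator {0..s} t * G t)"
proof (cases "s = 0")
  case True
  have "AE t in MI T. indicator {0..s} t * G t = 0"
    using AE_lborel_singleton[of "0::real"] True by (intro AE_lebesgue_onI) (auto elim!: eventually_mono simp: indicator_def)
  then have "(LINT t|MI T. indicator {0..s} t * G t) = 0"
    by (rule integral_eq_zero_AE)
  then show ?thesis using True by simp
next
  case False
  then have s0: "0 < s" "s < T" using s by auto
  interpret fm: finite_measure "MI T" by (rule finite_measure_MI)
  from smooth_step_exists obtain S :: "real \<Rightarrow> real" where S0: "smooth S \<and> (\<forall>x\<le>0. S x = 0) \<and> (\<forall>x\<ge>1. S x = 1) \<and> 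
      (\<forall>x. 0 \<le> S x \<and> S x \<le> 1)" by (rule exE)
  have S: "smooth S" "\<And>x. x \<le> 0 \<Longrightarrow> S x = 0" "\<And>x. x \<ge> 1 \<Longrightarrow> S x = 1" "\<And>x. 0 \<le> S x" "\<And>x. S x \<le> 1"
    using S0 by simp_all
  note S' = smooth_real_deriv[OF S(1)]
  have S'0: "deriv S x = 0" if "x < 0 \<or> x > 1" for x
  proof -
    define c where "c = S x"
    have "\<forall>\<^sub>F y in nhds x. S y = c"
    proof (cases "x < 0")
      case True then show ?thesis using eventually_nhds_in_open[of "{..<0}" x] 
        by (auto elim!: eventually_mono simp: S(2) c_def)
    next
      case False then show ?thesis using eventually_nhds_in_open[of "{1<..}" x] that
        by (auto elim!: eventually_mono simp: S(3) c_def)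
    qed
    then have "(S has_real_derivative 0) (at x) \<longleftrightarrow> ((\<lambda>_. c) has_real_derivative 0) (at x)"
      by (intro DERIV_cong_ev) auto
    then have "(S has_real_derivative 0) (at x)" by simp
    then show ?thesis by (rule DERIV_imp_deriv)
  qed
  obtain C where C: "\<And>x. \<bar>deriv S x\<bar> \<le> C"
  proof -
    have "continuous_on {0..1} (deriv S)" using S'(2) continuous_on_subset by blast
    then obtain C where "\<And>x. x \<in> {0..1} \<Longrightarrow> norm (deriv S x) \<le> C"
      using compact_imp_bounded[OF compact_continuous_image[OF _ compact_Icc]] by (fastforce simp: bounded_iff)
    then have *: "\<bar>deriv S x\<bar> \<le> C" if "x \<in> {0..1}" for x using that by (simp only: real_norm_def)
    have "\<bar>deriv S x\<bar> \<le> max C 0" for x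
    proof (cases "x \<in> {0..1}")
      case True then show ?thesis using *[of x] by linarith
    qed (use S'0[of x] in auto)
    then show ?thesis using that by blast
  qed
  \<comment> \<open>Equal to 1 up to time \<open>s - 1 / real (Suc n)\<close> and equal to 0 from
    \<open>s\<close> on.\<close>
  define \<eta> where "\<eta> n t = S ((- real (Suc n)) * t + real (Suc n) * s)" for n t
  have \<eta>_eq: "\<eta> n t = S (real (Suc n) * (s - t))" for n t by (simp add: \<eta>_def algebra_simps)
  have \<eta>: "smooth (\<eta> n)" for n unfolding \<eta>_def by (rule smooth_real_affine[OF S(1)])
  have \<eta>0: "\<eta> n t = 0" if "t \<ge> s" for n t unfolding \<eta>_eq using that by (intro S(2)) (simp add: mult_nonneg_nonpos)
  have \<eta>1: "\<eta> n t = 1" if "real (Suc n) * (s - t) \<ge> 1" for n t unfolding \<eta>_eq using that by (rule S(3))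
  have \<eta>c: "continuous_on A (\<eta> n)" for A n using smooth_continuous[OF \<eta>] continuous_on_subset by blast
  have \<eta>': "deriv (\<eta> n) t = - real (Suc n) * deriv S (real (Suc n) * (s - t))" for n t
  proof -
    have "((\<lambda>t. S (real (Suc n) * (s - t))) has_real_derivative (deriv S (real (Suc n) * (s - t)) * (- real (Suc n)))) (at t)"
      by (rule DERIV_chain2[OF S'(1)]) (auto intro!: derivative_eq_intros)
    moreover have "\<eta> n = (\<lambda>t. S (real (Suc n) * (s - t)))" using \<eta>_eq by blast
    ultimately show ?thesis using DERIV_imp_deriv by (metis mult.commute)
  qed
  note \<eta>D = smooth_real_deriv[OF \<eta>]
  have \<eta>'c: "continuous_on A (deriv (\<eta> n))" for A n using \<eta>D(2) continuous_on_subset by blast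
  have \<eta>'0: "deriv (\<eta> n) t = 0" if "t > s \<or> real (Suc n) * (s - t) > 1" for n t 
    unfolding \<eta>' using that by (subst S'0) (auto simp: mult_less_0_iff)
  have \<eta>'b: "\<bar>deriv (\<eta> n) t\<bar> \<le> real (Suc n) * C" for n t
    unfolding \<eta>' abs_mult using C by (intro mult_mono) auto
  have C0: "C \<ge> 0" using C[of 0] by linarith
  have \<eta>'i: "integrable (MI T) (deriv (\<eta> n))" for n
    by (rule fm.integrable_const_bound[of _ "real (Suc n) * C"])
       (use \<eta>'b in \<open>auto intro!: continuous_imp_measurable_on_sets_lebesgue \<eta>'c\<close>)
  have hm: "h \<in> borel_measurable (MI T)" by (intro continuous_imp_measurable_on_sets_lebesgue h) auto
  have K0: "0 \<le> K" using K[OF s] by linarith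
  have \<eta>'h: "integrable (MI T) (\<lambda>t. deriv (\<eta> n) t * h t)" for n
  proof (rule fm.integrable_const_bound[of _ "real (Suc n) * C * K"])
    have "\<bar>deriv (\<eta> n) t * h t\<bar> \<le> real (Suc n) * C * K" if "t \<in> {0..<T}" for t
      unfolding abs_mult using \<eta>'b K[OF that] C0 by (intro mult_mono) auto
    then show "AE t in MI T. norm (deriv (\<eta> n) t * h t) \<le> real (Suc n) * C * K" by (intro AE_I2) auto
    show "(\<lambda>t. deriv (\<eta> n) t * h t) \<in> borel_measurable (MI T)"
      using \<eta>'i[of n] hm by (intro borel_measurable_times) auto
  qed
  have \<eta>m: "\<eta> n \<in> borel_measurable (MI T)" for n by (intro continuous_imp_measurable_on_sets_lebesgue \<eta>c) auto
  have Gm: "G \<in> borel_measurable (MI T)" using G by simp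
  have \<eta>G: "integrable (MI T) (\<lambda>t. \<eta> n t * G t)" for n
  proof (rule Bochner_Integration.integrable_bound[OF G])
    show "(\<lambda>t. \<eta> n t * G t) \<in> borel_measurable (MI T)" by (rule borel_measurable_times[OF \<eta>m Gm])
    show "AE t in MI T. norm (\<eta> n t * G t) \<le> norm (G t)"
      using S(4,5) by (auto simp: abs_mult \<eta>_eq intro!: mult_left_le_one_le)
  qed
  have lim1: "(\<lambda>n. LINT t|MI T. \<eta> n t * G t) \<longlonglongrightarrow> (LINT t|MI T. indicator {0..s} t * G t)"
  proof (rule integral_dominated_convergence[where w="\<lambda>t. \<bar>G t\<bar>"])
    show "AE t in MI T. (\<lambda>n. \<eta> n t * G t) \<longlonglongrightarrow> indicator {0..s} t * G t"
    proof (rule AE_lebesgue_onI)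
      show "AE t in lborel. t \<in> {0..<T} \<longrightarrow> (\<lambda>n. \<eta> n t * G t) \<longlonglongrightarrow> indicator {0..s} t * G t"
        using AE_lborel_singleton[of s]
      proof (eventually_elim, intro impI tendsto_mult tendsto_const)
        fix t assume t: "t \<noteq> s" "t \<in> {0..<T}"
        show "(\<lambda>n. \<eta> n t) \<longlonglongrightarrow> indicator {0..s} t"
        proof (cases "t < s")
          case True
          then obtain n0 where n0: "1 < real n0 * (s - t)" using reals_Archimedean3[of "s - t"] by auto
          have "\<eta> n t = 1" if "n \<ge> n0" for n
          proof (rule \<eta>1)
            have "real n0 * (s - t) \<le> real (Suc n) * (s - t)" using True that by (intro mult_right_mono) auto
            then show "1 \<le> real (Suc n) * (s - t)" using n0 by linarith
          qed
          then have "(\<lambda>n. \<eta> n t) \<longlonglongrightarrow> 1" by (intro tendsto_eventually eventually_sequentiallyI)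
          then show ?thesis using True t by simp
        next
          case False
          then show ?thesis using t \<eta>0[of t] by simp
        qed
      qed
    qed simp
    show "AE t in MI T. norm (\<eta> n t * G t) \<le> \<bar>G t\<bar>" for n
      using S(4,5) by (auto simp: abs_mult \<eta>_eq intro!: mult_left_le_one_le)
    show "(\<lambda>t. \<eta> n t * G t) \<in> borel_measurable (MI T)" for n
      by (rule borel_measurable_times[OF \<eta>m Gm])
    show "(\<lambda>t. indicator {0..s} t * G t) \<in> borel_measurable (MI T)"
      by (rule borel_measurable_times[OF borel_measurable_lebesgue_on_borel Gm]) simp
    show "integrable (MI T) (\<lambda>t. \<bar>G t\<bar>)" using G by simp
  qed
  \<comment> \<open>Only for such \<open>n\<close> does the plateau reach time zero, so that the
    cutoff is 1 there and its derivative has total mass -1.\<close>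
  have ev: "\<forall>\<^sub>F n in sequentially. real (Suc n) * s > 1"
  proof -
    obtain n0 where n0: "1 < real n0 * s" using reals_Archimedean3[OF s0(1)] by auto
    have "real (Suc n) * s > 1" if "n \<ge> n0" for n
    proof -
      have "real n0 * s \<le> real (Suc n) * s" using s0 that by (intro mult_right_mono) auto
      then show ?thesis using n0 by linarith
    qed
    then show ?thesis by (rule eventually_sequentiallyI)
  qed
  have mass: "(LINT t|MI T. deriv (\<eta> n) t) = -1" if "real (Suc n) * s > 1" for n
  proof -
    have "(LINT t|MI T. deriv (\<eta> n) t) = (LINT t|MI T. deriv (\<eta> n) t * indicator {0..s} t)"
      using \<eta>'0 by (intro Bochner_Integration.integral_cong refl) (auto simp: indicator_def not_le)
    also have "\<dots> = (LINT t|lborel. deriv (\<eta> n) t * indicator {0..s} t)"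
      using s0 \<eta>'c[of UNIV n, THEN borel_measurable_continuous_onI] 
      by (intro integral_lebesgue_on_borel(1)) (auto simp: indicator_def)
    also have "\<dots> = \<eta> n s - \<eta> n 0"
      using s0 \<eta>D(1) \<eta>D(2) by (intro integral_FTC_Icc_real) (auto simp: continuous_on_eq_continuous_at)
    also have "\<dots> = -1" using \<eta>0[of s n] \<eta>1[of n 0] that by simp
    finally show ?thesis .
  qed
  have lim2: "(\<lambda>n. LINT t|MI T. deriv (\<eta> n) t * h t) \<longlonglongrightarrow> - h s"
  proof (rule LIMSEQ_I)
    fix e :: real assume e: "0 < e"
    \<comment> \<open>The derivative is at most \<open>real (Suc n) * C\<close> on an interval of
      length \<open>1 / real (Suc n)\<close>, so the error is at most \<open>C * e'\<close>. Adding
      1 to \<open>C\<close> covers \<open>C = 0\<close>.\<close>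
    define e' where "e' = e / (2 * (C + 1))"
    have "0 < C * e + e * 2" using e C0 by (intro add_nonneg_pos) auto
    then have e': "e' > 0" "C * e' < e" using e C0 by (auto simp: e'_def field_simps)
    have "isCont h s" 
      using s0 by (intro continuous_on_interior[OF h]) (auto simp: interior_atLeastLessThan)
    then obtain d where d: "d > 0" "\<And>t. \<bar>t - s\<bar> < d \<Longrightarrow> \<bar>h t - h s\<bar> < e'"
      using e'(1) unfolding continuous_at_eps_delta by (metis dist_real_def)
    obtain n1 where n1: "1 < real n1 * d" using reals_Archimedean3[OF d(1)] by auto
    obtain n0 where n0: "\<And>n. n \<ge> n0 \<Longrightarrow> real (Suc n) * s > 1" using ev by (auto simp: eventually_sequentially)
    have "norm ((LINT t|MI T. deriv (\<eta> n) t * h t) - - h s) < e" if n: "n \<ge> max n0 n1" for n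
    proof -
      let ?r = "1 / real (Suc n)"
      have r: "?r < d" "?r < s"
      proof -
        have "real n1 * d \<le> real (Suc n) * d" using d(1) n by (intro mult_right_mono) auto
        then have "1 < real (Suc n) * d" using n1 by linarith
        then show "?r < d" by (simp add: divide_less_eq mult.commute)
        show "?r < s" using n0[of n] n by (simp add: divide_less_eq mult.commute)
      qed
      have "(LINT t|MI T. deriv (\<eta> n) t * h t) + h s = (LINT t|MI T. deriv (\<eta> n) t * h t) - h s * (LINT t|MI T. deriv (\<eta> n) t)"
        using mass[OF n0, of n] n by simp
      also have "\<dots> = (LINT t|MI T. deriv (\<eta> n) t * (h t - h s))"
        using \<eta>'h \<eta>'i by (simp add: right_diff_distrib mult.commute)
      finally have eq: "(LINT t|MI T. deriv (\<eta> n) t * h t) + h s = (LINT t|MI T. deriv (\<eta> n) t * (h t - h s))" .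
      have "norm (LINT t|MI T. deriv (\<eta> n) t * (h t - h s)) \<le> (LINT t|MI T. real (Suc n) * C * e' * indicator {s - ?r..s} t)"
      proof (rule order_trans[OF integral_norm_bound integral_mono])
        have "integrable (MI T) (\<lambda>t. deriv (\<eta> n) t * h t - h s * deriv (\<eta> n) t)" using \<eta>'h \<eta>'i by simp
        then show "integrable (MI T) (\<lambda>t. norm (deriv (\<eta> n) t * (h t - h s)))" 
          by (intro integrable_norm) (simp add: right_diff_distrib mult.commute)
        have "s - ?r \<ge> 0" using r by simp
        then have "(\<lambda>t. indicator {s - ?r..s} t :: real) \<in> borel_measurable (MI T)"
          by (intro borel_measurable_lebesgue_on_borel) simp
        then show "integrable (MI T) (\<lambda>t. real (Suc n) * C * e' * indicator {s - ?r..s} t)"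
          by (intro integrable_mult_right fm.integrable_const_bound[of _ 1]) (auto simp: indicator_def)
        fix t assume "t \<in> space (MI T)"
        show "norm (deriv (\<eta> n) t * (h t - h s)) \<le> real (Suc n) * C * e' * indicator {s - ?r..s} t"
        proof (cases "t \<in> {s - ?r..s}")
          case True
          then have "\<bar>t - s\<bar> < d" using r by auto
          then have "\<bar>h t - h s\<bar> \<le> e'" using d(2) by (simp add: less_imp_le)
          then show ?thesis using True \<eta>'b[of n t] C0 by (auto simp: abs_mult intro!: mult_mono)
        next
          case False
          then have "t > s \<or> real (Suc n) * (s - t) > 1" by (auto simp: field_simps)
          then have "deriv (\<eta> n) t = 0" by (rule \<eta>'0)
          moreover have "0 \<le> real (Suc n) * C * e' * indicator {s - ?r..s} t"
            using C0 e'(1) by (intro mult_nonneg_nonneg) auto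
          ultimately show ?thesis by simp
        qed
      qed
      also have "\<dots> = real (Suc n) * C * e' * (LINT t|MI T. indicator {s - ?r..s} t)" by simp
      also have "(LINT t|MI T. indicator {s - ?r..s} t) = (LINT t|lborel. indicator {s - ?r..s} t :: real)"
        using r s0 by (intro integral_lebesgue_on_borel(1)) (auto simp: indicator_def)
      also have "\<dots> = ?r" by simp
      also have "real (Suc n) * C * e' * ?r = C * e'" by simp
      finally show ?thesis using eq e'(2) by simp
    qed
    then show "\<exists>no. \<forall>n\<ge>no. norm ((LINT t|MI T. deriv (\<eta> n) t * h t) - - h s) < e" by blast
  qed
  have "(\<lambda>n. (LINT t|MI T. deriv (\<eta> n) t * h t) + (LINT t|MI T. \<eta> n t * G t) + h 0) \<longlonglongrightarrow> - h s + (LINT t|MI T. indicator {0..s} t * G t) + h 0"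
    by (intro tendsto_intros lim1 lim2)
  moreover have "\<forall>\<^sub>F n in sequentially. (LINT t|MI T. deriv (\<eta> n) t * h t) + (LINT t|MI T. \<eta> n t * G t) + h 0 = 0"
    using ev
  proof eventually_elim
    case (elim n)
    have "(LINT t|MI T. deriv (\<eta> n) t * h t + \<eta> n t * G t) + \<eta> n 0 * h 0 = 0"
      using s0 \<eta>0 by (intro int[OF \<eta>, of s]) auto
    moreover have "\<eta> n 0 = 1" using \<eta>1[of n 0] elim by simp
    ultimately show ?case using \<eta>'h \<eta>G by simp
  qed
  ultimately have "- h s + (LINT t|MI T. indicator {0..s} t * G t) + h 0 = 0"
    using LIMSEQ_unique[OF _ tendsto_eventually] by blast
  then show ?thesis by simp
qed

section \<open>Uniform bounds for slices and their space-time integrals\<close>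

lemma Cw_L2_bounded:
  fixes v :: "real \<Rightarrow> real^2 \<Rightarrow> 'b::euclidean_space"
  assumes "v \<in> Cw_L2 T" 
  obtains M where "0 \<le> M" "\<And>t. t \<in> {0..<T} \<Longrightarrow> L2_norm torus (v t) \<le> M"
proof -
  have "Linf_L2_norm T v < \<infinity>" using assms by (simp add: Cw_L2_def Linf_L2_def)
  then obtain M where "Linf_L2_norm T v \<le> ereal M" 
    by (cases "Linf_L2_norm T v") auto
  then have "AE t in MI T. L2_norm torus (v t) \<le> M" by (rule Linf_L2_norm_AE)
  then have *: "L2_norm torus (v t) \<le> M" if "t \<in> {0..<T}" for t using Cw_L2_norm_le[OF assms] that by blast
  then have "L2_norm torus (v t) \<le> max M 0" if "t \<in> {0..<T}" for t using *[OF that] by linarith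
  then show ?thesis using that[of "max M 0"] by simp
qed

lemma continuous_time_bounded:
  fixes a :: "real \<Rightarrow> real" assumes "continuous_on UNIV a"
  obtains C where "0 \<le> C" "\<And>t. t \<in> {0..<T} \<Longrightarrow> \<bar>a t\<bar> \<le> C"
proof -
  have "continuous_on {0..T} a" using assms continuous_on_subset by blast
  then have "bounded (a ` {0..T})" by (intro compact_imp_bounded compact_continuous_image compact_Icc)
  then obtain C where "\<forall>t\<in>{0..T}. \<bar>a t\<bar> \<le> C" by (auto simp: bounded_iff)
  then have "\<bar>a t\<bar> \<le> max C 0" if "t \<in> {0..<T}" for t
    using that by (auto simp: le_max_iff_disj)
  then show ?thesis using that[of "max C 0"] by simp
qed

text \<open>The form in which the weak formulations are used: a bounded weight in time against
  slices that are uniformly bounded in L^1 at every time.\<close>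

lemma spacetime_weighted_integral:
  fixes g :: "real \<times> (real^2) \<Rightarrow> real"
  assumes g: "g \<in> borel_measurable (MS T)"
    and sl: "\<And>t. t \<in> {0..<T} \<Longrightarrow> integrable MT (\<lambda>x. g (t, x))" 
      "\<And>t. t \<in> {0..<T} \<Longrightarrow> (LINT x|MT. \<bar>g (t, x)\<bar>) \<le> C"
    and a: "a \<in> borel_measurable (MI T)" "\<And>t. t \<in> {0..<T} \<Longrightarrow> \<bar>a t\<bar> \<le> A"
  shows "integrable (MS T) (\<lambda>p. a (fst p) * g p)" 
    and "(LINT p|MS T. a (fst p) * g p) = (LINT t|MI T. a t * (LINT x|MT. g (t, x)))"
    and "integrable (MI T) (\<lambda>t. a t * (LINT x|MT. g (t, x)))"
proof -
  show i: "integrable (MS T) (\<lambda>p. a (fst p) * g p)"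
  proof (rule integrable_spacetimeI)
    show "(\<lambda>p. a (fst p) * g p) \<in> borel_measurable (MS T)"
      by (intro borel_measurable_times measurable_time_spacetime a(1) g)
    show "AE t in MI T. integrable MT (\<lambda>x. a (fst (t, x)) * g (t, x)) \<and> 
       (LINT x|MT. \<bar>a (fst (t, x)) * g (t, x)\<bar>) \<le> \<bar>A\<bar> * \<bar>C\<bar>"
    proof (rule AE_I2)
      fix t assume "t \<in> space (MI T)"
      then have t: "t \<in> {0..<T}" by simp
      have "(LINT x|MT. \<bar>a t * g (t, x)\<bar>) = \<bar>a t\<bar> * (LINT x|MT. \<bar>g (t, x)\<bar>)" by (simp add: abs_mult)
      also have "\<dots> \<le> \<bar>A\<bar> * \<bar>C\<bar>"
        using a(2)[OF t] sl(2)[OF t] by (intro mult_mono integral_nonneg_AE) auto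
      finally show "integrable MT (\<lambda>x. a (fst (t, x)) * g (t, x)) \<and> 
         (LINT x|MT. \<bar>a (fst (t, x)) * g (t, x)\<bar>) \<le> \<bar>A\<bar> * \<bar>C\<bar>" using sl(1)[OF t] by simp
    qed
  qed
  from Fubini_spacetime(2,3)[OF i]
  show "(LINT p|MS T. a (fst p) * g p) = (LINT t|MI T. a t * (LINT x|MT. g (t, x)))"
    and "integrable (MI T) (\<lambda>t. a t * (LINT x|MT. g (t, x)))" by simp_all
qed

lemma Cw_L2_inner_slice:
  fixes v :: "real \<Rightarrow> real^2 \<Rightarrow> real^2"
  assumes v: "v \<in> Cw_L2 T" and M: "\<And>t. t \<in> {0..<T} \<Longrightarrow> L2_norm torus (v t) \<le> M"
    and w: "continuous_on UNIV w"
  defines "g \<equiv> \<lambda>p. v (fst p) (snd p) \<bullet> w (snd p)"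
  shows "g \<in> borel_measurable (MS T)" 
    and "\<And>t. t \<in> {0..<T} \<Longrightarrow> integrable MT (\<lambda>x. g (t, x))" 
    and "\<And>t. t \<in> {0..<T} \<Longrightarrow> (LINT x|MT. \<bar>g (t, x)\<bar>) \<le> M * L2_norm torus w"
proof -
  have wL: "w \<in> L2 torus" by (rule L2_bounded_continuous[OF w])
  show "g \<in> borel_measurable (MS T)"
    unfolding g_def 
    by (intro borel_measurable_inner Cw_L2_measurable v measurable_space_spacetime borel_measurable_continuous_onI w)
  fix t assume t: "t \<in> {0..<T}"
  have vL: "v t \<in> L2 torus" by (rule Cw_L2_slice[OF v t])
  show i: "integrable MT (\<lambda>x. g (t, x))" unfolding g_def using L2_inner_integrable[OF vL wL] by simp
  have "(LINT x|MT. \<bar>g (t, x)\<bar>) \<le> (LINT x|MT. norm (v t x) * norm (w x))"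
    using i L2_norm_mult_integrable(1)[OF vL wL] by (intro integral_mono) (auto simp: g_def Cauchy_Schwarz_ineq2)
  also have "\<dots> \<le> L2_norm torus (v t) * L2_norm torus w" by (rule L2_norm_mult_integrable(2)[OF vL wL])
  also have "\<dots> \<le> M * L2_norm torus w" using M[OF t] by (intro mult_right_mono) auto
  finally show "(LINT x|MT. \<bar>g (t, x)\<bar>) \<le> M * L2_norm torus w" .
qed

text \<open>Product tests separate time from space; the spatial pairing is continuous in time and is
  annihilated by all cutoffs in time.\<close>

lemma div_free_slices:
  assumes v: "v \<in> Cw_L2 T" and df: "div_free_spacetime T v" and t: "t \<in> {0..<T}"
  shows "div_free (v t)"
  unfolding div_free_def
proof
  fix \<psi> :: "real^2 \<Rightarrow> real" assume \<psi>: "\<psi> \<in> torus_test"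
  obtain M where M: "\<And>t. t \<in> {0..<T} \<Longrightarrow> L2_norm torus (v t) \<le> M" using Cw_L2_bounded[OF v] by metis
  have gc: "continuous_on UNIV (grad \<psi>)" by (rule continuous_on_grad[OF torus_test_smooth[OF \<psi>]])
  have gL: "grad \<psi> \<in> L2 torus" by (rule grad_L2[OF \<psi>])
  define h where "h s = L2_inner torus (v s) (grad \<psi>)" for s
  have hc: "continuous_on {0..<T} h" unfolding h_def by (rule Cw_L2_inner_continuous[OF v gL])
  have int: "(LINT t|MI T. \<eta> t * h t) = 0" 
    if \<eta>: "smooth \<eta>" "0 < a" "b < T" "\<And>t. t \<notin> {a..b} \<Longrightarrow> \<eta> t = 0" for \<eta> :: "real \<Rightarrow> real" and a b
  proof -
    obtain A where A: "\<And>t. t \<in> {0..<T} \<Longrightarrow> \<bar>\<eta> t\<bar> \<le> A" using continuous_time_bounded[OF smooth_continuous[OF \<eta>(1)]] by metis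
    have \<eta>m: "\<eta> \<in> borel_measurable (MI T)"
      by (intro borel_measurable_lebesgue_on_borel borel_measurable_continuous_onI smooth_continuous \<eta>(1))
    have "(\<lambda>t x. \<eta> t *\<^sub>R \<psi> x) \<in> spacetime_test_interior T"
      by (rule spacetime_test_interior_product[OF \<eta> \<psi>])
    from bspec[OF df[unfolded div_free_spacetime_def] this]
    have "(LINT (t, x)|MS T. v t x \<bullet> grad (\<lambda>x. \<eta> t *\<^sub>R \<psi> x) x) = 0" .
    then have "(LINT p|MS T. \<eta> (fst p) * (v (fst p) (snd p) \<bullet> grad \<psi> (snd p))) = 0"
      by (simp only: grad_scaled[OF torus_test_smooth[OF \<psi>]] inner_scaleR_right case_prod_unfold)
    then show ?thesis
      using spacetime_weighted_integral(2)[OF Cw_L2_inner_slice[OF v M gc] \<eta>m A]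
      by (simp add: h_def L2_inner_def)
  qed
  have zero: "h s = 0" if s: "0 < s" "s < T" for s
  proof -
    have "h s \<le> 0" by (rule time_cutoff_integral_zero[OF hc int s])
    moreover have "- h s \<le> 0"
    proof (rule time_cutoff_integral_zero[of T "\<lambda>s. - h s", OF continuous_on_minus[OF hc] _ s])
      fix \<eta> :: "real \<Rightarrow> real" and a b
      assume "smooth \<eta>" "0 < a" "b < T" "\<And>t. t \<notin> {a..b} \<Longrightarrow> \<eta> t = 0"
      from int[OF this] show "(LINT t|MI T. \<eta> t * - h t) = 0" by simp
    qed
    ultimately show ?thesis by simp
  qed
  \<comment> \<open>Tests supported inside the open interval do not reach time zero; it is treated
    as a null set and recovered by weak continuity.\<close>
  have "AE s in MI T. L2_inner torus (v s) (grad \<psi>) = 0"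
    using AE_lborel_singleton[of "0::real"] zero unfolding h_def
    by (intro AE_lebesgue_onI) (auto elim!: eventually_mono)
  from Cw_L2_inner_eq_of_AE[OF v gL this t]
  show "(LINT x|MT. v t x \<bullet> grad \<psi> x) = 0" by (simp add: L2_inner_def)
qed

section \<open>The scalar flux and the integrated induction equation\<close>

definition crs :: "real^2 \<Rightarrow> real^2 \<Rightarrow> real" where
  "crs v w = v $ 1 * w $ 2 - v $ 2 * w $ 1"

text \<open>The difference of partial derivatives d_2 phi_1 - d_1 phi_2, the negative of the usual
  scalar curl; the sign is the one produced by the Frobenius pairing below.\<close>

definition rot :: "(real^2 \<Rightarrow> real^2) \<Rightarrow> real^2 \<Rightarrow> real" where
  "rot \<phi> x = jacobian \<phi> x $ 1 $ 2 - jacobian \<phi> x $ 2 $ 1"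

text \<open>An antisymmetric 2 x 2 matrix has one free entry. Hence the induction term is a scalar
  flux paired with the curl of the test field, which makes a scalar transport equation
  possible.\<close>

lemma tensor_antisym_inner: "(tensor v w - tensor w v) \<bullet> J = crs v w * (J $ 1 $ 2 - J $ 2 $ 1)"
  by (simp add: inner_vec_def sum_2 tensor_def crs_def algebra_simps)

text \<open>Lagrange's identity in the plane.\<close>

lemma abs_crs_le: "\<bar>crs v w\<bar> \<le> norm v * norm w"
proof -
  have "(crs v w)\<^sup>2 + (v \<bullet> w)\<^sup>2 = (norm v)\<^sup>2 * (norm w)\<^sup>2"
    unfolding norm2_vec2 inner_vec2 crs_def by (simp add: power2_eq_square algebra_simps)
  then have "(crs v w)\<^sup>2 \<le> (norm v * norm w)\<^sup>2"
    unfolding power_mult_distrib using zero_le_power2[of "v \<bullet> w"] by linarith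
  then show ?thesis by (simp add: abs_le_square_iff[symmetric] abs_mult)
qed

lemma crs_measurable [measurable (raw)]:
  "v \<in> borel_measurable M \<Longrightarrow> w \<in> borel_measurable M \<Longrightarrow> (\<lambda>x. crs (v x) (w x)) \<in> borel_measurable M"
  unfolding crs_def by (intro borel_measurable_diff borel_measurable_times borel_measurable_vec_nth)

lemma crs_integrable:
  assumes v: "v \<in> L2 torus" and w: "w \<in> L2 torus"
  shows "integrable MT (\<lambda>x. crs (v x) (w x))" 
    and "(LINT x|MT. \<bar>crs (v x) (w x)\<bar>) \<le> L2_norm torus v * L2_norm torus w"
proof -
  note [measurable] = L2_measurable[OF v] L2_measurable[OF w]
  show i: "integrable MT (\<lambda>x. crs (v x) (w x))"
    by (rule Bochner_Integration.integrable_bound[OF L2_norm_mult_integrable(1)[OF v w]]) (auto simp: abs_crs_le)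
  have "(LINT x|MT. \<bar>crs (v x) (w x)\<bar>) \<le> (LINT x|MT. norm (v x) * norm (w x))"
    using i L2_norm_mult_integrable(1)[OF v w] by (intro integral_mono) (auto simp: abs_crs_le)
  then show "(LINT x|MT. \<bar>crs (v x) (w x)\<bar>) \<le> L2_norm torus v * L2_norm torus w"
    using L2_norm_mult_integrable(2)[OF v w] by linarith
qed

lemma continuous_on_rot: "smooth \<phi> \<Longrightarrow> continuous_on UNIV (rot \<phi>)"
  unfolding rot_def jacobian_def matrix_def
  by (simp only: vec_lambda_beta) (intro continuous_on_diff continuous_on_component smooth_continuous smooth_deriv; simp)

lemma continuous_torus_bounded:
  fixes f :: "real^2 \<Rightarrow> real" assumes "continuous_on UNIV f"
  obtains C where "0 \<le> C" "\<And>x. x \<in> torus \<Longrightarrow> \<bar>f x\<bar> \<le> C"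
proof -
  have "continuous_on torus f" using assms continuous_on_subset by blast
  then have "bounded (f ` torus)" by (intro compact_imp_bounded compact_continuous_image compact_torus)
  then obtain C where "\<forall>t\<in>torus. \<bar>f t\<bar> \<le> C" by (auto simp: bounded_iff)
  then have "\<bar>f t\<bar> \<le> max C 0" if "t \<in> torus" for t
    using that by (auto simp: le_max_iff_disj)
  then show ?thesis using that[of "max C 0"] by simp
qed

lemma Cw_L2_crs_slice:
  fixes b u :: "real \<Rightarrow> real^2 \<Rightarrow> real^2"
  assumes b: "b \<in> Cw_L2 T" and u: "u \<in> Cw_L2 T" 
    and M: "\<And>t. t \<in> {0..<T} \<Longrightarrow> L2_norm torus (b t) \<le> M" "\<And>t. t \<in> {0..<T} \<Longrightarrow> L2_norm torus (u t) \<le> M"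
    and r: "continuous_on UNIV r" "\<And>x. x \<in> torus \<Longrightarrow> \<bar>r x\<bar> \<le> R"
  defines "g \<equiv> \<lambda>p. crs (b (fst p) (snd p)) (u (fst p) (snd p)) * r (snd p)"
  shows "g \<in> borel_measurable (MS T)" 
    and "\<And>t. t \<in> {0..<T} \<Longrightarrow> integrable MT (\<lambda>x. g (t, x))" 
    and "\<And>t. t \<in> {0..<T} \<Longrightarrow> (LINT x|MT. \<bar>g (t, x)\<bar>) \<le> M * M * R"
proof -
  have zt: "0 \<in> torus" by (simp add: mem_torus)
  have R: "0 \<le> R" using r(2)[OF zt] by linarith
  show "g \<in> borel_measurable (MS T)"
    unfolding g_def 
    by (intro borel_measurable_times crs_measurable Cw_L2_measurable b u measurable_space_spacetime borel_measurable_continuous_onI r(1))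
  fix t assume t: "t \<in> {0..<T}"
  have bL: "b t \<in> L2 torus" "u t \<in> L2 torus" using Cw_L2_slice[OF _ t] b u by auto
  note [measurable] = L2_measurable[OF bL(1)] L2_measurable[OF bL(2)]
  have rm [measurable]: "r \<in> borel_measurable MT" by (intro borel_measurable_MT borel_measurable_continuous_onI r(1))
  have ci: "integrable MT (\<lambda>x. R * \<bar>crs (b t x) (u t x)\<bar>)" using crs_integrable(1)[OF bL] by simp
  have le: "\<bar>g (t, x)\<bar> \<le> R * \<bar>crs (b t x) (u t x)\<bar>" if "x \<in> torus" for x
    unfolding g_def using mult_left_mono[OF r(2)[OF that], of "\<bar>crs (b t x) (u t x)\<bar>"] by (simp add: abs_mult mult.commute)
  show i: "integrable MT (\<lambda>x. g (t, x))"
  proof (rule Bochner_Integration.integrable_bound[OF ci])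
    show "(\<lambda>x. g (t, x)) \<in> borel_measurable MT" unfolding g_def by simp
    show "AE x in MT. norm (g (t, x)) \<le> norm (R * \<bar>crs (b t x) (u t x)\<bar>)"
      using le R by (intro AE_I2) (auto simp: abs_mult)
  qed
  have "(LINT x|MT. \<bar>g (t, x)\<bar>) \<le> (LINT x|MT. R * \<bar>crs (b t x) (u t x)\<bar>)"
    using i ci le by (intro integral_mono) auto
  also have "\<dots> = R * (LINT x|MT. \<bar>crs (b t x) (u t x)\<bar>)" by simp
  also have "\<dots> \<le> R * (L2_norm torus (b t) * L2_norm torus (u t))"
    using crs_integrable(2)[OF bL] R by (rule mult_left_mono)
  also have "\<dots> \<le> R * (M * M)"
    using M[OF t] R by (intro mult_left_mono mult_mono) (auto intro: order_trans[OF L2_norm_nonneg])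
  finally show "(LINT x|MT. \<bar>g (t, x)\<bar>) \<le> M * M * R" by (simp add: mult.commute)
qed

text \<open>With a product test the distributional equation is a weak ordinary differential equation
  for the pairing of \<open>b t\<close> with \<open>\<phi>\<close>, and the localisation lemma
  integrates it. The result holds at every time and for each spatial test field.\<close>

lemma weak_induction_integrated:
  fixes b u :: "real \<Rightarrow> real^2 \<Rightarrow> real^2"
  assumes b: "b \<in> Cw_L2 T" and u: "u \<in> Cw_L2 T" 
    and M: "\<And>t. t \<in> {0..<T} \<Longrightarrow> L2_norm torus (b t) \<le> M" "\<And>t. t \<in> {0..<T} \<Longrightarrow> L2_norm torus (u t) \<le> M"
    and b0: "AE x in MT. b 0 x = b0 x" "b0 \<in> L2 torus" and wi: "weak_induction T b u b0"
    and \<phi>: "\<phi> \<in> torus_test" and t: "t \<in> {0..<T}"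
  shows "L2_inner torus (b t) \<phi> = L2_inner torus (b 0) \<phi> + 
     (LINT s|MI T. indicator {0..t} s * (LINT x|MT. crs (b s x) (u s x) * rot \<phi> x))"
proof (rule time_cutoff_integral_eq[OF _ _ _ _ t])
  have \<phi>s: "smooth \<phi>" and \<phi>L: "\<phi> \<in> L2 torus" and \<phi>c: "continuous_on UNIV \<phi>"
    using torus_test_smooth[OF \<phi>] torus_test_L2[OF \<phi>] smooth_continuous by auto
  have T: "0 < T" using t by auto
  show "continuous_on {0..<T} (\<lambda>t. L2_inner torus (b t) \<phi>)" by (rule Cw_L2_inner_continuous[OF b \<phi>L])
  show "\<bar>L2_inner torus (b t) \<phi>\<bar> \<le> M * L2_norm torus \<phi>" if "t \<in> {0..<T}" for t
    by (rule order_trans[OF L2_Cauchy_Schwarz[OF Cw_L2_slice[OF b that] \<phi>L]]) (intro mult_right_mono M that L2_norm_nonneg)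
  obtain R where R: "\<And>x. x \<in> torus \<Longrightarrow> \<bar>rot \<phi> x\<bar> \<le> R" using continuous_torus_bounded[OF continuous_on_rot[OF \<phi>s]] by metis
  note bu = Cw_L2_crs_slice[OF b u M continuous_on_rot[OF \<phi>s] R]
  have "integrable (MI T) (\<lambda>t. 1 * (LINT x|MT. crs (b (fst (t, x)) (snd (t, x))) (u (fst (t, x)) (snd (t, x))) * rot \<phi> (snd (t, x))))"
    by (rule spacetime_weighted_integral(3)[OF bu, where A=1]) auto
  then show "integrable (MI T) (\<lambda>t. LINT x|MT. crs (b t x) (u t x) * rot \<phi> x)" by simp
  fix \<eta> :: "real \<Rightarrow> real" and T' assume \<eta>: "smooth \<eta>" "T' < T" "\<And>t. t > T' \<Longrightarrow> \<eta> t = 0"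
  note \<eta>' = smooth_real_deriv[OF \<eta>(1)]
  obtain A where A: "\<And>t. t \<in> {0..<T} \<Longrightarrow> \<bar>\<eta> t\<bar> \<le> A" using continuous_time_bounded[OF smooth_continuous[OF \<eta>(1)]] by metis
  obtain A' where A': "\<And>t. t \<in> {0..<T} \<Longrightarrow> \<bar>deriv \<eta> t\<bar> \<le> A'" using continuous_time_bounded[OF \<eta>'(2)] by metis
  have \<eta>m: "\<eta> \<in> borel_measurable (MI T)" "deriv \<eta> \<in> borel_measurable (MI T)"
    by (intro borel_measurable_lebesgue_on_borel borel_measurable_continuous_onI smooth_continuous \<eta>(1) \<eta>'(2))+
  note I1 = spacetime_weighted_integral[OF Cw_L2_inner_slice[OF b M(1) \<phi>c] \<eta>m(2) A']
  note I2 = spacetime_weighted_integral[OF bu \<eta>m(1) A]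
  have "(\<lambda>t x. \<eta> t *\<^sub>R \<phi> x) \<in> spacetime_test T" by (rule spacetime_test_product[OF \<eta> \<phi>])
  from bspec[OF wi[unfolded weak_induction_def] this]
  have "(LINT (t, x)|MS T. b t x \<bullet> time_deriv (\<lambda>t x. \<eta> t *\<^sub>R \<phi> x) t x +
        (tensor (b t x) (u t x) - tensor (u t x) (b t x)) \<bullet> jacobian (\<lambda>x. \<eta> t *\<^sub>R \<phi> x) x) +
     (LINT x|MT. b0 x \<bullet> (\<eta> 0 *\<^sub>R \<phi> x)) = 0" .
  also have "(LINT (t, x)|MS T. b t x \<bullet> time_deriv (\<lambda>t x. \<eta> t *\<^sub>R \<phi> x) t x +
        (tensor (b t x) (u t x) - tensor (u t x) (b t x)) \<bullet> jacobian (\<lambda>x. \<eta> t *\<^sub>R \<phi> x) x) =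
      (LINT p|MS T. deriv \<eta> (fst p) * (b (fst p) (snd p) \<bullet> \<phi> (snd p)) + 
         \<eta> (fst p) * (crs (b (fst p) (snd p)) (u (fst p) (snd p)) * rot \<phi> (snd p)))"
    by (simp only: time_deriv_product[OF \<eta>(1)] jacobian_scaled[OF \<phi>s] inner_scaleR_right tensor_antisym_inner 
        case_prod_unfold rot_def mult.assoc)
  also have "\<dots> = (LINT t|MI T. deriv \<eta> t * (LINT x|MT. b t x \<bullet> \<phi> x)) + (LINT t|MI T. \<eta> t * (LINT x|MT. crs (b t x) (u t x) * rot \<phi> x))"
    using I1(1,2) I2(1,2) by simp
  also have "\<dots> = (LINT t|MI T. deriv \<eta> t * L2_inner torus (b t) \<phi> + \<eta> t * (LINT x|MT. crs (b t x) (u t x) * rot \<phi> x))"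
    using I1(3) I2(3) by (simp add: L2_inner_def)
  also have "(LINT x|MT. b0 x \<bullet> (\<eta> 0 *\<^sub>R \<phi> x)) = \<eta> 0 * L2_inner torus (b 0) \<phi>"
  proof -
    have b00: "b 0 \<in> L2 torus" using Cw_L2_slice[OF b] T by simp
    note [measurable] = L2_measurable[OF b0(2)] L2_measurable[OF \<phi>L] L2_measurable[OF b00]
    have "(LINT x|MT. b0 x \<bullet> \<phi> x) = (LINT x|MT. b 0 x \<bullet> \<phi> x)"
      using b0(1) by (intro integral_cong_AE) (auto elim: eventually_mono)
    then show ?thesis by (simp add: L2_inner_def)
  qed
  finally show "(LINT t|MI T. deriv \<eta> t * L2_inner torus (b t) \<phi> + \<eta> t * (LINT x|MT. crs (b t x) (u t x) * rot \<phi> x)) + 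
     \<eta> 0 * L2_inner torus (b 0) \<phi> = 0" .
qed

subsection \<open>The stream function of a divergence-free field\<close>

text \<open>Applying the rotated gradient (d_2, -d_1) to \<open>chr k\<close> multiplies it by
  \<open>\<i>\<close> times this vector.\<close>

definition freqp :: "int \<times> int \<Rightarrow> real^2" where
  "freqp k = vector [freq k $ 2, - freq k $ 1]"

lemma freqp_nth [simp]: "freqp k $ 1 = freq k $ 2" "freqp k $ 2 = - freq k $ 1"
  by (simp_all add: freqp_def)

text \<open>The Fourier coefficients of the stream function: the two equations (d_2 Psi, -d_1 Psi) =
  v contracted with \<open>freqp k\<close> and divided by its squared length. The value 0 at
  \<open>k = 0\<close> encodes mean zero.\<close>

definition sc :: "(real^2 \<Rightarrow> real^2) \<Rightarrow> int \<times> int \<Rightarrow> complex" where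
  "sc v k = (if k = 0 then 0 else 
     (of_real (freq k $ 2) * fc (\<lambda>x. v x $ 1) k - of_real (freq k $ 1) * fc (\<lambda>x. v x $ 2) k) / (\<i> * of_real ((norm (freq k))\<^sup>2)))"

text \<open>Divergence-free and mean-zero, stated on the Fourier side, where both conditions pass to
  the limit coefficient by coefficient.\<close>

definition solenoidal :: "(real^2 \<Rightarrow> real^2) \<Rightarrow> bool" where
  "solenoidal v \<longleftrightarrow> v \<in> L2 torus \<and> (\<forall>k. of_real (freq k $ 1) * fc (\<lambda>x. v x $ 1) k + of_real (freq k $ 2) * fc (\<lambda>x. v x $ 2) k = 0)
     \<and> fc (\<lambda>x. v x $ 1) 0 = 0 \<and> fc (\<lambda>x. v x $ 2) 0 = 0"

lemma has_derivative_trig: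
  "((\<lambda>x. cos (freq k \<bullet> x + c)) has_derivative (\<lambda>h. - sin (freq k \<bullet> x + c) * (freq k \<bullet> h))) (at x)"
  "((\<lambda>x. sin (freq k \<bullet> x + c)) has_derivative (\<lambda>h. cos (freq k \<bullet> x + c) * (freq k \<bullet> h))) (at x)"
  by (auto intro!: derivative_eq_intros)

lemma grad_eqI:
  assumes "(\<psi> has_derivative (\<lambda>h. w \<bullet> h)) (at x)" shows "grad \<psi> x = w"
  unfolding grad_def frechet_derivative_at[OF assms, symmetric] by (simp add: vec_eq_iff inner_axis)

lemma grad_trig:
  "grad (\<lambda>x. cos (freq k \<bullet> x + c)) x = (- sin (freq k \<bullet> x + c)) *\<^sub>R freq k"
  "grad (\<lambda>x. sin (freq k \<bullet> x + c)) x = cos (freq k \<bullet> x + c) *\<^sub>R freq k"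
  using has_derivative_trig[of k c x] by (auto intro!: grad_eqI)

lemma fc_eqI_real:
  assumes "integrable MT f" "integrable MT g"
    "(LINT x|MT. f x * cos (freq k \<bullet> x)) = (LINT x|MT. g x * cos (freq k \<bullet> x))"
    "(LINT x|MT. f x * sin (freq k \<bullet> x)) = (LINT x|MT. g x * sin (freq k \<bullet> x))"
  shows "fc f k = fc g k"
  using fc_trig_parts[OF assms(1)] fc_trig_parts[OF assms(2)] assms(3,4) by (simp add: complex_eq_iff)

text \<open>Test functions are real, so the complex identity is obtained from cosine and sine tests
  separately.\<close>

lemma solenoidalI:
  assumes v: "v \<in> L2 torus" and df: "div_free v" and mz: "\<And>i. (LINT x|MT. v x $ i) = 0"
  shows "solenoidal v"
proof -
  have vi: "integrable MT (\<lambda>x. v x $ i)" for i by (rule L2_imp_integrable[OF L2_component[OF v]])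
  have "of_real (freq k $ 1) * fc (\<lambda>x. v x $ 1) k + of_real (freq k $ 2) * fc (\<lambda>x. v x $ 2) k = 0" for k
  proof -
    let ?d = "\<lambda>x. freq k $ 1 * v x $ 1 + freq k $ 2 * v x $ 2"
    have d: "integrable MT ?d" using vi by simp
    have deq: "?d x = v x \<bullet> freq k" for x by (simp only: inner_vec2 mult.commute)
    have eq: "of_real (freq k $ 1) * fc (\<lambda>x. v x $ 1) k + of_real (freq k $ 2) * fc (\<lambda>x. v x $ 2) k = fc ?d k"
      using vi by (subst fc_add) (auto simp: fc_scale)
    have "fc ?d k = fc (\<lambda>_. 0) k"
    proof (rule fc_eqI_real[OF d])
      have "(LINT x|MT. v x \<bullet> grad (\<lambda>x. cos (freq k \<bullet> x + 0)) x) = 0"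
        using df torus_test_trig(1) unfolding div_free_def by blast
      then have "(LINT x|MT. - (?d x * sin (freq k \<bullet> x))) = 0"
        unfolding deq by (simp add: grad_trig(1)[of k 0, simplified] mult.commute del: Bochner_Integration.integral_minus)
      then show "(LINT x|MT. ?d x * sin (freq k \<bullet> x)) = (LINT x|MT. 0 * sin (freq k \<bullet> x))"
        by (simp only: Bochner_Integration.integral_minus) simp
      have "(LINT x|MT. v x \<bullet> grad (\<lambda>x. sin (freq k \<bullet> x + 0)) x) = 0"
        using df torus_test_trig(2) unfolding div_free_def by blast
      then show "(LINT x|MT. ?d x * cos (freq k \<bullet> x)) = (LINT x|MT. 0 * cos (freq k \<bullet> x))"
        unfolding deq by (simp add: grad_trig(2)[of k 0, simplified] mult.commute)
    qed simp
    then show ?thesis unfolding eq by (simp add: fc_def)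
  qed
  moreover have "fc (\<lambda>x. v x $ i) 0 = 0" for i
    using mz[of i] by (simp add: fc_def)
  ultimately show ?thesis using v by (simp add: solenoidal_def)
qed

lemma norm_freq_pos: "k \<noteq> 0 \<Longrightarrow> 0 < (norm (freq k))\<^sup>2"
  by simp

lemma norm_freq_sq: "(norm (freq k))\<^sup>2 = (freq k $ 1)\<^sup>2 + (freq k $ 2)\<^sup>2"
  by (rule norm2_vec2)

text \<open>Two equations for one unknown coefficient; the divergence condition is what makes them
  consistent.\<close>

lemma sc_gradient:
  assumes "solenoidal v"
  shows "\<i> * of_real (freq k $ 2) * sc v k = fc (\<lambda>x. v x $ 1) k"
    and "\<i> * of_real (freq k $ 1) * sc v k = - fc (\<lambda>x. v x $ 2) k"
proof -
  let ?a = "complex_of_real (freq k $ 1)" and ?b = "complex_of_real (freq k $ 2)"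
  let ?f = "fc (\<lambda>x. v x $ 1) k" and ?g = "fc (\<lambda>x. v x $ 2) k"
  have df: "?a * ?f + ?b * ?g = 0" using assms unfolding solenoidal_def by blast
  have 0: "k = 0 \<Longrightarrow> ?f = 0 \<and> ?g = 0" using assms unfolding solenoidal_def by blast
  have "\<i> * ?b * sc v k = ?f \<and> \<i> * ?a * sc v k = - ?g"
  proof (cases "k = 0")
    case True then show ?thesis using 0 by (simp add: sc_def)
  next
    case False
    define n where "n = complex_of_real ((norm (freq k))\<^sup>2)"
    have n: "n = ?a\<^sup>2 + ?b\<^sup>2" by (simp add: n_def norm_freq_sq)
    have n0: "n \<noteq> 0" using False by (simp add: n_def)
    have s: "\<i> * sc v k = (?b * ?f - ?a * ?g) / n" using False n0 unfolding sc_def n_def[symmetric] by simp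
    \<comment> \<open>Splits off the multiple of the divergence \<open>?a * ?f + ?b * ?g\<close>,
      which is zero.\<close>
    have "?b * (?b * ?f - ?a * ?g) = n * ?f - ?a * (?a * ?f + ?b * ?g)" unfolding n by (simp add: algebra_simps power2_eq_square)
    then have 1: "?b * (?b * ?f - ?a * ?g) = n * ?f" using df by simp
    have "?a * (?b * ?f - ?a * ?g) = - (n * ?g) + ?b * (?a * ?f + ?b * ?g)" unfolding n by (simp add: algebra_simps power2_eq_square)
    then have 2: "?a * (?b * ?f - ?a * ?g) = - (n * ?g)" using df by simp
    have "\<i> * ?b * sc v k = ?b * (\<i> * sc v k)" by simp
    also have "\<dots> = ?f" unfolding s using 1 n0 by simp
    finally have A: "\<i> * ?b * sc v k = ?f" .
    have "\<i> * ?a * sc v k = ?a * (\<i> * sc v k)" by simp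
    also have "\<dots> = - ?g" unfolding s using 2 n0 by simp
    finally show ?thesis using A by simp
  qed
  then show "\<i> * ?b * sc v k = ?f" "\<i> * ?a * sc v k = - ?g" by auto
qed

text \<open>The potential gains one power of the frequency over the field. This decay controls the
  Fourier tails uniformly.\<close>

lemma sc_norm:
  assumes "solenoidal v"
  shows "(norm (freq k))\<^sup>2 * (norm (sc v k))\<^sup>2 = (norm (fc (\<lambda>x. v x $ 1) k))\<^sup>2 + (norm (fc (\<lambda>x. v x $ 2) k))\<^sup>2"
proof -
  have "norm (fc (\<lambda>x. v x $ 1) k) = \<bar>freq k $ 2\<bar> * norm (sc v k)"
    unfolding sc_gradient(1)[OF assms, symmetric] by (simp add: norm_mult del: freq_nth)
  moreover have "norm (fc (\<lambda>x. v x $ 2) k) = \<bar>freq k $ 1\<bar> * norm (sc v k)"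
    using arg_cong[OF sc_gradient(2)[OF assms, of k], of norm] by (simp add: norm_mult del: freq_nth)
  ultimately show ?thesis by (simp add: norm_freq_sq power_mult_distrib algebra_simps del: freq_nth)
qed

lemma sc_minus: "sc v (- k) = cnj (sc v k)"
  by (simp add: sc_def freq_minus fc_minus minus_divide_left algebra_simps del: freq_nth)

section \<open>The mollified potential and its test fields\<close>

definition psi :: "nat \<Rightarrow> (real^2 \<Rightarrow> real^2) \<Rightarrow> real^2 \<Rightarrow> real" where
  "psi N v x = (\<Sum>k\<in>cube N. fw N k * Re (sc v k * chr k x))"

text \<open>For fixed \<open>x\<close> a field in the variable \<open>y\<close>, built to represent
  evaluation of the mollified potential at \<open>x\<close>. The term \<open>k = 0\<close> is zero
  because \<open>freqp 0\<close> is.\<close>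

definition psi_test :: "nat \<Rightarrow> real^2 \<Rightarrow> real^2 \<Rightarrow> real^2" where
  "psi_test N x y = (\<Sum>k\<in>cube N. sin (freq (- k) \<bullet> y + freq k \<bullet> x) *\<^sub>R (fw N k / (norm (freq k))\<^sup>2) *\<^sub>R freqp k)"

lemma psi_test_torus_test: "psi_test N x \<in> torus_test"
  unfolding psi_test_def[abs_def]
  by (intro torus_test_sum torus_test_scaleR torus_test_trig torus_test_const)

lemma integral_sin_mult:
  assumes "integrable MT f" 
  shows "integrable MT (\<lambda>y. sin (freq (- k) \<bullet> y + freq k \<bullet> x) * f y)"
    and "(LINT y|MT. sin (freq (- k) \<bullet> y + freq k \<bullet> x) * f y) = Im (fc f k * chr k x)"
proof -
  have eq: "sin (freq (- k) \<bullet> y + freq k \<bullet> x) * f y = Im (chr k x * (of_real (f y) * cnj (chr k y)))" for y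
  proof -
    have "chr k x * (of_real (f y) * cnj (chr k y)) = of_real (f y) * cis (freq (- k) \<bullet> y + freq k \<bullet> x)"
      by (simp add: chr_def cis_cnj cis_mult freq_minus algebra_simps)
    then show ?thesis by (simp only: Im_complex_of_real times_complex.sel Re_complex_of_real cis.sel) simp
  qed
  have i: "integrable MT (\<lambda>y. chr k x * (of_real (f y) * cnj (chr k y)))" 
    by (intro integrable_mult_right integrable_mult_chr assms)
  show "integrable MT (\<lambda>y. sin (freq (- k) \<bullet> y + freq k \<bullet> x) * f y)" unfolding eq by (rule integrable_Im[OF i])
  have "(LINT y|MT. sin (freq (- k) \<bullet> y + freq k \<bullet> x) * f y) = Im (LINT y|MT. chr k x * (of_real (f y) * cnj (chr k y)))"
    unfolding eq by (intro integral_Im i)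
  also have "(LINT y|MT. chr k x * (of_real (f y) * cnj (chr k y))) = chr k x * fc f k"
    unfolding fc_def by (rule integral_mult_right_zero)
  finally show "(LINT y|MT. sin (freq (- k) \<bullet> y + freq k \<bullet> x) * f y) = Im (fc f k * chr k x)" by (simp only: mult.commute)
qed

text \<open>Point evaluation of the mollified potential is pairing with a smooth test field, so the
  weak equation can be used separately for each \<open>x\<close>.\<close>

lemma psi_eq_inner:
  assumes v: "v \<in> L2 torus" shows "L2_inner torus v (psi_test N x) = psi N v x"
proof -
  let ?s = "\<lambda>k y. sin (freq (- k) \<bullet> y + freq k \<bullet> x)"
  have vi: "integrable MT (\<lambda>x. v x $ i)" for i by (rule L2_imp_integrable[OF L2_component[OF v]])
  let ?c = "\<lambda>k. fw N k / (norm (freq k))\<^sup>2"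
  have eq: "v y \<bullet> psi_test N x y = (\<Sum>k\<in>cube N. ?c k * (freq k $ 2 * (?s k y * v y $ 1) - freq k $ 1 * (?s k y * v y $ 2)))" for y
    unfolding psi_test_def inner_sum_right inner_scaleR_right
    by (intro sum.cong refl) (simp add: inner_vec2 algebra_simps del: freq_nth)
  have "L2_inner torus v (psi_test N x) = (\<Sum>k\<in>cube N. ?c k * (freq k $ 2 * Im (fc (\<lambda>x. v x $ 1) k * chr k x) - freq k $ 1 * Im (fc (\<lambda>x. v x $ 2) k * chr k x)))"
    unfolding L2_inner_def eq using integral_sin_mult(1)[OF vi]
    by (simp add: Bochner_Integration.integral_sum integral_sin_mult(2)[OF vi] del: freq_nth times_complex.sel)
  also have "\<dots> = psi N v x"
    unfolding psi_def
  proof (intro sum.cong refl)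
    fix k
    show "?c k * (freq k $ 2 * Im (fc (\<lambda>x. v x $ 1) k * chr k x) - freq k $ 1 * Im (fc (\<lambda>x. v x $ 2) k * chr k x)) = fw N k * Re (sc v k * chr k x)"
    proof (cases "k = 0")
      case True then show ?thesis by (simp add: sc_def)
    next
      case False
      define z where "z = of_real (freq k $ 2) * fc (\<lambda>x. v x $ 1) k - of_real (freq k $ 1) * fc (\<lambda>x. v x $ 2) k"
      define n where "n = (norm (freq k))\<^sup>2"
      have "sc v k = z / (\<i> * of_real n)" using False by (simp add: sc_def z_def n_def del: freq_nth)
      moreover have "n \<noteq> 0" using False by (simp add: n_def)
      ultimately have z: "z = sc v k * (\<i> * of_real n)" and "n \<noteq> 0" by simp_all
      then have "sc v k * chr k x = of_real (1 / n) * (- \<i> * (z * chr k x))" by (simp add: field_simps)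
      then have "Re (sc v k * chr k x) = (1 / n) * Im (z * chr k x)" by (simp only: Re_complex_of_real Im_complex_of_real times_complex.sel) simp
      moreover have "Im (z * chr k x) = freq k $ 2 * Im (fc (\<lambda>x. v x $ 1) k * chr k x) - freq k $ 1 * Im (fc (\<lambda>x. v x $ 2) k * chr k x)"
        by (simp add: z_def algebra_simps del: freq_nth)
      ultimately show ?thesis by (simp add: n_def del: freq_nth times_complex.sel)
    qed
  qed
  finally show ?thesis .
qed

text \<open>The squared length produced by the curl cancels the denominators. What remains is minus
  the Fejer kernel without its zero frequency.\<close>

lemma rot_psi_test: "rot (psi_test N x) y = 1 - fejer_kernel N x y"
proof -
  let ?\<theta> = "\<lambda>k y. freq (- k) \<bullet> y + freq k \<bullet> x"
  let ?c = "\<lambda>k. fw N k / (norm (freq k))\<^sup>2"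
  have D: "(psi_test N x has_derivative (\<lambda>h. \<Sum>k\<in>cube N. (cos (?\<theta> k y) * (freq (- k) \<bullet> h)) *\<^sub>R ?c k *\<^sub>R freqp k)) (at y)"
    unfolding psi_test_def[abs_def]
    by (intro has_derivative_sum has_derivative_scaleR_left has_derivative_trig(2))
  have J: "jacobian (psi_test N x) y $ i $ j = (\<Sum>k\<in>cube N. (cos (?\<theta> k y) * (freq (- k) \<bullet> axis j 1)) * (?c k * freqp k $ i))" for i j
    unfolding jacobian_def frechet_derivative_at[OF D, symmetric] by (simp add: matrix_def mult.assoc del: freq_nth)
  have "rot (psi_test N x) y = (\<Sum>k\<in>cube N. cos (?\<theta> k y) * ?c k * (- (norm (freq k))\<^sup>2))"
  proof (unfold rot_def J sum_subtractf[symmetric], intro sum.cong refl)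
    fix k
    have "a * (- p) * (c * p) - a * (- q) * (c * (- q)) = a * c * (- (q\<^sup>2 + p\<^sup>2))" for a p q c :: real
      by (simp add: algebra_simps power2_eq_square)
    from this[of "cos (?\<theta> k y)" "freq k $ 2" "?c k" "freq k $ 1"]
    show "cos (?\<theta> k y) * (freq (- k) \<bullet> axis 2 1) * (?c k * freqp k $ 1) - cos (?\<theta> k y) * (freq (- k) \<bullet> axis 1 1) * (?c k * freqp k $ 2)
      = cos (?\<theta> k y) * ?c k * (- (norm (freq k))\<^sup>2)"
      by (simp only: freq_minus vector_uminus_component inner_minus_left inner_axis inner_real_def mult_1_right freqp_nth norm_freq_sq)
  qed
  \<comment> \<open>The missing term at \<open>k = 0\<close> would have been
    \<open>fw N 0 = 1\<close>; it reappears later as subtraction of the spatial mean of the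
    flux.\<close>
  also have "\<dots> = (\<Sum>k\<in>cube N. (if k = 0 then 1 else 0) - fw N k * cos (freq k \<bullet> (x - y)))"
  proof (intro sum.cong refl)
    fix k
    have "?\<theta> k y = freq k \<bullet> (x - y)" by (simp add: freq_minus inner_diff_right)
    then show "cos (?\<theta> k y) * ?c k * (- (norm (freq k))\<^sup>2) = (if k = 0 then 1 else 0) - fw N k * cos (freq k \<bullet> (x - y))"
      using norm_freq_pos[of k] by (cases "k = 0") auto
  qed
  also have "\<dots> = 1 - fejer_kernel N x y"
    by (simp add: sum_subtractf fejer_kernel_def)
  finally show ?thesis .
qed

lemma Re_chr_mult: "Re (c * chr k x) = Re c * cos (freq k \<bullet> x + 0) - Im c * sin (freq k \<bullet> x + 0)"
  by (simp add: chr_def)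

lemma torus_test_add: "f \<in> torus_test \<Longrightarrow> g \<in> torus_test \<Longrightarrow> (\<lambda>x. f x + g x) \<in> torus_test"
  by (auto simp: torus_test_def periodic_def intro!: smooth_add)

lemma psi_torus_test: "psi N v \<in> torus_test"
proof -
  have "psi N v = (\<lambda>x. \<Sum>k\<in>cube N. fw N k * (Re (sc v k) * cos (freq k \<bullet> x + 0) + (- Im (sc v k)) * sin (freq k \<bullet> x + 0)))"
    unfolding psi_def[abs_def] Re_chr_mult by simp
  moreover have "\<dots> \<in> torus_test"
    by (intro torus_test_sum torus_test_mult torus_test_add torus_test_const torus_test_trig)
  ultimately show ?thesis by simp
qed

lemma grad_psi:
  assumes "solenoidal v"
  shows "grad (psi N v) x $ 1 = - fejer N (\<lambda>x. v x $ 2) x" "grad (psi N v) x $ 2 = fejer N (\<lambda>x. v x $ 1) x"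
    and "(psi N v has_derivative (\<lambda>h. grad (psi N v) x \<bullet> h)) (at x)"
proof -
  have vL: "v \<in> L2 torus" using assms by (simp add: solenoidal_def)
  have vi: "integrable MT (\<lambda>x. v x $ i)" for i by (rule L2_imp_integrable[OF L2_component[OF vL]])
  have D1: "((\<lambda>x. Re (c * chr k x)) has_derivative (\<lambda>h. Re (\<i> * c * chr k x) * (freq k \<bullet> h))) (at x)" for c k
  proof -
    have "((\<lambda>x. Re c * cos (freq k \<bullet> x + 0) - Im c * sin (freq k \<bullet> x + 0)) has_derivative 
       (\<lambda>h. Re c * (- sin (freq k \<bullet> x + 0) * (freq k \<bullet> h)) - Im c * (cos (freq k \<bullet> x + 0) * (freq k \<bullet> h)))) (at x)"
      by (intro has_derivative_diff has_derivative_mult_right has_derivative_trig)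
    then show ?thesis unfolding Re_chr_mult by (rule has_derivative_eq_rhs) (auto simp: chr_def algebra_simps)
  qed
  define w where "w = (\<Sum>k\<in>cube N. (fw N k * Re (\<i> * sc v k * chr k x)) *\<^sub>R freq k)"
  have "(psi N v has_derivative (\<lambda>h. \<Sum>k\<in>cube N. fw N k * (Re (\<i> * sc v k * chr k x) * (freq k \<bullet> h)))) (at x)"
    unfolding psi_def[abs_def] by (intro has_derivative_sum has_derivative_mult_right D1)
  then have D: "(psi N v has_derivative (\<lambda>h. w \<bullet> h)) (at x)"
    by (rule has_derivative_eq_rhs) (simp add: w_def inner_sum_left mult.assoc)
  have g: "grad (psi N v) x = w" by (rule grad_eqI[OF D])
  then show "(psi N v has_derivative (\<lambda>h. grad (psi N v) x \<bullet> h)) (at x)" using D by simp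
  have "w $ 1 = (\<Sum>k\<in>cube N. fw N k * Re ((\<i> * of_real (freq k $ 1) * sc v k) * chr k x))"
    unfolding w_def by (simp add: algebra_simps del: freq_nth)
  also have "\<dots> = - fejer N (\<lambda>x. v x $ 2) x"
    unfolding sc_gradient(2)[OF assms] fejer_eq(1)[OF vi] by (simp add: sum_negf[symmetric] algebra_simps)
  finally show "grad (psi N v) x $ 1 = - fejer N (\<lambda>x. v x $ 2) x" using g by simp
  have "w $ 2 = (\<Sum>k\<in>cube N. fw N k * Re ((\<i> * of_real (freq k $ 2) * sc v k) * chr k x))"
    unfolding w_def by (simp add: algebra_simps del: freq_nth)
  also have "\<dots> = fejer N (\<lambda>x. v x $ 1) x"
    unfolding sc_gradient(1)[OF assms] fejer_eq(1)[OF vi] by simp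
  finally show "grad (psi N v) x $ 2 = fejer N (\<lambda>x. v x $ 1) x" using g by simp
qed

text \<open>Transport of the mollified potential by \<open>u\<close> is the same cross product as
  the flux, with the field replaced by its Fejer mean. The commutator can therefore be estimated
  without derivatives of \<open>u\<close>.\<close>

lemma crs_grad_psi:
  assumes "solenoidal v"
  shows "u \<bullet> grad (psi N v) x = crs (vector [fejer N (\<lambda>x. v x $ 1) x, fejer N (\<lambda>x. v x $ 2) x]) u"
  by (simp add: inner_vec2 crs_def grad_psi(1,2)[OF assms])

subsection \<open>Conservation of the mean-square potential for a single flow\<close>

lemma sin_lipschitz: "\<bar>sin x - sin y\<bar> \<le> \<bar>x - y\<bar>" for x y :: real
proof -
  have "\<bar>sin x - sin y\<bar> = 2 * \<bar>sin ((x - y) / 2)\<bar> * \<bar>cos ((x + y) / 2)\<bar>"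
    unfolding sin_diff_sin by (simp add: abs_mult)
  also have "\<dots> \<le> 2 * \<bar>(x - y) / 2\<bar> * 1"
    by (intro mult_mono abs_sin_x_le_abs_x) auto
  finally show ?thesis by simp
qed

text \<open>Mean value theorem for cosine, then the Lipschitz bound for its derivative.\<close>

lemma abs_cos_taylor: "\<bar>cos A - cos B + sin B * (A - B)\<bar> \<le> (A - B)\<^sup>2" for A B :: real
proof -
  have D: "(cos has_real_derivative - sin x) (at x)" for x :: real
    by (auto intro!: derivative_eq_intros)
  have "\<exists>z. \<bar>z - B\<bar> \<le> \<bar>A - B\<bar> \<and> cos A - cos B = - sin z * (A - B)"
  proof -
    consider "A = B" | "A < B" | "B < A" by linarith
    then show ?thesis
    proof cases
      case 1 then show ?thesis by auto
    next
      case 2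
      obtain z where "A < z" "z < B" "cos B - cos A = (B - A) * - sin z" using MVT2[OF 2, of cos "\<lambda>x. - sin x"] D by blast
      then show ?thesis using 2 by (intro exI[of _ z]) (auto simp: algebra_simps)
    next
      case 3
      obtain z where "B < z" "z < A" "cos A - cos B = (A - B) * - sin z" using MVT2[OF 3, of cos "\<lambda>x. - sin x"] D by blast
      then show ?thesis using 3 by (intro exI[of _ z]) (auto simp: algebra_simps)
    qed
  qed
  then obtain z where z: "\<bar>z - B\<bar> \<le> \<bar>A - B\<bar>" "cos A - cos B = - sin z * (A - B)" by blast
  have "cos A - cos B + sin B * (A - B) = (sin B - sin z) * (A - B)" unfolding z(2) by (simp add: algebra_simps)
  then have "\<bar>cos A - cos B + sin B * (A - B)\<bar> = \<bar>sin B - sin z\<bar> * \<bar>A - B\<bar>" by (simp add: abs_mult)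
  also have "\<dots> \<le> \<bar>A - B\<bar> * \<bar>A - B\<bar>"
    using sin_lipschitz[of B z] z(1) by (intro mult_right_mono) auto
  finally show ?thesis by (simp add: power2_eq_square abs_mult_self_eq)
qed

lemma cos_lipschitz: "\<bar>cos x - cos y\<bar> \<le> \<bar>x - y\<bar>" for x y :: real
  using sin_lipschitz[of "x + pi/2" "y + pi/2"] by (simp add: sin_add)

text \<open>Over \<open>n + 1\<close> equal steps the quadratic errors add up to
  \<open>C * t\<^sup>2 / real (Suc n)\<close>, which vanishes, while the increments of
  \<open>A\<close> telescope. This replaces differentiation in time.\<close>

lemma increment_bound_refine:
  fixes e A :: "real \<Rightarrow> real"
  assumes "\<And>s t. s \<in> {0..<T} \<Longrightarrow> t \<in> {0..<T} \<Longrightarrow> s \<le> t \<Longrightarrow> \<bar>e t - e s\<bar> \<le> A t - A s + C * (t - s)\<^sup>2"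
    and t: "t \<in> {0..<T}"
  shows "\<bar>e t - e 0\<bar> \<le> A t - A 0"
proof -
  have le: "\<bar>e t - e 0\<bar> \<le> A t - A 0 + C * t\<^sup>2 / real (Suc n)" for n
  proof -
    define r where "r i = real i * (t / real (Suc n))" for i
    have r: "r i \<in> {0..<T}" if "i \<le> Suc n" for i
    proof -
      have "r i \<le> real (Suc n) * (t / real (Suc n))" unfolding r_def using that t by (intro mult_right_mono) auto
      also have "\<dots> = t" by simp
      finally show ?thesis using t by (simp add: r_def)
    qed
    have "\<bar>e (r m) - e (r 0)\<bar> \<le> A (r m) - A (r 0) + real m * (C * (t / real (Suc n))\<^sup>2)" if "m \<le> Suc n" for m
      using that
    proof (induction m)
      case (Suc m)
      have 1: "\<bar>e (r (Suc m)) - e (r m)\<bar> \<le> A (r (Suc m)) - A (r m) + C * (r (Suc m) - r m)\<^sup>2"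
      proof (intro assms(1) r)
        show "r m \<le> r (Suc m)" unfolding r_def using t by (intro mult_right_mono) auto
      qed (use Suc.prems in auto)
      have 2: "r (Suc m) - r m = t / real (Suc n)" unfolding r_def by (simp only: of_nat_Suc) (simp add: algebra_simps add_divide_distrib)
      have "\<bar>e (r (Suc m)) - e (r m)\<bar> \<le> A (r (Suc m)) - A (r m) + C * (t / real (Suc n))\<^sup>2"
        using 1 unfolding 2 .
      moreover have "\<bar>e (r m) - e (r 0)\<bar> \<le> A (r m) - A (r 0) + real m * (C * (t / real (Suc n))\<^sup>2)" using Suc by simp
      moreover have "real (Suc m) * (C * (t / real (Suc n))\<^sup>2) = real m * (C * (t / real (Suc n))\<^sup>2) + C * (t / real (Suc n))\<^sup>2"
        by (simp only: of_nat_Suc) (simp add: algebra_simps)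
      ultimately show ?case by linarith
    qed simp
    from this[of "Suc n"] have "\<bar>e (r (Suc n)) - e (r 0)\<bar> \<le> A (r (Suc n)) - A (r 0) + real (Suc n) * (C * (t / real (Suc n))\<^sup>2)" by simp
    moreover have "r (Suc n) = t" "r 0 = 0" by (simp_all add: r_def)
    moreover have "real (Suc n) * (C * (t / real (Suc n))\<^sup>2) = C * t\<^sup>2 / real (Suc n)"
      by (simp add: power2_eq_square)
    ultimately show ?thesis by simp
  qed
  have "(\<lambda>n. A t - A 0 + C * t\<^sup>2 * inverse (real (Suc n))) \<longlonglongrightarrow> A t - A 0 + C * t\<^sup>2 * 0"
    by (intro tendsto_intros LIMSEQ_inverse_real_of_nat)
  then have "\<bar>e t - e 0\<bar> \<le> A t - A 0 + C * t\<^sup>2 * 0"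
    by (rule LIMSEQ_le_const) (use le in \<open>auto simp: divide_inverse\<close>)
  then show ?thesis by simp
qed

section \<open>Evolution of the mollified potential for one flow\<close>

locale flow =
  fixes T M :: real and b u :: "real \<Rightarrow> real^2 \<Rightarrow> real^2"
  assumes b: "b \<in> Cw_L2 T" and u: "u \<in> Cw_L2 T" 
    and bM: "\<And>t. t \<in> {0..<T} \<Longrightarrow> L2_norm torus (b t) \<le> M" and uM: "\<And>t. t \<in> {0..<T} \<Longrightarrow> L2_norm torus (u t) \<le> M"
    and sol: "\<And>t. t \<in> {0..<T} \<Longrightarrow> solenoidal (b t)" and udf: "\<And>t. t \<in> {0..<T} \<Longrightarrow> div_free (u t)"
    and evol: "\<And>\<phi> t. \<phi> \<in> torus_test \<Longrightarrow> t \<in> {0..<T} \<Longrightarrow> L2_inner torus (b t) \<phi> = L2_inner torus (b 0) \<phi> + 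
     (LINT s|MI T. indicator {0..t} s * (LINT x|MT. crs (b s x) (u s x) * rot \<phi> x))"
begin

lemma bL: "t \<in> {0..<T} \<Longrightarrow> b t \<in> L2 torus" by (rule Cw_L2_slice[OF b])
lemma uL: "t \<in> {0..<T} \<Longrightarrow> u t \<in> L2 torus" by (rule Cw_L2_slice[OF u])

definition g where "g t x = crs (b t x) (u t x)"

lemma g_integrable: "t \<in> {0..<T} \<Longrightarrow> integrable MT (g t)"
  unfolding g_def using crs_integrable(1)[OF bL uL] by simp

lemma M0: assumes "t \<in> {0..<T}" shows "0 \<le> M"
  using order_trans[OF L2_norm_nonneg bM[OF assms]] .

lemma g_L1: assumes "t \<in> {0..<T}" shows "(LINT x|MT. \<bar>g t x\<bar>) \<le> M * M"
proof -
  have "(LINT x|MT. \<bar>g t x\<bar>) \<le> L2_norm torus (b t) * L2_norm torus (u t)"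
    unfolding g_def using crs_integrable(2)[OF bL uL] assms by simp
  also have "\<dots> \<le> M * M" using bM[OF assms] uM[OF assms] M0[OF assms] by (intro mult_mono) auto
  finally show ?thesis .
qed

text \<open>Minus the formal time derivative of \<open>psi N (b t) x\<close>. The mean of the flux
  is removed because the potential has mean zero.\<close>

definition \<gamma> where "\<gamma> N t x = fejer N (g t) x - (LINT y|MT. g t y)"

lemma \<gamma>_eq: assumes "t \<in> {0..<T}" shows "(LINT y|MT. g t y * rot (psi_test N x) y) = - \<gamma> N t x"
proof -
  have "(LINT y|MT. g t y * rot (psi_test N x) y) = (LINT y|MT. g t y - fejer_kernel N x y * g t y)"
    by (intro Bochner_Integration.integral_cong) (auto simp: rot_psi_test algebra_simps)
  also have "\<dots> = - \<gamma> N t x"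
    using g_integrable[OF assms] fejer_kernel_mult_integrable[OF g_integrable[OF assms]] by (simp add: \<gamma>_def fejer_def)
  finally show ?thesis .
qed

lemma abs_fejer_kernel_le: "\<bar>fejer_kernel N x y\<bar> \<le> real (card (cube N))"
proof -
  have "\<bar>fejer_kernel N x y\<bar> \<le> (\<Sum>k\<in>cube N. \<bar>fw N k * cos (freq k \<bullet> (x - y))\<bar>)"
    unfolding fejer_kernel_def by (rule sum_abs)
  also have "\<dots> \<le> (\<Sum>k\<in>cube N. 1)"
    using fw_bounds by (intro sum_mono) (simp add: abs_mult mult_le_one)
  finally show ?thesis by simp
qed

text \<open>A crude Lipschitz constant in time. Its growth in \<open>N\<close> is harmless, as it
  only multiplies errors that disappear before \<open>N\<close> tends to infinity.\<close>

definition L where "L N = (real (card (cube N)) + 1) * (M * M)"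

lemma \<gamma>_bound: assumes t: "t \<in> {0..<T}" shows "\<bar>\<gamma> N t x\<bar> \<le> L N"
proof -
  have i: "integrable MT (\<lambda>y. \<bar>g t y\<bar>)" using g_integrable[OF t] by simp
  have "\<bar>fejer N (g t) x\<bar> \<le> (LINT y|MT. real (card (cube N)) * \<bar>g t y\<bar>)"
    unfolding fejer_def
  proof (rule order_trans[OF integral_abs_bound integral_mono])
    show "integrable MT (\<lambda>y. \<bar>fejer_kernel N x y * g t y\<bar>)"
      by (rule integrable_abs[OF fejer_kernel_mult_integrable[OF g_integrable[OF t]]])
    show "integrable MT (\<lambda>y. real (card (cube N)) * \<bar>g t y\<bar>)" using i by simp
    show "\<bar>fejer_kernel N x y * g t y\<bar> \<le> real (card (cube N)) * \<bar>g t y\<bar>" for y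
      unfolding abs_mult by (intro mult_right_mono abs_fejer_kernel_le) auto
  qed
  also have "\<dots> = real (card (cube N)) * (LINT y|MT. \<bar>g t y\<bar>)" by simp
  also have "\<dots> \<le> real (card (cube N)) * (M * M)" using g_L1[OF t] by (intro mult_left_mono) auto
  finally have "\<bar>fejer N (g t) x\<bar> \<le> real (card (cube N)) * (M * M)" .
  moreover have "\<bar>LINT y|MT. g t y\<bar> \<le> M * M" using integral_abs_bound[of MT "g t"] g_L1[OF t] by linarith
  ultimately show ?thesis unfolding \<gamma>_def L_def by (simp add: algebra_simps)
qed

lemma g_weight_integrable:
  assumes "continuous_on UNIV r" shows "integrable (MI T) (\<lambda>t. LINT x|MT. g t x * r x)"
proof -
  obtain R where R: "\<And>x. x \<in> torus \<Longrightarrow> \<bar>r x\<bar> \<le> R" using continuous_torus_bounded[OF assms] by metis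
  have "integrable (MI T) (\<lambda>t. 1 * (LINT x|MT. crs (b (fst (t, x)) (snd (t, x))) (u (fst (t, x)) (snd (t, x))) * r (snd (t, x))))"
    by (rule spacetime_weighted_integral(3)[OF Cw_L2_crs_slice[OF b u bM uM assms R], where A=1]) auto
  then show ?thesis by (simp add: g_def)
qed

lemma \<gamma>_integrable: "integrable (MI T) (\<lambda>t. \<gamma> N t x)"
proof -
  have "integrable (MI T) (\<lambda>t. - (LINT y|MT. g t y * rot (psi_test N x) y))"
    by (intro integrable_minus g_weight_integrable continuous_on_rot torus_test_smooth psi_test_torus_test)
  moreover have "integrable (MI T) (\<lambda>t. - (LINT y|MT. g t y * rot (psi_test N x) y)) \<longleftrightarrow> integrable (MI T) (\<lambda>t. \<gamma> N t x)"
    using \<gamma>_eq by (intro Bochner_Integration.integrable_cong) auto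
  ultimately show ?thesis by blast
qed

lemma indicator_integrable:
  fixes f :: "real \<Rightarrow> real"
  assumes "integrable (MI T) f" shows "integrable (MI T) (\<lambda>r. indicator {s<..t} r * f r)" "integrable (MI T) (\<lambda>r. indicator {s..t} r * f r)"
proof -
  have [measurable]: "f \<in> borel_measurable (MI T)" using assms by simp
  have i: "(\<lambda>r. indicator {s<..t} r :: real) \<in> borel_measurable (MI T)" "(\<lambda>r. indicator {s..t} r :: real) \<in> borel_measurable (MI T)"
    by (intro borel_measurable_lebesgue_on_borel; simp)+
  show "integrable (MI T) (\<lambda>r. indicator {s<..t} r * f r)" "integrable (MI T) (\<lambda>r. indicator {s..t} r * f r)"
    by (rule Bochner_Integration.integrable_bound[OF assms]; use i in \<open>auto simp: indicator_def\<close>)+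
qed

text \<open>The integrated equation tested with \<open>psi_test N x\<close>, subtracted at two
  times.\<close>

lemma psi_increment:
  assumes s: "s \<in> {0..<T}" and t: "t \<in> {0..<T}" and st: "s \<le> t"
  shows "psi N (b t) x - psi N (b s) x = - (LINT r|MI T. indicator {s<..t} r * \<gamma> N r x)"
proof -
  have e: "psi N (b t) x = psi N (b 0) x - (LINT r|MI T. indicator {0..t} r * \<gamma> N r x)" if t: "t \<in> {0..<T}" for t
  proof -
    have 0: "0 \<in> {0..<T}" using t by auto
    have "(LINT s|MI T. indicator {0..t} s * (LINT y|MT. crs (b s y) (u s y) * rot (psi_test N x) y)) = (LINT r|MI T. - (indicator {0..t} r * \<gamma> N r x))"
      using \<gamma>_eq by (intro Bochner_Integration.integral_cong) (auto simp: g_def)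
    then show ?thesis using evol[OF psi_test_torus_test t, of N x] psi_eq_inner[OF bL[OF t]] psi_eq_inner[OF bL[OF 0]] by simp
  qed
  have "(LINT r|MI T. indicator {0..t} r * \<gamma> N r x) - (LINT r|MI T. indicator {0..s} r * \<gamma> N r x)
      = (LINT r|MI T. indicator {0..t} r * \<gamma> N r x - indicator {0..s} r * \<gamma> N r x)"
    using indicator_integrable(2)[OF \<gamma>_integrable] by simp
  also have "\<dots> = (LINT r|MI T. indicator {s<..t} r * \<gamma> N r x)"
    using st by (intro Bochner_Integration.integral_cong) (auto simp: indicator_def)
  finally show ?thesis using e[OF s] e[OF t] by simp
qed

lemma measure_interval: 
  assumes "s \<in> {0..<T}" "t \<in> {0..<T}" "s \<le> t" 
  shows "(LINT r|MI T. indicator {s<..t} r * c) = (t - s) * c" "integrable (MI T) (\<lambda>r. indicator {s<..t} r * c)"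
proof -
  have "integrable lborel (\<lambda>r. indicator {s<..t} r * c)"
    using assms by (intro integrable_mult_left integrable_real_indicator) auto
  then show "integrable (MI T) (\<lambda>r. indicator {s<..t} r * c)"
    using assms by (subst integral_lebesgue_on_borel(2)) (auto simp: indicator_def)
  have "(LINT r|MI T. indicator {s<..t} r * c) = (LINT r|lborel. indicator {s<..t} r * c)"
    using assms by (intro integral_lebesgue_on_borel(1)) (auto simp: indicator_def)
  also have "\<dots> = (t - s) * c" using assms by simp
  finally show "(LINT r|MI T. indicator {s<..t} r * c) = (t - s) * c" .
qed

lemma interval_integral_bound:
  fixes f :: "real \<Rightarrow> real"
  assumes st: "s \<in> {0..<T}" "t \<in> {0..<T}" "s \<le> t" and f: "integrable (MI T) f" 
    and B: "\<And>r. r \<in> {0..<T} \<Longrightarrow> s < r \<Longrightarrow> r \<le> t \<Longrightarrow> \<bar>f r\<bar> \<le> B"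
  shows "\<bar>LINT r|MI T. indicator {s<..t} r * f r\<bar> \<le> (t - s) * B"
proof -
  have "\<bar>LINT r|MI T. indicator {s<..t} r * f r\<bar> \<le> (LINT r|MI T. \<bar>indicator {s<..t} r * f r\<bar>)" by (rule integral_abs_bound)
  also have "\<dots> \<le> (LINT r|MI T. indicator {s<..t} r * B)"
    using indicator_integrable(1)[OF f] measure_interval(2)[OF st] B
    by (intro integral_mono) (auto simp: indicator_def)
  finally show ?thesis unfolding measure_interval(1)[OF st] .
qed

lemma psi_lipschitz:
  assumes s: "s \<in> {0..<T}" and t: "t \<in> {0..<T}" and st: "s \<le> t"
  shows "\<bar>psi N (b t) x - psi N (b s) x\<bar> \<le> (t - s) * L N"
  unfolding psi_increment[OF assms] abs_minus_cancel
  by (rule interval_integral_bound[OF assms \<gamma>_integrable \<gamma>_bound])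

text \<open>Measurability is wanted for \<open>MI T \<Otimes>\<^sub>M MT\<close>, where integrals
  are exchanged later. It holds because \<open>psi\<close> is a finite sum of time-dependent
  coefficients times characters.\<close>

lemma psi_jointly_measurable: "(\<lambda>p. psi N (b (fst p)) (snd p)) \<in> borel_measurable (MI T \<Otimes>\<^sub>M MT)"
proof -
  have fcm: "(\<lambda>t. Re (fc (\<lambda>x. b t x $ i) k)) \<in> borel_measurable (MI T)" "(\<lambda>t. Im (fc (\<lambda>x. b t x $ i) k)) \<in> borel_measurable (MI T)" for i k
  proof -
    have bi: "integrable MT (\<lambda>x. b t x $ i)" if "t \<in> {0..<T}" for t by (rule L2_imp_integrable[OF L2_component[OF bL[OF that]]])
    have w: "(\<lambda>x. w x *\<^sub>R axis i (1::real)) \<in> L2 torus" if "continuous_on UNIV w" for w :: "real^2 \<Rightarrow> real"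
      by (intro L2_bounded_continuous continuous_on_scaleR that continuous_on_const)
    have eq: "L2_inner torus (b t) (\<lambda>x. w x *\<^sub>R axis i 1) = (LINT x|MT. b t x $ i * w x)" for w t
      by (simp add: L2_inner_def inner_axis mult.commute)
    have m: "(\<lambda>t. LINT x|MT. b t x $ i * w x) \<in> borel_measurable (MI T)" if "continuous_on UNIV w" for w
      using Cw_L2_inner_continuous[OF b w[OF that]] unfolding eq by (intro continuous_imp_measurable_on_sets_lebesgue) auto
    show "(\<lambda>t. Re (fc (\<lambda>x. b t x $ i) k)) \<in> borel_measurable (MI T)"
    proof (subst measurable_cong[where g="\<lambda>t. LINT x|MT. b t x $ i * cos (freq k \<bullet> x)"])
      show "(\<lambda>t. LINT x|MT. b t x $ i * cos (freq k \<bullet> x)) \<in> borel_measurable (MI T)"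
        by (intro m continuous_intros)
    qed (use fc_trig_parts(1)[OF bi] in simp)
    have "(\<lambda>t. - (LINT x|MT. b t x $ i * sin (freq k \<bullet> x))) \<in> borel_measurable (MI T)"
      by (intro borel_measurable_uminus m continuous_intros)
    then show "(\<lambda>t. Im (fc (\<lambda>x. b t x $ i) k)) \<in> borel_measurable (MI T)"
      by (subst measurable_cong[where g="\<lambda>t. - (LINT x|MT. b t x $ i * sin (freq k \<bullet> x))"])
        (use fc_trig_parts(2)[OF bi] in simp_all)
  qed
  have "(\<lambda>t. fc (\<lambda>x. b t x $ i) k) \<in> borel_measurable (MI T)" for i k
    using fcm[of i k] by (subst borel_measurable_complex_iff) auto
  then have [measurable]: "(\<lambda>t. sc (b t) k) \<in> borel_measurable (MI T)" for k
    unfolding sc_def by measurable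
  show ?thesis unfolding psi_def by measurable
qed

text \<open>As for \<open>psi\<close>: the Fejer mean of the flux is a finite sum whose coefficients
  are spatial integrals of the flux, measurable in time.\<close>

lemma \<gamma>_jointly_measurable: "(\<lambda>p. \<gamma> N (fst p) (snd p)) \<in> borel_measurable (MI T \<Otimes>\<^sub>M MT)"
proof -
  have m: "(\<lambda>t. LINT x|MT. g t x * w x) \<in> borel_measurable (MI T)" if "continuous_on UNIV w" for w
    using g_weight_integrable[OF that] by simp
  have [measurable]: "(\<lambda>t. LINT x|MT. g t x) \<in> borel_measurable (MI T)" using m[of "\<lambda>_. 1"] by simp
  have [measurable]: "(\<lambda>t. LINT x|MT. g t x * cos (freq k \<bullet> x)) \<in> borel_measurable (MI T)" for k by (intro m continuous_intros)
  have [measurable]: "(\<lambda>t. LINT x|MT. g t x * sin (freq k \<bullet> x)) \<in> borel_measurable (MI T)" for k by (intro m continuous_intros)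
  have "(\<lambda>p. (\<Sum>k\<in>cube N. fw N k * Re (Complex (LINT x|MT. g (fst p) x * cos (freq k \<bullet> x)) (- (LINT x|MT. g (fst p) x * sin (freq k \<bullet> x))) * chr k (snd p)))
     - (LINT x|MT. g (fst p) x)) \<in> borel_measurable (MI T \<Otimes>\<^sub>M MT)"
    unfolding times_complex.sel complex.sel chr_def cis.sel
  proof -
    have [measurable]: "(\<lambda>x. freq k \<bullet> x) \<in> borel_measurable MT" for k
      by (intro borel_measurable_MT borel_measurable_continuous_onI continuous_intros)
    show "(\<lambda>p. (\<Sum>k\<in>cube N. fw N k * ((LINT x|MT. g (fst p) x * cos (freq k \<bullet> x)) * cos (freq k \<bullet> snd p) - 
       - (LINT x|MT. g (fst p) x * sin (freq k \<bullet> x)) * sin (freq k \<bullet> snd p)))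
     - (LINT x|MT. g (fst p) x)) \<in> borel_measurable (MI T \<Otimes>\<^sub>M MT)" by measurable
  qed
  moreover have "\<gamma> N (fst p) (snd p) = (\<Sum>k\<in>cube N. fw N k * Re (Complex (LINT x|MT. g (fst p) x * cos (freq k \<bullet> x)) (- (LINT x|MT. g (fst p) x * sin (freq k \<bullet> x))) * chr k (snd p)))
     - (LINT x|MT. g (fst p) x)" if "p \<in> space (MI T \<Otimes>\<^sub>M MT)" for p
  proof -
    have t: "fst p \<in> {0..<T}" using that by (auto simp: space_pair_measure)
    have "fc (g (fst p)) k = Complex (LINT x|MT. g (fst p) x * cos (freq k \<bullet> x)) (- (LINT x|MT. g (fst p) x * sin (freq k \<bullet> x)))" for k
      using fc_trig_parts[OF g_integrable[OF t]] by (simp add: complex_eq_iff)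
    then show ?thesis unfolding \<gamma>_def fejer_eq(1)[OF g_integrable[OF t]] by simp
  qed
  ultimately show ?thesis by (subst measurable_cong) auto
qed

text \<open>Since \<open>psi\<close> changes at the rate \<open>- \<gamma>\<close>, the formal time
  derivative of \<open>e N d\<close> is \<open>d * q N d\<close>.\<close>

definition q where "q N d t = (LINT x|MT. sin (d * psi N (b t) x) * \<gamma> N t x)"
definition e where "e N d t = (LINT x|MT. cos (d * psi N (b t) x))"

lemma psi_measurable: "psi N v \<in> borel_measurable MT"
  by (intro borel_measurable_MT borel_measurable_continuous_onI smooth_continuous torus_test_smooth psi_torus_test)

lemma \<gamma>_slice_integrable: "t \<in> {0..<T} \<Longrightarrow> integrable MT (\<gamma> N t)"
  unfolding \<gamma>_def by (rule Bochner_Integration.integrable_diff[OF L2_imp_integrable[OF fejer_L2[OF g_integrable]] MT.integrable_const])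

lemma sin_\<gamma>_integrable: 
  assumes "t \<in> {0..<T}" shows "integrable MT (\<lambda>x. sin (d * psi N (b t) x) * \<gamma> N t x)"
proof -
  note [measurable] = psi_measurable
  have [measurable]: "\<gamma> N t \<in> borel_measurable MT" using \<gamma>_slice_integrable[OF assms] by simp
  show ?thesis 
    by (rule Bochner_Integration.integrable_bound[OF \<gamma>_slice_integrable[OF assms, of N]])
      (auto simp: abs_mult intro!: mult_left_le_one_le)
qed

lemma sin_\<gamma>_pair: "integrable (MI T \<Otimes>\<^sub>M MT) (\<lambda>p. sin (d * psi N (b (fst p)) (snd p)) * \<gamma> N (fst p) (snd p))"
proof -
  interpret I: finite_measure "MI T" by (rule finite_measure_MI)
  interpret P: pair_sigma_finite "MI T" MT ..
  interpret P': finite_measure "MI T \<Otimes>\<^sub>M MT" by (rule finite_measure_pair_measure) unfold_locales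
  note [measurable] = psi_jointly_measurable \<gamma>_jointly_measurable
  show ?thesis
  proof (rule P'.integrable_const_bound[of _ "L N"])
    show "AE p in MI T \<Otimes>\<^sub>M MT. norm (sin (d * psi N (b (fst p)) (snd p)) * \<gamma> N (fst p) (snd p)) \<le> L N"
    proof (rule AE_I2)
      fix p assume "p \<in> space (MI T \<Otimes>\<^sub>M MT)"
      then have t: "fst p \<in> {0..<T}" by (auto simp: space_pair_measure)
      have "\<bar>sin (d * psi N (b (fst p)) (snd p)) * \<gamma> N (fst p) (snd p)\<bar> \<le> 1 * L N"
        unfolding abs_mult using \<gamma>_bound[OF t] by (intro mult_mono) auto
      then show "norm (sin (d * psi N (b (fst p)) (snd p)) * \<gamma> N (fst p) (snd p)) \<le> L N" by simp
    qed
  qed measurable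
qed

lemma q_integrable: "integrable (MI T) (q N d)"
proof -
  interpret I: finite_measure "MI T" by (rule finite_measure_MI)
  interpret P: pair_sigma_finite "MI T" MT ..
  show ?thesis unfolding q_def[abs_def] using P.integrable_fst'[OF sin_\<gamma>_pair] by simp
qed

lemma swap_integrals:
  "(LINT x|MT. LINT r|MI T. indicator {s<..t} r * (sin (d * psi N (b r) x) * \<gamma> N r x)) = (LINT r|MI T. indicator {s<..t} r * q N d r)"
  "integrable MT (\<lambda>x. LINT r|MI T. indicator {s<..t} r * (sin (d * psi N (b r) x) * \<gamma> N r x))"
  "x \<in> torus \<Longrightarrow> integrable (MI T) (\<lambda>r. sin (d * psi N (b r) x) * \<gamma> N r x)"
proof -
  interpret I: finite_measure "MI T" by (rule finite_measure_MI)
  interpret P: pair_sigma_finite "MI T" MT ..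
  interpret Q: pair_sigma_finite MT "MI T" ..
  let ?f = "\<lambda>p. indicator {s<..t} (fst p) * (sin (d * psi N (b (fst p)) (snd p)) * \<gamma> N (fst p) (snd p))"
  have [measurable]: "(\<lambda>r. indicator {s<..t} r :: real) \<in> borel_measurable (MI T)"
    by (intro borel_measurable_lebesgue_on_borel) simp
  note [measurable] = psi_jointly_measurable \<gamma>_jointly_measurable
  have i: "integrable (MI T \<Otimes>\<^sub>M MT) ?f"
    by (rule Bochner_Integration.integrable_bound[OF sin_\<gamma>_pair[of d N]]) (measurable, auto simp: indicator_def)
  have "(LINT x|MT. LINT r|MI T. ?f (r, x)) = (LINT r|MI T. LINT x|MT. ?f (r, x))"
    using P.Fubini_integral[of "\<lambda>r x. ?f (r, x)"] i by (simp add: case_prod_unfold)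
  then show "(LINT x|MT. LINT r|MI T. indicator {s<..t} r * (sin (d * psi N (b r) x) * \<gamma> N r x)) = (LINT r|MI T. indicator {s<..t} r * q N d r)"
    by (simp add: q_def)
  show "integrable MT (\<lambda>x. LINT r|MI T. indicator {s<..t} r * (sin (d * psi N (b r) x) * \<gamma> N r x))"
    using P.integrable_snd[of "\<lambda>r x. ?f (r, x)"] i by (simp add: case_prod_unfold)
  assume x: "x \<in> torus"
  have "(\<lambda>r. (r, x)) \<in> MI T \<rightarrow>\<^sub>M MI T \<Otimes>\<^sub>M MT" using x by (intro measurable_Pair) auto
  from measurable_compose[OF this psi_jointly_measurable] measurable_compose[OF this \<gamma>_jointly_measurable]
  have [measurable]: "(\<lambda>r. psi N (b r) x) \<in> borel_measurable (MI T)" "(\<lambda>r. \<gamma> N r x) \<in> borel_measurable (MI T)" by simp_all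
  show "integrable (MI T) (\<lambda>r. sin (d * psi N (b r) x) * \<gamma> N r x)"
    by (rule Bochner_Integration.integrable_bound[OF \<gamma>_integrable[of N x]])
      (auto simp: abs_mult intro!: mult_left_le_one_le)
qed

text \<open>A substitute for the chain rule in time: cosine is expanded to first order at time
  \<open>s\<close>, and the sine is then unfrozen under the time integral.\<close>

lemma e_increment:
  assumes st: "s \<in> {0..<T}" "t \<in> {0..<T}" "s \<le> t" and d: "0 \<le> d"
  shows "\<bar>e N d t - e N d s - d * (LINT r|MI T. indicator {s<..t} r * q N d r)\<bar> \<le> 2 * d\<^sup>2 * (L N)\<^sup>2 * (t - s)\<^sup>2"
proof -
  note [measurable] = psi_measurable
  have ci: "integrable MT (\<lambda>x. cos (d * psi N (b r) x))" for r
    by (rule MT.integrable_const_bound[of _ 1]) auto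
  define R where "R x = (LINT r|MI T. indicator {s<..t} r * (sin (d * psi N (b r) x) * \<gamma> N r x))" for x
  have Ri: "integrable MT R" unfolding R_def by (rule swap_integrals(2))
  have pw: "\<bar>cos (d * psi N (b t) x) - cos (d * psi N (b s) x) - d * R x\<bar> \<le> 2 * d\<^sup>2 * (L N)\<^sup>2 * (t - s)\<^sup>2" if x: "x \<in> torus" for x
  proof -
    let ?A = "d * psi N (b t) x" and ?B = "d * psi N (b s) x"
    have L0: "0 \<le> L N" using order_trans[OF abs_ge_zero \<gamma>_bound[OF st(1)]] .
    have AB: "\<bar>?A - ?B\<bar> \<le> d * ((t - s) * L N)"
    proof -
      have "\<bar>?A - ?B\<bar> = d * \<bar>psi N (b t) x - psi N (b s) x\<bar>" using d by (simp add: right_diff_distrib[symmetric] abs_mult)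
      then show ?thesis using psi_lipschitz[OF st, of N x] d by (simp add: mult_left_mono)
    qed
    then have "(?A - ?B)\<^sup>2 \<le> (d * ((t - s) * L N))\<^sup>2"
      using abs_le_square_iff[of "?A - ?B" "d * ((t - s) * L N)"] by linarith
    \<comment> \<open>The first of two contributions of the same size; together they give the factor
      2 in the claim.\<close>
    then have 1: "\<bar>cos ?A - cos ?B + sin ?B * (?A - ?B)\<bar> \<le> d\<^sup>2 * (L N)\<^sup>2 * (t - s)\<^sup>2"
      using abs_cos_taylor[of ?A ?B] by (simp add: power_mult_distrib mult_ac)
    have si: "integrable (MI T) (\<lambda>r. sin ?B * \<gamma> N r x)" using \<gamma>_integrable by simp
    have sin_int: "integrable (MI T) (\<lambda>r. sin (d * psi N (b r) x) * \<gamma> N r x - sin ?B * \<gamma> N r x)"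
      using swap_integrals(3)[OF x] si by (rule Bochner_Integration.integrable_diff)
    have "sin ?B * (?A - ?B) + d * R x = d * (R x - (LINT r|MI T. indicator {s<..t} r * (sin ?B * \<gamma> N r x)))"
    proof -
      have "(LINT r|MI T. indicator {s<..t} r * (sin ?B * \<gamma> N r x)) = sin ?B * (LINT r|MI T. indicator {s<..t} r * \<gamma> N r x)"
      proof -
        have "(\<lambda>r. indicator {s<..t} r * (sin ?B * \<gamma> N r x)) = (\<lambda>r. sin ?B * (indicator {s<..t} r * \<gamma> N r x))"
          by (intro ext) (rule mult.left_commute)
        then show ?thesis by (simp only: integral_mult_right_zero)
      qed
      moreover have AB': "?A - ?B = d * - (LINT r|MI T. indicator {s<..t} r * \<gamma> N r x)"
        unfolding right_diff_distrib[symmetric] psi_increment[OF st] by simp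
      have "sin ?B * (?A - ?B) = - (d * (sin ?B * (LINT r|MI T. indicator {s<..t} r * \<gamma> N r x)))"
        unfolding AB' by simp
      ultimately show ?thesis by (simp only: right_diff_distrib)
    qed
    also have "R x - (LINT r|MI T. indicator {s<..t} r * (sin ?B * \<gamma> N r x)) = 
        (LINT r|MI T. indicator {s<..t} r * (sin (d * psi N (b r) x) * \<gamma> N r x - sin ?B * \<gamma> N r x))"
      unfolding R_def using indicator_integrable(1)[OF swap_integrals(3)[OF x]] indicator_integrable(1)[OF si]
      by (simp add: right_diff_distrib)
    finally have 2: "\<bar>sin ?B * (?A - ?B) + d * R x\<bar> = d * \<bar>LINT r|MI T. indicator {s<..t} r * (sin (d * psi N (b r) x) * \<gamma> N r x - sin ?B * \<gamma> N r x)\<bar>"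
      using d by (simp add: abs_mult)
    \<comment> \<open>The second contribution, from replacing the sine at the intermediate time
      \<open>r\<close> by its value at \<open>s\<close>; one factor \<open>L N\<close> comes from
      the sine, the other from \<open>\<gamma>\<close>.\<close>
    have 3: "\<bar>LINT r|MI T. indicator {s<..t} r * (sin (d * psi N (b r) x) * \<gamma> N r x - sin ?B * \<gamma> N r x)\<bar> \<le> (t - s) * (d * ((t - s) * L N) * L N)"
    proof (rule interval_integral_bound[OF st sin_int])
      fix r assume r: "r \<in> {0..<T}" "s < r" "r \<le> t"
      have "\<bar>sin (d * psi N (b r) x) * \<gamma> N r x - sin ?B * \<gamma> N r x\<bar> = \<bar>sin (d * psi N (b r) x) - sin ?B\<bar> * \<bar>\<gamma> N r x\<bar>"
        by (simp add: abs_mult left_diff_distrib[symmetric])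
      also have "\<dots> \<le> (d * ((t - s) * L N)) * L N"
      proof (rule mult_mono)
        have "\<bar>sin (d * psi N (b r) x) - sin ?B\<bar> \<le> \<bar>d * psi N (b r) x - ?B\<bar>" by (rule sin_lipschitz)
        also have "\<dots> = d * \<bar>psi N (b r) x - psi N (b s) x\<bar>" using d by (simp add: right_diff_distrib[symmetric] abs_mult)
        also have "\<dots> \<le> d * ((r - s) * L N)" using psi_lipschitz[OF st(1) r(1), of N x] r d by (intro mult_left_mono) auto
        also have "\<dots> \<le> d * ((t - s) * L N)" using r d L0 by (intro mult_left_mono mult_right_mono) auto
        finally show "\<bar>sin (d * psi N (b r) x) - sin ?B\<bar> \<le> d * ((t - s) * L N)" .
      qed (use \<gamma>_bound[OF r(1)] d L0 st in auto)
      finally show "\<bar>sin (d * psi N (b r) x) * \<gamma> N r x - sin ?B * \<gamma> N r x\<bar> \<le> d * ((t - s) * L N) * L N" .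
    qed
    have "\<bar>sin ?B * (?A - ?B) + d * R x\<bar> \<le> d * ((t - s) * (d * ((t - s) * L N) * L N))"
      unfolding 2 using 3 d by (rule mult_left_mono)
    also have "\<dots> = d\<^sup>2 * (L N)\<^sup>2 * (t - s)\<^sup>2" by (simp add: power2_eq_square mult_ac)
    finally show ?thesis using 1 by linarith
  qed
  have "e N d t - e N d s - d * (LINT r|MI T. indicator {s<..t} r * q N d r) = (LINT x|MT. cos (d * psi N (b t) x) - cos (d * psi N (b s) x) - d * R x)"
    unfolding e_def swap_integrals(1)[symmetric] R_def[symmetric] using ci Ri by simp
  also have "\<bar>\<dots>\<bar> \<le> (LINT x|MT. \<bar>cos (d * psi N (b t) x) - cos (d * psi N (b s) x) - d * R x\<bar>)" by (rule integral_abs_bound)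
  also have "\<dots> \<le> (LINT x|MT. 2 * d\<^sup>2 * (L N)\<^sup>2 * (t - s)\<^sup>2)"
    using pw ci Ri by (intro integral_mono) auto
  also have "\<dots> = 2 * d\<^sup>2 * (L N)\<^sup>2 * (t - s)\<^sup>2" using MT.prob_space by simp
  finally show ?thesis .
qed

text \<open>The quadratic errors are removed with \<open>N\<close> and \<open>d\<close> fixed, so
  \<open>L N\<close> drops out of the bound.\<close>

lemma e_change:
  assumes t: "t \<in> {0..<T}" and d: "0 \<le> d"
  shows "\<bar>e N d t - e N d 0\<bar> \<le> d * (LINT r|MI T. \<bar>q N d r\<bar>)"
proof -
  define A where "A t = d * (LINT r|MI T. indicator {0<..t} r * \<bar>q N d r\<bar>)" for t
  have qi: "integrable (MI T) (\<lambda>r. \<bar>q N d r\<bar>)" using q_integrable by simp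
  have "\<bar>e N d t - e N d 0\<bar> \<le> A t - A 0"
  proof (rule increment_bound_refine[OF _ t])
    fix s t assume st: "s \<in> {0..<T}" "t \<in> {0..<T}" "s \<le> t"
    have "A t - A s = d * (LINT r|MI T. indicator {0<..t} r * \<bar>q N d r\<bar> - indicator {0<..s} r * \<bar>q N d r\<bar>)"
      unfolding A_def using indicator_integrable(1)[OF qi] by (simp add: right_diff_distrib)
    also have "\<dots> = d * (LINT r|MI T. indicator {s<..t} r * \<bar>q N d r\<bar>)"
      using st by (intro arg_cong2[where f=times] refl Bochner_Integration.integral_cong) (auto simp: indicator_def)
    finally have A: "A t - A s = d * (LINT r|MI T. indicator {s<..t} r * \<bar>q N d r\<bar>)" .
    have "\<bar>LINT r|MI T. indicator {s<..t} r * q N d r\<bar> \<le> (LINT r|MI T. indicator {s<..t} r * \<bar>q N d r\<bar>)"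
      using integral_abs_bound[of "MI T" "\<lambda>r. indicator {s<..t} r * q N d r"] by (simp add: abs_mult)
    then have "\<bar>d * (LINT r|MI T. indicator {s<..t} r * q N d r)\<bar> \<le> A t - A s"
      unfolding A abs_mult using d by (simp add: mult_left_mono)
    then show "\<bar>e N d t - e N d s\<bar> \<le> A t - A s + 2 * d\<^sup>2 * (L N)\<^sup>2 * (t - s)\<^sup>2"
      using e_increment[OF st d, of N] by linarith
  qed
  also have "A t - A 0 \<le> d * (LINT r|MI T. \<bar>q N d r\<bar>)"
  proof -
    have "(LINT r|MI T. indicator {0<..t} r * \<bar>q N d r\<bar>) \<le> (LINT r|MI T. \<bar>q N d r\<bar>)"
      using indicator_integrable(1)[OF qi] qi by (intro integral_mono) (auto simp: indicator_def)
    then show ?thesis unfolding A_def using d by (simp add: mult_left_mono)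
  qed
  finally show ?thesis .
qed

end

section \<open>The commutator and its limit\<close>

context flow begin

definition Fb where "Fb N t x = (vector [fejer N (\<lambda>x. b t x $ 1) x, fejer N (\<lambda>x. b t x $ 2) x] :: real^2)"

lemma b_component: "t \<in> {0..<T} \<Longrightarrow> (\<lambda>x. b t x $ i) \<in> L2 torus" by (rule L2_component[OF bL])

lemma Fb_L2: assumes "t \<in> {0..<T}" shows "Fb N t \<in> L2 torus"
  by (rule L2_vec2) (simp_all add: Fb_def fejer_L2[OF L2_imp_integrable[OF b_component[OF assms]], unfolded eta_contract_eq])

definition defect where "defect N t = L2_norm torus (\<lambda>x. b t x - Fb N t x)"

lemma defect_tendsto: assumes t: "t \<in> {0..<T}" shows "(\<lambda>N. defect N t) \<longlonglongrightarrow> 0"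
proof -
  have i: "integrable MT (\<lambda>x. (fejer N (\<lambda>x. b t x $ i) x - b t x $ i)\<^sup>2)" for N i
    using L2_integrable_square[OF L2_diff[OF fejer_L2[OF L2_imp_integrable[OF b_component[OF t]]] b_component[OF t]]] by simp
  have "(norm (b t x - Fb N t x))\<^sup>2 = (fejer N (\<lambda>x. b t x $ 1) x - b t x $ 1)\<^sup>2 + (fejer N (\<lambda>x. b t x $ 2) x - b t x $ 2)\<^sup>2" for N x
    by (simp add: norm2_vec2 Fb_def power2_commute)
  then have "defect N t = sqrt ((LINT x|MT. (fejer N (\<lambda>x. b t x $ 1) x - b t x $ 1)\<^sup>2) + (LINT x|MT. (fejer N (\<lambda>x. b t x $ 2) x - b t x $ 2)\<^sup>2))" for N
    unfolding defect_def L2_norm_def using i by simp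
  moreover have "(\<lambda>N. sqrt ((LINT x|MT. (fejer N (\<lambda>x. b t x $ 1) x - b t x $ 1)\<^sup>2) + (LINT x|MT. (fejer N (\<lambda>x. b t x $ 2) x - b t x $ 2)\<^sup>2))) \<longlonglongrightarrow> sqrt (0 + 0)"
    by (intro tendsto_intros fejer_tendsto_L2 b_component t)
  ultimately show ?thesis by simp
qed

text \<open>Both terms are cross products with the same \<open>u\<close>, so their difference
  involves only the Fejer error of \<open>b\<close>, which is small in L^2.\<close>

lemma g_minus_transport:
  assumes t: "t \<in> {0..<T}"
  shows "g t x - u t x \<bullet> grad (psi N (b t)) x = crs (b t x - Fb N t x) (u t x)"
  unfolding crs_grad_psi[OF sol[OF t]] Fb_def[symmetric] g_def by (simp add: crs_def algebra_simps)

lemma defect_L1: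
  assumes t: "t \<in> {0..<T}"
  shows "(LINT x|MT. \<bar>g t x - u t x \<bullet> grad (psi N (b t)) x\<bar>) \<le> defect N t * M"
proof -
  have "(LINT x|MT. \<bar>g t x - u t x \<bullet> grad (psi N (b t)) x\<bar>) \<le> defect N t * L2_norm torus (u t)"
    unfolding g_minus_transport[OF t] defect_def by (rule crs_integrable(2)[OF L2_diff[OF bL[OF t] Fb_L2[OF t]] uL[OF t]])
  also have "\<dots> \<le> defect N t * M" using uM[OF t] by (intro mult_left_mono) (auto simp: defect_def)
  finally show ?thesis .
qed

lemma transport_integrable: "t \<in> {0..<T} \<Longrightarrow> integrable MT (\<lambda>x. u t x \<bullet> grad (psi N (b t)) x)"
  by (intro L2_inner_integrable uL grad_L2 psi_torus_test)

text \<open>The transport term integrates to zero because \<open>u\<close> is divergence-free, so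
  the mean of the flux is controlled by the commutator.\<close>

lemma integral_g_le: assumes t: "t \<in> {0..<T}" shows "\<bar>LINT x|MT. g t x\<bar> \<le> defect N t * M"
proof -
  have "(LINT x|MT. u t x \<bullet> grad (psi N (b t)) x) = 0"
    using udf[OF t] psi_torus_test unfolding div_free_def by blast
  then have "(LINT x|MT. g t x) = (LINT x|MT. g t x - u t x \<bullet> grad (psi N (b t)) x)"
    using g_integrable[OF t] transport_integrable[OF t] by simp
  also have "\<bar>\<dots>\<bar> \<le> (LINT x|MT. \<bar>g t x - u t x \<bullet> grad (psi N (b t)) x\<bar>)" by (rule integral_abs_bound)
  finally show ?thesis using defect_L1[OF t, of N] by linarith
qed

text \<open>The field \<open>u\<close> transports every function of the mollified potential without changing its
  integral; what remains of the time derivative is the mollification error of the flux.\<close>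

lemma sin_transport_zero:
  assumes t: "t \<in> {0..<T}" and d: "0 < d"
  shows "(LINT x|MT. sin (d * psi N (b t) x) * (u t x \<bullet> grad (psi N (b t)) x)) = 0"
proof -
  have G: "grad (\<lambda>x. cos (d * psi N (b t) x)) x = (- d * sin (d * psi N (b t) x)) *\<^sub>R grad (psi N (b t)) x" for x
  proof (rule grad_eqI)
    have "((\<lambda>x. d * psi N (b t) x) has_derivative (\<lambda>h. d * (grad (psi N (b t)) x \<bullet> h))) (at x)"
      by (intro has_derivative_mult_right grad_psi(3) sol t)
    from has_derivative_cos[OF this]
    show "((\<lambda>x. cos (d * psi N (b t) x)) has_derivative (\<bullet>) ((- d * sin (d * psi N (b t) x)) *\<^sub>R grad (psi N (b t)) x)) (at x)"
      by (rule has_derivative_eq_rhs) (auto simp: fun_eq_iff)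
  qed
  have "(\<lambda>x. cos (d * psi N (b t) x)) \<in> torus_test" 
    by (intro torus_test_cos torus_test_mult torus_test_const psi_torus_test)
  then have Z: "(LINT x|MT. u t x \<bullet> grad (\<lambda>x. cos (d * psi N (b t) x)) x) = 0"
    using udf[OF t] unfolding div_free_def by blast
  have "(LINT x|MT. (- d) * (sin (d * psi N (b t) x) * (u t x \<bullet> grad (psi N (b t)) x))) = 0"
    using Z by (simp only: G inner_scaleR_right mult.assoc)
  then have "(- d) * (LINT x|MT. sin (d * psi N (b t) x) * (u t x \<bullet> grad (psi N (b t)) x)) = 0"
    by (simp only: integral_mult_right_zero)
  then show ?thesis using d by simp
qed

text \<open>The vanishing transport integral is subtracted and the sine bounded by 1. The multiple 2
  arises because the defect enters once as commutator and once through the mean of the flux.\<close>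

lemma abs_q_le:
  assumes t: "t \<in> {0..<T}" and d: "0 < d"
  shows "\<bar>q N d t\<bar> \<le> (LINT x|MT. \<bar>fejer N (g t) x - g t x\<bar>) + 2 * (defect N t * M)"
proof -
  note gi = g_integrable[OF t]
  note [measurable] = psi_measurable
  let ?s = "\<lambda>x. sin (d * psi N (b t) x)" and ?w = "\<lambda>x. u t x \<bullet> grad (psi N (b t)) x"
  have wi: "integrable MT ?w" by (rule transport_integrable[OF t])
  have swi: "integrable MT (\<lambda>x. ?s x * ?w x)"
  proof (rule Bochner_Integration.integrable_bound[OF wi])
    have [measurable]: "?w \<in> borel_measurable MT" using wi by simp
    show "(\<lambda>x. ?s x * ?w x) \<in> borel_measurable MT" by measurable
  qed (auto simp: abs_mult intro!: mult_left_le_one_le)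
  have Fi: "integrable MT (\<lambda>x. fejer N (g t) x)" by (rule L2_imp_integrable[OF fejer_L2[OF gi]])
  define I where "I = (LINT x|MT. g t x)"
  have "q N d t = (LINT x|MT. ?s x * \<gamma> N t x - ?s x * ?w x)"
    unfolding q_def using sin_\<gamma>_integrable[OF t] swi sin_transport_zero[OF t d] by simp
  then have "\<bar>q N d t\<bar> \<le> (LINT x|MT. \<bar>?s x * \<gamma> N t x - ?s x * ?w x\<bar>)" by (simp only: integral_abs_bound)
  also have "\<dots> \<le> (LINT x|MT. \<bar>fejer N (g t) x - g t x\<bar> + \<bar>g t x - ?w x\<bar> + \<bar>I\<bar>)"
  proof (rule integral_mono)
    show "integrable MT (\<lambda>x. \<bar>?s x * \<gamma> N t x - ?s x * ?w x\<bar>)" using sin_\<gamma>_integrable[OF t] swi by simp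
    show "integrable MT (\<lambda>x. \<bar>fejer N (g t) x - g t x\<bar> + \<bar>g t x - ?w x\<bar> + \<bar>I\<bar>)" using Fi gi wi by simp
    fix x
    have "\<bar>?s x * \<gamma> N t x - ?s x * ?w x\<bar> = \<bar>?s x\<bar> * \<bar>\<gamma> N t x - ?w x\<bar>" by (simp add: abs_mult right_diff_distrib[symmetric])
    also have "\<dots> \<le> \<bar>\<gamma> N t x - ?w x\<bar>" by (intro mult_left_le_one_le) auto
    also have "\<dots> \<le> \<bar>fejer N (g t) x - g t x\<bar> + \<bar>g t x - ?w x\<bar> + \<bar>I\<bar>" unfolding \<gamma>_def I_def by linarith
    finally show "\<bar>?s x * \<gamma> N t x - ?s x * ?w x\<bar> \<le> \<bar>fejer N (g t) x - g t x\<bar> + \<bar>g t x - ?w x\<bar> + \<bar>I\<bar>" .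
  qed
  also have "\<dots> = (LINT x|MT. \<bar>fejer N (g t) x - g t x\<bar>) + (LINT x|MT. \<bar>g t x - ?w x\<bar>) + \<bar>I\<bar>"
    using Fi gi wi MT.prob_space by simp
  finally show ?thesis using defect_L1[OF t, of N] integral_g_le[OF t, of N] unfolding I_def by linarith
qed

lemma q_tendsto: assumes t: "t \<in> {0..<T}" and d: "0 < d" shows "(\<lambda>N. q N d t) \<longlonglongrightarrow> 0"
proof (rule Lim_null_comparison[OF always_eventually])
  show "\<forall>N. norm (q N d t) \<le> (LINT x|MT. \<bar>fejer N (g t) x - g t x\<bar>) + 2 * (defect N t * M)"
    using abs_q_le[OF assms] by simp
  have "(\<lambda>N. (LINT x|MT. \<bar>fejer N (g t) x - g t x\<bar>) + 2 * (defect N t * M)) \<longlonglongrightarrow> 0 + 2 * (0 * M)"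
    by (intro tendsto_intros fejer_tendsto_L1 g_integrable defect_tendsto t)
  then show "(\<lambda>N. (LINT x|MT. \<bar>fejer N (g t) x - g t x\<bar>) + 2 * (defect N t * M)) \<longlonglongrightarrow> 0" by simp
qed

text \<open>A dominating constant independent of \<open>N\<close>, which rests on the L^1
  contraction of Fejer means; \<open>L N\<close> would not do.\<close>

lemma abs_q_le_uniform: assumes t: "t \<in> {0..<T}" shows "\<bar>q N d t\<bar> \<le> 2 * (M * M)"
proof -
  note gi = g_integrable[OF t]
  have Fi: "integrable MT (\<lambda>x. fejer N (g t) x)" by (rule L2_imp_integrable[OF fejer_L2[OF gi]])
  have "\<bar>q N d t\<bar> \<le> (LINT x|MT. \<bar>sin (d * psi N (b t) x) * \<gamma> N t x\<bar>)" unfolding q_def by (rule integral_abs_bound)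
  also have "\<dots> \<le> (LINT x|MT. \<bar>fejer N (g t) x\<bar> + \<bar>LINT y|MT. g t y\<bar>)"
  proof (rule integral_mono)
    show "integrable MT (\<lambda>x. \<bar>sin (d * psi N (b t) x) * \<gamma> N t x\<bar>)" using sin_\<gamma>_integrable[OF t] by simp
    show "integrable MT (\<lambda>x. \<bar>fejer N (g t) x\<bar> + \<bar>LINT y|MT. g t y\<bar>)" using Fi by simp
    fix x
    have "\<bar>sin (d * psi N (b t) x) * \<gamma> N t x\<bar> \<le> \<bar>\<gamma> N t x\<bar>" unfolding abs_mult by (intro mult_left_le_one_le) auto
    then show "\<bar>sin (d * psi N (b t) x) * \<gamma> N t x\<bar> \<le> \<bar>fejer N (g t) x\<bar> + \<bar>LINT y|MT. g t y\<bar>" unfolding \<gamma>_def by linarith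
  qed
  also have "\<dots> = (LINT x|MT. \<bar>fejer N (g t) x\<bar>) + \<bar>LINT y|MT. g t y\<bar>" using Fi MT.prob_space by simp
  also have "\<dots> \<le> M * M + M * M"
    using fejer_L1_contraction[OF gi, of N] g_L1[OF t] integral_abs_bound[of MT "g t"] by linarith
  finally show ?thesis by simp
qed

text \<open>Convergence at each time is enough, by domination; no rate uniform in time is
  claimed.\<close>

lemma integral_q_tendsto: assumes d: "0 < d" shows "(\<lambda>N. LINT r|MI T. \<bar>q N d r\<bar>) \<longlonglongrightarrow> 0"
proof -
  interpret I: finite_measure "MI T" by (rule finite_measure_MI)
  have "(\<lambda>N. LINT r|MI T. \<bar>q N d r\<bar>) \<longlonglongrightarrow> (LINT r|MI T. 0)"
  proof (rule integral_dominated_convergence[where w="\<lambda>_. 2 * (M * M)"])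
    show "AE r in MI T. (\<lambda>N. \<bar>q N d r\<bar>) \<longlonglongrightarrow> 0" using q_tendsto d by (intro AE_I2 tendsto_rabs_zero) auto
    show "AE r in MI T. norm \<bar>q N d r\<bar> \<le> 2 * (M * M)" for N using abs_q_le_uniform by (intro AE_I2) auto
    show "(\<lambda>r. \<bar>q N d r\<bar>) \<in> borel_measurable (MI T)" for N using q_integrable[of N d] by (intro borel_measurable_abs) auto
  qed auto
  then show ?thesis by simp
qed

text \<open>\<open>psi N (b t)\<close> is the Fejer mean of \<open>\<Psi>\<close>, which converges
  in L^2, and cosine is Lipschitz.\<close>

lemma e_tendsto:
  assumes t: "t \<in> {0..<T}" and d: "0 \<le> d" and \<Psi>: "\<Psi> \<in> L2 torus" "\<And>k. fc \<Psi> k = sc (b t) k"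
  shows "(\<lambda>N. e N d t) \<longlonglongrightarrow> (LINT x|MT. cos (d * \<Psi> x))"
proof -
  note [measurable] = psi_measurable L2_measurable[OF \<Psi>(1)]
  have \<Psi>i: "integrable MT \<Psi>" by (rule L2_imp_integrable[OF \<Psi>(1)])
  have F: "fejer N \<Psi> x = psi N (b t) x" for N x unfolding fejer_eq(1)[OF \<Psi>i] psi_def \<Psi>(2) ..
  have bd: "norm (e N d t - (LINT x|MT. cos (d * \<Psi> x))) \<le> d * L2_norm torus (\<lambda>x. fejer N \<Psi> x - \<Psi> x)" for N
  proof -
    have i: "integrable MT (\<lambda>x. cos (d * psi N (b t) x))" "integrable MT (\<lambda>x. cos (d * \<Psi> x))"
      by (auto intro!: MT.integrable_const_bound[of _ 1])
    have D: "(\<lambda>x. fejer N \<Psi> x - \<Psi> x) \<in> L2 torus" by (intro L2_diff fejer_L2 \<Psi>i \<Psi>(1))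
    have "\<bar>e N d t - (LINT x|MT. cos (d * \<Psi> x))\<bar> = \<bar>LINT x|MT. cos (d * psi N (b t) x) - cos (d * \<Psi> x)\<bar>"
      unfolding e_def using i by simp
    also have "\<dots> \<le> (LINT x|MT. \<bar>cos (d * psi N (b t) x) - cos (d * \<Psi> x)\<bar>)" by (rule integral_abs_bound)
    also have "\<dots> \<le> (LINT x|MT. d * \<bar>fejer N \<Psi> x - \<Psi> x\<bar>)"
    proof (rule integral_mono)
      show "integrable MT (\<lambda>x. d * \<bar>fejer N \<Psi> x - \<Psi> x\<bar>)" using L2_imp_integrable[OF D] by simp
      fix x
      have "\<bar>cos (d * psi N (b t) x) - cos (d * \<Psi> x)\<bar> \<le> \<bar>d * psi N (b t) x - d * \<Psi> x\<bar>" by (rule cos_lipschitz)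
      also have "\<dots> = d * \<bar>fejer N \<Psi> x - \<Psi> x\<bar>" using d by (simp add: F right_diff_distrib[symmetric] abs_mult)
      finally show "\<bar>cos (d * psi N (b t) x) - cos (d * \<Psi> x)\<bar> \<le> d * \<bar>fejer N \<Psi> x - \<Psi> x\<bar>" .
    qed (use i in simp)
    also have "\<dots> \<le> d * L2_norm torus (\<lambda>x. fejer N \<Psi> x - \<Psi> x)"
      using integral_abs_le_L2_norm[OF D] d by (simp add: mult_left_mono)
    finally show ?thesis by simp
  qed
  have "(\<lambda>N. d * L2_norm torus (\<lambda>x. fejer N \<Psi> x - \<Psi> x)) \<longlonglongrightarrow> d * 0"
    by (intro tendsto_intros fejer_tendsto_L2_norm \<Psi>(1))
  then have l0: "(\<lambda>N. d * L2_norm torus (\<lambda>x. fejer N \<Psi> x - \<Psi> x)) \<longlonglongrightarrow> 0" by simp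
  have "(\<lambda>N. e N d t - (LINT x|MT. cos (d * \<Psi> x))) \<longlonglongrightarrow> 0"
    by (rule Lim_null_comparison[OF always_eventually l0]) (use bd in blast)
  then show ?thesis by (simp add: LIM_zero_iff)
qed

text \<open>\<open>N\<close> tends to infinity with \<open>d\<close> fixed: the endpoint values
  converge and the bound on their difference tends to zero.\<close>

lemma cos_conserved:
  assumes t: "t \<in> {0..<T}" and d: "0 < d" 
    and \<Psi>: "\<Psi> \<in> L2 torus" "\<And>k. fc \<Psi> k = sc (b t) k" and \<Psi>0: "\<Psi>0 \<in> L2 torus" "\<And>k. fc \<Psi>0 k = sc (b 0) k"
  shows "(LINT x|MT. cos (d * \<Psi> x)) = (LINT x|MT. cos (d * \<Psi>0 x))"
proof -
  have 0: "0 \<in> {0..<T}" using t by auto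
  have d0: "0 \<le> d" using d by simp
  have lim: "(\<lambda>N. e N d t - e N d 0) \<longlonglongrightarrow> (LINT x|MT. cos (d * \<Psi> x)) - (LINT x|MT. cos (d * \<Psi>0 x))"
    by (rule tendsto_diff[OF e_tendsto[OF t d0 \<Psi>] e_tendsto[OF 0 d0 \<Psi>0]])
  have "(\<lambda>N. e N d t - e N d 0) \<longlonglongrightarrow> 0"
  proof (rule Lim_null_comparison[OF always_eventually])
    show "\<forall>N. norm (e N d t - e N d 0) \<le> d * (LINT r|MI T. \<bar>q N d r\<bar>)" using e_change[OF t d0] by simp
    show "(\<lambda>N. d * (LINT r|MI T. \<bar>q N d r\<bar>)) \<longlonglongrightarrow> 0"
      using tendsto_mult[OF tendsto_const integral_q_tendsto[OF d], of d] by simp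
  qed
  from LIMSEQ_unique[OF lim this] show ?thesis by simp
qed

end

section \<open>From cosines back to squares\<close>

lemma one_minus_cos_scaled:
  fixes y d :: real assumes d: "0 < d"
  shows "0 \<le> 2 * (1 - cos (d * y)) / d\<^sup>2" "2 * (1 - cos (d * y)) / d\<^sup>2 \<le> y\<^sup>2"
proof -
  \<comment> \<open>The half-angle formula displays the quotient as a square; sign and upper bound
    then follow from the bound of sine by its argument.\<close>
  have eq: "2 * (1 - cos (d * y)) / d\<^sup>2 = (2 * sin (d * y / 2) / d)\<^sup>2"
    using cos_double_sin[of "d * y / 2"] by (simp add: power_divide power_mult_distrib)
  show "0 \<le> 2 * (1 - cos (d * y)) / d\<^sup>2" unfolding eq by simp
  have "\<bar>2 * sin (d * y / 2) / d\<bar> \<le> 2 * \<bar>d * y / 2\<bar> / d"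
  proof -
    have "\<bar>2 * sin (d * y / 2) / d\<bar> = 2 * \<bar>sin (d * y / 2)\<bar> / d" using d by (simp add: abs_mult)
    also have "\<dots> \<le> 2 * \<bar>d * y / 2\<bar> / d"
      using d abs_sin_x_le_abs_x[of "d * y / 2"] by (intro divide_right_mono mult_left_mono) auto
    finally show ?thesis .
  qed
  also have "\<dots> = \<bar>y\<bar>" using d by (simp add: abs_mult)
  finally show "2 * (1 - cos (d * y)) / d\<^sup>2 \<le> y\<^sup>2" unfolding eq by (simp only: abs_le_square_iff)
qed

lemma one_minus_cos_tendsto:
  fixes y :: real
  shows "(\<lambda>n. 2 * (1 - cos (inverse (real (Suc n)) * y)) / (inverse (real (Suc n)))\<^sup>2) \<longlonglongrightarrow> y\<^sup>2"
proof -
  have eq: "2 * (1 - cos (d * y)) / d\<^sup>2 = (2 * sin (d * y / 2) / d)\<^sup>2" for d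
    using cos_double_sin[of "d * y / 2"] by (simp add: power_divide power_mult_distrib)
  have "((\<lambda>d. 2 * sin (d * y / 2)) has_real_derivative y) (at 0)"
    by (auto intro!: derivative_eq_intros)
  then have "((\<lambda>d. 2 * sin (d * y / 2) / d) \<longlongrightarrow> y) (at 0)" by (simp add: DERIV_def)
  moreover have "filterlim (\<lambda>n. inverse (real (Suc n))) (at 0) sequentially"
    using LIMSEQ_inverse_real_of_nat by (auto simp: filterlim_at)
  ultimately have "(\<lambda>n. 2 * sin (inverse (real (Suc n)) * y / 2) / inverse (real (Suc n))) \<longlonglongrightarrow> y"
    by (rule filterlim_compose)
  then show ?thesis unfolding eq by (rule tendsto_power)
qed

text \<open>The square itself dominates the quotients for every \<open>d\<close>, so no
  integrability beyond L^2 is required.\<close>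

lemma square_integral_from_cos:
  assumes "\<Psi> \<in> L2 torus"
  shows "(\<lambda>n. 2 * (1 - (LINT x|MT. cos (inverse (real (Suc n)) * \<Psi> x))) / (inverse (real (Suc n)))\<^sup>2) \<longlonglongrightarrow> (LINT x|MT. (\<Psi> x)\<^sup>2)"
proof -
  note [measurable] = L2_measurable[OF assms]
  have i: "integrable MT (\<lambda>x. cos (d * \<Psi> x))" for d by (auto intro!: MT.integrable_const_bound[of _ 1])
  have eq: "2 * (1 - (LINT x|MT. cos (d * \<Psi> x))) / d\<^sup>2 = (LINT x|MT. 2 * (1 - cos (d * \<Psi> x)) / d\<^sup>2)" for d
    using i[of d] MT.prob_space by simp
  show ?thesis unfolding eq
  proof (rule integral_dominated_convergence[where w="\<lambda>x. (\<Psi> x)\<^sup>2"])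
    show "integrable MT (\<lambda>x. (\<Psi> x)\<^sup>2)" using L2_integrable_square[OF assms] by simp
    show "AE x in MT. (\<lambda>n. 2 * (1 - cos (inverse (real (Suc n)) * \<Psi> x)) / (inverse (real (Suc n)))\<^sup>2) \<longlonglongrightarrow> (\<Psi> x)\<^sup>2"
      by (intro AE_I2 one_minus_cos_tendsto)
    show "AE x in MT. norm (2 * (1 - cos (inverse (real (Suc n)) * \<Psi> x)) / (inverse (real (Suc n)))\<^sup>2) \<le> (\<Psi> x)\<^sup>2" for n
    proof (rule AE_I2)
      fix x
      have d: "0 < inverse (real (Suc n))" by simp
      show "norm (2 * (1 - cos (inverse (real (Suc n)) * \<Psi> x)) / (inverse (real (Suc n)))\<^sup>2) \<le> (\<Psi> x)\<^sup>2"
        using one_minus_cos_scaled[OF d, of "\<Psi> x"] by (simp only: real_norm_def abs_of_nonneg)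
    qed
  qed measurable
qed

lemma (in flow) potential_conserved:
  assumes t: "t \<in> {0..<T}" 
    and \<Psi>: "\<Psi> \<in> L2 torus" "\<And>k. fc \<Psi> k = sc (b t) k" and \<Psi>0: "\<Psi>0 \<in> L2 torus" "\<And>k. fc \<Psi>0 k = sc (b 0) k"
  shows "(LINT x|MT. (\<Psi> x)\<^sup>2) = (LINT x|MT. (\<Psi>0 x)\<^sup>2)"
proof -
  have "(LINT x|MT. cos (inverse (real (Suc n)) * \<Psi> x)) = (LINT x|MT. cos (inverse (real (Suc n)) * \<Psi>0 x))" for n
    by (rule cos_conserved[OF t _ \<Psi> \<Psi>0]) simp
  then show ?thesis
    using square_integral_from_cos[OF \<Psi>(1)] square_integral_from_cos[OF \<Psi>0(1)] LIMSEQ_unique by simp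
qed

subsection \<open>Stream functions of single fields\<close>

lemma solenoidal_L2: "solenoidal v \<Longrightarrow> v \<in> L2 torus"
  by (simp add: solenoidal_def)

lemma Bessel_vec2:
  fixes v :: "real^2 \<Rightarrow> real^2"
  assumes v: "v \<in> L2 torus" and F: "finite F"
  shows "(\<Sum>k\<in>F. (norm (fc (\<lambda>x. v x $ 1) k))\<^sup>2 + (norm (fc (\<lambda>x. v x $ 2) k))\<^sup>2) \<le> (L2_norm torus v)\<^sup>2"
proof -
  have i: "integrable MT (\<lambda>x. (v x $ i)\<^sup>2)" for i using L2_integrable_square[OF L2_component[OF v]] by simp
  have "(L2_norm torus v)\<^sup>2 = (LINT x|MT. (v x $ 1)\<^sup>2) + (LINT x|MT. (v x $ 2)\<^sup>2)"
    unfolding L2_norm_power2 norm2_vec2 using i by simp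
  then show ?thesis using Bessel[OF L2_component[OF v, of 1] F] Bessel[OF L2_component[OF v, of 2] F] by (simp add: sum.distrib)
qed

text \<open>Outside the cube one integer coordinate has modulus at least \<open>n + 1\<close>, hence
  so does the frequency; the factor \<open>2 * pi\<close> is discarded. Bessel's inequality for the
  field does the rest.\<close>

lemma sc_tail:
  assumes v: "solenoidal v" and F: "finite F" "F \<inter> cube n = {}"
  shows "(\<Sum>k\<in>F. (norm (sc v k))\<^sup>2) \<le> (L2_norm torus v)\<^sup>2 / (real n + 1)\<^sup>2"
proof -
  have "(real n + 1)\<^sup>2 * (norm (sc v k))\<^sup>2 \<le> (norm (fc (\<lambda>x. v x $ 1) k))\<^sup>2 + (norm (fc (\<lambda>x. v x $ 2) k))\<^sup>2" if "k \<in> F" for k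
  proof -
    have "k \<notin> cube n" using that F by auto
    then have "int n < \<bar>fst k\<bar> \<or> int n < \<bar>snd k\<bar>" by (cases k) (auto simp: cube_def)
    then have "real n + 1 \<le> \<bar>real_of_int (fst k)\<bar> \<or> real n + 1 \<le> \<bar>real_of_int (snd k)\<bar>"
      by linarith
    moreover have "1 * y \<le> 2 * pi * y" if "0 \<le> y" for y :: real
      using pi_ge_two that by (intro mult_right_mono) auto
    from this[of "\<bar>real_of_int (fst k)\<bar>"] this[of "\<bar>real_of_int (snd k)\<bar>"]
    have "\<bar>real_of_int (fst k)\<bar> \<le> \<bar>freq k $ 1\<bar>" "\<bar>real_of_int (snd k)\<bar> \<le> \<bar>freq k $ 2\<bar>" by (simp_all add: abs_mult)
    ultimately have "real n + 1 \<le> norm (freq k)"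
      using component_le_norm_cart[of "freq k" 1] component_le_norm_cart[of "freq k" 2] by linarith
    then have "(real n + 1)\<^sup>2 \<le> (norm (freq k))\<^sup>2" by (intro power_mono) auto
    then show ?thesis unfolding sc_norm[OF v, symmetric] by (intro mult_right_mono) auto
  qed
  then have "(\<Sum>k\<in>F. (real n + 1)\<^sup>2 * (norm (sc v k))\<^sup>2) \<le> (\<Sum>k\<in>F. (norm (fc (\<lambda>x. v x $ 1) k))\<^sup>2 + (norm (fc (\<lambda>x. v x $ 2) k))\<^sup>2)"
    by (rule sum_mono)
  also have "\<dots> \<le> (L2_norm torus v)\<^sup>2" by (rule Bessel_vec2[OF solenoidal_L2[OF v] F(1)])
  finally show ?thesis by (simp add: sum_distrib_left[symmetric] pos_le_divide_eq mult.commute)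
qed

lemma sc_0 [simp]: "sc v 0 = 0" by (simp add: sc_def)

text \<open>Side lengths \<open>2 ^ m\<close> turn the inverse-square tail into the geometric rate
  \<open>(1/4)^m\<close> required by \<open>Riesz_Fischer_rapid\<close>.\<close>

definition dyadic_cube :: "nat \<Rightarrow> (int \<times> int) set" where "dyadic_cube m = cube (2 ^ m)"

text \<open>An explicit pointwise limit rather than a chosen L^2 representative, so that joint
  measurability in time and space can be proved from the formula.\<close>

definition stream :: "(real^2 \<Rightarrow> real^2) \<Rightarrow> real^2 \<Rightarrow> real" where
  "stream v x = lim (\<lambda>m. Re (\<Sum>k\<in>dyadic_cube m. sc v k * chr k x))"

lemma stream_L2_fc:
  assumes v: "solenoidal v"
  shows "stream v \<in> L2 torus" "fc (stream v) k = sc v k"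
proof -
  have 1: "finite (dyadic_cube m)" "uminus ` dyadic_cube m = dyadic_cube m" for m by (simp_all add: dyadic_cube_def uminus_cube)
  have 2: "incseq dyadic_cube" unfolding dyadic_cube_def incseq_def by (intro allI impI mono_cube) simp
  have 3: "(\<Union>m. dyadic_cube m) = UNIV"
  proof -
    have "k \<in> (\<Union>m. dyadic_cube m)" for k
    proof -
      obtain N where "{k} \<subseteq> cube N" using finite_subset_cube[of "{k}"] by auto
      moreover have "N \<le> 2 ^ N" using less_exp[of N] by simp
      ultimately have "k \<in> dyadic_cube N" using mono_cube[of N "2 ^ N"] by (auto simp: dyadic_cube_def)
      then show ?thesis by blast
    qed
    then show ?thesis by blast
  qed
  have 4: "(\<Sum>k\<in>F. (norm (sc v k))\<^sup>2) \<le> (L2_norm torus v)\<^sup>2 * (1/4)^m" if F: "finite F" "F \<inter> dyadic_cube m = {}" for m F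
  proof -
    have "(\<Sum>k\<in>F. (norm (sc v k))\<^sup>2) \<le> (L2_norm torus v)\<^sup>2 / (real (2 ^ m) + 1)\<^sup>2"
      using F by (intro sc_tail v) (auto simp: dyadic_cube_def)
    also have "\<dots> \<le> (L2_norm torus v)\<^sup>2 / (2 ^ m)\<^sup>2"
    proof -
      have "(0::real) < 2 ^ m + 1" by (intro add_pos_nonneg) auto
      then show ?thesis by (intro divide_left_mono power_mono mult_pos_pos) auto
    qed
    also have "\<dots> = (L2_norm torus v)\<^sup>2 * (1/4)^m"
      by (simp add: power_mult_distrib[symmetric] power_divide power2_eq_square)
    finally show ?thesis .
  qed
  have "stream v = (\<lambda>x. lim (\<lambda>m. Re (\<Sum>k\<in>dyadic_cube m. sc v k * chr k x)))" by (rule ext) (rule stream_def)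
  then show "stream v \<in> L2 torus" "fc (stream v) k = sc v k"
    using Riesz_Fischer_rapid[of dyadic_cube "sc v", OF 1 2 3 sc_minus 4] by simp_all
qed

text \<open>Parseval's identity truncated to a cube, with a remainder that depends on the field only
  through its L^2 norm.\<close>

lemma stream_norm_bounds:
  assumes v: "solenoidal v" and \<Psi>: "\<Psi> \<in> L2 torus" "\<And>k. fc \<Psi> k = sc v k"
  shows "(\<Sum>k\<in>cube n. (norm (sc v k))\<^sup>2) \<le> (LINT x|MT. (\<Psi> x)\<^sup>2)"
    and "(LINT x|MT. (\<Psi> x)\<^sup>2) \<le> (\<Sum>k\<in>cube n. (norm (sc v k))\<^sup>2) + (L2_norm torus v)\<^sup>2 / (real n + 1)\<^sup>2"
proof -
  show "(\<Sum>k\<in>cube n. (norm (sc v k))\<^sup>2) \<le> (LINT x|MT. (\<Psi> x)\<^sup>2)"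
    using Bessel[OF \<Psi>(1) finite_cube[of n]] by (simp add: \<Psi>(2))
  show "(LINT x|MT. (\<Psi> x)\<^sup>2) \<le> (\<Sum>k\<in>cube n. (norm (sc v k))\<^sup>2) + (L2_norm torus v)\<^sup>2 / (real n + 1)\<^sup>2"
  proof (rule field_le_epsilon)
    fix e :: real assume "0 < e"
    then obtain S where S: "finite S" "(LINT x|MT. (\<Psi> x)\<^sup>2) - (\<Sum>k\<in>S. (norm (sc v k))\<^sup>2) < e"
      using Parseval_approx[OF \<Psi>(1)] unfolding \<Psi>(2) by blast
    have "(\<Sum>k\<in>S. (norm (sc v k))\<^sup>2) \<le> (\<Sum>k\<in>cube n \<union> (S - cube n). (norm (sc v k))\<^sup>2)"
      using S(1) by (intro sum_mono2) auto
    also have "\<dots> = (\<Sum>k\<in>cube n. (norm (sc v k))\<^sup>2) + (\<Sum>k\<in>S - cube n. (norm (sc v k))\<^sup>2)"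
      using S(1) by (intro sum.union_disjoint) auto
    also have "(\<Sum>k\<in>S - cube n. (norm (sc v k))\<^sup>2) \<le> (L2_norm torus v)\<^sup>2 / (real n + 1)\<^sup>2"
      using S(1) by (intro sc_tail v) auto
    finally show "(LINT x|MT. (\<Psi> x)\<^sup>2) \<le> (\<Sum>k\<in>cube n. (norm (sc v k))\<^sup>2) + (L2_norm torus v)\<^sup>2 / (real n + 1)\<^sup>2 + e"
      using S(2) by linarith
  qed
qed

text \<open>The compactness step: the tails are uniformly small under the common bound
  \<open>M\<close>, and the finitely many remaining coefficients converge. The corresponding claim
  for the fields themselves would fail, as their norms can drop in the weak limit.\<close>

lemma stream_norm_tendsto:
  assumes v: "\<And>j. solenoidal (v j)" "\<And>j. L2_norm torus (v j) \<le> M" and w: "solenoidal w" "L2_norm torus w \<le> M"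
    and lim: "\<And>k. (\<lambda>j. sc (v j) k) \<longlonglongrightarrow> sc w k"
  shows "(\<lambda>j. LINT x|MT. (stream (v j) x)\<^sup>2) \<longlonglongrightarrow> (LINT x|MT. (stream w x)\<^sup>2)"
proof (rule LIMSEQ_I)
  fix e :: real assume e: "0 < e"
  have "(\<lambda>n. M\<^sup>2 * (inverse (real (Suc n)))\<^sup>2) \<longlonglongrightarrow> M\<^sup>2 * 0\<^sup>2"
    by (intro tendsto_intros LIMSEQ_inverse_real_of_nat)
  then have "\<forall>\<^sub>F n in sequentially. M\<^sup>2 * (inverse (real (Suc n)))\<^sup>2 < e / 4"
    using e by (intro order_tendstoD(2)) auto
  then obtain n where "M\<^sup>2 * (inverse (real (Suc n)))\<^sup>2 < e / 4" by (auto simp: eventually_sequentially)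
  then have n: "M\<^sup>2 / (real n + 1)\<^sup>2 < e / 4" by (simp add: field_simps)
  have tail: "(L2_norm torus y)\<^sup>2 / (real n + 1)\<^sup>2 < e / 4" if "L2_norm torus y \<le> M" for y :: "real^2 \<Rightarrow> real^2"
  proof -
    have "(L2_norm torus y)\<^sup>2 / (real n + 1)\<^sup>2 \<le> M\<^sup>2 / (real n + 1)\<^sup>2" using that by (intro divide_right_mono power_mono) auto
    then show ?thesis using n by linarith
  qed
  have "(\<lambda>j. \<Sum>k\<in>cube n. (norm (sc (v j) k))\<^sup>2) \<longlonglongrightarrow> (\<Sum>k\<in>cube n. (norm (sc w k))\<^sup>2)"
    by (intro tendsto_intros lim)
  from LIMSEQ_D[OF this, of "e/4"] e obtain j0 where j0: 
    "\<And>j. j \<ge> j0 \<Longrightarrow> norm ((\<Sum>k\<in>cube n. (norm (sc (v j) k))\<^sup>2) - (\<Sum>k\<in>cube n. (norm (sc w k))\<^sup>2)) < e / 4" by auto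
  have "norm ((LINT x|MT. (stream (v j) x)\<^sup>2) - (LINT x|MT. (stream w x)\<^sup>2)) < e" if "j \<ge> j0" for j
    using j0[OF that] stream_norm_bounds[OF v(1) stream_L2_fc[OF v(1)], of j n] stream_norm_bounds[OF w(1) stream_L2_fc[OF w(1)], of n]
      tail[OF v(2)[of j]] tail[OF w(2)] e
    unfolding real_norm_def by linarith
  then show "\<exists>no. \<forall>j\<ge>no. norm ((LINT x|MT. (stream (v j) x)\<^sup>2) - (LINT x|MT. (stream w x)\<^sup>2)) < e" by blast
qed

subsection \<open>Weak convergence and Fourier coefficients\<close>

lemma L2_inner_real_trig:
  assumes f: "f \<in> L2 torus" and S: "finite S"
  shows "L2_inner torus f (\<lambda>x. Re (\<Sum>k\<in>S. c k * chr k x)) = Re (\<Sum>k\<in>S. c k * cnj (fc f k))"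
proof -
  have fi: "integrable MT f" by (rule L2_imp_integrable[OF f])
  have eq: "of_real (f x) * chr k x = of_real (f x) * cnj (chr (- k) x)" for k x by (simp add: chr_minus)
  have i: "integrable MT (\<lambda>x. c k * (of_real (f x) * chr k x))" for k
    unfolding eq by (intro integrable_mult_right integrable_mult_chr fi)
  have "L2_inner torus f (\<lambda>x. Re (\<Sum>k\<in>S. c k * chr k x)) = (LINT x|MT. Re (\<Sum>k\<in>S. c k * (of_real (f x) * chr k x)))"
    unfolding L2_inner_def by (intro Bochner_Integration.integral_cong refl) 
      (simp add: sum_distrib_left algebra_simps)
  also have "\<dots> = Re (LINT x|MT. (\<Sum>k\<in>S. c k * (of_real (f x) * chr k x)))"
    by (intro integral_Re Bochner_Integration.integrable_sum i)
  also have "(LINT x|MT. (\<Sum>k\<in>S. c k * (of_real (f x) * chr k x))) = (\<Sum>k\<in>S. c k * (LINT x|MT. of_real (f x) * chr k x))"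
    by (subst Bochner_Integration.integral_sum[OF i]) (simp only: integral_mult_right_zero)
  also have "\<dots> = (\<Sum>k\<in>S. c k * cnj (fc f k))"
    unfolding eq fc_def[symmetric] fc_minus ..
  finally show ?thesis .
qed

lemma real_trig_approx:
  fixes w :: "real^2 \<Rightarrow> real"
  assumes w: "w \<in> L2 torus" and e: "0 < e"
  shows "\<exists>S c. finite S \<and> L2_norm torus (\<lambda>x. w x - Re (\<Sum>k\<in>S. c k * chr k x)) < e"
proof -
  have "0 < e\<^sup>2" using e by simp
  then obtain p where p: "trig p" "(LINT x|MT. (norm (of_real (w x) - p x))\<^sup>2) < e\<^sup>2"
    using trig_dense_L2[OF w] by blast
  obtain S c where S: "finite S" "p = (\<lambda>x. \<Sum>k\<in>S. c k * chr k x)" using trig_sum_form[OF p(1)] by blast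
  have D: "(\<lambda>x. w x - Re (p x)) \<in> L2 torus" by (intro L2_diff w L2_Re_trig p(1))
  have le: "\<bar>w x - Re (p x)\<bar> \<le> norm (of_real (w x) - p x)" for x
    using abs_Re_le_cmod[of "of_real (w x) - p x"] by simp
  have i: "integrable MT (\<lambda>x. (norm (of_real (w x) - p x))\<^sup>2)"
  proof (rule Bochner_Integration.integrable_bound)
    show "integrable MT (\<lambda>x. 2 * (w x)\<^sup>2 + 2 * (norm (p x))\<^sup>2)"
      using L2_integrable_square[OF w] trig_square_integrable[OF p(1)] by simp
    show "(\<lambda>x. (norm (of_real (w x) - p x))\<^sup>2) \<in> borel_measurable MT"
      using L2_measurable[OF w] trig_measurable[OF p(1)] by measurable
    have "(norm (of_real (w x) - p x))\<^sup>2 \<le> 2 * (w x)\<^sup>2 + 2 * (norm (p x))\<^sup>2" for x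
    proof -
      have "norm (of_real (w x) - p x) \<le> \<bar>w x\<bar> + norm (p x)" by (rule order_trans[OF norm_triangle_ineq4]) simp
      then have "(norm (of_real (w x) - p x))\<^sup>2 \<le> (\<bar>w x\<bar> + norm (p x))\<^sup>2" by (intro power_mono) auto
      then show ?thesis using sum_squares_bound[of "\<bar>w x\<bar>" "norm (p x)"] by (simp add: power2_sum)
    qed
    then show "AE x in MT. norm ((norm (of_real (w x) - p x))\<^sup>2) \<le> norm (2 * (w x)\<^sup>2 + 2 * (norm (p x))\<^sup>2)" by (intro AE_I2) simp
  qed
  have "(LINT x|MT. (norm (w x - Re (p x)))\<^sup>2) \<le> (LINT x|MT. (norm (of_real (w x) - p x))\<^sup>2)"
    by (rule integral_mono[OF L2_integrable_square[OF D] i]) (use le in \<open>simp add: abs_le_square_iff[symmetric]\<close>)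
  then have "(L2_norm torus (\<lambda>x. w x - Re (p x)))\<^sup>2 < e\<^sup>2" using p(2) unfolding L2_norm_power2 by linarith
  then have "L2_norm torus (\<lambda>x. w x - Re (p x)) < e" using e by (simp add: power_less_imp_less_base)
  then show ?thesis using S by blast
qed

text \<open>Under a uniform bound it suffices to test with trigonometric polynomials, which are
  dense.\<close>

lemma weak_lim_from_fc:
  fixes f :: "nat \<Rightarrow> real^2 \<Rightarrow> real"
  assumes f: "\<And>n. f n \<in> L2 torus" "\<And>n. L2_norm torus (f n) \<le> M" and h: "h \<in> L2 torus" "L2_norm torus h \<le> M"
    and lim: "\<And>k. (\<lambda>n. fc (f n) k) \<longlonglongrightarrow> fc h k"
  shows "weak_lim_L2 torus f h"
  unfolding weak_lim_L2_def
proof (intro conjI allI ballI f(1) h(1))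
  fix w :: "real^2 \<Rightarrow> real" assume w: "w \<in> L2 torus"
  have M0: "0 \<le> M" using order_trans[OF L2_norm_nonneg h(2)] .
  show "(\<lambda>n. L2_inner torus (f n) w) \<longlonglongrightarrow> L2_inner torus h w"
  proof (rule LIMSEQ_I)
    fix e :: real assume e: "0 < e"
    \<comment> \<open>Replacing \<open>w\<close> by the polynomial costs at most
      \<open>M * e'\<close>, below \<open>e / 3\<close>, in each of the two pairings; the
      denominator also covers \<open>M = 0\<close>.\<close>
    define e' where "e' = (e / 3) / (M + 1)"
    have e': "0 < e'" using e M0 by (simp add: e'_def)
    have Me: "M * e' < e / 3"
    proof -
      have "M * e' < (M + 1) * e'" using e' by (simp add: algebra_simps)
      also have "\<dots> = e / 3"
      proof -
        have "M + 1 \<noteq> 0" using M0 by linarith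
        then show ?thesis unfolding e'_def using nonzero_mult_div_cancel_left[of "M + 1" "e / 3"] unfolding times_divide_eq_right[of "M + 1" "e / 3"] by blast
      qed
      finally show ?thesis .
    qed
    obtain S c where S: "finite S" "L2_norm torus (\<lambda>x. w x - Re (\<Sum>k\<in>S. c k * chr k x)) < e'"
      using real_trig_approx[OF w e'] by blast
    let ?p = "\<lambda>x. Re (\<Sum>k\<in>S. c k * chr k x)"
    have pL: "?p \<in> L2 torus" by (intro L2_Re_trig trig_sum S(1))
    have D: "(\<lambda>x. w x - ?p x) \<in> L2 torus" by (rule L2_diff[OF w pL])
    have err: "\<bar>L2_inner torus y w - L2_inner torus y ?p\<bar> < e / 3" if y: "y \<in> L2 torus" "L2_norm torus y \<le> M" for y
    proof -
      have "\<bar>L2_inner torus y w - L2_inner torus y ?p\<bar> \<le> L2_norm torus y * L2_norm torus (\<lambda>x. w x - ?p x)"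
        using L2_Cauchy_Schwarz[OF y(1) D] unfolding L2_inner_diff_right[OF y(1) w pL] .
      also have "\<dots> \<le> M * e'" using y(2) S(2) M0 by (intro mult_mono) auto
      finally show ?thesis using Me by linarith
    qed
    have "(\<lambda>n. Re (\<Sum>k\<in>S. c k * cnj (fc (f n) k))) \<longlonglongrightarrow> Re (\<Sum>k\<in>S. c k * cnj (fc h k))"
      by (intro tendsto_Re tendsto_sum tendsto_mult tendsto_const tendsto_cnj lim)
    then have "(\<lambda>n. L2_inner torus (f n) ?p) \<longlonglongrightarrow> L2_inner torus h ?p"
      by (simp only: L2_inner_real_trig[OF f(1) S(1)] L2_inner_real_trig[OF h(1) S(1)])
    from LIMSEQ_D[OF this, of "e/3"] e obtain n0 where n0: "\<And>n. n \<ge> n0 \<Longrightarrow> norm (L2_inner torus (f n) ?p - L2_inner torus h ?p) < e / 3" by auto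
    have "norm (L2_inner torus (f n) w - L2_inner torus h w) < e" if "n \<ge> n0" for n
      using n0[OF that] err[OF f(1,2)[of n]] err[OF h] unfolding real_norm_def by linarith
    then show "\<exists>no. \<forall>n\<ge>no. norm (L2_inner torus (f n) w - L2_inner torus h w) < e" by blast
  qed
qed

lemma L2_norm_component_le:
  fixes v :: "real^2 \<Rightarrow> real^2"
  assumes "v \<in> L2 torus" shows "L2_norm torus (\<lambda>x. v x $ i) \<le> L2_norm torus v"
  unfolding L2_norm_def
  using L2_integrable_square[OF L2_component[OF assms]] L2_integrable_square[OF assms]
  by (intro real_sqrt_le_mono integral_mono power_mono) (auto simp: component_le_norm_cart)

lemma L2_inner_components:
  fixes v w :: "real^2 \<Rightarrow> real^2"
  assumes "v \<in> L2 torus" "w \<in> L2 torus"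
  shows "L2_inner torus v w = L2_inner torus (\<lambda>x. v x $ 1) (\<lambda>x. w x $ 1) + L2_inner torus (\<lambda>x. v x $ 2) (\<lambda>x. w x $ 2)"
  using L2_inner_integrable[OF L2_component[OF assms(1)] L2_component[OF assms(2)]]
  unfolding L2_inner_def inner_vec2 by simp

lemma weak_lim_vec2_from_fc:
  fixes f :: "nat \<Rightarrow> real^2 \<Rightarrow> real^2"
  assumes f: "\<And>n. f n \<in> L2 torus" "\<And>n. L2_norm torus (f n) \<le> M" and h: "h \<in> L2 torus" "L2_norm torus h \<le> M"
    and lim: "\<And>i k. (\<lambda>n. fc (\<lambda>x. f n x $ i) k) \<longlonglongrightarrow> fc (\<lambda>x. h x $ i) k"
  shows "weak_lim_L2 torus f h"
proof -
  have "weak_lim_L2 torus (\<lambda>n x. f n x $ i) (\<lambda>x. h x $ i)" for i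
    by (rule weak_lim_from_fc[where M=M])
       (auto intro!: L2_component f(1) h(1) lim order_trans[OF L2_norm_component_le[OF f(1)] f(2)] order_trans[OF L2_norm_component_le[OF h(1)] h(2)])
  then have c: "(\<lambda>n. L2_inner torus (\<lambda>x. f n x $ i) w) \<longlonglongrightarrow> L2_inner torus (\<lambda>x. h x $ i) w" if "w \<in> L2 torus" for i w
    using that by (auto simp: weak_lim_L2_def)
  show ?thesis unfolding weak_lim_L2_def
  proof (intro conjI allI ballI f(1) h(1))
    fix w :: "real^2 \<Rightarrow> real^2" assume w: "w \<in> L2 torus"
    show "(\<lambda>n. L2_inner torus (f n) w) \<longlonglongrightarrow> L2_inner torus h w"
      unfolding L2_inner_components[OF f(1) w] L2_inner_components[OF h(1) w]
      by (intro tendsto_add c L2_component w)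
  qed
qed

text \<open>Expresses a coefficient through pairings with smooth vector fields, to which the
  evolution equation applies. The phase \<open>+ 0\<close> matches
  \<open>torus_test_trig\<close>.\<close>

lemma fc_eq_inner:
  fixes v :: "real^2 \<Rightarrow> real^2"
  assumes "v \<in> L2 torus"
  shows "fc (\<lambda>x. v x $ i) k = Complex (L2_inner torus v (\<lambda>x. cos (freq k \<bullet> x + 0) *\<^sub>R axis i 1)) (- L2_inner torus v (\<lambda>x. sin (freq k \<bullet> x + 0) *\<^sub>R axis i 1))"
  using fc_trig_parts[OF L2_imp_integrable[OF L2_component[OF assms, of i]], of k]
  by (simp add: complex_eq_iff L2_inner_def inner_axis mult.commute)

lemma trig_axis_torus_test:
  "(\<lambda>x. cos (freq k \<bullet> x + 0) *\<^sub>R axis i (1::real)) \<in> torus_test" "(\<lambda>x. sin (freq k \<bullet> x + 0) *\<^sub>R axis i (1::real)) \<in> torus_test"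
  by (intro torus_test_scaleR torus_test_trig torus_test_const)+

text \<open>The constant involves only the common norm bound and the test field, so along a sequence
  of flows it gives equicontinuity in time.\<close>

lemma (in flow) inner_lipschitz:
  assumes \<phi>: "\<phi> \<in> torus_test" and R: "\<And>x. x \<in> torus \<Longrightarrow> \<bar>rot \<phi> x\<bar> \<le> R"
    and st: "s \<in> {0..<T}" "t \<in> {0..<T}" "s \<le> t"
  shows "\<bar>L2_inner torus (b t) \<phi> - L2_inner torus (b s) \<phi>\<bar> \<le> (t - s) * (M * M * R)"
proof -
  let ?G = "\<lambda>s. LINT x|MT. g s x * rot \<phi> x"
  have rc: "continuous_on UNIV (rot \<phi>)" by (rule continuous_on_rot[OF torus_test_smooth[OF \<phi>]])
  have Gi: "integrable (MI T) ?G" by (rule g_weight_integrable[OF rc])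
  have "(LINT r|MI T. indicator {0..t} r * ?G r) - (LINT r|MI T. indicator {0..s} r * ?G r) = (LINT r|MI T. indicator {0..t} r * ?G r - indicator {0..s} r * ?G r)"
    using indicator_integrable(2)[OF Gi] by simp
  also have "\<dots> = (LINT r|MI T. indicator {s<..t} r * ?G r)"
    using st by (intro Bochner_Integration.integral_cong) (auto simp: indicator_def)
  finally have "L2_inner torus (b t) \<phi> - L2_inner torus (b s) \<phi> = (LINT r|MI T. indicator {s<..t} r * ?G r)"
    using evol[OF \<phi> st(1)] evol[OF \<phi> st(2)] by (simp add: g_def)
  also have "\<bar>\<dots>\<bar> \<le> (t - s) * (M * M * R)"
  proof (rule interval_integral_bound[OF st Gi])
    fix r assume r: "r \<in> {0..<T}"
    have "\<bar>?G r\<bar> \<le> (LINT x|MT. \<bar>g r x * rot \<phi> x\<bar>)" by (rule integral_abs_bound)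
    also have "\<dots> \<le> M * M * R"
      using Cw_L2_crs_slice(3)[OF b u bM uM rc R r] by (simp add: g_def)
    finally show "\<bar>?G r\<bar> \<le> M * M * R" .
  qed
  finally show ?thesis .
qed

text \<open>Weak convergence controls time averages over short windows, and the common Lipschitz
  bound makes each value close to such an average. So the values form Cauchy sequences at every
  time.\<close>

lemma lipschitz_weak_limit:
  fixes H :: "nat \<Rightarrow> real \<Rightarrow> real"
  assumes lip: "\<And>j s t. s \<in> {0..<T} \<Longrightarrow> t \<in> {0..<T} \<Longrightarrow> s \<le> t \<Longrightarrow> \<bar>H j t - H j s\<bar> \<le> (t - s) * K"
    and bdd: "\<And>j t. t \<in> {0..<T} \<Longrightarrow> \<bar>H j t\<bar> \<le> B"
    and G: "integrable (MI T) G"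
    and weak: "\<And>\<eta>. \<eta> \<in> borel_measurable (MI T) \<Longrightarrow> (\<And>t. \<bar>\<eta> t\<bar> \<le> 1) \<Longrightarrow> 
       (\<lambda>j. LINT t|MI T. \<eta> t * H j t) \<longlonglongrightarrow> (LINT t|MI T. \<eta> t * G t)"
  obtains c where "\<And>t. t \<in> {0..<T} \<Longrightarrow> (\<lambda>j. H j t) \<longlonglongrightarrow> c t" "AE t in MI T. G t = c t"
proof -
  interpret fm: finite_measure "MI T" by (rule finite_measure_MI)
  have Hc: "continuous_on {0..<T} (H j)" for j
  proof (rule continuous_on_sequentiallyI)
    fix s t assume s: "\<forall>n. s n \<in> {0..<T}" and t: "t \<in> {0..<T}" and st: "s \<longlonglongrightarrow> t"
    have bd: "\<bar>H j (s n) - H j t\<bar> \<le> \<bar>s n - t\<bar> * \<bar>K\<bar>" for n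
    proof (cases "s n \<le> t")
      case True
      have "\<bar>H j (s n) - H j t\<bar> \<le> (t - s n) * K" using lip[of "s n" t j] s t True by (simp add: abs_minus_commute)
      also have "\<dots> \<le> (t - s n) * \<bar>K\<bar>" using True by (intro mult_left_mono) auto
      also have "\<dots> = \<bar>s n - t\<bar> * \<bar>K\<bar>" using True by simp
      finally show ?thesis .
    next
      case False
      have "\<bar>H j (s n) - H j t\<bar> \<le> (s n - t) * K" using lip[of t "s n" j] s t False by simp
      also have "\<dots> \<le> (s n - t) * \<bar>K\<bar>" using False by (intro mult_left_mono) auto
      also have "\<dots> = \<bar>s n - t\<bar> * \<bar>K\<bar>" using False by simp
      finally show ?thesis .
    qed
    have l0: "(\<lambda>n. \<bar>s n - t\<bar> * \<bar>K\<bar>) \<longlonglongrightarrow> 0"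
      using tendsto_mult[OF tendsto_rabs[OF LIM_zero[OF st]] tendsto_const[of "\<bar>K\<bar>"]] by simp
    have "(\<lambda>n. H j (s n) - H j t) \<longlonglongrightarrow> 0"
      by (rule Lim_null_comparison[OF always_eventually l0]) (use bd in simp)
    then show "(\<lambda>n. H j (s n)) \<longlonglongrightarrow> H j t" by (simp add: LIM_zero_iff)
  qed
  have Hm: "H j \<in> borel_measurable (MI T)" for j by (intro continuous_imp_measurable_on_sets_lebesgue Hc) auto
  have Hi: "integrable (MI T) (H j)" for j
    using Hm bdd by (intro fm.integrable_const_bound[of _ B]) auto
  have conv: "convergent (\<lambda>j. H j t)" if t: "t \<in> {0..<T}" for t
  proof (rule Cauchy_convergent, rule CauchyI)
    fix e :: real assume e: "0 < e"
    \<comment> \<open>The first entry keeps the window \<open>{t<..t+h}\<close> below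
      \<open>T\<close>; the second keeps the oscillation on it below \<open>e / 8\<close>, with
      \<open>+ 1\<close> covering \<open>K = 0\<close>.\<close>
    define h where "h = min ((T - t) / 2) (e / (8 * (\<bar>K\<bar> + 1)))"
    have h: "0 < h" "t + h < T" "h * (\<bar>K\<bar> + 1) \<le> e / 8"
    proof -
      have p: "0 < 8 * (\<bar>K\<bar> + 1)" by simp
      show "0 < h" using t e p unfolding h_def by simp
      have "h \<le> (T - t) / 2" unfolding h_def by (rule min.cobounded1)
      moreover have "t < T" using t by simp
      ultimately show "t + h < T" by argo
      have "h \<le> e / (8 * (\<bar>K\<bar> + 1))" unfolding h_def by (rule min.cobounded2)
      then have "h * (\<bar>K\<bar> + 1) \<le> e / (8 * (\<bar>K\<bar> + 1)) * (\<bar>K\<bar> + 1)" by (intro mult_right_mono) auto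
      also have "\<dots> = e / 8" using p by (simp add: field_simps)
      finally show "h * (\<bar>K\<bar> + 1) \<le> e / 8" .
    qed
    let ?\<eta> = "indicator {t<..t+h} :: real \<Rightarrow> real"
    have \<eta>m: "?\<eta> \<in> borel_measurable (MI T)" by (rule borel_measurable_lebesgue_on_borel) simp
    have \<eta>H: "integrable (MI T) (\<lambda>r. ?\<eta> r * H j r)" for j
    proof (rule Bochner_Integration.integrable_bound[OF Hi[of j]])
      show "(\<lambda>r. ?\<eta> r * H j r) \<in> borel_measurable (MI T)" by (rule borel_measurable_times[OF \<eta>m Hm])
    qed (auto simp: indicator_def)
    have \<eta>c: "integrable (MI T) (\<lambda>r. ?\<eta> r * C)" "(LINT r|MI T. ?\<eta> r * C) = h * C" for C
    proof -
      have "integrable lborel (\<lambda>r. ?\<eta> r * C)"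
        using h by (intro integrable_mult_left integrable_real_indicator) auto
      then show "integrable (MI T) (\<lambda>r. ?\<eta> r * C)"
        using t h by (subst integral_lebesgue_on_borel(2)) (auto simp: indicator_def)
      have "(LINT r|MI T. ?\<eta> r * C) = (LINT r|lborel. ?\<eta> r * C)"
        using t h by (intro integral_lebesgue_on_borel(1)) (auto simp: indicator_def)
      also have "\<dots> = h * C" using h by simp
      finally show "(LINT r|MI T. ?\<eta> r * C) = h * C" .
    qed
    have avg: "\<bar>h * H j t - (LINT r|MI T. ?\<eta> r * H j r)\<bar> \<le> h * (e / 8)" for j
    proof -
      have eq: "h * H j t - (LINT r|MI T. ?\<eta> r * H j r) = (LINT r|MI T. ?\<eta> r * H j t - ?\<eta> r * H j r)"
        unfolding Bochner_Integration.integral_diff[OF \<eta>c(1) \<eta>H] \<eta>c(2) ..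
      have "\<bar>h * H j t - (LINT r|MI T. ?\<eta> r * H j r)\<bar> \<le> (LINT r|MI T. \<bar>?\<eta> r * H j t - ?\<eta> r * H j r\<bar>)"
        unfolding eq by (rule integral_abs_bound)
      also have "\<dots> \<le> (LINT r|MI T. ?\<eta> r * (e / 8))"
      proof (rule integral_mono)
        show "integrable (MI T) (\<lambda>r. \<bar>?\<eta> r * H j t - ?\<eta> r * H j r\<bar>)"
          by (rule integrable_abs[OF Bochner_Integration.integrable_diff[OF \<eta>c(1) \<eta>H]])
        show "integrable (MI T) (\<lambda>r. ?\<eta> r * (e / 8))" by (rule \<eta>c(1))
        fix r assume "r \<in> space (MI T)"
        then have r: "r \<in> {0..<T}" by simp
        show "\<bar>?\<eta> r * H j t - ?\<eta> r * H j r\<bar> \<le> ?\<eta> r * (e / 8)"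
        proof (cases "r \<in> {t<..t+h}")
          case True
          have "\<bar>H j t - H j r\<bar> \<le> (r - t) * K" using lip[OF t r, of j] True by (simp add: abs_minus_commute)
          also have "\<dots> \<le> (r - t) * (\<bar>K\<bar> + 1)" using True by (intro mult_left_mono) auto
          also have "\<dots> \<le> h * (\<bar>K\<bar> + 1)" using True by (intro mult_right_mono) auto
          finally show ?thesis using True h(3) by simp
        qed simp
      qed
      finally show ?thesis unfolding \<eta>c(2) .
    qed
    have "(\<lambda>j. LINT r|MI T. ?\<eta> r * H j r) \<longlonglongrightarrow> (LINT r|MI T. ?\<eta> r * G r)"
      by (rule weak[OF \<eta>m]) (simp add: indicator_def)
    then have C: "Cauchy (\<lambda>j. LINT r|MI T. ?\<eta> r * H j r)" by (rule LIMSEQ_imp_Cauchy)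
    have "0 < h * (e / 4)" using h e by simp
    from CauchyD[OF C this] obtain N where N0: "\<forall>m\<ge>N. \<forall>n\<ge>N. norm ((LINT r|MI T. ?\<eta> r * H m r) - (LINT r|MI T. ?\<eta> r * H n r)) < h * (e / 4)"
      by (rule exE)
    have N: "norm ((LINT r|MI T. ?\<eta> r * H m r) - (LINT r|MI T. ?\<eta> r * H n r)) < h * (e / 4)" if "m \<ge> N" "n \<ge> N" for m n
      using N0 that by simp
    have "norm (H m t - H n t) < e" if mn: "m \<ge> N" "n \<ge> N" for m n
    proof -
      \<comment> \<open>Two averaging errors of \<open>e / 8\<close> and the Cauchy tolerance
        \<open>e / 4\<close> add up to \<open>e / 2\<close>.\<close>
      have "\<bar>h * H m t - h * H n t\<bar> < h * (e / 4) + 2 * (h * (e / 8))"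
        using avg[of m] avg[of n] N[OF mn] unfolding real_norm_def by linarith
      then have "h * \<bar>H m t - H n t\<bar> < h * (e / 2)"
        using h(1) by (simp add: right_diff_distrib[symmetric] abs_mult)
      then show ?thesis using h(1) e by simp
    qed
    then show "\<exists>M. \<forall>m\<ge>M. \<forall>n\<ge>M. norm (H m t - H n t) < e" by blast
  qed
  define c where "c t = lim (\<lambda>j. H j t)" for t
  have c: "(\<lambda>j. H j t) \<longlonglongrightarrow> c t" if "t \<in> {0..<T}" for t
    using conv[OF that] by (simp add: c_def convergent_LIMSEQ_iff)
  have cb: "\<bar>c t\<bar> \<le> B" if "t \<in> {0..<T}" for t
    by (rule LIMSEQ_le_const2[OF tendsto_rabs[OF c[OF that]]]) (use bdd that in blast)
  have cm: "c \<in> borel_measurable (MI T)" unfolding c_def using Hm by measurable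
  have Gm: "G \<in> borel_measurable (MI T)" using G by simp
  \<comment> \<open>Testing with the sign of the difference turns equality of the weak limits into a
    vanishing L^1 norm.\<close>
  define \<eta> where "\<eta> t = sgn (c t - G t)" for t
  have \<eta>m: "\<eta> \<in> borel_measurable (MI T)" unfolding \<eta>_def using cm Gm by measurable
  have \<eta>1: "\<bar>\<eta> t\<bar> \<le> 1" for t by (simp add: \<eta>_def sgn_if)
  have ci: "integrable (MI T) c" using cm cb by (intro fm.integrable_const_bound[of _ B]) auto
  have l1: "(\<lambda>j. LINT t|MI T. \<eta> t * H j t) \<longlonglongrightarrow> (LINT t|MI T. \<eta> t * G t)" by (rule weak[OF \<eta>m \<eta>1])
  have l2: "(\<lambda>j. LINT t|MI T. \<eta> t * H j t) \<longlonglongrightarrow> (LINT t|MI T. \<eta> t * c t)"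
  proof (rule integral_dominated_convergence[where w="\<lambda>_. \<bar>B\<bar>"])
    show "AE t in MI T. (\<lambda>j. \<eta> t * H j t) \<longlonglongrightarrow> \<eta> t * c t" using c by (intro AE_I2 tendsto_intros) auto
    show "AE t in MI T. norm (\<eta> t * H j t) \<le> \<bar>B\<bar>" for j
    proof (rule AE_I2)
      fix t assume "t \<in> space (MI T)"
      then have "\<bar>H j t\<bar> \<le> \<bar>B\<bar>" using bdd[of t j] by simp
      then have "\<bar>\<eta> t\<bar> * \<bar>H j t\<bar> \<le> 1 * \<bar>B\<bar>" using \<eta>1 by (intro mult_mono) auto
      then show "norm (\<eta> t * H j t) \<le> \<bar>B\<bar>" by (simp add: abs_mult)
    qed
    show "(\<lambda>t. \<eta> t * c t) \<in> borel_measurable (MI T)" "(\<lambda>t. \<eta> t * H j t) \<in> borel_measurable (MI T)" for j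
      by (intro borel_measurable_times \<eta>m cm Hm)+
  qed simp
  have \<eta>i: "integrable (MI T) (\<lambda>t. \<eta> t * f t)" if f: "integrable (MI T) f" for f
    by (rule Bochner_Integration.integrable_bound[OF f])
       (use \<eta>m \<eta>1 f in \<open>auto simp: abs_mult intro!: borel_measurable_times mult_left_le_one_le\<close>)
  have "(LINT t|MI T. \<eta> t * c t) - (LINT t|MI T. \<eta> t * G t) = 0" using LIMSEQ_unique[OF l1 l2] by simp
  then have "(LINT t|MI T. \<eta> t * c t - \<eta> t * G t) = 0" using \<eta>i[OF ci] \<eta>i[OF G] by simp
  moreover have "\<eta> t * c t - \<eta> t * G t = \<bar>c t - G t\<bar>" for t
  proof -
    have "\<eta> t * c t - \<eta> t * G t = (c t - G t) * sgn (c t - G t)" by (simp add: \<eta>_def algebra_simps)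
    then show ?thesis unfolding abs_sgn[of "c t - G t"] .
  qed
  ultimately have "(LINT t|MI T. \<bar>c t - G t\<bar>) = 0" by simp
  moreover have "integrable (MI T) (\<lambda>t. \<bar>c t - G t\<bar>)" using ci G by simp
  ultimately have "AE t in MI T. \<bar>c t - G t\<bar> = 0"
    by (subst (asm) integral_nonneg_eq_0_iff_AE) auto
  then have "AE t in MI T. G t = c t" by (auto elim: eventually_mono)
  then show ?thesis using that c by blast
qed

subsection \<open>Weak gradients on the torus\<close>

lemma periodic_int:
  assumes "periodic f" "x $ 1 = y $ 1 + of_int m" "x $ 2 = y $ 2 + of_int n" shows "f x = f y"
proof -
  have step: "f (z + of_int m *\<^sub>R axis i 1) = f z" for z i m
  proof (induction m arbitrary: z rule: int_induct[where k=0])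
    case (step1 m)
    have eq: "z + of_int (m + 1) *\<^sub>R axis i 1 = (z + of_int m *\<^sub>R axis i 1) + axis i (1::real)" by (simp add: algebra_simps)
    have "f ((z + of_int m *\<^sub>R axis i 1) + axis i 1) = f (z + of_int m *\<^sub>R axis i 1)"
      using assms(1) unfolding periodic_def by blast
    then show ?case using step1(2)[of z] unfolding eq by (rule trans)
  next
    case (step2 m)
    have eq: "z + of_int m *\<^sub>R axis i 1 = (z + of_int (m - 1) *\<^sub>R axis i 1) + axis i (1::real)" by (simp add: algebra_simps)
    have "f ((z + of_int (m - 1) *\<^sub>R axis i 1) + axis i 1) = f (z + of_int (m - 1) *\<^sub>R axis i 1)"
      using assms(1) unfolding periodic_def by blast
    then show ?case using step2(2)[of z] unfolding eq by (rule trans[OF sym])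
  qed simp
  have "x = (y + of_int m *\<^sub>R axis 1 1) + of_int n *\<^sub>R axis 2 1"
    using assms(2,3) by (intro vec2_eqI) auto
  then show ?thesis using step by simp
qed

lemma torus_representative:
  obtains y :: "real^2" and m n :: int where "y \<in> torus" "x $ 1 = y $ 1 + m" "x $ 2 = y $ 2 + n"
proof (rule that[of "vector [frac (x $ 1), frac (x $ 2)]" "\<lfloor>x $ 1\<rfloor>" "\<lfloor>x $ 2\<rfloor>"])
  show "vector [frac (x $ 1), frac (x $ 2)] \<in> torus"
    by (simp add: mem_torus frac_lt_1 less_imp_le)
qed (simp_all add: frac_def)

lemma chr_periodic: "periodic (chr k)"
  unfolding periodic_def
proof (intro allI)
  fix x i
  have "freq k \<bullet> (x + axis i 1) = freq k \<bullet> x + 2 * pi * of_int (if i = 1 then fst k else snd k)"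
    by (simp add: inner_add_right freq_axis)
  then show "chr k (x + axis i 1) = chr k x" 
    unfolding chr_def by (simp only: cis_mult[symmetric]) (simp add: cis_multiple_2pi)
qed

lemma trig_uniformly_dense_periodic:
  fixes h :: "real^2 \<Rightarrow> real"
  assumes h: "continuous_on UNIV h" "periodic h" and e: "0 < e"
  shows "\<exists>S c. finite S \<and> (\<forall>x. norm (of_real (h x) - (\<Sum>k\<in>S. c k * chr k x)) < e)"
proof -
  have "h x = h y" if "chr (1,0) x = chr (1,0) y" "chr (0,1) x = chr (0,1) y" for x y
    using that unfolding chr_basic_eq_iff by (auto intro: periodic_int[OF h(2)])
  moreover have "continuous_on torus h" using h(1) continuous_on_subset by blast
  ultimately obtain p where p: "trig p" "\<And>x. x \<in> torus \<Longrightarrow> norm (of_real (h x) - p x) < e"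
    using trig_uniformly_dense[OF _ e, of h] by blast
  obtain S c where S: "finite S" "p = (\<lambda>x. \<Sum>k\<in>S. c k * chr k x)" using trig_sum_form[OF p(1)] by blast
  have "norm (of_real (h x) - (\<Sum>k\<in>S. c k * chr k x)) < e" for x
  proof -
    obtain y m n where y: "y \<in> torus" "x $ 1 = y $ 1 + of_int m" "x $ 2 = y $ 2 + of_int n" by (rule torus_representative)
    have "h x = h y" "chr k x = chr k y" for k
      using periodic_int[OF h(2) y(2,3)] periodic_int[OF chr_periodic y(2,3)] by auto
    then show ?thesis using p(2)[OF y(1)] S(2) by simp
  qed
  then show ?thesis using S(1) by blast
qed

text \<open>Translation only rotates the phases of a trigonometric polynomial and fixes its constant
  term; uniform approximation carries this over. No cutting and reassembling of the square is
  involved.\<close>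

lemma integral_translate_periodic:
  fixes h :: "real^2 \<Rightarrow> real"
  assumes h: "continuous_on UNIV h" "periodic h" 
  shows "(LINT x|MT. h (x + a)) = (LINT x|MT. h x)"
proof -
  have hi: "integrable MT (\<lambda>x. h (x + b))" for b
    by (intro L2_imp_integrable L2_bounded_continuous continuous_on_compose2[OF h(1)]) (auto intro!: continuous_intros)
  have "\<bar>(LINT x|MT. h (x + a)) - (LINT x|MT. h x)\<bar> \<le> 0 + e" if e: "0 < e" for e
  proof -
    obtain S c where S: "finite S" "\<And>x. norm (of_real (h x) - (\<Sum>k\<in>S. c k * chr k x)) < e / 2"
      using trig_uniformly_dense_periodic[OF h, of "e/2"] e by auto
    \<comment> \<open>The constant term of the approximation, hence its mean after every
      translation.\<close>
    define z where "z = (if 0 \<in> S then c 0 else 0)"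
    have "norm (of_real (LINT x|MT. h (x + b)) - z) \<le> e / 2" for b
    proof -
      have pi: "integrable MT (\<lambda>x. \<Sum>k\<in>S. c k * chr k (x + b))"
      proof -
        have "(\<lambda>x. \<Sum>k\<in>S. c k * chr k (x + b)) = (\<lambda>x. \<Sum>k\<in>S. (c k * chr k b) * chr k x)"
          by (simp add: chr_def inner_add_right cis_mult[symmetric] mult_ac)
        then show ?thesis using trig_integrable[OF trig_sum[OF S(1)]] by simp
      qed
      have "(LINT x|MT. (\<Sum>k\<in>S. c k * chr k (x + b))) = (\<Sum>k\<in>S. (c k * chr k b) * (LINT x|MT. chr k x))"
      proof -
        have "(\<lambda>x. \<Sum>k\<in>S. c k * chr k (x + b)) = (\<lambda>x. \<Sum>k\<in>S. (c k * chr k b) * chr k x)"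
          by (simp add: chr_def inner_add_right cis_mult[symmetric] mult_ac)
        then show ?thesis
          by (simp add: Bochner_Integration.integral_sum trig_integrable[OF trig_chr] trig_integrable[OF trig_chr[of 1], simplified])
      qed
      also have "\<dots> = z"
        using S(1) by (simp add: z_def integral_chr if_distrib[of "\<lambda>z. _ * z"] sum.delta cong: if_cong)
      finally have P: "(LINT x|MT. (\<Sum>k\<in>S. c k * chr k (x + b))) = z" .
      have "of_real (LINT x|MT. h (x + b)) - z = (LINT x|MT. of_real (h (x + b)) - (\<Sum>k\<in>S. c k * chr k (x + b)))"
        using hi[of b] pi by (simp add: P integral_complex_of_real)
      also have "norm \<dots> \<le> (LINT x|MT. norm (of_real (h (x + b)) - (\<Sum>k\<in>S. c k * chr k (x + b))))" by (rule integral_norm_bound)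
      also have "\<dots> \<le> (LINT x|MT. e / 2)"
      proof (rule integral_mono)
        show "integrable MT (\<lambda>x. norm (of_real (h (x + b)) - (\<Sum>k\<in>S. c k * chr k (x + b))))"
          using hi[of b] pi by (intro integrable_norm Bochner_Integration.integrable_diff) simp_all
        show "norm (of_real (h (x + b)) - (\<Sum>k\<in>S. c k * chr k (x + b))) \<le> e / 2" for x using S(2)[of "x + b"] by simp
      qed simp
      finally show ?thesis using MT.prob_space by simp
    qed
    from this[of a] this[of 0] have "norm (of_real (LINT x|MT. h (x + a)) - of_real (LINT x|MT. h x) :: complex) \<le> e / 2 + e / 2"
      using norm_triangle_ineq4[of "of_real (LINT x|MT. h (x + a)) - z" "of_real (LINT x|MT. h x) - z"] by simp
    then show ?thesis by (simp only: of_real_diff[symmetric] norm_of_real)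
  qed
  then have "\<bar>(LINT x|MT. h (x + a)) - (LINT x|MT. h x)\<bar> \<le> 0" by (rule field_le_epsilon)
  then show ?thesis by simp
qed

lemma grad_periodic: assumes "\<theta> \<in> torus_test" shows "periodic (\<lambda>x. grad \<theta> x $ i)"
  unfolding periodic_def
proof (intro allI)
  fix x j
  have D: "(\<theta> has_derivative frechet_derivative \<theta> (at y)) (at y)" for y
    by (rule smooth_has_derivative[OF torus_test_smooth[OF assms]])
  have "((\<lambda>y. \<theta> (y + axis j 1)) has_derivative frechet_derivative \<theta> (at (x + axis j 1))) (at x)"
  proof -
    have "((\<lambda>y. y + axis j 1) has_derivative (\<lambda>h. h)) (at x)" by (auto intro!: derivative_eq_intros)
    from has_derivative_compose[OF this D] show ?thesis .
  qed
  moreover have "(\<lambda>y. \<theta> (y + axis j 1)) = \<theta>" using torus_test_periodic[OF assms] by (auto simp: periodic_def)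
  ultimately have "frechet_derivative \<theta> (at (x + axis j 1)) = frechet_derivative \<theta> (at x)"
    using frechet_derivative_at by metis
  then show "grad \<theta> (x + axis j 1) $ i = grad \<theta> x $ i" by (simp add: grad_def)
qed

text \<open>Difference quotients have integral zero by translation invariance, are bounded through
  the mean value theorem, and converge pointwise to the partial derivative.\<close>

lemma integral_grad_zero:
  assumes \<theta>: "\<theta> \<in> torus_test" shows "(LINT x|MT. grad \<theta> x $ i) = 0"
proof -
  have c: "continuous_on UNIV \<theta>" by (rule smooth_continuous[OF torus_test_smooth[OF \<theta>]])
  have gc: "continuous_on UNIV (\<lambda>x. grad \<theta> x $ i)"
    by (intro continuous_on_component continuous_on_grad torus_test_smooth \<theta>)
  obtain C where C: "\<And>x. x \<in> torus \<Longrightarrow> \<bar>grad \<theta> x $ i\<bar> \<le> C" using continuous_torus_bounded[OF gc] by metis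
  have Call: "\<bar>grad \<theta> x $ i\<bar> \<le> C" for x
  proof -
    obtain y m n where y: "y \<in> torus" "x $ 1 = y $ 1 + of_int m" "x $ 2 = y $ 2 + of_int n" by (rule torus_representative)
    show ?thesis using periodic_int[OF grad_periodic[OF \<theta>, of i] y(2,3)] C[OF y(1)] by simp
  qed
  have line: "((\<lambda>s. \<theta> (x + s *\<^sub>R axis i 1)) has_real_derivative grad \<theta> (x + s *\<^sub>R axis i 1) $ i) (at s)" for x s
  proof -
    have "((\<lambda>s. x + s *\<^sub>R axis i 1) has_derivative (\<lambda>h. h *\<^sub>R axis i 1)) (at s)" by (auto intro!: derivative_eq_intros)
    from has_derivative_compose[OF this smooth_has_derivative[OF torus_test_smooth[OF \<theta>]]]
    have D: "((\<lambda>s. \<theta> (x + s *\<^sub>R axis i 1)) has_derivative (\<lambda>h. frechet_derivative \<theta> (at (x + s *\<^sub>R axis i 1)) (h *\<^sub>R axis i 1))) (at s)" .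
    have lin: "linear (frechet_derivative \<theta> (at y))" for y
      using smooth_has_derivative[OF torus_test_smooth[OF \<theta>]] has_derivative_linear by blast
    show ?thesis unfolding has_field_derivative_def
      by (rule has_derivative_eq_rhs[OF D]) (simp add: linear_cmul[OF lin] grad_def fun_eq_iff mult.commute)
  qed
  define h where "h n = inverse (real (Suc n))" for n
  have h: "0 < h n" for n by (simp add: h_def)
  define q where "q n x = (\<theta> (x + h n *\<^sub>R axis i 1) - \<theta> x) / h n" for n x
  have qc: "continuous_on UNIV (q n)" for n
    unfolding q_def using h[of n] by (intro continuous_intros c continuous_on_compose2[OF c]) auto
  have "(\<lambda>n. LINT x|MT. q n x) \<longlonglongrightarrow> (LINT x|MT. grad \<theta> x $ i)"
  proof (rule integral_dominated_convergence[where w="\<lambda>_. C"])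
    show "AE x in MT. (\<lambda>n. q n x) \<longlonglongrightarrow> grad \<theta> x $ i"
    proof (rule AE_I2)
      fix x
      have "((\<lambda>s. (\<theta> (x + s *\<^sub>R axis i 1) - \<theta> x) / s) \<longlongrightarrow> grad \<theta> x $ i) (at 0)"
        using line[of x 0] by (simp add: DERIV_def)
      moreover have "filterlim h (at 0) sequentially"
      proof -
        have "h \<longlonglongrightarrow> 0" unfolding h_def by (rule LIMSEQ_inverse_real_of_nat)
        then show ?thesis using order_less_imp_not_eq2[OF h] by (simp add: filterlim_at)
      qed
      ultimately show "(\<lambda>n. q n x) \<longlonglongrightarrow> grad \<theta> x $ i" unfolding q_def by (rule filterlim_compose)
    qed
    show "AE x in MT. norm (q n x) \<le> C" for n
    proof (rule AE_I2)
      fix x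
      obtain z where z: "\<theta> (x + h n *\<^sub>R axis i 1) - \<theta> (x + 0 *\<^sub>R axis i 1) = (h n - 0) * grad \<theta> (x + z *\<^sub>R axis i 1) $ i"
        using MVT2[OF h[of n], of "\<lambda>s. \<theta> (x + s *\<^sub>R axis i 1)" "\<lambda>s. grad \<theta> (x + s *\<^sub>R axis i 1) $ i"] line by blast
      then have "q n x = grad \<theta> (x + z *\<^sub>R axis i 1) $ i" using h[of n] by (simp add: q_def)
      then show "norm (q n x) \<le> C" using Call by simp
    qed
    show "q n \<in> borel_measurable MT" "(\<lambda>x. grad \<theta> x $ i) \<in> borel_measurable MT" for n
      by (intro borel_measurable_MT borel_measurable_continuous_onI qc gc)+
  qed simp
  moreover have "(LINT x|MT. q n x) = 0" for n
  proof -
    have "integrable MT (\<lambda>x. \<theta> (x + b))" for b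
      by (intro L2_imp_integrable L2_bounded_continuous continuous_on_compose2[OF c]) (auto intro!: continuous_intros)
    from this[of 0] this[of "h n *\<^sub>R axis i 1"] show ?thesis
      unfolding q_def using integral_translate_periodic[OF c torus_test_periodic[OF \<theta>], of "h n *\<^sub>R axis i 1"] by simp
  qed
  ultimately show ?thesis by (simp add: LIMSEQ_const_iff)
qed

lemma torus_integration_by_parts:
  assumes f: "f \<in> torus_test" and \<psi>: "\<psi> \<in> torus_test"
  shows "(LINT x|MT. f x * grad \<psi> x $ i) = - (LINT x|MT. grad f x $ i * \<psi> x)"
proof -
  have D: "(f has_derivative frechet_derivative f (at x)) (at x)" "(\<psi> has_derivative frechet_derivative \<psi> (at x)) (at x)" for x
    using smooth_has_derivative torus_test_smooth f \<psi> by blast+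
  have g: "grad (\<lambda>x. f x * \<psi> x) x $ i = f x * grad \<psi> x $ i + grad f x $ i * \<psi> x" for x
    unfolding grad_def frechet_derivative_at[OF has_derivative_mult[OF D(1)[of x] D(2)[of x]], symmetric] by simp
  have i: "integrable MT (\<lambda>x. f x * grad \<psi> x $ i)" "integrable MT (\<lambda>x. grad f x $ i * \<psi> x)"
    by (intro L2_imp_integrable L2_bounded_continuous continuous_on_mult continuous_on_component continuous_on_grad 
        smooth_continuous torus_test_smooth f \<psi>)+
  have "(LINT x|MT. f x * grad \<psi> x $ i) + (LINT x|MT. grad f x $ i * \<psi> x) = 0"
    using integral_grad_zero[OF torus_test_mult[OF f \<psi>], of i] i unfolding g by simp
  then show ?thesis by simp
qed

text \<open>The rotation that turns a field back into the gradient of its stream function: (d_1 Psi,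
  d_2 Psi) = (-b_2, b_1).\<close>

definition perp :: "real^2 \<Rightarrow> real^2" where "perp v = vector [- v $ 2, v $ 1]"

lemma perp_nth [simp]: "perp v $ 1 = - v $ 2" "perp v $ 2 = v $ 1" by (simp_all add: perp_def)

lemma norm_perp [simp]: "norm (perp v) = norm v"
proof -
  have "(norm (perp v))\<^sup>2 = (norm v)\<^sup>2" unfolding norm2_vec2 by simp
  then show ?thesis by simp
qed

lemma perp_L2: assumes "v \<in> L2 torus" shows "(\<lambda>x. perp (v x)) \<in> L2 torus"
  using L2_component[OF assms] L2_scaleR[OF L2_component[OF assms], of "-1"] by (intro L2_vec2) simp_all

lemma L2_limit_integral:
  fixes f :: "nat \<Rightarrow> real^2 \<Rightarrow> real"
  assumes f: "\<And>n. f n \<in> L2 torus" and h: "h \<in> L2 torus" and w: "w \<in> L2 torus"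
    and lim: "(\<lambda>n. L2_norm torus (\<lambda>x. f n x - h x)) \<longlonglongrightarrow> 0"
  shows "(\<lambda>n. LINT x|MT. f n x * w x) \<longlonglongrightarrow> (LINT x|MT. h x * w x)"
proof -
  have bd: "norm (L2_inner torus (f n) w - L2_inner torus h w) \<le> L2_norm torus (\<lambda>x. f n x - h x) * L2_norm torus w" for n
    unfolding L2_inner_diff_left[OF w f h, symmetric] real_norm_def by (rule L2_Cauchy_Schwarz[OF L2_diff[OF f h] w])
  have l0: "(\<lambda>n. L2_norm torus (\<lambda>x. f n x - h x) * L2_norm torus w) \<longlonglongrightarrow> 0"
    using tendsto_mult[OF lim tendsto_const[of "L2_norm torus w"]] by simp
  have "(\<lambda>n. L2_inner torus (f n) w - L2_inner torus h w) \<longlonglongrightarrow> 0"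
    by (rule Lim_null_comparison[OF always_eventually l0]) (use bd in blast)
  then show ?thesis by (simp add: LIM_zero_iff L2_inner_def)
qed

text \<open>Classical integration by parts holds for the smooth Fejer means of the potential, whose
  gradients are rotated Fejer means of the field; both sides converge in L^2.\<close>

lemma has_weak_gradient_stream:
  assumes v: "solenoidal v" shows "has_weak_gradient (stream v) (\<lambda>x. perp (v x))"
  unfolding has_weak_gradient_def
proof (intro conjI ballI allI)
  note vL = solenoidal_L2[OF v]
  note sL = stream_L2_fc(1)[OF v]
  note si = L2_imp_integrable[OF sL]
  have vi: "integrable MT (\<lambda>x. v x $ i)" for i by (rule L2_imp_integrable[OF L2_component[OF vL]])
  show "stream v \<in> L2 torus" by (rule sL)
  show "(\<lambda>x. perp (v x)) \<in> L2 torus" by (rule perp_L2[OF vL])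
  fix \<psi> :: "real^2 \<Rightarrow> real" and i :: 2 assume \<psi>: "\<psi> \<in> torus_test"
  have psi_eq: "psi N v x = fejer N (stream v) x" for N x
    unfolding fejer_eq(1)[OF si] psi_def stream_L2_fc(2)[OF v] ..
  have \<psi>L: "\<psi> \<in> L2 torus" by (rule torus_test_L2[OF \<psi>])
  have 1: "(\<lambda>N. LINT x|MT. psi N v x * grad \<psi> x $ i) \<longlonglongrightarrow> (LINT x|MT. stream v x * grad \<psi> x $ i)"
    unfolding psi_eq
    by (intro L2_limit_integral fejer_L2 si sL L2_component grad_L2 \<psi> fejer_tendsto_L2_norm)
  have F: "(\<lambda>N. LINT x|MT. fejer N (\<lambda>x. v x $ j) x * \<psi> x) \<longlonglongrightarrow> (LINT x|MT. v x $ j * \<psi> x)" for j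
    by (intro L2_limit_integral fejer_L2 vi L2_component vL \<psi>L fejer_tendsto_L2_norm)
  have 2: "(\<lambda>N. - (LINT x|MT. grad (psi N v) x $ i * \<psi> x)) \<longlonglongrightarrow> - (LINT x|MT. perp (v x) $ i * \<psi> x)"
  proof -
    consider "i = 1" | "i = 2" using exhaust_2 by blast
    then show ?thesis
    proof cases
      case 1 then show ?thesis using tendsto_minus[OF tendsto_minus[OF F[of 2]]] by (simp add: grad_psi(1)[OF v])
    next
      case 2 then show ?thesis using tendsto_minus[OF F[of 1]] by (simp add: grad_psi(2)[OF v])
    qed
  qed
  have "(LINT x|MT. psi N v x * grad \<psi> x $ i) = - (LINT x|MT. grad (psi N v) x $ i * \<psi> x)" for N
    by (rule torus_integration_by_parts[OF psi_torus_test \<psi>])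
  with 1 2 show "(LINT x|MT. stream v x * grad \<psi> x $ i) = - (LINT x|MT. perp (v x) $ i * \<psi> x)"
    using LIMSEQ_unique by simp
qed

text \<open>The weak gradient tested with cosines and sines. Uniqueness of weak gradients and of
  stream functions are both read off from this formula.\<close>

lemma fc_weak_gradient:
  assumes "has_weak_gradient f g" shows "fc (\<lambda>x. g x $ i) k = \<i> * of_real (freq k $ i) * fc f k"
proof -
  have f: "f \<in> L2 torus" and g: "g \<in> L2 torus" and wg: "\<And>\<psi>. \<psi> \<in> torus_test \<Longrightarrow> 
      (LINT x|MT. f x * grad \<psi> x $ i) = - (LINT x|MT. g x $ i * \<psi> x)"
    using assms by (auto simp: has_weak_gradient_def)
  have "(LINT x|MT. f x * (- (freq k $ i) * sin (freq k \<bullet> x))) = - (LINT x|MT. g x $ i * cos (freq k \<bullet> x))"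
    using wg[OF torus_test_trig(1)[of k 0]] unfolding grad_trig by (simp add: mult_ac del: freq_nth)
  moreover have "(LINT x|MT. f x * (- (freq k $ i) * sin (freq k \<bullet> x))) = - (freq k $ i) * (LINT x|MT. f x * sin (freq k \<bullet> x))"
    unfolding integral_mult_right_zero[symmetric] by (intro Bochner_Integration.integral_cong refl) (simp del: freq_nth)
  ultimately have A: "(LINT x|MT. g x $ i * cos (freq k \<bullet> x)) = freq k $ i * (LINT x|MT. f x * sin (freq k \<bullet> x))" by (simp del: freq_nth)
  have "(LINT x|MT. f x * (freq k $ i * cos (freq k \<bullet> x))) = - (LINT x|MT. g x $ i * sin (freq k \<bullet> x))"
    using wg[OF torus_test_trig(2)[of k 0]] unfolding grad_trig by (simp add: mult_ac del: freq_nth)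
  moreover have "(LINT x|MT. f x * (freq k $ i * cos (freq k \<bullet> x))) = freq k $ i * (LINT x|MT. f x * cos (freq k \<bullet> x))"
    unfolding integral_mult_right_zero[symmetric] by (intro Bochner_Integration.integral_cong refl) (simp del: freq_nth)
  ultimately have B: "(LINT x|MT. g x $ i * sin (freq k \<bullet> x)) = - (freq k $ i * (LINT x|MT. f x * cos (freq k \<bullet> x)))" by (simp del: freq_nth)
  show ?thesis
    using fc_trig_parts[OF L2_imp_integrable[OF L2_component[OF g, of i]], of k] fc_trig_parts[OF L2_imp_integrable[OF f], of k] A B
    by (simp add: complex_eq_iff del: freq_nth)
qed

lemma weak_gradient_unique:
  assumes "has_weak_gradient f g" "has_weak_gradient f g'" shows "AE x in MT. g x = g' x"
proof -
  have L: "g \<in> L2 torus" "g' \<in> L2 torus" using assms by (auto simp: has_weak_gradient_def)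
  have "AE x in MT. g x $ i = g' x $ i" for i
    by (rule fc_eq_imp_AE_eq) (auto intro: L2_component L simp: fc_weak_gradient[OF assms(1)] fc_weak_gradient[OF assms(2)] simp del: freq_nth)
  from this[of 1] this[of 2] show ?thesis by eventually_elim (rule vec2_eqI)
qed

lemma weak_grad_works: "f \<in> W12 \<Longrightarrow> has_weak_gradient f (weak_grad f)"
  using someI[of "has_weak_gradient f"] unfolding W12_def weak_grad_def by auto

lemma weak_grad_stream:
  assumes v: "solenoidal v" shows "AE x in MT. weak_grad (stream v) x = perp (v x)"
  using weak_gradient_unique[OF weak_grad_works has_weak_gradient_stream[OF v]] has_weak_gradient_stream[OF v] 
  by (auto simp: W12_def)

text \<open>Every stream function has the same coefficients: the gradient determines those with
  \<open>k \<noteq> 0\<close>, and mean zero the remaining one. This permits a conclusion about all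
  stream functions.\<close>

lemma stream_function_fc:
  assumes sf: "stream_function T b \<Psi>" and t: "t \<in> {0..<T}" and bL: "b t \<in> L2 torus"
  shows "\<Psi> t \<in> L2 torus" "fc (\<Psi> t) k = sc (b t) k"
proof -
  have mz: "mean_zero (\<Psi> t)" and ae: "AE x in MT. b t x = vector [weak_grad (\<Psi> t) x $ 2, - weak_grad (\<Psi> t) x $ 1]"
    using sf t by (auto simp: stream_function_def)
  have "weak_lim_W12 (\<lambda>n. \<Psi> t) (\<Psi> t)" using sf t by (auto simp: stream_function_def Cw_W12_def)
  then have W: "\<Psi> t \<in> W12" by (simp add: weak_lim_W12_def)
  note wg = weak_grad_works[OF W]
  show L: "\<Psi> t \<in> L2 torus" using wg by (simp add: has_weak_gradient_def)
  have gL: "weak_grad (\<Psi> t) \<in> L2 torus" using wg by (simp add: has_weak_gradient_def)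
  have 1: "fc (\<lambda>x. b t x $ 1) k = \<i> * of_real (freq k $ 2) * fc (\<Psi> t) k" for k
  proof -
    have "fc (\<lambda>x. b t x $ 1) k = fc (\<lambda>x. weak_grad (\<Psi> t) x $ 2) k"
      using ae by (intro fc_cong_AE L2_measurable L2_component bL gL) (auto elim: eventually_mono)
    then show ?thesis using fc_weak_gradient[OF wg] by simp
  qed
  have 2: "fc (\<lambda>x. b t x $ 2) k = - (\<i> * of_real (freq k $ 1) * fc (\<Psi> t) k)" for k
  proof -
    have "fc (\<lambda>x. b t x $ 2) k = fc (\<lambda>x. (-1) * weak_grad (\<Psi> t) x $ 1) k"
      using ae L2_scaleR[OF L2_component[OF gL, of 1], of "-1"] 
      by (intro fc_cong_AE L2_measurable L2_component bL) (auto elim: eventually_mono)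
    then show ?thesis using fc_weak_gradient[OF wg, of 1 k] fc_scale[of "-1" "\<lambda>x. weak_grad (\<Psi> t) x $ 1" k] by simp
  qed
  show "fc (\<Psi> t) k = sc (b t) k"
  proof (cases "k = 0")
    case True then show ?thesis using mz by (simp add: fc_def mean_zero_def)
  next
    case False
    define n where "n = complex_of_real ((norm (freq k))\<^sup>2)"
    have n0: "\<i> * n \<noteq> 0" using False by (simp add: n_def)
    have "of_real (freq k $ 2) * fc (\<lambda>x. b t x $ 1) k - of_real (freq k $ 1) * fc (\<lambda>x. b t x $ 2) k = (\<i> * n) * fc (\<Psi> t) k"
      unfolding 1 2 n_def norm_freq_sq by (simp add: algebra_simps power2_eq_square del: freq_nth)
    then have "sc (b t) k = ((\<i> * n) * fc (\<Psi> t) k) / (\<i> * n)" using False by (simp only: sc_def n_def if_False)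
    then show ?thesis by (simp only: nonzero_mult_div_cancel_left[OF n0])
  qed
qed

subsection \<open>The limit field\<close>

text \<open>A pointwise bound alone would not suffice: the essential supremum is infinite unless the
  norm is measurable in time, which joint measurability provides.\<close>

lemma Linf_L2I:
  fixes v :: "real \<Rightarrow> real^2 \<Rightarrow> 'b::euclidean_space"
  assumes m: "(\<lambda>p. v (fst p) (snd p)) \<in> borel_measurable (MS T)"
    and L: "\<And>t. t \<in> {0..<T} \<Longrightarrow> v t \<in> L2 torus" and M: "\<And>t. t \<in> {0..<T} \<Longrightarrow> L2_norm torus (v t) \<le> M"
  shows "v \<in> Linf_L2 T" "(\<lambda>t. L2_norm torus (v t)) \<in> borel_measurable (MI T)"
proof -
  have "(\<lambda>p. (norm (v (fst p) (snd p)))\<^sup>2) \<in> borel_measurable (MS T)" using m by measurable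
  from measurable_slice_integral[OF this]
  show N: "(\<lambda>t. L2_norm torus (v t)) \<in> borel_measurable (MI T)" unfolding L2_norm_def by simp
  then have "(\<lambda>t. ereal (L2_norm torus (v t))) \<in> borel_measurable (MI T)" by simp
  then have "Linf_L2_norm T v \<le> ereal M" unfolding Linf_L2_norm_def
    by (rule esssup_I) (use M in auto)
  then have "Linf_L2_norm T v < \<infinity>" by auto
  moreover have "AE t in MI T. v t \<in> L2 torus" using L by (intro AE_I2) simp
  ultimately show "v \<in> Linf_L2 T" using m by (simp add: Linf_L2_def case_prod_unfold)
qed

text \<open>Tests of product form turn weak convergence in space-time into weak convergence in time
  of the spatial pairings.\<close>

lemma spacetime_inner_product:
  fixes V :: "real \<Rightarrow> real^2 \<Rightarrow> real^2"
  assumes T: "0 < T" and V: "(\<lambda>(t, x). V t x) \<in> L2 (spacetime T)" and \<phi>: "continuous_on UNIV \<phi>"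
    and \<eta>: "\<eta> \<in> borel_measurable (MI T)" "\<And>t. \<bar>\<eta> t\<bar> \<le> (1::real)"
  shows "(\<lambda>(t, x). \<eta> t *\<^sub>R \<phi> x) \<in> L2 (spacetime T)"
    and "L2_inner (spacetime T) (\<lambda>(t, x). V t x) (\<lambda>(t, x). \<eta> t *\<^sub>R \<phi> x) = (LINT t|MI T. \<eta> t * L2_inner torus (V t) \<phi>)"
    and "integrable (MI T) (\<lambda>t. \<eta> t * L2_inner torus (V t) \<phi>)"
proof -
  interpret S: finite_measure "MS T" using T by (intro finite_measure_MS) simp
  have "continuous_on UNIV (\<lambda>x. norm (\<phi> x))" by (intro continuous_intros \<phi>)
  from continuous_torus_bounded[OF this] obtain C where C: "0 \<le> C" "\<And>x. x \<in> torus \<Longrightarrow> \<bar>norm (\<phi> x)\<bar> \<le> C" by metis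
  have m: "(\<lambda>p. \<eta> (fst p) *\<^sub>R \<phi> (snd p)) \<in> borel_measurable (MS T)"
    by (intro borel_measurable_scaleR measurable_time_spacetime \<eta>(1) measurable_space_spacetime borel_measurable_continuous_onI \<phi>)
  have "integrable (MS T) (\<lambda>p. (norm (\<eta> (fst p) *\<^sub>R \<phi> (snd p)))\<^sup>2)"
  proof (rule S.integrable_const_bound[of _ "C\<^sup>2"])
    show "AE p in MS T. norm ((norm (\<eta> (fst p) *\<^sub>R \<phi> (snd p)))\<^sup>2) \<le> C\<^sup>2"
    proof (rule AE_I2)
      fix p assume "p \<in> space (MS T)"
      then have "snd p \<in> torus" by (auto simp: spacetime_def)
      then have "norm (\<eta> (fst p) *\<^sub>R \<phi> (snd p)) \<le> 1 * C" unfolding norm_scaleR using \<eta>(2) C by (intro mult_mono) auto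
      then show "norm ((norm (\<eta> (fst p) *\<^sub>R \<phi> (snd p)))\<^sup>2) \<le> C\<^sup>2" by (simp add: power_mono)
    qed
    show "(\<lambda>p. (norm (\<eta> (fst p) *\<^sub>R \<phi> (snd p)))\<^sup>2) \<in> borel_measurable (MS T)" using m by measurable
  qed
  then show w: "(\<lambda>(t, x). \<eta> t *\<^sub>R \<phi> x) \<in> L2 (spacetime T)" using m by (simp add: L2_def case_prod_unfold)
  have i: "integrable (MS T) (\<lambda>p. V (fst p) (snd p) \<bullet> (\<eta> (fst p) *\<^sub>R \<phi> (snd p)))"
    using L2_inner_integrable[OF V w] by (simp add: case_prod_unfold)
  have eq: "(LINT x|MT. V (fst (t, x)) (snd (t, x)) \<bullet> (\<eta> (fst (t, x)) *\<^sub>R \<phi> (snd (t, x)))) = \<eta> t * L2_inner torus (V t) \<phi>" for t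
    by (simp add: L2_inner_def)
  show "L2_inner (spacetime T) (\<lambda>(t, x). V t x) (\<lambda>(t, x). \<eta> t *\<^sub>R \<phi> x) = (LINT t|MI T. \<eta> t * L2_inner torus (V t) \<phi>)"
    using Fubini_spacetime(3)[OF i] unfolding eq by (simp only: L2_inner_def case_prod_unfold)
  show "integrable (MI T) (\<lambda>t. \<eta> t * L2_inner torus (V t) \<phi>)"
    using Fubini_spacetime(2)[OF i] unfolding eq .
qed

lemma AE_slice_L2:
  fixes V :: "real \<Rightarrow> real^2 \<Rightarrow> real^2"
  assumes V: "(\<lambda>(t, x). V t x) \<in> L2 (spacetime T)" shows "AE t in MI T. V t \<in> L2 torus"
proof -
  have m: "(\<lambda>p. V (fst p) (snd p)) \<in> borel_measurable (MS T)" and i: "integrable (MS T) (\<lambda>p. (norm (V (fst p) (snd p)))\<^sup>2)"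
    using V by (simp_all add: L2_def case_prod_unfold)
  have c: "AE t in MI T. (\<lambda>x. V t x $ i) \<in> borel_measurable MT" for i
    using AE_measurable_slice[OF borel_measurable_vec_nth[OF m, of i]] by simp
  show ?thesis
    using c[of 1] c[of 2] Fubini_spacetime(1)[OF i]
    by eventually_elim (simp add: L2_def borel_measurable_vec2)
qed

section \<open>Slices of the limit and its weakly continuous representative\<close>

locale flow_sequence =
  fixes T M :: real and b u :: "nat \<Rightarrow> real \<Rightarrow> real^2 \<Rightarrow> real^2" and blim :: "real \<Rightarrow> real^2 \<Rightarrow> real^2"
  assumes T: "0 < T" and fl: "\<And>j. flow T M (b j) (u j)"
    and wl: "weak_lim_L2 (spacetime T) (\<lambda>j (t, x). b j t x) (\<lambda>(t, x). blim t x)"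
begin

lemma b_L2: "t \<in> {0..<T} \<Longrightarrow> b j t \<in> L2 torus" by (rule flow.bL[OF fl])
lemma b_norm: "t \<in> {0..<T} \<Longrightarrow> L2_norm torus (b j t) \<le> M" by (rule flow.bM[OF fl])
lemma b_sol: "t \<in> {0..<T} \<Longrightarrow> solenoidal (b j t)" by (rule flow.sol[OF fl])

lemma blim_L2: "(\<lambda>(t, x). blim t x) \<in> L2 (spacetime T)" using wl by (simp add: weak_lim_L2_def)

lemma inner_lipschitz_uniform:
  assumes "\<phi> \<in> torus_test"
  shows "\<exists>K. \<forall>j. \<forall>s\<in>{0..<T}. \<forall>t\<in>{0..<T}. s \<le> t \<longrightarrow> \<bar>L2_inner torus (b j t) \<phi> - L2_inner torus (b j s) \<phi>\<bar> \<le> (t - s) * K"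
proof -
  obtain R where R: "\<And>x. x \<in> torus \<Longrightarrow> \<bar>rot \<phi> x\<bar> \<le> R" 
    using continuous_torus_bounded[OF continuous_on_rot[OF torus_test_smooth[OF assms]]] by metis
  have "\<bar>L2_inner torus (b j t) \<phi> - L2_inner torus (b j s) \<phi>\<bar> \<le> (t - s) * (M * M * R)" 
    if "s \<in> {0..<T}" "t \<in> {0..<T}" "s \<le> t" for j s t
    by (rule flow.inner_lipschitz[OF fl assms R that])
  then show ?thesis by blast
qed

text \<open>Equicontinuity makes the pairings converge at every time, whereas the weak limit
  identifies them only at almost every time.\<close>

lemma inner_limit:
  assumes \<phi>: "\<phi> \<in> torus_test"
  shows "\<exists>c. (\<forall>t\<in>{0..<T}. (\<lambda>j. L2_inner torus (b j t) \<phi>) \<longlonglongrightarrow> c t) \<and> (AE t in MI T. L2_inner torus (blim t) \<phi> = c t)"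
proof -
  have \<phi>c: "continuous_on UNIV \<phi>" by (rule smooth_continuous[OF torus_test_smooth[OF \<phi>]])
  have \<phi>L: "\<phi> \<in> L2 torus" by (rule torus_test_L2[OF \<phi>])
  from inner_lipschitz_uniform[OF \<phi>] obtain K where K: 
    "\<forall>j. \<forall>s\<in>{0..<T}. \<forall>t\<in>{0..<T}. s \<le> t \<longrightarrow> \<bar>L2_inner torus (b j t) \<phi> - L2_inner torus (b j s) \<phi>\<bar> \<le> (t - s) * K" by (rule exE)
  have bst: "(\<lambda>(t, x). b j t x) \<in> L2 (spacetime T)" for j using wl unfolding weak_lim_L2_def by blast
  show ?thesis
  proof (rule lipschitz_weak_limit[where H="\<lambda>j t. L2_inner torus (b j t) \<phi>" and G="\<lambda>t. L2_inner torus (blim t) \<phi>" and K=K and B="M * L2_norm torus \<phi>" and T=T])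
    show "\<bar>L2_inner torus (b j t) \<phi> - L2_inner torus (b j s) \<phi>\<bar> \<le> (t - s) * K" if "s \<in> {0..<T}" "t \<in> {0..<T}" "s \<le> t" for j s t
      using K that by blast
    show "\<bar>L2_inner torus (b j t) \<phi>\<bar> \<le> M * L2_norm torus \<phi>" if "t \<in> {0..<T}" for j t
      by (rule order_trans[OF L2_Cauchy_Schwarz[OF b_L2[OF that] \<phi>L]]) (intro mult_right_mono b_norm that L2_norm_nonneg)
    show "integrable (MI T) (\<lambda>t. L2_inner torus (blim t) \<phi>)"
      using spacetime_inner_product(3)[OF T blim_L2 \<phi>c, of "\<lambda>_. 1"] by simp
    show "(\<lambda>j. LINT t|MI T. \<eta> t * L2_inner torus (b j t) \<phi>) \<longlonglongrightarrow> (LINT t|MI T. \<eta> t * L2_inner torus (blim t) \<phi>)"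
      if \<eta>: "\<eta> \<in> borel_measurable (MI T)" "\<And>t. \<bar>\<eta> t\<bar> \<le> 1" for \<eta>
    proof -
      have "(\<lambda>j. L2_inner (spacetime T) (\<lambda>(t, x). b j t x) (\<lambda>(t, x). \<eta> t *\<^sub>R \<phi> x)) \<longlonglongrightarrow> L2_inner (spacetime T) (\<lambda>(t, x). blim t x) (\<lambda>(t, x). \<eta> t *\<^sub>R \<phi> x)"
        using wl spacetime_inner_product(1)[OF T blim_L2 \<phi>c \<eta>] unfolding weak_lim_L2_def by blast
      then show ?thesis
        unfolding spacetime_inner_product(2)[OF T blim_L2 \<phi>c \<eta>] spacetime_inner_product(2)[OF T bst \<phi>c \<eta>] .
    qed
    fix c assume "\<And>t. t \<in> {0..<T} \<Longrightarrow> (\<lambda>j. L2_inner torus (b j t) \<phi>) \<longlonglongrightarrow> c t" "AE t in MI T. L2_inner torus (blim t) \<phi> = c t"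
    then show ?thesis by (intro exI[of _ c] conjI ballI)
  qed
qed

definition cf where "cf i k t = lim (\<lambda>j. fc (\<lambda>x. b j t x $ i) k)"

lemma fc_limit:
  shows "t \<in> {0..<T} \<Longrightarrow> (\<lambda>j. fc (\<lambda>x. b j t x $ i) k) \<longlonglongrightarrow> cf i k t"
    and "AE t in MI T. blim t \<in> L2 torus \<longrightarrow> fc (\<lambda>x. blim t x $ i) k = cf i k t"
proof -
  let ?C = "\<lambda>x. cos (freq k \<bullet> x + 0) *\<^sub>R axis i (1::real)" and ?S = "\<lambda>x. sin (freq k \<bullet> x + 0) *\<^sub>R axis i (1::real)"
  from inner_limit[OF trig_axis_torus_test(1)[of k i]] obtain p where p: "\<forall>t\<in>{0..<T}. (\<lambda>j. L2_inner torus (b j t) ?C) \<longlonglongrightarrow> p t"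
    "AE t in MI T. L2_inner torus (blim t) ?C = p t" by (elim exE conjE)
  from inner_limit[OF trig_axis_torus_test(2)[of k i]] obtain q where q: "\<forall>t\<in>{0..<T}. (\<lambda>j. L2_inner torus (b j t) ?S) \<longlonglongrightarrow> q t"
    "AE t in MI T. L2_inner torus (blim t) ?S = q t" by (elim exE conjE)
  have lim: "(\<lambda>j. fc (\<lambda>x. b j t x $ i) k) \<longlonglongrightarrow> Complex (p t) (- q t)" if t: "t \<in> {0..<T}" for t
    unfolding fc_eq_inner[OF b_L2[OF t]] using p(1) q(1) t by (intro tendsto_Complex tendsto_minus) auto
  then have cf: "cf i k t = Complex (p t) (- q t)" if "t \<in> {0..<T}" for t
    unfolding cf_def using that by (intro limI) auto
  show "t \<in> {0..<T} \<Longrightarrow> (\<lambda>j. fc (\<lambda>x. b j t x $ i) k) \<longlonglongrightarrow> cf i k t" using lim cf by simp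
  show "AE t in MI T. blim t \<in> L2 torus \<longrightarrow> fc (\<lambda>x. blim t x $ i) k = cf i k t"
    using p(2) q(2) AE_space
  proof eventually_elim
    case (elim t)
    then have t: "t \<in> {0..<T}" by simp
    show ?case
    proof
      assume L: "blim t \<in> L2 torus"
      show "fc (\<lambda>x. blim t x $ i) k = cf i k t" unfolding cf[OF t] fc_eq_inner[OF L] using elim(1,2) by simp
    qed
  qed
qed

text \<open>Conjugate symmetry and the Bessel bound survive in the limit, so Riesz-Fischer yields a
  field even at the exceptional times.\<close>

lemma slice_limit_exists:
  assumes t: "t \<in> {0..<T}" shows "\<exists>v. v \<in> L2 torus \<and> (\<forall>i k. fc (\<lambda>x. v x $ i) k = cf i k t)"
proof -
  have 1: "cf i (- k) t = cnj (cf i k t)" for i k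
    by (rule LIMSEQ_unique[OF fc_limit(1)[OF t, of i "-k"]]) (simp only: fc_minus, rule tendsto_cnj[OF fc_limit(1)[OF t]])
  have 2: "(\<Sum>k\<in>F. (norm (cf i k t))\<^sup>2) \<le> M\<^sup>2" if F: "finite F" for F i
  proof (rule LIMSEQ_le_const2)
    show "(\<lambda>j. \<Sum>k\<in>F. (norm (fc (\<lambda>x. b j t x $ i) k))\<^sup>2) \<longlonglongrightarrow> (\<Sum>k\<in>F. (norm (cf i k t))\<^sup>2)"
      by (intro tendsto_intros fc_limit(1) t)
    have "(\<Sum>k\<in>F. (norm (fc (\<lambda>x. b j t x $ i) k))\<^sup>2) \<le> M\<^sup>2" for j
    proof -
      have "(\<Sum>k\<in>F. (norm (fc (\<lambda>x. b j t x $ i) k))\<^sup>2) \<le> (L2_norm torus (\<lambda>x. b j t x $ i))\<^sup>2"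
        using Bessel[OF L2_component[OF b_L2[OF t]] F] by (simp add: L2_norm_power2)
      also have "\<dots> \<le> M\<^sup>2"
        using order_trans[OF L2_norm_component_le[OF b_L2[OF t]] b_norm[OF t]] by (intro power_mono) auto
      finally show ?thesis .
    qed
    then show "\<exists>N. \<forall>n\<ge>N. (\<Sum>k\<in>F. (norm (fc (\<lambda>x. b n t x $ i) k))\<^sup>2) \<le> M\<^sup>2" by blast
  qed
  obtain f1 where f1: "f1 \<in> L2 torus" "\<And>k. fc f1 k = cf 1 k t" using Riesz_Fischer[of "\<lambda>k. cf 1 k t", OF 1 2] by blast
  obtain f2 where f2: "f2 \<in> L2 torus" "\<And>k. fc f2 k = cf 2 k t" using Riesz_Fischer[of "\<lambda>k. cf 2 k t", OF 1 2] by blast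
  define v where "v x = (vector [f1 x, f2 x] :: real^2)" for x
  have "v \<in> L2 torus" by (rule L2_vec2) (simp_all add: v_def f1 f2)
  moreover have "fc (\<lambda>x. v x $ i) k = cf i k t" for i k
  proof -
    consider "i = 1" | "i = 2" using exhaust_2 by blast
    then show ?thesis by cases (simp_all add: v_def f1 f2)
  qed
  ultimately show ?thesis by blast
qed

text \<open>The given field is kept wherever its slice has the right coefficients, so that equality
  with \<open>blim t\<close> at almost every time is equality of functions, not merely equality
  almost everywhere in space.\<close>

definition blim' where "blim' t = 
  (if blim t \<in> L2 torus \<and> (\<forall>i k. fc (\<lambda>x. blim t x $ i) k = cf i k t) then blim t 
   else (SOME v. v \<in> L2 torus \<and> (\<forall>i k. fc (\<lambda>x. v x $ i) k = cf i k t)))"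

lemma blim'_AE: "AE t in MI T. blim' t = blim t"
proof -
  \<comment> \<open>There are countably many frequencies, so a single null set of times serves them
    all.\<close>
  have "AE t in MI T. \<forall>i k. blim t \<in> L2 torus \<longrightarrow> fc (\<lambda>x. blim t x $ i) k = cf i k t"
    unfolding AE_all_countable using fc_limit(2) by blast
  with AE_slice_L2[OF blim_L2] show ?thesis
    by eventually_elim (simp add: blim'_def)
qed

lemma blim'_slice:
  assumes t: "t \<in> {0..<T}" shows "blim' t \<in> L2 torus" "fc (\<lambda>x. blim' t x $ i) k = cf i k t"
proof -
  have "blim' t \<in> L2 torus \<and> (\<forall>i k. fc (\<lambda>x. blim' t x $ i) k = cf i k t)"
  proof (cases "blim t \<in> L2 torus \<and> (\<forall>i k. fc (\<lambda>x. blim t x $ i) k = cf i k t)")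
    case True then show ?thesis by (simp add: blim'_def)
  next
    case False
    then have eq: "blim' t = (SOME v. v \<in> L2 torus \<and> (\<forall>i k. fc (\<lambda>x. v x $ i) k = cf i k t))" unfolding blim'_def by (rule if_not_P)
    show ?thesis unfolding eq by (rule someI_ex[OF slice_limit_exists[OF t]])
  qed
  then show "blim' t \<in> L2 torus" "fc (\<lambda>x. blim' t x $ i) k = cf i k t" by blast+
qed

lemma blim'_weak_lim: assumes t: "t \<in> {0..<T}" shows "weak_lim_L2 torus (\<lambda>j. b j t) (blim' t)"
\<comment> \<open>The bound by \<open>M\<close> for the limit slice is not yet known; it follows
  afterwards from this very convergence.\<close>
proof (rule weak_lim_vec2_from_fc[where M="max M (L2_norm torus (blim' t))"])
  show "L2_norm torus (b j t) \<le> max M (L2_norm torus (blim' t))" for j using b_norm[OF t, of j] by simp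
  show "(\<lambda>j. fc (\<lambda>x. b j t x $ i) k) \<longlonglongrightarrow> fc (\<lambda>x. blim' t x $ i) k" for i k
    unfolding blim'_slice(2)[OF t] by (rule fc_limit(1)[OF t])
qed (use b_L2[OF t] blim'_slice(1)[OF t] in auto)

lemma blim'_norm: "t \<in> {0..<T} \<Longrightarrow> L2_norm torus (blim' t) \<le> M"
  by (rule weak_lim_L2_norm_le[OF blim'_weak_lim b_norm])

lemma sc_limit: assumes t: "t \<in> {0..<T}" shows "(\<lambda>j. sc (b j t) k) \<longlonglongrightarrow> sc (blim' t) k"
proof (cases "k = 0")
  case False
  have l: "(\<lambda>j. fc (\<lambda>x. b j t x $ i) k) \<longlonglongrightarrow> fc (\<lambda>x. blim' t x $ i) k" for i
    unfolding blim'_slice(2)[OF t] by (rule fc_limit(1)[OF t])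
  have "\<i> * complex_of_real ((norm (freq k))\<^sup>2) \<noteq> 0" using False by simp
  then show ?thesis unfolding sc_def if_not_P[OF False]
    by (intro tendsto_divide tendsto_diff tendsto_mult tendsto_const l)
qed simp

lemma blim'_solenoidal: assumes t: "t \<in> {0..<T}" shows "solenoidal (blim' t)"
proof -
  have l: "(\<lambda>j. fc (\<lambda>x. b j t x $ i) k) \<longlonglongrightarrow> fc (\<lambda>x. blim' t x $ i) k" for i k
    unfolding blim'_slice(2)[OF t] by (rule fc_limit(1)[OF t])
  have s: "of_real (freq k $ 1) * fc (\<lambda>x. b j t x $ 1) k + of_real (freq k $ 2) * fc (\<lambda>x. b j t x $ 2) k = 0"
    "fc (\<lambda>x. b j t x $ 1) 0 = 0" "fc (\<lambda>x. b j t x $ 2) 0 = 0" for j k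
    using b_sol[OF t, of j] unfolding solenoidal_def by blast+
  have "(\<lambda>j. of_real (freq k $ 1) * fc (\<lambda>x. b j t x $ 1) k + of_real (freq k $ 2) * fc (\<lambda>x. b j t x $ 2) k) \<longlonglongrightarrow> 
     of_real (freq k $ 1) * fc (\<lambda>x. blim' t x $ 1) k + of_real (freq k $ 2) * fc (\<lambda>x. blim' t x $ 2) k" for k
    by (intro tendsto_add tendsto_mult tendsto_const l)
  then have "of_real (freq k $ 1) * fc (\<lambda>x. blim' t x $ 1) k + of_real (freq k $ 2) * fc (\<lambda>x. blim' t x $ 2) k = 0" for k
    unfolding s(1) using LIMSEQ_unique[OF tendsto_const] by metis
  moreover have "fc (\<lambda>x. blim' t x $ 1) 0 = 0" "fc (\<lambda>x. blim' t x $ 2) 0 = 0"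
    using l[of 1 0] l[of 2 0] unfolding s(2,3) using LIMSEQ_unique[OF tendsto_const] by metis+
  ultimately show ?thesis using blim'_slice(1)[OF t] unfolding solenoidal_def by blast
qed

text \<open>The Lipschitz estimate, being uniform along the sequence, is inherited by the limit at
  all pairs of times.\<close>

lemma blim'_inner_continuous:
  assumes \<phi>: "\<phi> \<in> torus_test" and s: "\<And>n. s n \<in> {0..<T}" "s \<longlonglongrightarrow> t" and t: "t \<in> {0..<T}"
  shows "(\<lambda>n. L2_inner torus (blim' (s n)) \<phi>) \<longlonglongrightarrow> L2_inner torus (blim' t) \<phi>"
proof -
  from inner_lipschitz_uniform[OF \<phi>] obtain K where K: 
    "\<forall>j. \<forall>s\<in>{0..<T}. \<forall>t\<in>{0..<T}. s \<le> t \<longrightarrow> \<bar>L2_inner torus (b j t) \<phi> - L2_inner torus (b j s) \<phi>\<bar> \<le> (t - s) * K" by (rule exE)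
  have lim: "(\<lambda>j. L2_inner torus (b j r) \<phi>) \<longlonglongrightarrow> L2_inner torus (blim' r) \<phi>" if "r \<in> {0..<T}" for r
    using blim'_weak_lim[OF that] torus_test_L2[OF \<phi>] unfolding weak_lim_L2_def by blast
  have lip: "\<bar>L2_inner torus (blim' r) \<phi> - L2_inner torus (blim' q) \<phi>\<bar> \<le> (r - q) * K" if "q \<in> {0..<T}" "r \<in> {0..<T}" "q \<le> r" for q r
  proof (rule LIMSEQ_le_const2)
    show "(\<lambda>j. \<bar>L2_inner torus (b j r) \<phi> - L2_inner torus (b j q) \<phi>\<bar>) \<longlonglongrightarrow> \<bar>L2_inner torus (blim' r) \<phi> - L2_inner torus (blim' q) \<phi>\<bar>"
      by (intro tendsto_rabs tendsto_diff lim that)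
    show "\<exists>N. \<forall>j\<ge>N. \<bar>L2_inner torus (b j r) \<phi> - L2_inner torus (b j q) \<phi>\<bar> \<le> (r - q) * K" using K that by blast
  qed
  have bd: "\<bar>L2_inner torus (blim' (s n)) \<phi> - L2_inner torus (blim' t) \<phi>\<bar> \<le> \<bar>s n - t\<bar> * \<bar>K\<bar>" for n
  proof (cases "s n \<le> t")
    case True
    have "\<bar>L2_inner torus (blim' (s n)) \<phi> - L2_inner torus (blim' t) \<phi>\<bar> \<le> (t - s n) * K" using lip[OF s(1) t True] by (simp only: abs_minus_commute)
    also have "\<dots> \<le> (t - s n) * \<bar>K\<bar>" using True by (intro mult_left_mono) auto
    also have "\<dots> = \<bar>s n - t\<bar> * \<bar>K\<bar>" using True by simp
    finally show ?thesis .
  next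
    case False
    have "\<bar>L2_inner torus (blim' (s n)) \<phi> - L2_inner torus (blim' t) \<phi>\<bar> \<le> (s n - t) * K" using lip[OF t s(1)] False by simp
    also have "\<dots> \<le> (s n - t) * \<bar>K\<bar>" using False by (intro mult_left_mono) auto
    also have "\<dots> = \<bar>s n - t\<bar> * \<bar>K\<bar>" using False by simp
    finally show ?thesis .
  qed
  have l0: "(\<lambda>n. \<bar>s n - t\<bar> * \<bar>K\<bar>) \<longlonglongrightarrow> 0"
    using tendsto_mult[OF tendsto_rabs[OF LIM_zero[OF s(2)]] tendsto_const[of "\<bar>K\<bar>"]] by simp
  have "(\<lambda>n. L2_inner torus (blim' (s n)) \<phi> - L2_inner torus (blim' t) \<phi>) \<longlonglongrightarrow> 0"
    by (rule Lim_null_comparison[OF always_eventually l0]) (use bd in simp)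
  then show ?thesis by (simp add: LIM_zero_iff)
qed

lemma blim'_fc_continuous:
  assumes s: "\<And>n. s n \<in> {0..<T}" "s \<longlonglongrightarrow> t" and t: "t \<in> {0..<T}"
  shows "(\<lambda>n. fc (\<lambda>x. blim' (s n) x $ i) k) \<longlonglongrightarrow> fc (\<lambda>x. blim' t x $ i) k"
  unfolding fc_eq_inner[OF blim'_slice(1)[OF s(1)]] fc_eq_inner[OF blim'_slice(1)[OF t]]
  by (intro tendsto_Complex tendsto_minus blim'_inner_continuous trig_axis_torus_test s t)

lemma blim'_sc_continuous:
  assumes s: "\<And>n. s n \<in> {0..<T}" "s \<longlonglongrightarrow> t" and t: "t \<in> {0..<T}"
  shows "(\<lambda>n. sc (blim' (s n)) k) \<longlonglongrightarrow> sc (blim' t) k"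
proof (cases "k = 0")
  case False
  have "\<i> * complex_of_real ((norm (freq k))\<^sup>2) \<noteq> 0" using False by simp
  then show ?thesis unfolding sc_def if_not_P[OF False]
    by (intro tendsto_divide tendsto_diff tendsto_mult tendsto_const blim'_fc_continuous s t)
qed simp

lemma blim'_weak_continuous:
  assumes s: "\<And>n. s n \<in> {0..<T}" "s \<longlonglongrightarrow> t" and t: "t \<in> {0..<T}"
  shows "weak_lim_L2 torus (\<lambda>n. blim' (s n)) (blim' t)"
  by (rule weak_lim_vec2_from_fc[OF blim'_slice(1)[OF s(1)] blim'_norm[OF s(1)] blim'_slice(1)[OF t] blim'_norm[OF t] blim'_fc_continuous[OF s t]])

lemma blim'_measurable: "(\<lambda>p. blim' (fst p) (snd p)) \<in> borel_measurable (MS T)"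
proof (rule borel_measurable_lebesgue_on_AE[OF spacetime_borel(2)])
  show "(\<lambda>p. blim (fst p) (snd p)) \<in> borel_measurable (MS T)" using L2_measurable[OF blim_L2] by (simp add: case_prod_unfold)
  show "AE p in MS T. blim (fst p) (snd p) = blim' (fst p) (snd p)"
    using AE_time_spacetime[OF blim'_AE] by eventually_elim simp
qed

lemma blim'_Cw: "blim' \<in> Cw_L2 T"
  using Linf_L2I(1)[of blim' T M] blim'_measurable blim'_slice(1) blim'_norm blim'_weak_continuous
  unfolding Cw_L2_def by blast

subsection \<open>The stream function of the limit field\<close>

text \<open>Each partial sum combines coefficients continuous in time with characters in space, and
  \<open>stream\<close> is the pointwise \<open>lim\<close> of these sums.\<close>

lemma stream_measurable: "(\<lambda>p. stream (blim' (fst p)) (snd p)) \<in> borel_measurable (MS T)"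
proof -
  have scc: "continuous_on {0..<T} (\<lambda>t. sc (blim' t) k)" for k
    by (rule continuous_on_sequentiallyI) (intro blim'_sc_continuous; simp)
  have "(\<lambda>t. Re (sc (blim' t) k)) \<in> borel_measurable (MI T)" "(\<lambda>t. Im (sc (blim' t) k)) \<in> borel_measurable (MI T)" for k
    by (intro continuous_imp_measurable_on_sets_lebesgue continuous_on_Re continuous_on_Im scc; simp)+
  note [measurable] = this[THEN measurable_time_spacetime]
  have [measurable]: "(\<lambda>p. Re (chr k (snd p))) \<in> borel_measurable (MS T)" "(\<lambda>p. Im (chr k (snd p))) \<in> borel_measurable (MS T)" for k
    by (rule measurable_space_spacetime; intro borel_measurable_continuous_onI continuous_intros)+
  show ?thesis unfolding stream_def Re_sum times_complex.sel by measurable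
qed

lemma stream_norm: assumes t: "t \<in> {0..<T}" shows "L2_norm torus (stream (blim' t)) \<le> M"
proof -
  note v = blim'_solenoidal[OF t]
  \<comment> \<open>With only the zero frequency in the cube, whose coefficient is zero, the tail
    bound is a Poincare inequality with constant 1.\<close>
  have "cube 0 = {0}" by (auto simp: cube_def zero_prod_def)
  then have "(LINT x|MT. (stream (blim' t) x)\<^sup>2) \<le> (L2_norm torus (blim' t))\<^sup>2"
    using stream_norm_bounds(2)[OF v stream_L2_fc[OF v], of 0] by simp
  then have "(L2_norm torus (stream (blim' t)))\<^sup>2 \<le> (L2_norm torus (blim' t))\<^sup>2" by (simp add: L2_norm_power2)
  then have "L2_norm torus (stream (blim' t)) \<le> L2_norm torus (blim' t)" by (rule power2_le_imp_le) simp
  then show ?thesis using blim'_norm[OF t] by simp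
qed

lemma stream_W12: "t \<in> {0..<T} \<Longrightarrow> stream (blim' t) \<in> W12"
  using has_weak_gradient_stream[OF blim'_solenoidal] by (auto simp: W12_def)

lemma weak_grad_L2: "f \<in> W12 \<Longrightarrow> weak_grad f \<in> L2 torus"
  using weak_grad_works by (auto simp: has_weak_gradient_def)

lemma norm_weak_grad: assumes t: "t \<in> {0..<T}" shows "L2_norm torus (weak_grad (stream (blim' t))) = L2_norm torus (blim' t)"
proof -
  note [measurable] = L2_measurable[OF weak_grad_L2[OF stream_W12[OF t]]] L2_measurable[OF blim'_slice(1)[OF t]]
  have "(LINT x|MT. (norm (weak_grad (stream (blim' t)) x))\<^sup>2) = (LINT x|MT. (norm (blim' t x))\<^sup>2)"
    using weak_grad_stream[OF blim'_solenoidal[OF t]] by (intro integral_cong_AE) (auto elim: eventually_mono)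
  then show ?thesis by (simp add: L2_norm_def)
qed

text \<open>Rotation is antisymmetric and moves to the other factor with a sign, so pairings of
  gradients become pairings with the field.\<close>

lemma inner_weak_grad:
  assumes t: "t \<in> {0..<T}" and z: "z \<in> L2 torus"
  shows "L2_inner torus (weak_grad (stream (blim' t))) z = - L2_inner torus (blim' t) (\<lambda>x. perp (z x))"
proof -
  note [measurable] = L2_measurable[OF weak_grad_L2[OF stream_W12[OF t]]] L2_measurable[OF blim'_slice(1)[OF t]] 
    L2_measurable[OF z] L2_measurable[OF perp_L2[OF z]]
  have "L2_inner torus (weak_grad (stream (blim' t))) z = (LINT x|MT. - (blim' t x \<bullet> perp (z x)))"
    unfolding L2_inner_def
    using weak_grad_stream[OF blim'_solenoidal[OF t]] 
    by (intro integral_cong_AE) (auto elim!: eventually_mono simp: inner_vec2)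
  then show ?thesis by (simp add: L2_inner_def)
qed

text \<open>The inner product of W^{1,2} splits into a pairing with the potential and one with the
  field; each is weakly continuous in L^2.\<close>

lemma stream_Cw: "(\<lambda>t. stream (blim' t)) \<in> Cw_W12 T"
proof -
  have SL: "stream (blim' t) \<in> L2 torus" if "t \<in> {0..<T}" for t by (rule stream_L2_fc(1)[OF blim'_solenoidal[OF that]])
  have Wn: "W12_norm (stream (blim' t)) = sqrt ((L2_norm torus (stream (blim' t)))\<^sup>2 + (L2_norm torus (blim' t))\<^sup>2)" if "t \<in> {0..<T}" for t
    unfolding W12_norm_def norm_weak_grad[OF that] ..
  have "(\<lambda>t. sqrt ((L2_norm torus (stream (blim' t)))\<^sup>2 + (L2_norm torus (blim' t))\<^sup>2)) \<in> borel_measurable (MI T)"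
    using Linf_L2I(2)[OF stream_measurable SL stream_norm] Linf_L2I(2)[OF blim'_measurable blim'_slice(1) blim'_norm] by measurable
  then have "(\<lambda>t. W12_norm (stream (blim' t))) \<in> borel_measurable (MI T)"
    using Wn by (subst measurable_cong) auto
  then have m: "(\<lambda>t. ereal (W12_norm (stream (blim' t)))) \<in> borel_measurable (MI T)" by simp
  have "esssup (MI T) (\<lambda>t. ereal (W12_norm (stream (blim' t)))) \<le> ereal (sqrt (M\<^sup>2 + M\<^sup>2))"
  proof (rule esssup_I[OF m], rule AE_I2)
    fix t assume "t \<in> space (MI T)"
    then have t: "t \<in> {0..<T}" by simp
    have "(L2_norm torus (stream (blim' t)))\<^sup>2 \<le> M\<^sup>2" "(L2_norm torus (blim' t))\<^sup>2 \<le> M\<^sup>2"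
      using stream_norm[OF t] blim'_norm[OF t] by (auto intro: power_mono)
    then show "ereal (W12_norm (stream (blim' t))) \<le> ereal (sqrt (M\<^sup>2 + M\<^sup>2))" unfolding Wn[OF t] by simp
  qed
  then have "esssup (MI T) (\<lambda>t. ereal (W12_norm (stream (blim' t)))) < \<infinity>" by auto
  moreover have W: "AE t in MI T. stream (blim' t) \<in> W12" by (intro AE_I2) (simp add: stream_W12)
  ultimately have "(\<lambda>t. stream (blim' t)) \<in> Linf_W12 T"
    using stream_measurable W by (simp add: Linf_W12_def case_prod_unfold)
  moreover have "weak_lim_W12 (\<lambda>n. stream (blim' (s n))) (stream (blim' t))"
    if s: "\<And>n. s n \<in> {0..<T}" "s \<longlonglongrightarrow> t" and t: "t \<in> {0..<T}" for s t
  proof -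
    have "weak_lim_L2 torus (\<lambda>n. stream (blim' (s n))) (stream (blim' t))"
    proof (rule weak_lim_from_fc[OF SL[OF s(1)] stream_norm[OF s(1)] SL[OF t] stream_norm[OF t]])
      show "(\<lambda>n. fc (stream (blim' (s n))) k) \<longlonglongrightarrow> fc (stream (blim' t)) k" for k
        unfolding stream_L2_fc(2)[OF blim'_solenoidal[OF s(1)]] stream_L2_fc(2)[OF blim'_solenoidal[OF t]] by (rule blim'_sc_continuous[OF s t])
    qed
    then have 1: "(\<lambda>n. L2_inner torus (stream (blim' (s n))) w) \<longlonglongrightarrow> L2_inner torus (stream (blim' t)) w" if "w \<in> L2 torus" for w
      using that unfolding weak_lim_L2_def by blast
    have 2: "(\<lambda>n. L2_inner torus (blim' (s n)) w) \<longlonglongrightarrow> L2_inner torus (blim' t) w" if "w \<in> L2 torus" for w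
      using blim'_weak_continuous[OF s t] that unfolding weak_lim_L2_def by blast
    have "(\<lambda>n. W12_inner (stream (blim' (s n))) w) \<longlonglongrightarrow> W12_inner (stream (blim' t)) w" if w: "w \<in> W12" for w
    proof -
      have wL: "w \<in> L2 torus" using weak_grad_works[OF w] by (simp add: has_weak_gradient_def)
      show ?thesis
        unfolding W12_inner_def inner_weak_grad[OF s(1) weak_grad_L2[OF w]] inner_weak_grad[OF t weak_grad_L2[OF w]]
        by (intro tendsto_add tendsto_minus 1 2 wL perp_L2 weak_grad_L2 w)
    qed
    then show ?thesis unfolding weak_lim_W12_def using stream_W12[OF s(1)] stream_W12[OF t] by blast
  qed
  ultimately show ?thesis unfolding Cw_W12_def by blast
qed

lemma stream_function_exists: "stream_function T blim' (\<lambda>t. stream (blim' t))"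
  unfolding stream_function_def
proof (intro conjI ballI stream_Cw)
  fix t assume t: "t \<in> {0..<T}"
  have "fc (stream (blim' t)) 0 = 0" unfolding stream_L2_fc(2)[OF blim'_solenoidal[OF t]] by simp
  then show "mean_zero (stream (blim' t))" by (simp add: fc_def mean_zero_def)
  show "AE x in MT. blim' t x = vector [weak_grad (stream (blim' t)) x $ 2, - weak_grad (stream (blim' t)) x $ 1]"
    using weak_grad_stream[OF blim'_solenoidal[OF t]] by eventually_elim (rule vec2_eqI; simp)
qed

text \<open>The integral for \<open>b j\<close> is the same at times \<open>t\<close> and 0, and it
  converges at both; uniqueness of limits compares the two.\<close>

lemma potential_constant:
  assumes sf: "stream_function T blim' \<Psi>" and t: "t \<in> {0..<T}"
  shows "(LINT x|MT. (\<Psi> t x)\<^sup>2) = (LINT x|MT. (stream (blim' 0) x)\<^sup>2)"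
proof -
  have 0: "0 \<in> {0..<T}" using T by simp
  have "AE x in MT. \<Psi> t x = stream (blim' t) x"
    using stream_function_fc[OF sf t blim'_slice(1)[OF t]] stream_L2_fc[OF blim'_solenoidal[OF t]]
    by (intro fc_eq_imp_AE_eq) auto
  then have "(LINT x|MT. (\<Psi> t x)\<^sup>2) = (LINT x|MT. (stream (blim' t) x)\<^sup>2)"
    using L2_measurable[OF stream_function_fc(1)[OF sf t blim'_slice(1)[OF t]]] L2_measurable[OF stream_L2_fc(1)[OF blim'_solenoidal[OF t]]]
    by (intro integral_cong_AE) (auto elim!: eventually_mono)
  also have "\<dots> = (LINT x|MT. (stream (blim' 0) x)\<^sup>2)"
  proof (rule LIMSEQ_unique)
    show "(\<lambda>j. LINT x|MT. (stream (b j t) x)\<^sup>2) \<longlonglongrightarrow> (LINT x|MT. (stream (blim' t) x)\<^sup>2)"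
      by (rule stream_norm_tendsto[OF b_sol[OF t] b_norm[OF t] blim'_solenoidal[OF t] blim'_norm[OF t] sc_limit[OF t]])
    have "(LINT x|MT. (stream (b j t) x)\<^sup>2) = (LINT x|MT. (stream (b j 0) x)\<^sup>2)" for j
      by (rule flow.potential_conserved[OF fl t stream_L2_fc[OF b_sol[OF t]] stream_L2_fc[OF b_sol[OF 0]]])
    then show "(\<lambda>j. LINT x|MT. (stream (b j t) x)\<^sup>2) \<longlonglongrightarrow> (LINT x|MT. (stream (blim' 0) x)\<^sup>2)"
      using stream_norm_tendsto[OF b_sol[OF 0] b_norm[OF 0] blim'_solenoidal[OF 0] blim'_norm[OF 0] sc_limit[OF 0]] by simp
  qed
  finally show ?thesis .
qed

end

theorem mainTheorem9:
  fixes T :: real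
    and b u :: "nat \<Rightarrow> real \<Rightarrow> real^2 \<Rightarrow> real^2"
    and b0 u0 :: "nat \<Rightarrow> real^2 \<Rightarrow> real^2"
    and blim ulim :: "real \<Rightarrow> real^2 \<Rightarrow> real^2"
  assumes "0 < T"
    and "\<And>j. b j \<in> Cw_L2 T" and "\<And>j. u j \<in> Cw_L2 T"
    and "\<And>j. b0 j \<in> L2 torus" and "\<And>j. u0 j \<in> L2 torus"
    and "\<And>j. div_free (b0 j)" and "\<And>j. div_free (u0 j)"
    and "\<And>j. weak_induction T (b j) (u j) (b0 j)"
    and "\<And>j. div_free_spacetime T (u j)" and "\<And>j. div_free_spacetime T (b j)"
    and "\<And>j. AE x in lebesgue_on torus. u j 0 x = u0 j x"
    and "\<And>j. AE x in lebesgue_on torus. b j 0 x = b0 j x"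
    and "\<And>j. AE t in lebesgue_on {0..<T}. mean_zero (u j t) \<and> mean_zero (b j t)"
    and "(SUP j. Linf_L2_norm T (u j) + Linf_L2_norm T (b j)) < \<infinity>"
    and "weak_lim_L2 (spacetime T) (\<lambda>j (t, x). b j t x) (\<lambda>(t, x). blim t x)"
    and "weak_lim_L2 (spacetime T) (\<lambda>j (t, x). u j t x) (\<lambda>(t, x). ulim t x)"
  shows "\<exists>b'. (AE t in lebesgue_on {0..<T}. b' t = blim t) \<and> b' \<in> Cw_L2 T \<and>
           (\<exists>\<Psi>. stream_function T b' \<Psi>) \<and>
           (\<forall>\<Psi>. stream_function T b' \<Psi> \<longrightarrow>
              (\<exists>c. \<forall>t\<in>{0..<T}. (LINT x|lebesgue_on torus. \<bar>\<Psi> t x\<bar>\<^sup>2) = c))"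
proof -
  note T = assms(1) and b = assms(2) and u = assms(3) and b0 = assms(4) and wi = assms(8)
    and divu = assms(9) and divb = assms(10) and binit = assms(12) and mz = assms(13) and sup = assms(14) and wl = assms(15)
  define s where "s = (SUP j. Linf_L2_norm T (u j) + Linf_L2_norm T (b j))"
  have le_s: "Linf_L2_norm T (u j) \<le> s" "Linf_L2_norm T (b j) \<le> s" for j
  proof -
    have le: "Linf_L2_norm T (u j) + Linf_L2_norm T (b j) \<le> s" unfolding s_def by (rule SUP_upper) simp
    have "Linf_L2_norm T (u j) + 0 \<le> Linf_L2_norm T (u j) + Linf_L2_norm T (b j)"
      by (intro add_left_mono Linf_L2_norm_nonneg T)
    then show "Linf_L2_norm T (u j) \<le> s" using le by simp
    have "0 + Linf_L2_norm T (b j) \<le> Linf_L2_norm T (u j) + Linf_L2_norm T (b j)"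
      by (intro add_right_mono Linf_L2_norm_nonneg T)
    then show "Linf_L2_norm T (b j) \<le> s" using le by simp
  qed
  have "0 \<le> s" using Linf_L2_norm_nonneg[OF T] le_s(1)[of 0] by (rule order_trans)
  moreover have "s < \<infinity>" unfolding s_def by (rule sup)
  ultimately obtain M where M: "s = ereal M" by (cases s) auto
  have bM: "L2_norm torus (b j t) \<le> M" and uM: "L2_norm torus (u j t) \<le> M" if "t \<in> {0..<T}" for j t
    using Cw_L2_norm_le[OF b Linf_L2_norm_AE that] Cw_L2_norm_le[OF u Linf_L2_norm_AE that] le_s[of j] unfolding M by blast+
  \<comment> \<open>The distributional and almost-everywhere hypotheses are upgraded to every time
    by weak continuity, with one bound \<open>M\<close> for all \<open>j\<close>.\<close>
  have fl: "flow T M (b j) (u j)" for j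
  proof
    show "b j \<in> Cw_L2 T" "u j \<in> Cw_L2 T" by (rule b, rule u)
    show "L2_norm torus (b j t) \<le> M" "L2_norm torus (u j t) \<le> M" if "t \<in> {0..<T}" for t
      by (rule bM[OF that], rule uM[OF that])
    show "div_free (u j t)" if "t \<in> {0..<T}" for t by (rule div_free_slices[OF u divu that])
    have mzb: "AE t in MI T. mean_zero (b j t)" using mz[of j] by eventually_elim simp
    show "solenoidal (b j t)" if t: "t \<in> {0..<T}" for t
      by (rule solenoidalI[OF Cw_L2_slice[OF b t] div_free_slices[OF b divb t] mean_zero_slices[OF b mzb t]])
    show "L2_inner torus (b j t) \<phi> = L2_inner torus (b j 0) \<phi> + 
        (LINT s|MI T. indicator {0..t} s * (LINT x|MT. crs (b j s x) (u j s x) * rot \<phi> x))"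
      if "\<phi> \<in> torus_test" "t \<in> {0..<T}" for \<phi> t
      by (rule weak_induction_integrated[OF b u bM uM binit b0 wi that])
  qed
  interpret flow_sequence T M b u blim by (rule flow_sequence.intro[OF T fl wl])
  show ?thesis
  proof (intro exI[of _ blim'] conjI allI impI blim'_AE blim'_Cw)
    show "\<exists>\<Psi>. stream_function T blim' \<Psi>" using stream_function_exists by blast
    fix \<Psi> assume "stream_function T blim' \<Psi>"
    then show "\<exists>c. \<forall>t\<in>{0..<T}. (LINT x|MT. \<bar>\<Psi> t x\<bar>\<^sup>2) = c"
      using potential_constant by (intro exI[of _ "LINT x|MT. (stream (blim' 0) x)\<^sup>2"]) (simp add: power2_abs)
  qed
qed

end
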